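(* Let $\alpha\in(0,\tfrac14)$ and $T\in(0,1]$. For any $0<\epsilon<\tfrac1{12}$ and $0<\delta<\tfrac23\epsilon$, there exists $\eta=\eta(\epsilon)>0$ such that $$\|uvw\|_{\mathcal X_T^{-\frac34+\epsilon,-\frac12+\delta}}\lesssim T^{\eta}\,\|u\|_{\mathcal X_T^{\frac14+\epsilon,\frac12+\delta}}\,\|v\|_{\mathcal X_T^{\frac14+\epsilon,\frac12+\delta}}\,\|w\|_{\mathcal X_T^{\frac14+\epsilon,\frac12+\delta}}$$ for all $u,v,w$, with a constant independent of $u,v,w$ and $T$.
   Context: $\mathbb T^2=(\mathbb R/2\pi\mathbb Z)^2$, $\langle x\rangle=\sqrt{1+|x|^2}$. $\mathcal X^{s,b}$ is the closure of the Schwartz functions on $\mathbb R\times\mathbb T^2$ under $\|u\|_{\mathcal X^{s,b}}=\|\langle n\rangle^s\langle|\lambda|-\langle n\rangle\rangle^b\,\widetilde u(\lambda,n)\|_{L^2_\lambda\ell^2_n(\mathbb R\times\mathbb Z^2)}$, $\widetilde u$ being the space-time Fourier transform. $\|u\|_{\mathcal X^{s,b}_T}=\inf\{\|w\|_{\mathcal X^{s,b}}:w|_{[0,T]}=u\}$. *)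

theory Defs
  imports "HOL-Analysis.Analysis"
begin

text \<open>Points \<open>(t, x1, x2)\<close> of \<open>\<real> \<times> \<real>\<^sup>2\<close>. Functions on \<open>\<real> \<times> \<T>\<^sup>2\<close>,
  where \<open>\<T> = \<real> / 2\<pi>\<int>\<close>, are given by lifts that are \<open>2\<pi>\<close>-periodic in \<open>x1\<close> and \<open>x2\<close>;
  integrals over \<open>\<T>\<^sup>2\<close> are taken over the fundamental cell \<open>[0,2\<pi>]\<^sup>2\<close>.\<close>

type_synonym spacetime = "real \<times> real \<times> real"

type_synonym functional = "(spacetime \<Rightarrow> complex) \<Rightarrow> complex"

definition torus_cell :: "(real \<times> real) set" where
  "torus_cell = {0..2*pi} \<times> {0..2*pi}"

definition jap :: "'a::real_normed_vector \<Rightarrow> real" where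
  "jap x = sqrt (1 + (norm x)\<^sup>2)"

definition freq :: "int \<times> int \<Rightarrow> real \<times> real" where
  "freq n = (real_of_int (fst n), real_of_int (snd n))"


subsection \<open>Schwartz functions on \<open>\<real> \<times> \<T>\<^sup>2\<close>\<close>

text \<open>\<open>iter_deriv vs f\<close> is the iterated directional derivative of \<open>f\<close> along the vectors of the
  list \<open>vs\<close>; with \<open>vs\<close> a list of basis vectors these are all iterated partial derivatives.\<close>

primrec iter_deriv :: "'a::euclidean_space list \<Rightarrow> ('a \<Rightarrow> 'b::real_normed_vector) \<Rightarrow> 'a \<Rightarrow> 'b" where
  "iter_deriv [] f = f"
| "iter_deriv (v # vs) f = (\<lambda>p. frechet_derivative (iter_deriv vs f) (at p) v)"

definition smooth :: "('a::euclidean_space \<Rightarrow> 'b::real_normed_vector) \<Rightarrow> bool" where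
  "smooth f \<longleftrightarrow> (\<forall>vs. set vs \<subseteq> Basis \<longrightarrow> iter_deriv vs f differentiable_on UNIV)"

definition schwartz :: "(spacetime \<Rightarrow> complex) set" where
  "schwartz = {f. smooth f
      \<and> (\<forall>t x y. f (t, x + 2*pi, y) = f (t, x, y) \<and> f (t, x, y + 2*pi) = f (t, x, y))
      \<and> (\<forall>N vs. set vs \<subseteq> Basis \<longrightarrow>
            (\<exists>M. \<forall>p. jap (fst p) ^ N * norm (iter_deriv vs f p) \<le> M))}"


subsection \<open>Tempered distributions on \<open>\<real> \<times> \<T>\<^sup>2\<close>\<close>

text \<open>A distribution is a functional of which only the values on Schwartz functions matter.
  The last clause is continuity: \<open>u\<close> is bounded by finitely many Schwartz seminorms.\<close>

definition tempered :: "functional \<Rightarrow> bool" where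
  "tempered u \<longleftrightarrow>
     (\<forall>\<phi>\<in>schwartz. \<forall>\<psi>\<in>schwartz. u (\<lambda>p. \<phi> p + \<psi> p) = u \<phi> + u \<psi>) \<and>
     (\<forall>c. \<forall>\<phi>\<in>schwartz. u (\<lambda>p. c * \<phi> p) = c * u \<phi>) \<and>
     (\<exists>C N. \<forall>\<phi>\<in>schwartz. \<forall>M.
        (\<forall>vs p. set vs \<subseteq> Basis \<and> length vs \<le> N \<longrightarrow> jap (fst p) ^ N * norm (iter_deriv vs \<phi> p) \<le> M)
        \<longrightarrow> norm (u \<phi>) \<le> C * M)"

definition dist_of :: "(spacetime \<Rightarrow> complex) \<Rightarrow> functional" where
  "dist_of f = (\<lambda>\<phi>. LINT p:UNIV \<times> torus_cell|lborel. f p * \<phi> p)"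

definition fourier :: "(spacetime \<Rightarrow> complex) \<Rightarrow> real \<Rightarrow> int \<times> int \<Rightarrow> complex" where
  "fourier f l n =
     (LINT p:UNIV \<times> torus_cell|lborel. f p * cis (- (l * fst p + freq n \<bullet> snd p)))"

definition freq_measure :: "(real \<times> (int \<times> int)) measure" where
  "freq_measure = lborel \<Otimes>\<^sub>M count_space UNIV"

text \<open>\<open>has_fourier u F\<close>: the space-time Fourier transform of the distribution \<open>u\<close> is the function
  \<open>F\<close> (unique almost everywhere). This is Fourier inversion, tested against \<open>\<phi>\<close>:
  \<open>\<integral> u \<phi> = (2\<pi>)\<^sup>-\<^sup>3 \<Sum>\<^sub>n \<integral> F(\<lambda>,n) \<phi>~(-\<lambda>,-n) d\<lambda>\<close>.\<close>

definition has_fourier :: "functional \<Rightarrow> (real \<times> (int \<times> int) \<Rightarrow> complex) \<Rightarrow> bool" where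
  "has_fourier u F \<longleftrightarrow> F \<in> borel_measurable freq_measure \<and>
     (\<forall>\<phi>\<in>schwartz.
        integrable freq_measure (\<lambda>(l, n). F (l, n) * fourier \<phi> (- l) (- n)) \<and>
        u \<phi> = of_real (1 / (2*pi)^3) *
               (LINT q|freq_measure. (case q of (l, n) \<Rightarrow> F (l, n) * fourier \<phi> (- l) (- n))))"


subsection \<open>The spaces \<open>X\<^sup>s\<^sup>,\<^sup>b\<close> and their restrictions to \<open>[0,T]\<close>\<close>

definition ennsqrt :: "ennreal \<Rightarrow> ennreal" where
  "ennsqrt x = (if x = \<infinity> then \<infinity> else ennreal (sqrt (enn2real x)))"

definition weighted_L2 :: "real \<Rightarrow> real \<Rightarrow> (real \<times> (int \<times> int) \<Rightarrow> complex) \<Rightarrow> ennreal" where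
  "weighted_L2 s b F = ennsqrt (\<integral>\<^sup>+ (l, n). ennreal
      ((jap (freq n) powr s * jap (\<bar>l\<bar> - jap (freq n)) powr b * norm (F (l, n)))\<^sup>2) \<partial>freq_measure)"

text \<open>As the Fourier transform is unique almost everywhere, the infimum merely selects its norm, and
  is \<open>\<infinity>\<close> if the Fourier transform is not a function.\<close>

definition X_norm :: "real \<Rightarrow> real \<Rightarrow> functional \<Rightarrow> ennreal" where
  "X_norm s b u = Inf {weighted_L2 s b F | F. has_fourier u F}"

definition X_space :: "real \<Rightarrow> real \<Rightarrow> functional set" where
  "X_space s b = {u. tempered u \<and>
     (\<exists>f :: nat \<Rightarrow> spacetime \<Rightarrow> complex. (\<forall>k. f k \<in> schwartz) \<and>
        (\<lambda>k. X_norm s b (\<lambda>\<phi>. u \<phi> - dist_of (f k) \<phi>)) \<longlonglongrightarrow> 0)}"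

text \<open>Restriction to \<open>[0,T]\<close> is restriction of distributions to the open set \<open>(0,T) \<times> \<T>\<^sup>2\<close>, that is,
  to the following test functions.\<close>

definition test_functions :: "real \<Rightarrow> (spacetime \<Rightarrow> complex) set" where
  "test_functions T = {\<phi>\<in>schwartz. \<exists>a c. 0 < a \<and> c < T \<and> (\<forall>p. fst p \<notin> {a..c} \<longrightarrow> \<phi> p = 0)}"

definition equal_on :: "real \<Rightarrow> functional \<Rightarrow> functional \<Rightarrow> bool" where
  "equal_on T w u \<longleftrightarrow> (\<forall>\<phi>\<in>test_functions T. w \<phi> = u \<phi>)"

definition XT_norm :: "real \<Rightarrow> real \<Rightarrow> real \<Rightarrow> functional \<Rightarrow> ennreal" where
  "XT_norm s b T u = Inf {X_norm s b w | w. w \<in> X_space s b \<and> equal_on T w u}"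

definition XT_space :: "real \<Rightarrow> real \<Rightarrow> real \<Rightarrow> functional set" where
  "XT_space s b T = {u. \<exists>w\<in>X_space s b. equal_on T w u}"


subsection \<open>Products\<close>

text \<open>\<open>represents T f u\<close>: on \<open>[0,T]\<close>, the distribution \<open>u\<close> is the function \<open>f \<in> L\<^sup>1([0,T] \<times> \<T>\<^sup>2)\<close>
  (unique almost everywhere). Test functions vanish outside \<open>(0,T) \<times> \<T>\<^sup>2\<close>, so the values of \<open>f\<close>
  at other times and outside the cell do not matter.\<close>

definition represents :: "real \<Rightarrow> (spacetime \<Rightarrow> complex) \<Rightarrow> functional \<Rightarrow> bool" where
  "represents T f u \<longleftrightarrow>
     set_integrable lborel ({0..T} \<times> torus_cell) f \<and> equal_on T (dist_of f) u"

text \<open>The distribution \<open>z\<close> is the pointwise product \<open>u v w\<close> on \<open>[0,T]\<close>; in particular \<open>u\<close>, \<open>v\<close>, \<open>w\<close>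
  and the product are integrable functions there.\<close>

definition is_product :: "real \<Rightarrow> functional \<Rightarrow> functional \<Rightarrow> functional \<Rightarrow> functional \<Rightarrow> bool" where
  "is_product T u v w z \<longleftrightarrow>
     (\<exists>f g h. represents T f u \<and> represents T g v \<and> represents T h w \<and>
              represents T (\<lambda>p. f p * g p * h p) z)"

end

theory Submission
  imports Defs "HOL-Probability.Probability"
begin

text \<open>The estimate is proved on the Fourier side. There a product becomes a convolution, which only grows
when both factors are replaced by their absolute values; so the whole analysis concerns nonnegative
functions on the frequency space \<open>\<real> \<times> \<int>\<^sup>2\<close>, with the two weights \<open>\<langle>n\<rangle>\<close> (\<open>fq\<close>) and \<open>\<langle>|\<lambda>| - \<langle>n\<rangle>\<rangle>\<close> (\<open>md\<close>).

Bilinear bound. By Cauchy--Schwarz, the \<open>L\<^sup>2\<close> norm of \<open>F * G\<close> with \<open>F\<close> damped by \<open>\<langle>n\<rangle>^(-3/4-eps)\<close> and both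
factors carrying the modulation weight to the power \<open>2/5\<close> is controlled by a resonance sum over the
lattice points \<open>n\<^sub>1\<close> for which \<open>\<langle>n\<^sub>1\<rangle> + \<langle>n - n\<^sub>1\<rangle>\<close> is close to a given number. On a line of lattice points
this function is uniformly convex, so its values are quadratically separated and few of them are
close to any number (\<open>line_sum_bound\<close>, \<open>resonance_sum\<close>, \<open>bilinear\<close>).

Trilinear bound. Paired with a fourth function, a product of three becomes a symmetric quadrilinear
form. Of the four frequencies, the two smallest can absorb all the derivatives, and Cauchy--Schwarz
splits the form into two bilinear ones (\<open>quadrilinear\<close>, \<open>trilinear_freq\<close>). This only uses modulation
exponents \<open>\<plusminus>2/5\<close>. A smooth cutoff in time at scale \<open>T\<close> turns the gap between \<open>2/5\<close> and \<open>1/2 - \<delta>\<close> into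
a positive power of \<open>T\<close> (\<open>time_cutoff\<close>); it does not change the product on \<open>[0,T]\<close>.

From Schwartz functions to distributions. The bilinear bound is an \<open>L\<^sup>4\<close> bound for functions whose
frequencies lie in a dyadic band. Interpolated with the \<open>L\<^sup>2\<close> bound and summed over the bands it
embeds \<open>X\<close> with exponents \<open>1/4 + eps\<close> and \<open>1/2 + \<delta>\<close> into \<open>L\<^sup>3\<close> (\<open>L3_embedding\<close>). A rapidly converging
sequence of Schwartz approximants therefore converges almost everywhere below a majorant in \<open>L\<^sup>3\<close>
(\<open>X_space_approximates\<close>). Three such majorants make the product of the limits integrable, and
dominated convergence and Fatou's lemma carry the estimate over (\<open>trilinear_in_X_space\<close>). The norm
of a distribution is tied to its approximants by the uniqueness of the Fourier transform
(\<open>has_fourier_unique\<close>).\<close>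

type_synonym freqpt = "real \<times> (int \<times> int)"

abbreviation fmeas :: "(freqpt \<Rightarrow> 'b::topological_space) \<Rightarrow> bool" where
  "fmeas F \<equiv> F \<in> borel_measurable freq_measure"

abbreviation nnF :: "(freqpt \<Rightarrow> ennreal) \<Rightarrow> ennreal" (binder "\<oint>" 10) where
  "nnF f \<equiv> nn_integral freq_measure f"

abbreviation amp :: "(freqpt \<Rightarrow> complex) \<Rightarrow> freqpt \<Rightarrow> ennreal" where
  "amp F \<equiv> (\<lambda>q. ennreal (norm (F q)))"

abbreviation fint :: "(freqpt \<Rightarrow> 'b::{banach, second_countable_topology}) \<Rightarrow> bool" where
  "fint F \<equiv> integrable freq_measure F"

section \<open>The bracket and its convexity\<close>

lemma jap_ge_1: "1 \<le> jap x" by (simp add: jap_def)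
lemma jap_pos: "0 < jap x" using jap_ge_1[of x] by linarith
lemma jap_minus[simp]: "jap (- x) = jap x" by (simp add: jap_def)
lemma jap_sq: "(jap x)\<^sup>2 = 1 + (norm x)\<^sup>2" by (simp add: jap_def)
lemma norm_le_jap: "norm x \<le> jap x" by (simp add: jap_def real_le_rsqrt)
lemma jap_real: "jap (x::real) = sqrt (1 + x\<^sup>2)" by (simp add: jap_def)
lemma jap_le_1_plus: "jap x \<le> 1 + norm x"
 unfolding jap_def by (rule real_le_lsqrt) (auto simp: power2_eq_square algebra_simps)
lemma jap_triangle: "jap (x + y) \<le> jap x + jap y"
proof -
 have "jap (x + y) = norm (1::real, x + y)" by (simp add: jap_def norm_Pair)
 also have "\<dots> \<le> norm (1::real, norm x + norm y)" by (simp add: norm_Pair norm_triangle_ineq power_mono)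
 also have "\<dots> \<le> norm ((1::real, norm x) + (1, norm y))"
  by (simp add: norm_Pair)
 also have "\<dots> \<le> jap x + jap y"
  using norm_triangle_ineq[of "(1::real, norm x)" "(1, norm y)"] by (simp add: jap_def norm_Pair)
 finally show ?thesis .
qed

lemma jap_freq: "jap (freq n) = sqrt (1 + (real_of_int (fst n))\<^sup>2 + (real_of_int (snd n))\<^sup>2)"
 by (simp add: jap_def freq_def norm_Pair)

lemma jap_measurable[measurable]: "(jap :: real \<Rightarrow> real) \<in> borel_measurable borel"
 unfolding jap_def by measurable

lemma freq_minus[simp]: "freq (- n) = - freq n" by (simp add: freq_def)
lemma freq_add: "freq (m + n) = freq m + freq n" by (simp add: freq_def)

lemma tangent_lower_bound:
 fixes B x y :: real
 assumes "0 < B"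
 shows "sqrt (B\<^sup>2 + x\<^sup>2) + x / sqrt (B\<^sup>2 + x\<^sup>2) * (y - x) \<le> sqrt (B\<^sup>2 + y\<^sup>2)"
proof -
 define u v where "u = sqrt (B\<^sup>2 + x\<^sup>2)" and "v = sqrt (B\<^sup>2 + y\<^sup>2)"
 have u: "u > 0" "u\<^sup>2 = B\<^sup>2 + x\<^sup>2" and v: "v > 0" "v\<^sup>2 = B\<^sup>2 + y\<^sup>2"
  using assms by (auto simp: u_def v_def add_pos_nonneg)
 have "(B\<^sup>2 + x * y)\<^sup>2 \<le> (u * v)\<^sup>2"
 proof -
  have "(u * v)\<^sup>2 - (B\<^sup>2 + x * y)\<^sup>2 = B\<^sup>2 * (x - y)\<^sup>2"
   by (simp add: power_mult_distrib u v) (simp add: power2_eq_square algebra_simps)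
  thus ?thesis by (smt (verit) mult_nonneg_nonneg zero_le_power2)
 qed
 hence "B\<^sup>2 + x * y \<le> u * v" using u v by (meson mult_pos_pos less_imp_le power2_le_imp_le)
 moreover have "u\<^sup>2 + x * (y - x) = B\<^sup>2 + x * y" unfolding u by (simp add: power2_eq_square algebra_simps)
 ultimately have "u\<^sup>2 + x * (y - x) \<le> u * v" by simp
 hence "u + x / u * (y - x) \<le> v" using u by (simp add: field_simps power2_eq_square)
 thus ?thesis by (simp add: u_def v_def)
qed

text \<open>Where \<open>|x|\<close> and \<open>|y|\<close> are at most \<open>A\<close>, the second derivative \<open>A\<^sup>2 / (A\<^sup>2 + x\<^sup>2)^(3/2)\<close> of \<open>\<surd>(A\<^sup>2 + x\<^sup>2)\<close> is at least of size \<open>1 / A\<close>;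
this is the convexity that separates the values in the resonance sum.\<close>

lemma tangent_lower_bound_quadratic:
 fixes A x y :: real
 assumes "1 \<le> A" "\<bar>x\<bar> \<le> A" "\<bar>y\<bar> \<le> A"
 shows "sqrt (A\<^sup>2 + x\<^sup>2) + x / sqrt (A\<^sup>2 + x\<^sup>2) * (y - x) + (y - x)\<^sup>2 / (8 * A) \<le> sqrt (A\<^sup>2 + y\<^sup>2)"
proof -
 define u v where "u = sqrt (A\<^sup>2 + x\<^sup>2)" and "v = sqrt (A\<^sup>2 + y\<^sup>2)"
 have u: "u > 0" "u\<^sup>2 = A\<^sup>2 + x\<^sup>2" and v: "v > 0" "v\<^sup>2 = A\<^sup>2 + y\<^sup>2"
  using assms by (auto simp: u_def v_def add_pos_nonneg)
 have x2: "x\<^sup>2 \<le> A\<^sup>2" and y2: "y\<^sup>2 \<le> A\<^sup>2"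
  using assms by (auto simp: abs_le_square_iff[symmetric])
 have A94: "(3/2 * A)\<^sup>2 = 9/4 * A\<^sup>2" by (simp add: power2_eq_square)
 have uA: "u \<le> 3/2 * A"
  by (rule power2_le_imp_le) (unfold A94 u, use assms x2 zero_le_power2[of A] in \<open>linarith+\<close>)
 have vA: "v \<le> 3/2 * A"
  by (rule power2_le_imp_le) (unfold A94 v, use assms y2 zero_le_power2[of A] in \<open>linarith+\<close>)
 have xy: "\<bar>x * y\<bar> \<le> A\<^sup>2" using assms by (simp add: abs_mult power2_eq_square mult_mono)
 define s where "s = u * v + (A\<^sup>2 + x * y)"
 have uv: "u * v \<le> 9/4 * A\<^sup>2" using mult_mono[OF uA vA] u v assms by (simp add: power2_eq_square)
 have A2: "A\<^sup>2 > 0" using assms by simp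
 have s: "0 < s" "s \<le> 17/4 * A\<^sup>2"
  unfolding s_def using uv xy mult_pos_pos[OF u(1) v(1)] by (auto simp: abs_le_iff)
 have eq: "(u * v - (A\<^sup>2 + x * y)) * s = A\<^sup>2 * (y - x)\<^sup>2"
 proof -
  have "(u * v - (A\<^sup>2 + x * y)) * s = (u\<^sup>2) * (v\<^sup>2) - (A\<^sup>2 + x * y)\<^sup>2"
   by (simp add: s_def power2_eq_square algebra_simps)
  also have "\<dots> = A\<^sup>2 * (y - x)\<^sup>2" unfolding u v by (simp add: power2_eq_square algebra_simps)
  finally show ?thesis .
 qed
 have us: "u * s \<le> 8 * A * A\<^sup>2"
 proof -
  have "u * s \<le> (3/2 * A) * (17/4 * A\<^sup>2)" by (rule mult_mono) (use uA s u assms in auto)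
  also have "\<dots> \<le> 8 * A * A\<^sup>2" using assms by simp
  finally show ?thesis .
 qed
 have "(y - x)\<^sup>2 / (8 * A) = A\<^sup>2 * (y - x)\<^sup>2 / (8 * A * A\<^sup>2)" using assms by simp
 also have "\<dots> \<le> A\<^sup>2 * (y - x)\<^sup>2 / (u * s)"
  by (rule divide_left_mono) (use us u s assms in \<open>auto intro!: mult_pos_pos\<close>)
 also have "\<dots> = (u * v - (A\<^sup>2 + x * y)) / u" using eq s u by (simp add: field_simps)
 also have "\<dots> = v - u - x / u * (y - x)"
 proof -
  have "u * v - (A\<^sup>2 + x * y) = u * v - u\<^sup>2 - x * (y - x)"
   unfolding u by (simp add: power2_eq_square algebra_simps)
  thus ?thesis using u by (simp add: field_simps power2_eq_square)
 qed
 finally show ?thesis by (simp add: u_def v_def)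
qed

lemma sum_int_powr_bounded:
 fixes \<theta> :: real
 assumes "\<theta> > 1/2"
 shows "\<exists>K>0. \<forall>S :: int set. finite S \<longrightarrow> (\<Sum>k\<in>S. (1 + (real_of_int k)\<^sup>2) powr (- \<theta>)) \<le> K"
proof -
 let ?g = "\<lambda>n::nat. (1 + (real n)\<^sup>2) powr (- \<theta>)"
 have sm: "summable ?g"
 proof (rule summable_comparison_test)
  show "summable (\<lambda>n. of_nat n powr (- 2 * \<theta>) :: real)"
   using assms by (subst summable_real_powr_iff) auto
  have "?g n \<le> real n powr (- 2 * \<theta>)" if "n \<ge> 1" for n
  proof -
   have "?g n \<le> ((real n)\<^sup>2) powr (- \<theta>)" using assms that by (intro powr_mono2') auto
   also have "\<dots> = (real n powr 2) powr (- \<theta>)" using that by simp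
   also have "\<dots> = real n powr (- 2 * \<theta>)" unfolding powr_powr by simp
   finally show ?thesis .
  qed
  thus "\<exists>N. \<forall>n\<ge>N. norm (?g n) \<le> of_nat n powr (- 2 * \<theta>)" by auto
 qed
 have "(\<Sum>k\<in>S. (1 + (real_of_int k)\<^sup>2) powr (- \<theta>)) \<le> 2 * (\<Sum>n. ?g n) + 1" if "finite S" for S :: "int set"
 proof -
  let ?h = "\<lambda>k::int. (1 + (real_of_int k)\<^sup>2) powr (- \<theta>)"
  define T where "T = (nat \<circ> abs) ` S"
  have T: "finite T" using that by (simp add: T_def)
  have sub: "S \<subseteq> int ` T \<union> (\<lambda>n. - int n) ` T"
  proof
   fix k assume "k \<in> S"
   hence "nat \<bar>k\<bar> \<in> T" by (auto simp: T_def)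
   moreover have "k = int (nat \<bar>k\<bar>) \<or> k = - int (nat \<bar>k\<bar>)" by auto
   ultimately show "k \<in> int ` T \<union> (\<lambda>n. - int n) ` T" by blast
  qed
  have "sum ?h S \<le> sum ?h (int ` T \<union> (\<lambda>n. - int n) ` T)"
   using T sub by (intro sum_mono2) auto
  also have "\<dots> \<le> sum ?h (int ` T) + sum ?h ((\<lambda>n. - int n) ` T)"
   using T by (subst sum_Un) (auto intro!: sum_nonneg)
  also have "sum ?h (int ` T) = sum ?g T" by (subst sum.reindex) (auto intro: inj_onI)
  also have "sum ?h ((\<lambda>n. - int n) ` T) = sum ?g T" by (subst sum.reindex) (auto intro: inj_onI)
  also have "sum ?g T \<le> (\<Sum>n. ?g n)" using sm T by (intro sum_le_suminf) auto
  finally show ?thesis by simp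
 qed
 moreover have "2 * (\<Sum>n. ?g n) + 1 > 0" using suminf_nonneg[OF sm] by simp
 ultimately show ?thesis by blast
qed

text \<open>If \<open>k\<^sub>0\<close> minimises \<open>|\<tau> - f k|\<close>, then \<open>|f k - f k\<^sub>0| \<le> 2 |\<tau> - f k|\<close>, so the separation of the values of
\<open>f\<close> makes the \<open>k\<close>-th term at most a constant times \<open>(\<langle>k - k\<^sub>0\<rangle>\<^sup>2 / A)^(-\<theta>)\<close>, which is summable.\<close>

lemma separated_sum_bound:
 fixes \<theta> :: real
 assumes "\<theta> > 1/2"
 shows "\<exists>K>0. \<forall>(P :: int set) f \<tau> A. finite P \<longrightarrow> 1 \<le> A \<longrightarrow>
   (\<forall>j\<in>P. \<forall>k\<in>P. (real_of_int (j - k))\<^sup>2 / (8 * A) \<le> \<bar>f j - f k\<bar>) \<longrightarrow>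
   (\<Sum>k\<in>P. jap (\<tau> - f k) powr (- \<theta>)) \<le> K * A powr \<theta>"
proof -
 obtain K where K: "K > 0" "\<And>S :: int set. finite S \<Longrightarrow> (\<Sum>k\<in>S. (1 + (real_of_int k)\<^sup>2) powr (- \<theta>)) \<le> K"
  using sum_int_powr_bounded[OF assms] by blast
 show ?thesis
 proof (intro exI[of _ "32 powr \<theta> * K"] conjI allI impI)
  show "32 powr \<theta> * K > 0" using K by simp
  fix P :: "int set" and f :: "int \<Rightarrow> real" and \<tau> A :: real
  assume P: "finite P" and A: "1 \<le> A"
   and sep: "\<forall>j\<in>P. \<forall>k\<in>P. (real_of_int (j - k))\<^sup>2 / (8 * A) \<le> \<bar>f j - f k\<bar>"
  show "(\<Sum>k\<in>P. jap (\<tau> - f k) powr (- \<theta>)) \<le> 32 powr \<theta> * K * A powr \<theta>"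
  proof (cases "P = {}")
   case True thus ?thesis using K A by simp
  next
   case False
   obtain k0 where k0: "k0 \<in> P" "\<And>k. k \<in> P \<Longrightarrow> \<bar>\<tau> - f k0\<bar> \<le> \<bar>\<tau> - f k\<bar>"
    using arg_min_if_finite[OF P False, of "\<lambda>k. \<bar>\<tau> - f k\<bar>"] by (meson not_le)
   have bd: "jap (\<tau> - f k) powr (- \<theta>) \<le> 32 powr \<theta> * A powr \<theta> * (1 + (real_of_int (k - k0))\<^sup>2) powr (- \<theta>)"
    if k: "k \<in> P" for k
   proof -
    let ?d = "(real_of_int (k - k0))\<^sup>2"
    have "?d / (8 * A) \<le> \<bar>f k - f k0\<bar>" using sep k k0(1) by blast
    also have "\<dots> \<le> 2 * \<bar>\<tau> - f k\<bar>" using k0(2)[OF k] by (smt (verit))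
    finally have d: "?d / (16 * A) \<le> \<bar>\<tau> - f k\<bar>" using A by (simp add: field_simps)
    have "(1 + ?d) / (32 * A) \<le> (1 + ?d / (16 * A)) / 2"
     using A by (simp add: field_simps)
    also have "\<dots> \<le> (jap (\<tau> - f k) + jap (\<tau> - f k)) / 2"
     using d jap_ge_1[of "\<tau> - f k"] norm_le_jap[of "\<tau> - f k"] by (intro divide_right_mono add_mono) auto
    finally have le: "(1 + ?d) / (32 * A) \<le> jap (\<tau> - f k)" by simp
    have pos: "0 < (1 + ?d) / (32 * A)" using A by (intro divide_pos_pos add_pos_nonneg) auto
    have "jap (\<tau> - f k) powr (- \<theta>) \<le> ((1 + ?d) / (32 * A)) powr (- \<theta>)"
     using le pos assms by (intro powr_mono2') auto
    also have "\<dots> = (1 + ?d) powr (-\<theta>) / (32 * A) powr (-\<theta>)"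
     by (rule powr_divide)
    also have "\<dots> = (1 + ?d) powr (-\<theta>) * (32 * A) powr \<theta>"
     by (simp add: powr_minus divide_simps)
    also have "(32 * A) powr \<theta> = 32 powr \<theta> * A powr \<theta>" using A by (simp add: powr_mult)
    finally show ?thesis by (simp add: mult_ac)
   qed
   have "(\<Sum>k\<in>P. jap (\<tau> - f k) powr (- \<theta>)) \<le>
     (\<Sum>k\<in>P. 32 powr \<theta> * A powr \<theta> * (1 + (real_of_int (k - k0))\<^sup>2) powr (- \<theta>))"
    by (rule sum_mono) (rule bd)
   also have "\<dots> = 32 powr \<theta> * A powr \<theta> * (\<Sum>k\<in>(\<lambda>k. k - k0) ` P. (1 + (real_of_int k)\<^sup>2) powr (- \<theta>))"
    by (subst sum.reindex) (auto intro: inj_onI simp: sum_distrib_left)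
   also have "\<dots> \<le> 32 powr \<theta> * A powr \<theta> * K"
    by (rule mult_left_mono) (use K P in auto)
   finally show ?thesis by (simp add: mult_ac)
  qed
 qed
qed

text \<open>The function in the sum is convex, so on each of the two sets where its derivative is nonnegative
and negative the tangent inequality, taken at the suitable one of two points, separates its values.\<close>

lemma line_sum_bound:
 fixes \<theta> :: real
 assumes "\<theta> > 1/2"
 shows "\<exists>K>0. \<forall>\<tau> A B m. 1 \<le> A \<longrightarrow> 0 < B \<longrightarrow>
   (\<Sum>k | \<bar>real_of_int k\<bar> \<le> A. jap (\<tau> - (sqrt (A\<^sup>2 + (real_of_int k)\<^sup>2) + sqrt (B\<^sup>2 + (real_of_int k - m)\<^sup>2))) powr (- \<theta>))
    \<le> K * A powr \<theta>"
proof -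
 obtain K where K: "K > 0" "\<And>(P :: int set) f \<tau> A. finite P \<Longrightarrow> 1 \<le> A \<Longrightarrow>
   (\<forall>j\<in>P. \<forall>k\<in>P. (real_of_int (j - k))\<^sup>2 / (8 * A) \<le> \<bar>f j - f k\<bar>) \<Longrightarrow>
   (\<Sum>k\<in>P. jap (\<tau> - f k) powr (- \<theta>)) \<le> K * A powr \<theta>"
  using separated_sum_bound[OF assms] by blast
 show ?thesis
 proof (intro exI[of _ "2 * K"] conjI allI impI)
  show "0 < 2 * K" using K by simp
  fix \<tau> A B m :: real
  assume A: "1 \<le> A" and B: "0 < B"
  define f where "f = (\<lambda>x::real. sqrt (A\<^sup>2 + x\<^sup>2) + sqrt (B\<^sup>2 + (x - m)\<^sup>2))"
  define D where "D = (\<lambda>x::real. x / sqrt (A\<^sup>2 + x\<^sup>2) + (x - m) / sqrt (B\<^sup>2 + (x - m)\<^sup>2))"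
  have tan: "f x + D x * (y - x) + (y - x)\<^sup>2 / (8 * A) \<le> f y" if "\<bar>x\<bar> \<le> A" "\<bar>y\<bar> \<le> A" for x y
   using tangent_lower_bound_quadratic[OF A that] tangent_lower_bound[OF B, of "x - m" "y - m"]
   by (simp add: f_def D_def algebra_simps)
  define S where "S = {k::int. \<bar>real_of_int k\<bar> \<le> A}"
  have finS: "finite S"
  proof (rule finite_subset)
   show "S \<subseteq> {- \<lfloor>A\<rfloor>..\<lfloor>A\<rfloor>}"
   proof
    fix k assume "k \<in> S"
    hence "real_of_int \<bar>k\<bar> \<le> A" by (simp add: S_def)
    hence "\<bar>k\<bar> \<le> \<lfloor>A\<rfloor>" by (simp only: le_floor_iff)
    thus "k \<in> {- \<lfloor>A\<rfloor>..\<lfloor>A\<rfloor>}" by auto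
   qed
  qed simp
  let ?P = "{k\<in>S. D (real_of_int k) \<ge> 0}" and ?N = "{k\<in>S. D (real_of_int k) < 0}"
  let ?h = "\<lambda>k::int. f (real_of_int k)"
  have sep1: "(real_of_int (j - k))\<^sup>2 / (8 * A) \<le> \<bar>?h j - ?h k\<bar>" if "j \<in> ?P" "k \<in> ?P" for j k
  proof -
   have *: "(real_of_int (k - j))\<^sup>2 / (8 * A) \<le> \<bar>?h j - ?h k\<bar>" if "j \<le> k" "j \<in> ?P" "k \<in> ?P" for j k
   proof -
    have "0 \<le> D (real_of_int j) * (real_of_int k - real_of_int j)" using that by simp
    moreover have "?h j + D j * (real_of_int k - real_of_int j) + (real_of_int k - real_of_int j)\<^sup>2 / (8 * A) \<le> ?h k"
     by (rule tan) (use that in \<open>auto simp: S_def\<close>)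
    ultimately have "(real_of_int k - real_of_int j)\<^sup>2 / (8 * A) \<le> \<bar>?h j - ?h k\<bar>" by linarith
    thus ?thesis by simp
   qed
   have sym: "(real_of_int (j - k))\<^sup>2 = (real_of_int (k - j))\<^sup>2" "\<bar>?h k - ?h j\<bar> = \<bar>?h j - ?h k\<bar>"
    by (auto simp: power2_commute)
   show ?thesis
   proof (cases "j \<le> k")
    case True
    show ?thesis using *[of j k] that True sym by simp
   next
    case False
    hence "k \<le> j" by simp
    thus ?thesis using *[of k j] that sym by simp
   qed
  qed
  have sep2: "(real_of_int (j - k))\<^sup>2 / (8 * A) \<le> \<bar>?h j - ?h k\<bar>" if "j \<in> ?N" "k \<in> ?N" for j k
  proof -
   have *: "(real_of_int (k - j))\<^sup>2 / (8 * A) \<le> \<bar>?h j - ?h k\<bar>" if "k \<le> j" "j \<in> ?N" "k \<in> ?N" for j k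
   proof -
    have "0 \<le> D (real_of_int j) * (real_of_int k - real_of_int j)" using that
     by (intro mult_nonpos_nonpos) auto
    moreover have "?h j + D j * (real_of_int k - real_of_int j) + (real_of_int k - real_of_int j)\<^sup>2 / (8 * A) \<le> ?h k"
     by (rule tan) (use that in \<open>auto simp: S_def\<close>)
    ultimately have "(real_of_int k - real_of_int j)\<^sup>2 / (8 * A) \<le> \<bar>?h j - ?h k\<bar>" by linarith
    thus ?thesis by simp
   qed
   have sym: "(real_of_int (j - k))\<^sup>2 = (real_of_int (k - j))\<^sup>2" "\<bar>?h k - ?h j\<bar> = \<bar>?h j - ?h k\<bar>"
    by (auto simp: power2_commute)
   show ?thesis
   proof (cases "j \<le> k")
    case True
    show ?thesis using *[where j=k and k=j] that True sym by simp
   next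
    case False
    hence "k \<le> j" by simp
    thus ?thesis using *[where j=j and k=k] that sym by simp
   qed
  qed
  have "S = ?P \<union> ?N" by auto
  hence "(\<Sum>k\<in>S. jap (\<tau> - ?h k) powr (- \<theta>)) = (\<Sum>k\<in>?P. jap (\<tau> - ?h k) powr (- \<theta>)) + (\<Sum>k\<in>?N. jap (\<tau> - ?h k) powr (- \<theta>))"
   using finS by (subst sum.union_disjoint[symmetric]) auto
  also have "\<dots> \<le> K * A powr \<theta> + K * A powr \<theta>"
   by (intro add_mono K A ballI sep1 sep2) (use finS in auto)
  finally show "(\<Sum>k | \<bar>real_of_int k\<bar> \<le> A. jap (\<tau> - (sqrt (A\<^sup>2 + (real_of_int k)\<^sup>2) + sqrt (B\<^sup>2 + (real_of_int k - m)\<^sup>2))) powr (- \<theta>)) \<le> 2 * K * A powr \<theta>"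
   by (simp add: S_def f_def)
 qed
qed

section \<open>The frequency space\<close>

interpretation int2: sigma_finite_measure "count_space (UNIV :: (int \<times> int) set)"
 by (rule sigma_finite_measure_count_space_countable) simp

interpretation freq_pair: pair_sigma_finite lborel "count_space (UNIV :: (int \<times> int) set)" ..

lemma sigma_finite_freq: "sigma_finite_measure freq_measure"
 unfolding freq_measure_def by (rule freq_pair.sigma_finite_measure_axioms)

interpretation freq: sigma_finite_measure freq_measure by (rule sigma_finite_freq)

interpretation freq2: pair_sigma_finite freq_measure freq_measure ..

lemma space_freq[simp]: "space freq_measure = UNIV"
 by (simp add: freq_measure_def space_pair_measure)

lemma measurable_freq_fst[measurable]: "fmeas fst"
 unfolding freq_measure_def by measurable

lemma measurable_freq_snd[measurable]: "snd \<in> measurable freq_measure (count_space UNIV)"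
 unfolding freq_measure_def by measurable

lemma measurable_freq_Pair[measurable (raw)]:
 "f \<in> borel_measurable N \<Longrightarrow> g \<in> measurable N (count_space UNIV) \<Longrightarrow>
   (\<lambda>x. (f x, g x)) \<in> measurable N freq_measure"
 unfolding freq_measure_def by measurable

lemma measurable_freq_iff:
 "f \<in> measurable N freq_measure \<longleftrightarrow> (\<lambda>x. fst (f x)) \<in> borel_measurable N \<and> (\<lambda>x. snd (f x)) \<in> measurable N (count_space UNIV)"
 unfolding freq_measure_def by (simp add: measurable_pair_iff comp_def)

lemma measurable_freq_diff[measurable (raw)]:
 assumes "f \<in> measurable N freq_measure" "g \<in> measurable N freq_measure"
 shows "(\<lambda>x. f x - g x) \<in> measurable N freq_measure"
proof -
 have f: "(\<lambda>x. fst (f x)) \<in> borel_measurable N" "(\<lambda>x. snd (f x)) \<in> measurable N (count_space UNIV)"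
  and g: "(\<lambda>x. fst (g x)) \<in> borel_measurable N" "(\<lambda>x. snd (g x)) \<in> measurable N (count_space UNIV)"
  using assms by (simp_all add: measurable_freq_iff)
 have "(\<lambda>x. snd (f x) - snd (g x)) \<in> measurable N (count_space UNIV)"
  by (rule measurable_compose_countable[OF _ f(2), where f="\<lambda>i x. i - snd (g x)"])
    (rule measurable_compose[OF g(2)], simp)
 thus ?thesis using f(1) g(1) by (simp add: measurable_freq_iff)
qed

lemma measurable_freq_add[measurable (raw)]:
 assumes "f \<in> measurable N freq_measure" "g \<in> measurable N freq_measure"
 shows "(\<lambda>x. f x + g x) \<in> measurable N freq_measure"
proof -
 have "(\<lambda>x. f x - (0 - g x)) \<in> measurable N freq_measure"
  using assms by (intro measurable_freq_diff) (auto simp: zero_prod_def)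
 thus ?thesis by simp
qed

lemma measurable_freq_uminus[measurable (raw)]:
 assumes "f \<in> measurable N freq_measure"
 shows "(\<lambda>x. - f x) \<in> measurable N freq_measure"
proof -
 have "(\<lambda>x. 0 - f x) \<in> measurable N freq_measure"
  using assms by (intro measurable_freq_diff) (auto simp: zero_prod_def)
 thus ?thesis by simp
qed

lemma nn_integral_freq:
 assumes "fmeas f"
 shows "(\<oint> q. f q) = (\<integral>\<^sup>+ n. (\<integral>\<^sup>+ l. f (l, n) \<partial>lborel) \<partial>count_space UNIV)"
 using freq_pair.nn_integral_snd[of f] assms unfolding freq_measure_def by simp

text \<open>Lebesgue and counting measure are invariant under reflections, and two reflections make a shift.\<close>

lemma nn_integral_freq_reflect:
 assumes [measurable]: "fmeas f"
 shows "(\<oint> q. f (a - q)) = (\<oint> q. f q)"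
proof -
 have [measurable]: "fmeas (\<lambda>q. f (a - q))"
  by measurable
 have sl[measurable]: "(\<lambda>l. f (l, n)) \<in> borel_measurable borel" for n
  by measurable
 have "(\<oint> q. f (a - q)) = (\<integral>\<^sup>+ n. (\<integral>\<^sup>+ l. f (fst a - l, snd a - n) \<partial>lborel) \<partial>count_space UNIV)"
  by (subst nn_integral_freq) (auto simp: minus_prod_def)
 also have "\<dots> = (\<integral>\<^sup>+ n. (\<integral>\<^sup>+ l. f (l, snd a - n) \<partial>lborel) \<partial>count_space UNIV)"
 proof (rule nn_integral_cong)
  fix n
  show "(\<integral>\<^sup>+ l. f (fst a - l, snd a - n) \<partial>lborel) = (\<integral>\<^sup>+ l. f (l, snd a - n) \<partial>lborel)"
   using nn_integral_real_affine[OF sl, of "-1" "snd a - n" "fst a"] by simp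
 qed
 also have "\<dots> = (\<integral>\<^sup>+ n. (\<integral>\<^sup>+ l. f (l, n) \<partial>lborel) \<partial>count_space UNIV)"
  by (rule nn_integral_bij_count_space[where f="\<lambda>n. \<integral>\<^sup>+ l. f (l, n) \<partial>lborel"])
    (rule bij_betw_byWitness[where f'="\<lambda>n. snd a - n"], auto)
 finally show ?thesis by (simp add: nn_integral_freq)
qed

lemma nn_integral_freq_shift:
 assumes [measurable]: "fmeas f"
 shows "(\<oint> q. f (q + a)) = (\<oint> q. f q)"
proof -
 have [measurable]: "fmeas (\<lambda>q. f (a - q))"
  by measurable
 show ?thesis
  using nn_integral_freq_reflect[of "\<lambda>q. f (a - q)" 0] nn_integral_freq_reflect[of f a]
  by (simp add: add.commute)
qed

section \<open>One-dimensional integrals\<close>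

lemma nn_integral_count_le:
 fixes f :: "int \<Rightarrow> real"
 assumes "\<And>S. finite S \<Longrightarrow> sum f S \<le> K" "\<And>k. 0 \<le> f k"
 shows "(\<integral>\<^sup>+ k. ennreal (f k) \<partial>count_space UNIV) \<le> ennreal K"
proof -
 have "(\<integral>\<^sup>+ k. ennreal (f k) \<partial>count_space UNIV) = (\<integral>\<^sup>+ n. ennreal (f (int_decode n)) \<partial>count_space UNIV)"
  by (rule nn_integral_bij_count_space[symmetric]) (rule bij_int_decode)
 also have "\<dots> = (\<Sum>n. ennreal (f (int_decode n)))" by (rule nn_integral_count_space_nat)
 also have "\<dots> \<le> ennreal K"
  unfolding suminf_eq_SUP
 proof (rule SUP_least)
  fix N
  have "(\<Sum>n<N. f (int_decode n)) = sum f (int_decode ` {..<N})"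
   by (subst sum.reindex) (auto intro: inj_onI dest: injD[OF inj_int_decode])
  also have "\<dots> \<le> K" by (rule assms) simp
  finally show "(\<Sum>n<N. ennreal (f (int_decode n))) \<le> ennreal K"
   using assms(2) by (simp add: sum_ennreal ennreal_leI)
 qed
 finally show ?thesis .
qed

lemma nn_integral_jap_powr:
 fixes \<rho> :: real
 assumes "1 < \<rho>"
 shows "\<exists>C>0. (\<integral>\<^sup>+ l. ennreal (jap (l :: real) powr (- \<rho>)) \<partial>lborel) \<le> ennreal C"
proof -
 have half: "(\<integral>\<^sup>+ l. ennreal (l powr (- \<rho>)) * indicator {1..} l \<partial>lborel) = ennreal (1 / (\<rho> - 1))"
 proof -
  have "(\<integral>\<^sup>+ l. ennreal (l powr (- \<rho>)) * indicator {1..} l \<partial>lborel) = ennreal (0 - (- (1 / (\<rho> - 1)) * 1 powr (1 - \<rho>)))"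
  proof (rule nn_integral_FTC_atLeast[where F="\<lambda>l. - (1 / (\<rho> - 1)) * l powr (1 - \<rho>)"])
   show "DERIV (\<lambda>l. - (1 / (\<rho> - 1)) * l powr (1 - \<rho>)) x :> x powr - \<rho>" if "1 \<le> x" for x
   proof -
    have "DERIV (\<lambda>l. - (1 / (\<rho> - 1)) * l powr (1 - \<rho>)) x :> - (1 / (\<rho> - 1)) * ((1 - \<rho>) * x powr (1 - \<rho> - 1))"
     using that by (intro DERIV_cmult DERIV_fun_powr[where g="\<lambda>x. x", THEN DERIV_cong]) (auto simp: has_real_derivative_powr)
    also have "- (1 / (\<rho> - 1)) * ((1 - \<rho>) * x powr (1 - \<rho> - 1)) = x powr - \<rho>"
     using assms by (simp add: field_simps)
    finally show ?thesis .
   qed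
   have "((\<lambda>x. x powr (1 - \<rho>)) \<longlongrightarrow> 0) at_top"
    using assms by (intro tendsto_neg_powr filterlim_ident) auto
   from tendsto_mult_left[OF this, of "- (1 / (\<rho> - 1))"]
   show "((\<lambda>x. - (1 / (\<rho> - 1)) * x powr (1 - \<rho>)) \<longlongrightarrow> 0) at_top" by simp
  qed auto
  thus ?thesis by simp
 qed
 have bd: "ennreal (jap l powr (- \<rho>)) \<le> indicator {-1..1} l + (ennreal (l powr (- \<rho>)) * indicator {1..} l
   + ennreal ((-l) powr (- \<rho>)) * indicator {1..} (-l))" for l :: real
 proof -
  have le1: "jap l powr (- \<rho>) \<le> 1" using powr_mono2'[of "-\<rho>" 1 "jap l"] jap_ge_1[of l] assms by simp
  consider "\<bar>l\<bar> \<le> 1" | "l > 1" | "l < -1" by linarith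
  thus ?thesis
  proof cases
   case 1 thus ?thesis using le1 by (auto simp: indicator_def abs_le_iff add_increasing2 intro: order_trans[of _ 1])
  next
   case 2
   have "jap l powr (- \<rho>) \<le> l powr (- \<rho>)"
    using 2 assms norm_le_jap[of l] by (intro powr_mono2') auto
   thus ?thesis using 2 by (simp add: ennreal_leI)
  next
   case 3
   have "jap l powr (- \<rho>) \<le> (-l) powr (- \<rho>)"
    using 3 assms norm_le_jap[of l] by (intro powr_mono2') auto
   thus ?thesis using 3 by (simp add: ennreal_leI)
  qed
 qed
 have refl: "(\<integral>\<^sup>+ l. ennreal ((-l) powr (- \<rho>)) * indicator {1..} (-l) \<partial>lborel) = ennreal (1 / (\<rho> - 1))"
  using nn_integral_real_affine[of "\<lambda>l. ennreal (l powr (- \<rho>)) * indicator {1..} l" "-1" 0] half by simp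
 have "(\<integral>\<^sup>+ l. ennreal (jap (l::real) powr (- \<rho>)) \<partial>lborel) \<le>
   (\<integral>\<^sup>+ l. indicator {-1..1} l + (ennreal (l powr (- \<rho>)) * indicator {1..} l
   + ennreal ((-l) powr (- \<rho>)) * indicator {1..} (-l)) \<partial>lborel)"
  by (intro nn_integral_mono bd)
 also have "\<dots> = 2 + (ennreal (1 / (\<rho> - 1)) + ennreal (1 / (\<rho> - 1)))"
  by (subst nn_integral_add, measurable, subst nn_integral_add, measurable) (simp add: half refl)
 also have "\<dots> = ennreal (2 + 2 / (\<rho> - 1))"
  using assms by (simp flip: ennreal_plus ennreal_numeral)
 finally show ?thesis using assms by (intro exI[of _ "2 + 2 / (\<rho> - 1)"]) (auto intro: add_pos_pos)
qed

text \<open>Either \<open>|l - p|\<close> or \<open>|q - l|\<close> is at least \<open>|q - p| / 2\<close>; the corresponding factor yields the decay in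
\<open>q - p\<close>, and what is left still has exponent above \<open>1\<close>, since \<open>8/5 - \<theta> > 1\<close>.\<close>

lemma nn_integral_jap_product:
 fixes \<theta> :: real
 assumes "0 < \<theta>" "\<theta> < 3/5"
 shows "\<exists>C>0. \<forall>p q. (\<integral>\<^sup>+ l. ennreal (jap (l - p) powr (-4/5) * jap (q - l) powr (-4/5)) \<partial>lborel)
      \<le> ennreal (C * jap (q - p :: real) powr (- \<theta>))"
proof -
 define \<rho> where "\<rho> = 8/5 - \<theta>"
 obtain C where C: "C > 0" "(\<integral>\<^sup>+ l. ennreal (jap (l::real) powr (- \<rho>)) \<partial>lborel) \<le> ennreal C"
  using nn_integral_jap_powr[of \<rho>] assms by (auto simp: \<rho>_def)
 have bd: "jap (l - p) powr (-4/5) * jap (q - l) powr (-4/5) \<le>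
   2 powr \<theta> * jap (q - p) powr (- \<theta>) * (jap (l - p) powr (- \<rho>) + jap (q - l) powr (- \<rho>))" for l p q :: real
 proof -
  define a b d where "a = jap (l - p)" and "b = jap (q - l)" and "d = jap (q - p)"
  have pos: "a > 0" "b > 0" "d > 0" by (auto simp: a_def b_def d_def jap_pos)
  have tri: "d \<le> a + b" using jap_triangle[of "l - p" "q - l"] by (simp add: a_def b_def d_def)
  have *: "x powr (-4/5) * y powr (-4/5) \<le> 2 powr \<theta> * d powr (-\<theta>) * x powr (-\<rho>)"
   if "x \<le> y" "0 < x" "d \<le> x + y" for x y
  proof -
   have y: "y > 0" using that by linarith
   have "y powr (-4/5) = y powr (-\<theta>) * y powr (\<theta> - 4/5)" by (simp flip: powr_add)
   also have "\<dots> \<le> (d/2) powr (-\<theta>) * x powr (\<theta> - 4/5)"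
    using that assms y pos by (intro mult_mono powr_mono2') auto
   also have "(d/2) powr (-\<theta>) = 2 powr \<theta> * d powr (-\<theta>)"
    by (simp add: powr_divide powr_minus divide_simps)
   finally have "x powr (-4/5) * y powr (-4/5) \<le> x powr (-4/5) * (2 powr \<theta> * d powr (-\<theta>) * x powr (\<theta> - 4/5))"
    by (intro mult_left_mono) auto
   also have "\<dots> = 2 powr \<theta> * d powr (-\<theta>) * (x powr (-4/5) * x powr (\<theta> - 4/5))" by simp
   also have "x powr (-4/5) * x powr (\<theta> - 4/5) = x powr (-\<rho>)" by (simp add: \<rho>_def flip: powr_add)
   finally show ?thesis .
  qed
  have "a powr (-4/5) * b powr (-4/5) \<le> 2 powr \<theta> * d powr (-\<theta>) * (a powr (-\<rho>) + b powr (-\<rho>))"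
  proof (cases "a \<le> b")
   case True
   have "2 powr \<theta> * d powr (-\<theta>) * a powr (-\<rho>) \<le> 2 powr \<theta> * d powr (-\<theta>) * (a powr (-\<rho>) + b powr (-\<rho>))"
    by (intro mult_left_mono) auto
   thus ?thesis using *[OF True pos(1) tri] by linarith
  next
   case False
   have "2 powr \<theta> * d powr (-\<theta>) * b powr (-\<rho>) \<le> 2 powr \<theta> * d powr (-\<theta>) * (a powr (-\<rho>) + b powr (-\<rho>))"
    by (intro mult_left_mono) auto
   thus ?thesis using *[of b a] False pos(2) tri by (simp add: mult.commute add.commute)
  qed
  thus ?thesis by (simp add: a_def b_def d_def)
 qed
 show ?thesis
 proof (intro exI[of _ "2 powr \<theta> * (2 * C)"] conjI allI)
  show "2 powr \<theta> * (2 * C) > 0" using C by simp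
  fix p q :: real
  let ?c = "2 powr \<theta> * jap (q - p) powr (- \<theta>)"
  have "(\<integral>\<^sup>+ l. ennreal (jap (l - p) powr (-4/5) * jap (q - l) powr (-4/5)) \<partial>lborel) \<le>
    (\<integral>\<^sup>+ l. ennreal ?c * (ennreal (jap (l - p) powr (- \<rho>)) + ennreal (jap (q - l) powr (- \<rho>))) \<partial>lborel)"
   by (intro nn_integral_mono) (use bd in \<open>simp add: ennreal_leI flip: ennreal_mult ennreal_plus\<close>)
  also have "\<dots> = ennreal ?c * ((\<integral>\<^sup>+ l. ennreal (jap (l - p) powr (- \<rho>)) \<partial>lborel) + (\<integral>\<^sup>+ l. ennreal (jap (q - l) powr (- \<rho>)) \<partial>lborel))"
   by (subst nn_integral_cmult, measurable, subst nn_integral_add) auto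
  also have "(\<integral>\<^sup>+ l. ennreal (jap (l - p) powr (- \<rho>)) \<partial>lborel) = (\<integral>\<^sup>+ l. ennreal (jap (l::real) powr (- \<rho>)) \<partial>lborel)"
   using nn_integral_real_affine[of "\<lambda>l. ennreal (jap l powr (- \<rho>))" 1 "-p"] by simp
  also have "(\<integral>\<^sup>+ l. ennreal (jap (q - l) powr (- \<rho>)) \<partial>lborel) = (\<integral>\<^sup>+ l. ennreal (jap (l::real) powr (- \<rho>)) \<partial>lborel)"
   using nn_integral_real_affine[of "\<lambda>l. ennreal (jap l powr (- \<rho>))" "-1" q] by simp
  also have "ennreal ?c * ((\<integral>\<^sup>+ l. ennreal (jap (l::real) powr (- \<rho>)) \<partial>lborel) + (\<integral>\<^sup>+ l. ennreal (jap (l::real) powr (- \<rho>)) \<partial>lborel))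
    \<le> ennreal ?c * (ennreal C + ennreal C)"
   by (intro mult_left_mono add_mono C) auto
  also have "\<dots> = ennreal (2 powr \<theta> * (2 * C) * jap (q - p) powr (- \<theta>))"
   using C by (simp add: mult_ac flip: ennreal_plus ennreal_mult)
  finally show "(\<integral>\<^sup>+ l. ennreal (jap (l - p) powr (-4/5) * jap (q - l) powr (-4/5)) \<partial>lborel)
      \<le> ennreal (2 powr \<theta> * (2 * C) * jap (q - p) powr (- \<theta>))" .
 qed
qed

section \<open>The resonance sum\<close>

text \<open>Along a line with fixed first coordinate \<open>i\<close> the terms with \<open>|k| \<le> \<langle>i\<rangle>\<close> fall under \<open>line_sum_bound\<close> with
\<open>A = \<langle>i\<rangle>\<close>. The sum is then at most a multiple of \<open>A\<close> to the power \<open>\<theta> - 3/2 - 2 eps = -1 - 3/2 eps\<close>, which can be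
summed over \<open>i\<close>.\<close>

lemma resonance_half:
 fixes eps :: real
 assumes "0 < eps"
 defines "\<theta> \<equiv> 1/2 + eps/2"
 shows "\<exists>C>0. \<forall>\<tau> m1 m2. (\<integral>\<^sup>+ i. (\<integral>\<^sup>+ k. indicator {k. \<bar>real_of_int k\<bar> \<le> jap (real_of_int i)} k *
    ennreal (jap (freq (i, k)) powr (- (3/2 + 2 * eps)) *
     jap (\<tau> - (jap (freq (i, k)) + jap (freq (m1 - i, m2 - k)))) powr (- \<theta>)) \<partial>count_space UNIV) \<partial>count_space UNIV) \<le> ennreal C"
proof -
 have th: "\<theta> > 1/2" using assms by simp
 obtain K where K: "K > 0" "\<And>\<tau> A B m. 1 \<le> A \<Longrightarrow> 0 < B \<Longrightarrow>
   (\<Sum>k | \<bar>real_of_int k\<bar> \<le> A. jap (\<tau> - (sqrt (A\<^sup>2 + (real_of_int k)\<^sup>2) + sqrt (B\<^sup>2 + (real_of_int k - m)\<^sup>2))) powr (- \<theta>))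
    \<le> K * A powr \<theta>"
  using line_sum_bound[OF th] by blast
 define \<kappa> where "\<kappa> = 1/2 + 3/4 * eps"
 obtain L where L: "L > 0" "\<And>S :: int set. finite S \<Longrightarrow> (\<Sum>k\<in>S. (1 + (real_of_int k)\<^sup>2) powr (- \<kappa>)) \<le> L"
  using sum_int_powr_bounded[of \<kappa>] assms by (auto simp: \<kappa>_def)
 have inner: "(\<integral>\<^sup>+ k. indicator {k. \<bar>real_of_int k\<bar> \<le> jap (real_of_int i)} k *
    ennreal (jap (freq (i, k)) powr (- (3/2 + 2 * eps)) *
     jap (\<tau> - (jap (freq (i, k)) + jap (freq (m1 - i, m2 - k)))) powr (- \<theta>)) \<partial>count_space UNIV)
   \<le> ennreal (K * (1 + (real_of_int i)\<^sup>2) powr (- \<kappa>))" for \<tau> and i m1 m2 :: int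
 proof -
  define A where "A = jap (real_of_int i)"
  define B where "B = jap (real_of_int (m1 - i))"
  define S where "S = {k::int. \<bar>real_of_int k\<bar> \<le> A}"
  have A: "1 \<le> A" "A > 0" and B: "0 < B" by (auto simp: A_def B_def jap_ge_1 jap_pos)
  have finS: "finite S"
  proof (rule finite_subset)
   show "S \<subseteq> {- \<lfloor>A\<rfloor>..\<lfloor>A\<rfloor>}"
   proof
    fix k assume "k \<in> S"
    hence "real_of_int \<bar>k\<bar> \<le> A" by (simp add: S_def)
    hence "\<bar>k\<bar> \<le> \<lfloor>A\<rfloor>" by (simp only: le_floor_iff)
    thus "k \<in> {- \<lfloor>A\<rfloor>..\<lfloor>A\<rfloor>}" by auto
   qed
  qed simp
  have f1: "jap (freq (i, k)) = sqrt (A\<^sup>2 + (real_of_int k)\<^sup>2)" for k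
   by (simp add: jap_freq A_def jap_sq)
  have f2: "jap (freq (m1 - i, m2 - k)) = sqrt (B\<^sup>2 + (real_of_int k - real_of_int m2)\<^sup>2)" for k
   by (simp add: jap_freq B_def jap_sq power2_commute)
  have Af: "A \<le> jap (freq (i, k))" for k unfolding f1 by (rule real_le_rsqrt) simp
  let ?g = "\<lambda>k. jap (freq (i, k)) powr (- (3/2 + 2 * eps)) *
     jap (\<tau> - (jap (freq (i, k)) + jap (freq (m1 - i, m2 - k)))) powr (- \<theta>)"
  have "(\<integral>\<^sup>+ k. indicator S k * ennreal (?g k) \<partial>count_space UNIV) = (\<Sum>k\<in>S. ennreal (?g k))"
   using nn_integral_indicator_finite[of S "count_space UNIV" "\<lambda>k. ennreal (?g k)"] finS by (simp add: mult.commute)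
  also have "\<dots> = ennreal (\<Sum>k\<in>S. ?g k)" by (rule sum_ennreal) simp
  finally have eq: "(\<integral>\<^sup>+ k. indicator S k * ennreal (?g k) \<partial>count_space UNIV) = ennreal (\<Sum>k\<in>S. ?g k)" .
  have "(\<Sum>k\<in>S. ?g k) \<le> (\<Sum>k\<in>S. A powr (- (3/2 + 2 * eps)) *
    jap (\<tau> - (jap (freq (i, k)) + jap (freq (m1 - i, m2 - k)))) powr (- \<theta>))"
   using Af A assms by (intro sum_mono mult_right_mono powr_mono2') auto
  also have "\<dots> = A powr (- (3/2 + 2 * eps)) * (\<Sum>k\<in>S. jap (\<tau> - (jap (freq (i, k)) + jap (freq (m1 - i, m2 - k)))) powr (- \<theta>))"
   by (rule sum_distrib_left[symmetric])
  also have "\<dots> \<le> A powr (- (3/2 + 2 * eps)) * (K * A powr \<theta>)"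
   unfolding f1 f2 S_def by (intro mult_left_mono K A B) simp
  also have "\<dots> = K * (A powr (- (3/2 + 2 * eps)) * A powr \<theta>)" by simp
  also have "A powr (- (3/2 + 2 * eps)) * A powr \<theta> = A powr (- (2 * \<kappa>))"
   by (simp add: \<kappa>_def \<theta>_def flip: powr_add)
  also have "A powr (- (2 * \<kappa>)) = (A powr 2) powr (- \<kappa>)" by (simp only: powr_powr) simp
  also have "A powr 2 = 1 + (real_of_int i)\<^sup>2" using A by (simp add: A_def jap_sq)
  finally have "(\<Sum>k\<in>S. ?g k) \<le> K * (1 + (real_of_int i)\<^sup>2) powr (- \<kappa>)" .
  hence "ennreal (\<Sum>k\<in>S. ?g k) \<le> ennreal (K * (1 + (real_of_int i)\<^sup>2) powr (- \<kappa>))"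
   by (rule ennreal_leI)
  thus ?thesis using eq unfolding S_def A_def by simp
 qed
 show ?thesis
 proof (intro exI[of _ "K * L"] conjI allI)
  show "K * L > 0" using K L by simp
  fix \<tau> m1 m2
  have "(\<integral>\<^sup>+ i. (\<integral>\<^sup>+ k. indicator {k. \<bar>real_of_int k\<bar> \<le> jap (real_of_int i)} k *
    ennreal (jap (freq (i, k)) powr (- (3/2 + 2 * eps)) *
     jap (\<tau> - (jap (freq (i, k)) + jap (freq (m1 - i, m2 - k)))) powr (- \<theta>)) \<partial>count_space UNIV) \<partial>count_space UNIV)
    \<le> (\<integral>\<^sup>+ i. ennreal (K * (1 + (real_of_int i)\<^sup>2) powr (- \<kappa>)) \<partial>count_space UNIV)"
   by (intro nn_integral_mono inner)
  also have "\<dots> \<le> ennreal (K * L)"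
   by (rule nn_integral_count_le) (use K L in \<open>auto simp flip: sum_distrib_left\<close>)
  finally show "(\<integral>\<^sup>+ i. (\<integral>\<^sup>+ k. indicator {k. \<bar>real_of_int k\<bar> \<le> jap (real_of_int i)} k *
    ennreal (jap (freq (i, k)) powr (- (3/2 + 2 * eps)) *
     jap (\<tau> - (jap (freq (i, k)) + jap (freq (m1 - i, m2 - k)))) powr (- \<theta>)) \<partial>count_space UNIV) \<partial>count_space UNIV) \<le> ennreal (K * L)" .
 qed
qed

text \<open>The lattice is covered by the points with \<open>|k| \<le> \<langle>i\<rangle>\<close> and their mirror images under the exchange of the
two coordinates.\<close>

lemma resonance_sum:
 fixes eps :: real
 assumes "0 < eps"
 defines "\<theta> \<equiv> 1/2 + eps/2"
 shows "\<exists>C>0. \<forall>\<tau> m. (\<integral>\<^sup>+ n. ennreal (jap (freq n) powr (- (3/2 + 2 * eps)) *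
     jap (\<tau> - (jap (freq n) + jap (freq (m - n)))) powr (- \<theta>)) \<partial>count_space UNIV) \<le> ennreal C"
proof -
 obtain C where C: "C > 0" "\<And>\<tau> m1 m2. (\<integral>\<^sup>+ i. (\<integral>\<^sup>+ k. indicator {k. \<bar>real_of_int k\<bar> \<le> jap (real_of_int i)} k *
    ennreal (jap (freq (i, k)) powr (- (3/2 + 2 * eps)) *
     jap (\<tau> - (jap (freq (i, k)) + jap (freq (m1 - i, m2 - k)))) powr (- \<theta>)) \<partial>count_space UNIV) \<partial>count_space UNIV) \<le> ennreal C"
  using resonance_half[OF assms(1)] unfolding \<theta>_def by blast
 show ?thesis
 proof (intro exI[of _ "C + C"] conjI allI)
  show "C + C > 0" using C by simp
  fix \<tau> and m :: "int \<times> int"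
  define g where "g = (\<lambda>m n. ennreal (jap (freq n) powr (- (3/2 + 2 * eps)) *
     jap (\<tau> - (jap (freq n) + jap (freq (m - n)))) powr (- \<theta>)))"
  define ind :: "int \<times> int \<Rightarrow> ennreal" where "ind = (\<lambda>n. indicator {k. \<bar>real_of_int k\<bar> \<le> jap (real_of_int (fst n))} (snd n))"
  have sw: "bij_betw prod.swap UNIV (UNIV :: (int \<times> int) set)"
   by (rule bij_betw_byWitness[where f'=prod.swap]) auto
  have le: "g m n \<le> ind n * g m n + ind (prod.swap n) * g m n" for n
  proof -
   have "ind n = 1 \<or> ind (prod.swap n) = 1"
    using norm_le_jap[of "real_of_int (fst n)"] norm_le_jap[of "real_of_int (snd n)"]
    by (auto simp: ind_def indicator_def)
   thus ?thesis by (auto simp: add_increasing add_increasing2)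
  qed
  have half: "(\<integral>\<^sup>+ n. ind n * g m n \<partial>count_space UNIV) \<le> ennreal C" for m :: "int \<times> int"
  proof -
   have "(\<integral>\<^sup>+ n. ind n * g m n \<partial>count_space UNIV) = (\<integral>\<^sup>+ i. (\<integral>\<^sup>+ k. ind (i, k) * g m (i, k) \<partial>count_space UNIV) \<partial>count_space UNIV)"
    by (rule nn_integral_fst_count_space[symmetric])
   also have "\<dots> \<le> ennreal C"
    using C(2)[of \<tau> "fst m" "snd m"] by (simp add: ind_def g_def minus_prod_def)
   finally show ?thesis .
  qed
  have nsw: "norm (freq (prod.swap n)) = norm (freq n)" for n
   by (simp add: freq_def norm_Pair add.commute)
  have jsw: "jap (freq (prod.swap n)) = jap (freq n)" for n
   by (simp add: jap_def nsw)
  have gsw: "g m n = g (prod.swap m) (prod.swap n)" for n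
  proof -
   have "prod.swap m - prod.swap n = prod.swap (m - n)" by (simp add: prod_eq_iff)
   thus ?thesis unfolding g_def by (simp only: jsw)
  qed
  have "(\<integral>\<^sup>+ n. g m n \<partial>count_space UNIV) \<le> (\<integral>\<^sup>+ n. ind n * g m n \<partial>count_space UNIV) + (\<integral>\<^sup>+ n. ind (prod.swap n) * g m n \<partial>count_space UNIV)"
   by (subst nn_integral_add[symmetric]) (auto intro!: nn_integral_mono le)
  also have "(\<integral>\<^sup>+ n. ind (prod.swap n) * g m n \<partial>count_space UNIV) = (\<integral>\<^sup>+ n. ind n * g (prod.swap m) n \<partial>count_space UNIV)"
   unfolding gsw by (rule nn_integral_bij_count_space[OF sw])
  also have "(\<integral>\<^sup>+ n. ind n * g m n \<partial>count_space UNIV) + \<dots> \<le> ennreal C + ennreal C"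
   by (intro add_mono half)
  finally show "(\<integral>\<^sup>+ n. ennreal (jap (freq n) powr (- (3/2 + 2 * eps)) *
     jap (\<tau> - (jap (freq n) + jap (freq (m - n)))) powr (- \<theta>)) \<partial>count_space UNIV) \<le> ennreal (C + C)"
   using C by (subst ennreal_plus) (auto simp: g_def)
 qed
qed

section \<open>Convolutions and their energy\<close>

text \<open>The frequency weight \<open>\<langle>n\<rangle>\<close> and the modulation weight \<open>\<langle>|\<lambda>| - \<langle>n\<rangle>\<rangle>\<close> of the point \<open>(\<lambda>, n)\<close>.\<close>

definition fq :: "freqpt \<Rightarrow> real" where
 "fq q = jap (freq (snd q))"

definition md :: "freqpt \<Rightarrow> real" where
 "md q = jap (\<bar>fst q\<bar> - jap (freq (snd q)))"

definition conv :: "(freqpt \<Rightarrow> ennreal) \<Rightarrow> (freqpt \<Rightarrow> ennreal) \<Rightarrow> freqpt \<Rightarrow> ennreal" where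
 "conv F G x = (\<oint> a. F a * G (x - a))"

lemma fq_ge_1: "1 \<le> fq q" and fq_pos: "0 < fq q" and md_ge_1: "1 \<le> md q" and md_pos: "0 < md q"
 by (simp_all add: fq_def md_def jap_ge_1 jap_pos)

lemma fq_uminus[simp]: "fq (- q) = fq q" and md_uminus[simp]: "md (- q) = md q"
 by (simp_all add: fq_def md_def)

lemma fq_measurable[measurable]: "fmeas fq"
 unfolding fq_def by measurable

lemma md_measurable[measurable]: "fmeas md"
 unfolding md_def by measurable

lemma conv_measurable[measurable]:
 assumes [measurable]: "fmeas F" "fmeas G"
 shows "fmeas (conv F G)"
 unfolding conv_def by measurable

lemma conv_commute:
 assumes [measurable]: "fmeas F" "fmeas G"
 shows "conv F G = conv G F"
proof
 fix x
 have "conv F G x = (\<oint> a. F (x - a) * G (x - (x - a)))"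
  unfolding conv_def by (rule nn_integral_freq_reflect[symmetric]) measurable
 thus "conv F G x = conv G F x" by (simp add: conv_def mult.commute)
qed

lemma conv_mono:
 assumes "\<And>q. F q \<le> F' q" "\<And>q. G q \<le> G' q"
 shows "conv F G x \<le> conv F' G' x"
 unfolding conv_def by (intro nn_integral_mono mult_mono assms) auto

lemma conv_add_left:
 assumes [measurable]: "fmeas F" "fmeas F'" "fmeas G"
 shows "conv (\<lambda>q. F q + F' q) G x = conv F G x + conv F' G x"
 unfolding conv_def by (subst nn_integral_add[symmetric]) (auto simp: distrib_right)

lemma conv_add_right:
 assumes [measurable]: "fmeas F" "fmeas G" "fmeas G'"
 shows "conv F (\<lambda>q. G q + G' q) x = conv F G x + conv F G' x"
 unfolding conv_def by (subst nn_integral_add[symmetric]) (auto simp: distrib_left)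

lemma conv_integral:
 assumes [measurable]: "fmeas F" "fmeas G" "fmeas \<psi>"
 shows "(\<oint> y. conv F G y * \<psi> y) = (\<oint> a. F a * (\<oint> b. G b * \<psi> (a + b)))"
proof -
 have "(\<oint> y. conv F G y * \<psi> y) = (\<oint> y. (\<oint> a. F a * (G (y - a) * \<psi> y)))"
  unfolding conv_def by (subst nn_integral_multc[symmetric]) (auto simp: mult.assoc)
 also have "\<dots> = (\<oint> a. (\<oint> y. F a * (G (y - a) * \<psi> y)))"
  by (rule freq2.Fubini') measurable
 also have "\<dots> = (\<oint> a. F a * (\<oint> y. G (y - a) * \<psi> y))"
  by (subst nn_integral_cmult) auto
 also have "\<dots> = (\<oint> a. F a * (\<oint> b. G b * \<psi> (a + b)))"
 proof (rule nn_integral_cong)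
  fix a
  have "(\<oint> b. G b * \<psi> (a + b)) = (\<oint> y. G (y - a) * \<psi> y)"
   using nn_integral_freq_shift[of "\<lambda>y. G (y - a) * \<psi> y" a] by (simp add: add.commute)
  thus "F a * (\<oint> y. G (y - a) * \<psi> y) = F a * (\<oint> b. G b * \<psi> (a + b))" by simp
 qed
 finally show ?thesis .
qed

lemma conv_energy_expand:
 assumes [measurable]: "fmeas F" "fmeas G"
 shows "(\<oint> x. (conv F G x)\<^sup>2) =
  (\<oint> a. F a * (\<oint> c. F c * (\<oint> x. G (x - a) * G (x - c))))"
proof -
 have "(\<oint> x. (conv F G x)\<^sup>2) = (\<oint> x. (\<oint> a. F a * (G (x - a) * conv F G x)))"
  unfolding power2_eq_square
  by (subst (1) conv_def, subst nn_integral_multc[symmetric]) (auto simp: mult.assoc)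
 also have "\<dots> = (\<oint> a. (\<oint> x. F a * (G (x - a) * conv F G x)))"
  by (rule freq2.Fubini') measurable
 also have "\<dots> = (\<oint> a. F a * (\<oint> x. G (x - a) * conv F G x))"
  by (subst nn_integral_cmult) auto
 also have "\<dots> = (\<oint> a. F a * (\<oint> c. F c * (\<oint> x. G (x - a) * G (x - c))))"
 proof (rule nn_integral_cong)
  fix a
  have "(\<oint> x. G (x - a) * conv F G x) = (\<oint> x. (\<oint> c. F c * (G (x - a) * G (x - c))))"
   unfolding conv_def by (subst nn_integral_cmult[symmetric]) (auto simp: mult_ac)
  also have "\<dots> = (\<oint> c. (\<oint> x. F c * (G (x - a) * G (x - c))))"
   by (rule freq2.Fubini') measurable
  also have "\<dots> = (\<oint> c. F c * (\<oint> x. G (x - a) * G (x - c)))"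
   by (subst nn_integral_cmult) auto
  finally show "F a * (\<oint> x. G (x - a) * conv F G x) =
    F a * (\<oint> c. F c * (\<oint> x. G (x - a) * G (x - c)))" by simp
 qed
 finally show ?thesis .
qed

text \<open>Expanding the square, the substitution \<open>x \<mapsto> a + c - x\<close> exchanges the two occurrences of \<open>G\<close>. This
reduces interactions of opposite signs of \<open>\<lambda>\<close> to those of equal signs.\<close>

lemma conv_energy_reflect:
 assumes [measurable]: "fmeas F" "fmeas G"
 shows "(\<oint> x. (conv F (\<lambda>q. G (- q)) x)\<^sup>2) = (\<oint> x. (conv F G x)\<^sup>2)"
proof -
 have [measurable]: "fmeas (\<lambda>q. G (- q))" by measurable
 have "(\<oint> x. G (- (x - a)) * G (- (x - c))) = (\<oint> x. G (x - a) * G (x - c))" for a c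
 proof -
  have "(\<oint> x. G (x - a) * G (x - c)) = (\<oint> x. G (a + c - x - a) * G (a + c - x - c))"
   by (rule nn_integral_freq_reflect[symmetric]) measurable
  thus ?thesis by (simp add: algebra_simps)
 qed
 thus ?thesis by (simp add: conv_energy_expand)
qed

section \<open>The bilinear estimate\<close>

text \<open>The damped factor of the bilinear estimate, and the squared norm that bounds both factors. The
modulation exponent \<open>2/5\<close> is below \<open>1/2\<close>, which leaves room for the power of \<open>T\<close>, but large enough for
\<open>4/5 + 4/5 - 1\<close> to exceed the \<open>1/2\<close> needed in the resonance sum.\<close>

definition lo :: "real \<Rightarrow> (freqpt \<Rightarrow> ennreal) \<Rightarrow> freqpt \<Rightarrow> ennreal" where
 "lo eps F q = ennreal (fq q powr (- (3/4 + eps))) * F q"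

definition NL :: "(freqpt \<Rightarrow> ennreal) \<Rightarrow> ennreal" where
 "NL F = (\<oint> q. (ennreal (md q powr (2/5)) * F q)\<^sup>2)"

lemma lo_measurable[measurable]:
 "fmeas F \<Longrightarrow> fmeas (lo eps F)"
 unfolding lo_def by measurable

lemma NL_reflect:
 assumes [measurable]: "fmeas F"
 shows "NL (\<lambda>q. F (- q)) = NL F"
proof -
 have "NL (\<lambda>q. F (- q)) = (\<oint> q. (ennreal (md (0 - q) powr (2/5)) * F (0 - q))\<^sup>2)"
  by (simp add: NL_def)
 also have "\<dots> = NL F"
  unfolding NL_def by (rule nn_integral_freq_reflect) measurable
 finally show ?thesis .
qed

lemma NL_mono: "(\<And>q. F q \<le> G q) \<Longrightarrow> NL F \<le> NL G"
 unfolding NL_def by (intro nn_integral_mono power_mono mult_left_mono) auto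

lemma resonance_integral:
 fixes eps :: real
 assumes "0 < eps" "eps < 1/5"
 shows "\<exists>C>0. \<forall>x. (\<oint> a. ennreal (fq a powr (- (3/2 + 2 * eps)) *
   (jap (fst a - fq a) powr (-4/5) * jap (fst x - fst a - fq (x - a)) powr (-4/5)))) \<le> ennreal C"
proof -
 define \<theta> where "\<theta> = 1/2 + eps/2"
 obtain C1 where C1: "C1 > 0" "\<And>p q. (\<integral>\<^sup>+ l. ennreal (jap (l - p) powr (-4/5) * jap (q - l) powr (-4/5)) \<partial>lborel)
      \<le> ennreal (C1 * jap (q - p :: real) powr (- \<theta>))"
  using nn_integral_jap_product[of \<theta>] assms by (auto simp: \<theta>_def)
 obtain C2 where C2: "C2 > 0" "\<And>\<tau> m. (\<integral>\<^sup>+ n. ennreal (jap (freq n) powr (- (3/2 + 2 * eps)) *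
     jap (\<tau> - (jap (freq n) + jap (freq (m - n)))) powr (- \<theta>)) \<partial>count_space UNIV) \<le> ennreal C2"
  using resonance_sum[OF assms(1)] unfolding \<theta>_def by blast
 show ?thesis
 proof (intro exI[of _ "C1 * C2"] conjI allI)
  show "C1 * C2 > 0" using C1 C2 by simp
  fix x :: "freqpt"
  let ?w = "\<lambda>n. jap (freq n) powr (- (3/2 + 2 * eps))"
  have "(\<oint> a. ennreal (fq a powr (- (3/2 + 2 * eps)) *
   (jap (fst a - fq a) powr (-4/5) * jap (fst x - fst a - fq (x - a)) powr (-4/5))))
   = (\<integral>\<^sup>+ n. (\<integral>\<^sup>+ l. ennreal (?w n) *
     ennreal (jap (l - jap (freq n)) powr (-4/5) * jap ((fst x - jap (freq (snd x - n))) - l) powr (-4/5)) \<partial>lborel) \<partial>count_space UNIV)"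
   by (subst nn_integral_freq) (auto simp: fq_def ennreal_mult' algebra_simps)
  also have "\<dots> \<le> (\<integral>\<^sup>+ n. ennreal (?w n) * ennreal (C1 * jap ((fst x - jap (freq (snd x - n))) - jap (freq n)) powr (- \<theta>)) \<partial>count_space UNIV)"
   by (subst nn_integral_cmult, measurable) (intro nn_integral_mono mult_left_mono C1, simp)
  also have "\<dots> = (\<integral>\<^sup>+ n. ennreal C1 * ennreal (?w n * jap (fst x - (jap (freq n) + jap (freq (snd x - n)))) powr (- \<theta>)) \<partial>count_space UNIV)"
   using C1 by (intro nn_integral_cong) (auto simp: algebra_simps simp flip: ennreal_mult')
  also have "\<dots> \<le> ennreal C1 * ennreal C2"
   by (subst nn_integral_cmult, measurable) (intro mult_left_mono C2, simp)
  also have "\<dots> = ennreal (C1 * C2)" using C1 C2 by (simp add: ennreal_mult)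
  finally show "(\<oint> a. ennreal (fq a powr (- (3/2 + 2 * eps)) *
   (jap (fst a - fq a) powr (-4/5) * jap (fst x - fst a - fq (x - a)) powr (-4/5)))) \<le> ennreal (C1 * C2)" .
 qed
qed

lemma powr_square: "(x powr p)\<^sup>2 = x powr (2 * p :: real)" for x :: real
 by (simp add: power2_eq_square flip: powr_add)

text \<open>For \<open>\<lambda> \<ge> 0\<close> the modulation is \<open>\<lambda> - \<langle>n\<rangle>\<close>. Cauchy--Schwarz in the convolution variable leaves the supremum
over \<open>x\<close> of the integral bounded in \<open>resonance_integral\<close>.\<close>

lemma bilinear_positive:
 fixes eps :: real
 assumes "0 < eps" "eps < 1/5"
 shows "\<exists>C>0. \<forall>F G. fmeas F \<longrightarrow> fmeas G \<longrightarrow>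
   (\<forall>q. fst q < 0 \<longrightarrow> F q = 0 \<and> G q = 0) \<longrightarrow>
   (\<oint> x. (conv (lo eps F) G x)\<^sup>2) \<le> ennreal C * (NL F * NL G)"
proof -
 obtain C where C: "C > 0" "\<And>x. (\<oint> a. ennreal (fq a powr (- (3/2 + 2 * eps)) *
   (jap (fst a - fq a) powr (-4/5) * jap (fst x - fst a - fq (x - a)) powr (-4/5)))) \<le> ennreal C"
  using resonance_integral[OF assms] by blast
 show ?thesis
 proof (intro exI[of _ C] conjI allI impI C(1))
  fix F G :: "freqpt \<Rightarrow> ennreal"
  assume [measurable]: "fmeas F" "fmeas G"
   and supp: "\<forall>q. fst q < 0 \<longrightarrow> F q = 0 \<and> G q = 0"
  define f where "f = (\<lambda>q. ennreal (md q powr (2/5)) * F q)"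
  define g where "g = (\<lambda>q. ennreal (md q powr (2/5)) * G q)"
  have [measurable]: "fmeas f" "fmeas g"
   unfolding f_def g_def by measurable
  define k where "k = (\<lambda>x a. ennreal (fq a powr (- (3/4 + eps)) *
    (jap (fst a - fq a) powr (-2/5) * jap (fst x - fst a - fq (x - a)) powr (-2/5))))"
  have k_meas[measurable]: "fmeas (k x)" for x
   unfolding k_def by measurable
  have k_sq: "(k x a)\<^sup>2 = ennreal (fq a powr (- (3/2 + 2 * eps)) *
   (jap (fst a - fq a) powr (-4/5) * jap (fst x - fst a - fq (x - a)) powr (-4/5)))" for x a
   unfolding k_def by (simp add: ennreal_power power_mult_distrib powr_square algebra_simps)
  have pt: "lo eps F a * G (x - a) = (f a * g (x - a)) * k x a" for x a
  proof (cases "fst a < 0 \<or> fst (x - a) < 0")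
   case True
   hence "F a = 0 \<or> G (x - a) = 0" using supp by blast
   thus ?thesis by (auto simp: lo_def f_def g_def)
  next
   case False
   have m1: "md a = jap (fst a - fq a)" and m2: "md (x - a) = jap (fst x - fst a - fq (x - a))"
    using False by (auto simp: md_def fq_def)
   have one: "ennreal (md q powr (2/5)) * ennreal (md q powr (-2/5)) = 1" for q
    using md_pos[of q] by (simp flip: ennreal_mult' powr_add)
   have "(f a * g (x - a)) * k x a = (ennreal (fq a powr (- (3/4 + eps))) * F a * G (x - a)) *
     (ennreal (md a powr (2/5)) * ennreal (md a powr (-2/5))) * (ennreal (md (x - a) powr (2/5)) * ennreal (md (x - a) powr (-2/5)))"
    unfolding k_def f_def g_def m1[symmetric] m2[symmetric] by (simp add: ennreal_mult' mult_ac)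
   thus ?thesis unfolding one by (simp add: lo_def)
  qed
  have "(conv (lo eps F) G x)\<^sup>2 \<le> (\<oint> a. (f a * g (x - a))\<^sup>2) * ennreal C" for x
  proof -
   have "(conv (lo eps F) G x)\<^sup>2 \<le> (\<oint> a. (f a * g (x - a))\<^sup>2) * (\<oint> a. (k x a)\<^sup>2)"
    unfolding conv_def pt by (rule Cauchy_Schwarz_nn_integral) measurable
   also have "\<dots> \<le> (\<oint> a. (f a * g (x - a))\<^sup>2) * ennreal C"
    unfolding k_sq by (intro mult_left_mono C(2)) auto
   finally show ?thesis .
  qed
  hence "(\<oint> x. (conv (lo eps F) G x)\<^sup>2) \<le> (\<oint> x. (\<oint> a. (f a * g (x - a))\<^sup>2) * ennreal C)"
   by (intro nn_integral_mono)
  also have "\<dots> = (\<oint> x. conv (\<lambda>q. (f q)\<^sup>2) (\<lambda>q. (g q)\<^sup>2) x * 1) * ennreal C"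
   by (subst nn_integral_multc) (auto simp: conv_def power_mult_distrib)
  also have "(\<oint> x. conv (\<lambda>q. (f q)\<^sup>2) (\<lambda>q. (g q)\<^sup>2) x * 1) = NL F * NL G"
   by (subst conv_integral) (auto simp: nn_integral_multc NL_def f_def g_def)
  finally show "(\<oint> x. (conv (lo eps F) G x)\<^sup>2) \<le> ennreal C * (NL F * NL G)"
   by (simp add: mult.commute)
 qed
qed

lemma ennreal_sq_add_le: "(a + b :: ennreal)\<^sup>2 \<le> 2 * a\<^sup>2 + 2 * b\<^sup>2"
proof (cases "a = \<top> \<or> b = \<top>")
 case True thus ?thesis by (auto simp: power2_eq_square ennreal_mult_top ennreal_top_mult)
next
 case False
 then obtain x y where xy: "a = ennreal x" "b = ennreal y" "x \<ge> 0" "y \<ge> 0"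
  by (metis ennreal_cases)
 have "(x + y)\<^sup>2 \<le> 2 * x\<^sup>2 + 2 * y\<^sup>2" using zero_le_power2[of "x - y"] by (simp add: power2_eq_square algebra_simps)
 hence "ennreal ((x + y)\<^sup>2) \<le> ennreal (2 * x\<^sup>2 + 2 * y\<^sup>2)" by (rule ennreal_leI)
 moreover have "ennreal ((x + y)\<^sup>2) = (a + b)\<^sup>2" using xy by (simp add: ennreal_power flip: ennreal_plus)
 moreover have "ennreal (2 * x\<^sup>2 + 2 * y\<^sup>2) = 2 * a\<^sup>2 + 2 * b\<^sup>2"
  using xy by (simp add: ennreal_plus ennreal_mult ennreal_power)
 ultimately show ?thesis by simp
qed

text \<open>Each factor is split according to the sign of \<open>\<lambda>\<close>. Equal signs are covered by \<open>bilinear_positive\<close>,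
after a reflection of both factors if they are negative, and opposite signs by
\<open>conv_energy_reflect\<close>.\<close>

lemma bilinear:
 fixes eps :: real
 assumes "0 < eps" "eps < 1/5"
 shows "\<exists>C>0. \<forall>F G. fmeas F \<longrightarrow> fmeas G \<longrightarrow>
   (\<oint> x. (conv (lo eps F) G x)\<^sup>2) \<le> ennreal C * (NL F * NL G)"
proof -
 obtain C where C: "C > 0" "\<And>F G. fmeas F \<Longrightarrow> fmeas G \<Longrightarrow>
   (\<forall>q. fst q < 0 \<longrightarrow> F q = 0 \<and> G q = 0) \<Longrightarrow>
   (\<oint> x. (conv (lo eps F) G x)\<^sup>2) \<le> ennreal C * (NL F * NL G)"
  using bilinear_positive[OF assms] by blast
 show ?thesis
 proof (intro exI[of _ "16 * C"] conjI allI impI)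
  show "16 * C > 0" using C by simp
  fix F G :: "freqpt \<Rightarrow> ennreal"
  assume [measurable]: "fmeas F" "fmeas G"
  define P where "P = (\<lambda>(F :: freqpt \<Rightarrow> ennreal) q. F q * indicator {0..} (fst q))"
  define M where "M = (\<lambda>(F :: freqpt \<Rightarrow> ennreal) q. F q * indicator {..<0} (fst q))"
  have P_meas[measurable]: "fmeas (P F)" if "fmeas F" for F
   using that unfolding P_def by measurable
  have M_meas[measurable]: "fmeas (M F)" if "fmeas F" for F
   using that unfolding M_def by measurable
  have PM: "F = (\<lambda>q. P F q + M F q)" for F
   by (auto simp: P_def M_def indicator_def fun_eq_iff)
  have leP: "P F q \<le> F q" and leM: "M F q \<le> F q" for F q
   by (auto simp: P_def M_def indicator_def)
  let ?B = "ennreal C * (NL F * NL G)"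
  define R where "R = (\<lambda>(F :: freqpt \<Rightarrow> ennreal) q. F (- q))"
  have R_meas[measurable]: "fmeas (R F)" if "fmeas F" for F
   using that unfolding R_def by measurable
  have NR: "NL (R F) = NL F" if "fmeas F" for F
   using NL_reflect[OF that] by (simp add: R_def)
  have loR: "lo eps (R F) = R (lo eps F)" for F by (simp add: R_def lo_def fun_eq_iff)
  have en: "(\<oint> x. (conv F (R G) x)\<^sup>2) = (\<oint> x. (conv F G x)\<^sup>2)"
   if "fmeas F" "fmeas G" for F G
   unfolding R_def by (rule conv_energy_reflect[OF that])
  have en': "(\<oint> x. (conv (R F) G x)\<^sup>2) = (\<oint> x. (conv F G x)\<^sup>2)"
   if [measurable]: "fmeas F" "fmeas G" for F G
   using en[of G F] by (simp add: conv_commute[of _ G])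
  have Bmono: "ennreal C * (NL F' * NL G') \<le> ?B" if "NL F' \<le> NL F" "NL G' \<le> NL G" for F' G'
   by (intro mult_left_mono mult_mono that) auto
  have N4: "NL (P F) \<le> NL F" "NL (M F) \<le> NL F" "NL (P G) \<le> NL G" "NL (M G) \<le> NL G"
   by (auto intro!: NL_mono leP leM)
  have pp: "(\<oint> x. (conv (lo eps (P F)) (P G) x)\<^sup>2) \<le> ?B"
   by (rule order_trans[OF C(2) Bmono]) (auto simp: N4, auto simp: P_def)
  have pm: "(\<oint> x. (conv (lo eps (P F)) (M G) x)\<^sup>2) \<le> ?B"
   by (subst en[symmetric], measurable, rule order_trans[OF C(2) Bmono])
     (auto simp: N4 NR, auto simp: P_def M_def R_def)
  have mp: "(\<oint> x. (conv (lo eps (M F)) (P G) x)\<^sup>2) \<le> ?B"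
   by (subst en'[symmetric], measurable, subst loR[symmetric], rule order_trans[OF C(2) Bmono])
     (auto simp: N4 NR, auto simp: P_def M_def R_def)
  have mm: "(\<oint> x. (conv (lo eps (M F)) (M G) x)\<^sup>2) \<le> ?B"
   by (subst en[symmetric], measurable, subst en'[symmetric], measurable, subst loR[symmetric], rule order_trans[OF C(2) Bmono])
     (auto simp: N4 NR, auto simp: P_def M_def R_def)
  have lo_add: "lo eps F = (\<lambda>q. lo eps (P F) q + lo eps (M F) q)"
   by (subst PM[of F]) (simp add: lo_def fun_eq_iff distrib_left)
  have split: "conv (lo eps F) G x = (conv (lo eps (P F)) (P G) x + conv (lo eps (P F)) (M G) x) +
    (conv (lo eps (M F)) (P G) x + conv (lo eps (M F)) (M G) x)" for x
   by (subst PM[of G], subst lo_add) (simp add: conv_add_left conv_add_right)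
  have "(conv (lo eps F) G x)\<^sup>2 \<le> 4 * ((conv (lo eps (P F)) (P G) x)\<^sup>2 + (conv (lo eps (P F)) (M G) x)\<^sup>2 +
    (conv (lo eps (M F)) (P G) x)\<^sup>2 + (conv (lo eps (M F)) (M G) x)\<^sup>2)" for x
  proof -
   have "(conv (lo eps F) G x)\<^sup>2 \<le> 2 * (conv (lo eps (P F)) (P G) x + conv (lo eps (P F)) (M G) x)\<^sup>2 +
     2 * (conv (lo eps (M F)) (P G) x + conv (lo eps (M F)) (M G) x)\<^sup>2"
    unfolding split by (rule ennreal_sq_add_le)
   also have "\<dots> \<le> 2 * (2 * (conv (lo eps (P F)) (P G) x)\<^sup>2 + 2 * (conv (lo eps (P F)) (M G) x)\<^sup>2) +
     2 * (2 * (conv (lo eps (M F)) (P G) x)\<^sup>2 + 2 * (conv (lo eps (M F)) (M G) x)\<^sup>2)"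
    by (intro add_mono mult_left_mono ennreal_sq_add_le) auto
   also have "\<dots> = 4 * ((conv (lo eps (P F)) (P G) x)\<^sup>2 + (conv (lo eps (P F)) (M G) x)\<^sup>2 +
    (conv (lo eps (M F)) (P G) x)\<^sup>2 + (conv (lo eps (M F)) (M G) x)\<^sup>2)"
    by (simp add: distrib_left mult.assoc[symmetric] add.assoc)
   finally show ?thesis .
  qed
  hence "(\<oint> x. (conv (lo eps F) G x)\<^sup>2) \<le> (\<oint> x. 4 * ((conv (lo eps (P F)) (P G) x)\<^sup>2 + (conv (lo eps (P F)) (M G) x)\<^sup>2 +
    (conv (lo eps (M F)) (P G) x)\<^sup>2 + (conv (lo eps (M F)) (M G) x)\<^sup>2))"
   by (intro nn_integral_mono)
  also have "\<dots> \<le> 4 * (?B + ?B + ?B + ?B)"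
   by (subst nn_integral_cmult, measurable, subst nn_integral_add, measurable, subst nn_integral_add, measurable,
     subst nn_integral_add, measurable) (intro mult_left_mono add_mono pp pm mp mm, simp)
  also have "\<dots> = ennreal (16 * C) * (NL F * NL G)"
  proof -
   have "x + x + x + x = 4 * x" for x :: ennreal
   proof -
    have "4 * x = (1 + 1 + 1 + 1) * x" by simp
    thus ?thesis by (simp only: distrib_right mult_1_left)
   qed
   thus ?thesis using C(1) by (simp add: ennreal_mult mult.assoc[symmetric])
  qed
  finally show "(\<oint> x. (conv (lo eps F) G x)\<^sup>2) \<le> ennreal (16 * C) * (NL F * NL G)" .
 qed
qed

section \<open>The quadrilinear form\<close>

text \<open>The integral of \<open>F(a) G(b) H(c) Z(a + b + c)\<close>.\<close>

definition Q4 :: "(freqpt \<Rightarrow> ennreal) \<Rightarrow> (freqpt \<Rightarrow> ennreal) \<Rightarrow>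
  (freqpt \<Rightarrow> ennreal) \<Rightarrow> (freqpt \<Rightarrow> ennreal) \<Rightarrow> ennreal" where
 "Q4 F G H Z = (\<oint> a. F a * (\<oint> b. G b * (\<oint> c. H c * Z (a + b + c))))"

lemma Q4_eq_conv:
 assumes [measurable]: "fmeas F" "fmeas G"
  "fmeas H" "fmeas Z"
 shows "Q4 F G H Z = (\<oint> y. conv F G y * conv (\<lambda>q. H (- q)) Z y)"
proof -
 have eq: "(\<oint> c. H c * Z (y + c)) = conv (\<lambda>q. H (- q)) Z y" for y
  using nn_integral_freq_reflect[of "\<lambda>c. H c * Z (y + c)" 0] by (simp add: conv_def)
 have "Q4 F G H Z = (\<oint> a. F a * (\<oint> b. G b * conv (\<lambda>q. H (- q)) Z (a + b)))"
  unfolding Q4_def eq ..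
 also have "\<dots> = (\<oint> y. conv F G y * conv (\<lambda>q. H (- q)) Z y)"
  by (rule conv_integral[symmetric]) measurable
 finally show ?thesis .
qed

lemma Q4_swap12:
 assumes [measurable]: "fmeas F" "fmeas G"
  "fmeas H" "fmeas Z"
 shows "Q4 F G H Z = Q4 G F H Z"
 by (simp add: Q4_eq_conv conv_commute[of F G])

lemma Q4_swap23:
 assumes [measurable]: "fmeas F" "fmeas G"
  "fmeas H" "fmeas Z"
 shows "Q4 F G H Z = Q4 F H G Z"
proof -
 have "(\<oint> b. G b * (\<oint> c. H c * Z (a + b + c))) =
  (\<oint> c. H c * (\<oint> b. G b * Z (a + c + b)))" for a
 proof -
  have "(\<oint> b. G b * (\<oint> c. H c * Z (a + b + c))) =
    (\<oint> b. (\<oint> c. G b * (H c * Z (a + b + c))))"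
   by (subst nn_integral_cmult) auto
  also have "\<dots> = (\<oint> c. (\<oint> b. G b * (H c * Z (a + b + c))))"
   by (rule freq2.Fubini') measurable
  also have "\<dots> = (\<oint> c. (\<oint> b. H c * (G b * Z (a + c + b))))"
   by (simp add: ac_simps)
  also have "\<dots> = (\<oint> c. H c * (\<oint> b. G b * Z (a + c + b)))"
   by (subst nn_integral_cmult) auto
  finally show ?thesis .
 qed
 thus ?thesis by (simp add: Q4_def)
qed

lemma Q4_Cauchy_Schwarz:
 assumes [measurable]: "fmeas F" "fmeas G"
  "fmeas H" "fmeas Z"
 shows "(Q4 F G H Z)\<^sup>2 \<le> (\<oint> y. (conv F G y)\<^sup>2) * (\<oint> y. (conv (\<lambda>q. H (- q)) Z y)\<^sup>2)"
 unfolding Q4_eq_conv[OF assms] by (rule Cauchy_Schwarz_nn_integral) measurable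

text \<open>Order the four numbers: the exponents on the left add up to \<open>3/2 + 2 eps\<close>, and moving them from larger
to smaller numbers, \<open>3/4 + eps\<close> to each of the two smallest, only increases the product. The right-hand
side sums over all candidates for the two smallest.\<close>

lemma two_smallest:
 fixes a b c d eps :: real
 assumes "1 \<le> a" "1 \<le> b" "1 \<le> c" "1 \<le> d" "0 < eps" "eps < 1/4"
 defines "p \<equiv> 1/4 + eps" and "q \<equiv> 3/4 - eps" and "r \<equiv> 3/4 + eps"
 shows "a powr -p * b powr -p * c powr -p * d powr -q \<le>
   a powr -r * b powr -r + a powr -r * c powr -r + b powr -r * c powr -r +
   a powr -r * d powr -r + b powr -r * d powr -r + c powr -r * d powr -r"
proof -
 have lin1: "r * (x + y) \<le> p * (x + y + z) + q * w" if "x \<le> z" "y \<le> z" "x \<le> w" "y \<le> w" for x y z w :: real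
 proof -
  have "p * ((x + y) / 2) \<le> p * z" "q * ((x + y) / 2) \<le> q * w"
   using that assms(5,6) by (intro mult_left_mono; simp add: p_def q_def)+
  moreover have "p * ((x + y) / 2) + q * ((x + y) / 2) = (x + y) / 2"
   by (subst distrib_right[symmetric]) (simp add: p_def q_def)
  moreover have "r * (x + y) = p * (x + y) + (x + y) / 2"
   by (simp add: p_def r_def field_simps)
  moreover have "p * (x + y + z) = p * (x + y) + p * z" by (rule distrib_left)
  ultimately show ?thesis by linarith
 qed
 have lin2: "r * (x + w) \<le> p * (x + y + z) + q * w" if "x \<le> y" "w \<le> y" "x \<le> z" "w \<le> z" for x y z w :: real
 proof -
  have "eps * w \<le> eps * y" "eps * w \<le> eps * z"
   using that assms(5) by (auto intro!: mult_left_mono)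
  moreover have "2 * x \<le> y + z" using that by linarith
  moreover have "4 * (r * (x + w)) = 3 * x + 3 * w + 4 * (eps * x) + 4 * (eps * w)"
   by (simp add: r_def algebra_simps)
  moreover have "4 * (p * (x + y + z) + q * w) = x + y + z + 4 * (eps * x) + 4 * (eps * y) + 4 * (eps * z) + 3 * w - 4 * (eps * w)"
   by (simp add: p_def q_def algebra_simps)
  ultimately have "4 * (r * (x + w)) \<le> 4 * (p * (x + y + z) + q * w)" using that by linarith
  thus ?thesis by simp
 qed
 have powr4: "a powr -p * b powr -p * c powr -p * d powr -q = exp (- (p * (ln a + ln b + ln c) + q * ln d))"
  and powr2: "a powr -r * d powr -r = exp (- (r * (ln a + ln d)))"
  if "1 \<le> a" "1 \<le> b" "1 \<le> c" "1 \<le> d" for a b c d :: real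
  using that by (simp_all add: powr_def algebra_simps flip: exp_add)
 have small: "a powr -p * b powr -p * c powr -p * d powr -q \<le> a powr -r * b powr -r"
  if "1 \<le> a" "1 \<le> b" "a \<le> c" "a \<le> d" "b \<le> c" "b \<le> d" for a b c d :: real
  using lin1[of "ln a" "ln c" "ln b" "ln d"] that by (simp add: powr4 powr2)
 have small2: "a powr -p * b powr -p * c powr -p * d powr -q \<le> a powr -r * d powr -r"
  if "1 \<le> a" "1 \<le> d" "a \<le> b" "a \<le> c" "d \<le> b" "d \<le> c" for a b c d :: real
  using lin2[of "ln a" "ln b" "ln d" "ln c"] that by (simp add: powr4 powr2)
 have nn: "0 \<le> x powr -r * y powr -r" for x y :: real by simp
 consider "a \<le> c \<and> a \<le> d \<and> b \<le> c \<and> b \<le> d" | "a \<le> b \<and> a \<le> d \<and> c \<le> b \<and> c \<le> d" | "b \<le> a \<and> b \<le> d \<and> c \<le> a \<and> c \<le> d"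
  | "a \<le> b \<and> a \<le> c \<and> d \<le> b \<and> d \<le> c" | "b \<le> a \<and> b \<le> c \<and> d \<le> a \<and> d \<le> c" | "c \<le> a \<and> c \<le> b \<and> d \<le> a \<and> d \<le> b"
  by linarith
 thus ?thesis
 proof cases
  case 1
  have "a powr -p * b powr -p * c powr -p * d powr -q \<le> a powr -r * b powr -r"
   using small[of a b c d] 1 assms(1-4) by (simp add: mult_ac)
  thus ?thesis using nn[of a c] nn[of b c] nn[of a d] nn[of b d] nn[of c d] by linarith
 next
  case 2
  have "a powr -p * b powr -p * c powr -p * d powr -q \<le> a powr -r * c powr -r"
   using small[of a c b d] 2 assms(1-4) by (simp add: mult_ac)
  thus ?thesis using nn[of a b] nn[of b c] nn[of a d] nn[of b d] nn[of c d] by linarith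
 next
  case 3
  have "a powr -p * b powr -p * c powr -p * d powr -q \<le> b powr -r * c powr -r"
   using small[of b c a d] 3 assms(1-4) by (simp add: mult_ac)
  thus ?thesis using nn[of a b] nn[of a c] nn[of a d] nn[of b d] nn[of c d] by linarith
 next
  case 4
  have "a powr -p * b powr -p * c powr -p * d powr -q \<le> a powr -r * d powr -r"
   using small2[where a=a and b=b and c=c and d=d] 4 assms(1-4) by (simp add: mult_ac)
  thus ?thesis using nn[of a b] nn[of a c] nn[of b c] nn[of b d] nn[of c d] by linarith
 next
  case 5
  have "a powr -p * b powr -p * c powr -p * d powr -q \<le> b powr -r * d powr -r"
   using small2[where a=b and b=a and c=c and d=d] 5 assms(1-4) by (simp add: mult_ac)
  thus ?thesis using nn[of a b] nn[of a c] nn[of b c] nn[of a d] nn[of c d] by linarith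
 next
  case 6
  have "a powr -p * b powr -p * c powr -p * d powr -q \<le> c powr -r * d powr -r"
   using small2[where a=c and b=a and c=b and d=d] 6 assms(1-4) by (simp add: mult_ac)
  thus ?thesis using nn[of a b] nn[of a c] nn[of b c] nn[of a d] nn[of b d] by linarith
 qed
qed

lemma ennreal_sum6_sq:
 fixes x1 x2 x3 x4 x5 x6 M :: ennreal
 assumes "x1\<^sup>2 \<le> M" "x2\<^sup>2 \<le> M" "x3\<^sup>2 \<le> M" "x4\<^sup>2 \<le> M" "x5\<^sup>2 \<le> M" "x6\<^sup>2 \<le> M"
 shows "(x1 + x2 + x3 + x4 + x5 + x6)\<^sup>2 \<le> 36 * M"
proof -
 define S where "S = {x1,x2,x3,x4,x5,x6}"
 have "Max S \<in> S" by (rule Max_in) (auto simp: S_def)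
 hence m: "(Max S)\<^sup>2 \<le> M" using assms by (auto simp: S_def)
 have le: "x \<le> Max S" if "x \<in> S" for x using that by (intro Max_ge) (auto simp: S_def)
 have "x1 + x2 + x3 + x4 + x5 + x6 \<le> Max S + Max S + Max S + Max S + Max S + Max S"
  by (intro add_mono le) (auto simp: S_def)
 also have "\<dots> = 6 * Max S"
 proof -
  have "6 * Max S = (1 + 1 + 1 + 1 + 1 + 1) * Max S" by simp
  thus ?thesis by (simp only: distrib_right mult_1_left)
 qed
 finally have "(x1 + x2 + x3 + x4 + x5 + x6)\<^sup>2 \<le> (6 * Max S)\<^sup>2" by (intro power_mono) auto
 also have "\<dots> = 36 * (Max S)\<^sup>2" by (simp add: power_mult_distrib)
 also have "\<dots> \<le> 36 * M" using m by (intro mult_left_mono) auto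
 finally show ?thesis .
qed

definition wt :: "real \<Rightarrow> (freqpt \<Rightarrow> ennreal) \<Rightarrow> freqpt \<Rightarrow> ennreal" where
 "wt s F q = ennreal (fq q powr s) * F q"

lemma wt_measurable[measurable]:
 "fmeas F \<Longrightarrow> fmeas (wt s F)"
 unfolding wt_def by measurable

lemma Q4_mono_sum:
 fixes eps :: real
 assumes [measurable]: "fmeas F" "fmeas G"
  "fmeas H" "fmeas Z"
  and eps: "0 < eps" "eps < 1/4"
 shows "Q4 (wt (-(1/4+eps)) F) (wt (-(1/4+eps)) G) (wt (-(1/4+eps)) H) (wt (-(3/4-eps)) Z) \<le>
  Q4 (lo eps F) (lo eps G) H Z + Q4 (lo eps F) G (lo eps H) Z + Q4 F (lo eps G) (lo eps H) Z +
  Q4 (lo eps F) G H (lo eps Z) + Q4 F (lo eps G) H (lo eps Z) + Q4 F G (lo eps H) (lo eps Z)"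
proof -
 define M3 where "M3 = freq_measure \<Otimes>\<^sub>M (freq_measure \<Otimes>\<^sub>M freq_measure)"
 define I where "I = (\<lambda>(F :: freqpt \<Rightarrow> ennreal) (G :: freqpt \<Rightarrow> ennreal)
   (H :: freqpt \<Rightarrow> ennreal) (Z :: freqpt \<Rightarrow> ennreal) t.
   F (fst t) * G (fst (snd t)) * H (snd (snd t)) * Z (fst t + fst (snd t) + snd (snd t)))"
 have I_meas: "I F G H Z \<in> borel_measurable M3"
  if [measurable]: "fmeas F" "fmeas G"
  "fmeas H" "fmeas Z" for F G H Z
  unfolding I_def M3_def by measurable
 have Q4_alt: "Q4 F G H Z = (\<integral>\<^sup>+ t. I F G H Z t \<partial>M3)"
  if [measurable]: "fmeas F" "fmeas G"
  "fmeas H" "fmeas Z" for F G H Z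
 proof -
  have m: "I F G H Z \<in> borel_measurable M3" by (rule I_meas) fact+
  have m1: "(\<lambda>s. I F G H Z (a, s)) \<in> borel_measurable (freq_measure \<Otimes>\<^sub>M freq_measure)" for a
   unfolding I_def fst_conv snd_conv by measurable
  have "(\<integral>\<^sup>+ t. I F G H Z t \<partial>M3) = (\<oint> a. (\<integral>\<^sup>+ s. I F G H Z (a, s) \<partial>(freq_measure \<Otimes>\<^sub>M freq_measure)))"
   using m unfolding M3_def
   by (rule sigma_finite_measure.nn_integral_fst[OF freq2.sigma_finite_measure_axioms, symmetric])
  also have "\<dots> = (\<oint> a. (\<oint> b. (\<oint> c. I F G H Z (a, b, c))))"
   by (intro nn_integral_cong freq.nn_integral_fst[symmetric] m1)
  also have "\<dots> = (\<oint> a. (\<oint> b. F a * (G b * (\<oint> c. H c * Z (a + b + c)))))"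
   by (simp add: I_def mult.assoc nn_integral_cmult)
  also have "\<dots> = Q4 F G H Z"
   by (simp add: Q4_def nn_integral_cmult)
  finally show ?thesis ..
 qed
 let ?p = "1/4 + eps" and ?q = "3/4 - eps" and ?r = "3/4 + eps"
 have pt: "wt (-?p) F a * wt (-?p) G b * wt (-?p) H c * wt (-?q) Z d \<le>
   lo eps F a * lo eps G b * H c * Z d + lo eps F a * G b * lo eps H c * Z d + F a * lo eps G b * lo eps H c * Z d
   + lo eps F a * G b * H c * lo eps Z d + F a * lo eps G b * H c * lo eps Z d + F a * G b * lo eps H c * lo eps Z d" for a b c d
 proof -
  let ?X = "F a * G b * H c * Z d"
  have e0: "ennreal (fq a powr -?r * fq b powr -?r) * ?X = lo eps F a * lo eps G b * H c * Z d"
   by (simp add: lo_def ennreal_mult' mult_ac)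
  have e1: "ennreal (fq a powr -?r * fq c powr -?r) * ?X = lo eps F a * G b * lo eps H c * Z d"
   by (simp add: lo_def ennreal_mult' mult_ac)
  have e2: "ennreal (fq b powr -?r * fq c powr -?r) * ?X = F a * lo eps G b * lo eps H c * Z d"
   by (simp add: lo_def ennreal_mult' mult_ac)
  have e3: "ennreal (fq a powr -?r * fq d powr -?r) * ?X = lo eps F a * G b * H c * lo eps Z d"
   by (simp add: lo_def ennreal_mult' mult_ac)
  have e4: "ennreal (fq b powr -?r * fq d powr -?r) * ?X = F a * lo eps G b * H c * lo eps Z d"
   by (simp add: lo_def ennreal_mult' mult_ac)
  have e5: "ennreal (fq c powr -?r * fq d powr -?r) * ?X = F a * G b * lo eps H c * lo eps Z d"
   by (simp add: lo_def ennreal_mult' mult_ac)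
  have "wt (-?p) F a * wt (-?p) G b * wt (-?p) H c * wt (-?q) Z d =
    ennreal (fq a powr -?p * fq b powr -?p * fq c powr -?p * fq d powr -?q) * ?X"
   by (simp add: wt_def ennreal_mult' mult_ac)
  also have "\<dots> \<le> ennreal (fq a powr -?r * fq b powr -?r + fq a powr -?r * fq c powr -?r + fq b powr -?r * fq c powr -?r +
    fq a powr -?r * fq d powr -?r + fq b powr -?r * fq d powr -?r + fq c powr -?r * fq d powr -?r) * ?X"
   using two_smallest[OF fq_ge_1[of a] fq_ge_1[of b] fq_ge_1[of c] fq_ge_1[of d] eps]
   by (intro mult_right_mono ennreal_leI) auto
  also have "\<dots> = ennreal (fq a powr -?r * fq b powr -?r) * ?X + ennreal (fq a powr -?r * fq c powr -?r) * ?X + ennreal (fq b powr -?r * fq c powr -?r) * ?X + ennreal (fq a powr -?r * fq d powr -?r) * ?X + ennreal (fq b powr -?r * fq d powr -?r) * ?X + ennreal (fq c powr -?r * fq d powr -?r) * ?X"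
   by (simp add: ennreal_plus distrib_right)
  also have "\<dots> = lo eps F a * lo eps G b * H c * Z d + lo eps F a * G b * lo eps H c * Z d + F a * lo eps G b * lo eps H c * Z d + lo eps F a * G b * H c * lo eps Z d + F a * lo eps G b * H c * lo eps Z d + F a * G b * lo eps H c * lo eps Z d"
   by (simp only: e0 e1 e2 e3 e4 e5)
  finally show ?thesis .
 qed
 have "Q4 (wt (-?p) F) (wt (-?p) G) (wt (-?p) H) (wt (-?q) Z) = (\<integral>\<^sup>+ t. I (wt (-?p) F) (wt (-?p) G) (wt (-?p) H) (wt (-?q) Z) t \<partial>M3)"
  by (rule Q4_alt) measurable
 also have "\<dots> \<le> (\<integral>\<^sup>+ t. I (lo eps F) (lo eps G) H Z t + I (lo eps F) G (lo eps H) Z t + I F (lo eps G) (lo eps H) Z t + I (lo eps F) G H (lo eps Z) t + I F (lo eps G) H (lo eps Z) t + I F G (lo eps H) (lo eps Z) t \<partial>M3)"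
  by (intro nn_integral_mono) (unfold I_def, rule pt)
 also have "\<dots> = Q4 (lo eps F) (lo eps G) H Z + Q4 (lo eps F) G (lo eps H) Z + Q4 F (lo eps G) (lo eps H) Z + Q4 (lo eps F) G H (lo eps Z) + Q4 F (lo eps G) H (lo eps Z) + Q4 F G (lo eps H) (lo eps Z)"
  by (simp add: nn_integral_add borel_measurable_add Q4_alt I_meas lo_measurable assms(1-4))
 finally show ?thesis .
qed

text \<open>In every term of \<open>Q4_mono_sum\<close> two of the four functions are damped. By the symmetry of the form each
of these two can be put into a different convolution of \<open>Q4_Cauchy_Schwarz\<close>, where \<open>bilinear\<close> applies.\<close>

lemma quadrilinear:
 fixes eps :: real
 assumes "0 < eps" "eps < 1/5"
 shows "\<exists>C>0. \<forall>F G H Z. fmeas F \<longrightarrow> fmeas G \<longrightarrow>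
   fmeas H \<longrightarrow> fmeas Z \<longrightarrow>
   (Q4 (wt (-(1/4+eps)) F) (wt (-(1/4+eps)) G) (wt (-(1/4+eps)) H) (wt (-(3/4-eps)) Z))\<^sup>2
    \<le> ennreal C * (NL F * NL G * NL H * NL Z)"
proof -
 obtain C where C: "C > 0" "\<And>F G. fmeas F \<Longrightarrow> fmeas G \<Longrightarrow>
   (\<oint> x. (conv (lo eps F) G x)\<^sup>2) \<le> ennreal C * (NL F * NL G)"
  using bilinear[OF assms] by blast
 have eps: "eps < 1/4" using assms by simp
 show ?thesis
 proof (intro exI[of _ "36 * C\<^sup>2"] conjI allI impI)
  show "36 * C\<^sup>2 > 0" using C by simp
  fix F G H Z :: "freqpt \<Rightarrow> ennreal"
  assume m[measurable]: "fmeas F" "fmeas G"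
   "fmeas H" "fmeas Z"
  let ?M = "(ennreal C)\<^sup>2 * (NL F * NL G * NL H * NL Z)"
  have A: "(Q4 (lo eps F) G (lo eps H) Z)\<^sup>2 \<le> (ennreal C)\<^sup>2 * (NL F * NL G * NL H * NL Z)"
   if [measurable]: "fmeas F" "fmeas G"
    "fmeas H" "fmeas Z" for F G H Z
  proof -
   have loR: "(\<lambda>q. lo eps H (- q)) = lo eps (\<lambda>q. H (- q))" by (simp add: lo_def fun_eq_iff)
   have "(Q4 (lo eps F) G (lo eps H) Z)\<^sup>2 \<le> (\<oint> y. (conv (lo eps F) G y)\<^sup>2) * (\<oint> y. (conv (lo eps (\<lambda>q. H (- q))) Z y)\<^sup>2)"
    unfolding loR[symmetric] by (rule Q4_Cauchy_Schwarz) measurable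
   also have "\<dots> \<le> (ennreal C * (NL F * NL G)) * (ennreal C * (NL (\<lambda>q. H (- q)) * NL Z))"
    by (intro mult_mono C) auto
   also have "NL (\<lambda>q. H (- q)) = NL H" by (rule NL_reflect) measurable
   finally show ?thesis by (simp add: power2_eq_square mult_ac)
  qed
  have B: "(Q4 (lo eps F) G H (lo eps Z))\<^sup>2 \<le> (ennreal C)\<^sup>2 * (NL F * NL G * NL H * NL Z)"
   if [measurable]: "fmeas F" "fmeas G"
    "fmeas H" "fmeas Z" for F G H Z
  proof -
   have cc: "conv (\<lambda>q. H (- q)) (lo eps Z) = conv (lo eps Z) (\<lambda>q. H (- q))" by (rule conv_commute) measurable
   have "(Q4 (lo eps F) G H (lo eps Z))\<^sup>2 \<le> (\<oint> y. (conv (lo eps F) G y)\<^sup>2) * (\<oint> y. (conv (lo eps Z) (\<lambda>q. H (- q)) y)\<^sup>2)"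
    unfolding cc[symmetric] by (rule Q4_Cauchy_Schwarz) measurable
   also have "\<dots> \<le> (ennreal C * (NL F * NL G)) * (ennreal C * (NL Z * NL (\<lambda>q. H (- q))))"
    by (intro mult_mono C) auto
   also have "NL (\<lambda>q. H (- q)) = NL H" by (rule NL_reflect) measurable
   finally show ?thesis by (simp add: power2_eq_square mult_ac)
  qed
  have "(Q4 (wt (-(1/4+eps)) F) (wt (-(1/4+eps)) G) (wt (-(1/4+eps)) H) (wt (-(3/4-eps)) Z))\<^sup>2 \<le>
    (Q4 (lo eps F) (lo eps G) H Z + Q4 (lo eps F) G (lo eps H) Z + Q4 F (lo eps G) (lo eps H) Z +
  Q4 (lo eps F) G H (lo eps Z) + Q4 F (lo eps G) H (lo eps Z) + Q4 F G (lo eps H) (lo eps Z))\<^sup>2"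
   by (intro power_mono Q4_mono_sum m assms(1) eps) simp
  also have "\<dots> \<le> 36 * ?M"
  proof (rule ennreal_sum6_sq)
   show "(Q4 (lo eps F) G (lo eps H) Z)\<^sup>2 \<le> ?M" by (rule A) measurable
   show "(Q4 (lo eps F) (lo eps G) H Z)\<^sup>2 \<le> ?M"
    using A[of F H G Z] by (subst Q4_swap23) (auto simp: mult_ac)
   show "(Q4 F (lo eps G) (lo eps H) Z)\<^sup>2 \<le> ?M"
    using A[of G F H Z] by (subst Q4_swap12) (auto simp: mult_ac)
   show "(Q4 (lo eps F) G H (lo eps Z))\<^sup>2 \<le> ?M" by (rule B) measurable
   show "(Q4 F (lo eps G) H (lo eps Z))\<^sup>2 \<le> ?M"
    using B[of G F H Z] by (subst Q4_swap12) (auto simp: mult_ac)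
   show "(Q4 F G (lo eps H) (lo eps Z))\<^sup>2 \<le> ?M"
    using B[of H F G Z] by (subst Q4_swap23, (measurable)[4], subst Q4_swap12) (auto simp: mult_ac)
  qed
  also have "\<dots> = ennreal (36 * C\<^sup>2) * (NL F * NL G * NL H * NL Z)"
   using C(1) by (simp add: ennreal_mult ennreal_power mult.assoc)
  finally show "(Q4 (wt (-(1/4+eps)) F) (wt (-(1/4+eps)) G) (wt (-(1/4+eps)) H) (wt (-(3/4-eps)) Z))\<^sup>2
    \<le> ennreal (36 * C\<^sup>2) * (NL F * NL G * NL H * NL Z)" .
 qed
qed

section \<open>Duality\<close>

text \<open>Testing with \<open>Z = A\<close> gives the bound after division by the norm, provided that it is finite; hence
\<open>A\<close> is truncated, in height and to a set of finite measure, and the truncations increase to \<open>A\<close>.\<close>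

lemma L2_duality:
 assumes M: "sigma_finite_measure M" and A[measurable]: "A \<in> borel_measurable M"
  and dual: "\<And>Z. Z \<in> borel_measurable M \<Longrightarrow> (\<integral>\<^sup>+ x. A x * Z x \<partial>M)\<^sup>2 \<le> K * (\<integral>\<^sup>+ x. (Z x)\<^sup>2 \<partial>M)"
 shows "(\<integral>\<^sup>+ x. (A x)\<^sup>2 \<partial>M) \<le> (K :: ennreal)"
proof -
 interpret sigma_finite_measure M by (rule M)
 obtain E :: "nat \<Rightarrow> _" where E: "range E \<subseteq> sets M" "(\<Union>i. E i) = space M" "\<And>i. emeasure M (E i) \<noteq> \<infinity>" "incseq E"
  by (rule sigma_finite_incseq) blast
 have [measurable]: "E i \<in> sets M" for i using E(1) by auto
 define Z where "Z = (\<lambda>(k::nat) x. min (A x) (of_nat k) * indicator (E k) x)"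
 have Zm[measurable]: "Z k \<in> borel_measurable M" for k unfolding Z_def by measurable
 have bound: "(\<integral>\<^sup>+ x. Z k x * Z k x \<partial>M) \<le> K" for k
 proof -
  define I where "I = (\<integral>\<^sup>+ x. (Z k x)\<^sup>2 \<partial>M)"
  have "I \<le> (\<integral>\<^sup>+ x. (of_nat k)\<^sup>2 * indicator (E k) x \<partial>M)"
   unfolding I_def
  proof (intro nn_integral_mono)
   fix x
   have "(Z k x)\<^sup>2 \<le> (of_nat k * indicator (E k) x)\<^sup>2"
    unfolding Z_def by (intro power_mono mult_right_mono) auto
   thus "(Z k x)\<^sup>2 \<le> (of_nat k)\<^sup>2 * indicator (E k) x" by (auto simp: indicator_def split: if_splits)
  qed
  also have "\<dots> = (of_nat k)\<^sup>2 * emeasure M (E k)" by (rule nn_integral_cmult_indicator) measurable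
  also have "\<dots> < \<infinity>" using E(3)[of k] by (simp add: ennreal_mult_less_top less_top power2_eq_square of_nat_less_top)
  finally have fin: "I < \<infinity>" .
  have "I \<le> (\<integral>\<^sup>+ x. A x * Z k x \<partial>M)"
   unfolding I_def power2_eq_square
   by (intro nn_integral_mono mult_right_mono) (auto simp: Z_def indicator_def)
  hence "I\<^sup>2 \<le> (\<integral>\<^sup>+ x. A x * Z k x \<partial>M)\<^sup>2" by (intro power_mono) auto
  also have "\<dots> \<le> K * I" unfolding I_def by (rule dual) measurable
  finally have le: "I * I \<le> K * I" by (simp add: power2_eq_square)
  have "I \<le> K"
  proof (cases "I = 0")
   case False
   have "I * I / I \<le> K * I / I" using le by (intro divide_right_mono_ennreal)
   thus ?thesis using False fin by (simp add: ennreal_mult_divide_eq)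
  qed simp
  thus ?thesis by (simp add: I_def power2_eq_square)
 qed
 have lim: "(\<lambda>k. Z k x * Z k x) \<longlonglongrightarrow> A x * A x" if "x \<in> space M" for x
 proof -
  have "x \<in> (\<Union>i. E i)" using that by (simp only: E(2))
  then obtain i where i: "x \<in> E i" by blast
  have "x \<in> E k" if "k \<ge> i" for k using incseqD[OF E(4) that] i by blast
  hence ev: "eventually (\<lambda>k. min (A x) (of_nat k) = Z k x) sequentially"
   unfolding Z_def by (intro eventually_sequentiallyI[of i]) simp
  have "(\<lambda>k. min (A x) (of_nat k)) \<longlonglongrightarrow> min (A x) \<top>"
   by (intro tendsto_min tendsto_const of_nat_tendsto_top_ennreal)
  hence "(\<lambda>k. Z k x) \<longlonglongrightarrow> A x" using ev by (auto intro: Lim_transform_eventually)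
  thus ?thesis by (intro tendsto_mult_ennreal) auto
 qed
 have "(\<integral>\<^sup>+ x. (A x)\<^sup>2 \<partial>M) = (\<integral>\<^sup>+ x. liminf (\<lambda>k. Z k x * Z k x) \<partial>M)"
 proof (rule nn_integral_cong)
  fix x assume "x \<in> space M"
  thus "(A x)\<^sup>2 = liminf (\<lambda>k. Z k x * Z k x)"
   using lim_imp_Liminf[OF _ lim] by (simp add: power2_eq_square)
 qed
 also have "\<dots> \<le> liminf (\<lambda>k. \<integral>\<^sup>+ x. Z k x * Z k x \<partial>M)" by (rule nn_integral_liminf) measurable
 also have "\<dots> \<le> liminf (\<lambda>k::nat. K)" by (intro Liminf_mono) (auto simp: bound)
 also have "\<dots> = K" by (rule Liminf_const) simp
 finally show ?thesis .
qed

section \<open>The trilinear estimate on the Fourier side\<close>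

text \<open>The square of the norm of the solution space, for a nonnegative Fourier transform.\<close>

definition EN :: "real \<Rightarrow> real \<Rightarrow> (freqpt \<Rightarrow> ennreal) \<Rightarrow> ennreal" where
 "EN s b F = (\<oint> q. (ennreal (fq q powr s * md q powr b) * F q)\<^sup>2)"

text \<open>The weights of \<open>EN\<close> are moved onto the functions, so that by duality the claim is the bound for the
quadrilinear form. The damping exponent of the dual function is \<open>3/4 - eps\<close>.\<close>

lemma trilinear_freq:
 fixes eps :: real
 assumes "0 < eps" "eps < 1/5"
 shows "\<exists>C>0. \<forall>F G H. fmeas F \<longrightarrow> fmeas G \<longrightarrow>
   fmeas H \<longrightarrow>
   EN (- 3/4 + eps) (- 2/5) (conv (conv F G) H) \<le> ennreal C * (EN (1/4 + eps) (2/5) F * EN (1/4 + eps) (2/5) G * EN (1/4 + eps) (2/5) H)"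
proof -
 obtain C where C: "C > 0" "\<And>F G H Z. fmeas F \<Longrightarrow> fmeas G \<Longrightarrow>
   fmeas H \<Longrightarrow> fmeas Z \<Longrightarrow>
   (Q4 (wt (-(1/4+eps)) F) (wt (-(1/4+eps)) G) (wt (-(1/4+eps)) H) (wt (-(3/4-eps)) Z))\<^sup>2
    \<le> ennreal C * (NL F * NL G * NL H * NL Z)"
  using quadrilinear[OF assms] by blast
 show ?thesis
 proof (intro exI[of _ C] conjI allI impI C(1))
  fix F G H :: "freqpt \<Rightarrow> ennreal"
  assume m[measurable]: "fmeas F" "fmeas G"
   "fmeas H"
  let ?p = "1/4 + eps"
  have cancel: "wt (-s) (wt s F) = F" for s F
   by (auto simp: wt_def fun_eq_iff mult.assoc[symmetric] less_imp_neq[OF fq_pos, symmetric] simp flip: ennreal_mult' powr_add)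
  have NLwt: "NL (wt ?p F) = EN ?p (2/5) F" for F
   unfolding NL_def EN_def wt_def by (simp add: ennreal_mult' mult_ac)
  show "EN (- 3/4 + eps) (- 2/5) (conv (conv F G) H) \<le> ennreal C * (EN (1/4 + eps) (2/5) F * EN (1/4 + eps) (2/5) G * EN (1/4 + eps) (2/5) H)"
   unfolding EN_def[of "- 3/4 + eps"]
  proof (rule L2_duality[OF sigma_finite_freq])
   show "fmeas (\<lambda>q. ennreal (fq q powr (- 3/4 + eps) * md q powr (- 2/5)) * conv (conv F G) H q)"
    by measurable
   fix Z :: "freqpt \<Rightarrow> ennreal"
   assume [measurable]: "fmeas Z"
   define Y where "Y = (\<lambda>q. ennreal (md q powr (- 2/5)) * Z q)"
   have [measurable]: "fmeas Y" unfolding Y_def by measurable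
   have NY: "NL Y = (\<oint> x. (Z x)\<^sup>2)"
   proof -
    have "ennreal (md q powr (2/5)) * (ennreal (md q powr (- 2/5)) * Z q) = Z q" for q
     using md_pos[of q] by (simp add: mult.assoc[symmetric] flip: ennreal_mult' powr_add)
    thus ?thesis by (simp add: NL_def Y_def)
   qed
   have "(\<oint> x. ennreal (fq x powr (- 3/4 + eps) * md x powr (- 2/5)) * conv (conv F G) H x * Z x) =
     (\<oint> x. conv (conv F G) H x * wt (-(3/4-eps)) Y x)"
    by (intro nn_integral_cong) (simp add: wt_def Y_def ennreal_mult' mult_ac)
   also have "\<dots> = (\<oint> y. conv F G y * (\<oint> c. H c * wt (-(3/4-eps)) Y (y + c)))"
    by (rule conv_integral) measurable
   also have "\<dots> = Q4 F G H (wt (-(3/4-eps)) Y)"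
    unfolding Q4_def by (rule conv_integral) measurable
   also have "\<dots> = Q4 (wt (-?p) (wt ?p F)) (wt (-?p) (wt ?p G)) (wt (-?p) (wt ?p H)) (wt (-(3/4-eps)) Y)"
    unfolding cancel ..
   finally show "(\<oint> x. ennreal (fq x powr (- 3/4 + eps) * md x powr (- 2/5)) * conv (conv F G) H x * Z x)\<^sup>2
     \<le> ennreal C * (EN (1/4 + eps) (2/5) F * EN (1/4 + eps) (2/5) G * EN (1/4 + eps) (2/5) H) * (\<oint> x. (Z x)\<^sup>2)"
    using C(2)[of "wt ?p F" "wt ?p G" "wt ?p H" Y] by (simp add: NLwt NY mult.assoc)
  qed
 qed
qed

section \<open>Time localisation\<close>

lemma nn_integral_powr_near_0:
 fixes \<rho> :: real
 assumes "\<rho> < 1"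
 shows "(\<integral>\<^sup>+ x. ennreal (\<bar>x\<bar> powr (- \<rho>)) * indicator {-1..1} x \<partial>lborel) \<le> ennreal (2 / (1 - \<rho>))"
proof -
 have m: "(\<lambda>x::real. ennreal (x powr (- \<rho>)) * indicator {0..1} x) \<in> borel_measurable borel" by measurable
 have "((\<lambda>x. x powr (- \<rho>)) has_integral (1 powr (- \<rho> + 1) / (- \<rho> + 1))) {0..1}"
  using assms by (intro has_integral_powr_from_0) auto
 hence "(\<integral>\<^sup>+ x. ennreal (indicator {0..1} x * x powr (- \<rho>)) \<partial>lborel) = ennreal (1 powr (- \<rho> + 1) / (- \<rho> + 1))"
  by (rule nn_integral_has_integral_lebesgue[rotated]) auto
 also have "(\<lambda>x::real. ennreal (indicator {0..1} x * x powr (- \<rho>))) = (\<lambda>x. ennreal (x powr (- \<rho>)) * indicator {0..1} x)"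
  by (auto simp: indicator_def fun_eq_iff)
 finally have half: "(\<integral>\<^sup>+ x. ennreal (x powr (- \<rho>)) * indicator {0..1} x \<partial>lborel) = ennreal (1 / (1 - \<rho>))"
  by (simp add: add.commute)
 have refl: "(\<integral>\<^sup>+ x. ennreal ((- x) powr (- \<rho>)) * indicator {0..1} (- x) \<partial>lborel) = ennreal (1 / (1 - \<rho>))"
  using nn_integral_real_affine[OF m, of "-1" 0] half by simp
 have "(\<integral>\<^sup>+ x. ennreal (\<bar>x\<bar> powr (- \<rho>)) * indicator {-1..1} x \<partial>lborel) \<le>
  (\<integral>\<^sup>+ x. ennreal (x powr (- \<rho>)) * indicator {0..1} x + ennreal ((- x) powr (- \<rho>)) * indicator {0..1} (- x) \<partial>lborel)"
  by (intro nn_integral_mono) (auto simp: indicator_def abs_if)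
 also have "\<dots> = ennreal (1 / (1 - \<rho>)) + ennreal (1 / (1 - \<rho>))"
  by (subst nn_integral_add) (auto simp: half refl)
 also have "\<dots> = ennreal (2 / (1 - \<rho>))" using assms by (simp flip: ennreal_plus)
 finally show ?thesis .
qed

lemma jap_powr_neg_le:
 fixes x T \<rho> :: real
 assumes "0 < T" "0 < \<rho>" "x \<noteq> 0"
 shows "jap (x / T) powr (- \<rho>) \<le> T powr \<rho> * \<bar>x\<bar> powr (- \<rho>)"
proof -
 have "jap (x / T) powr (- \<rho>) \<le> (\<bar>x\<bar> / T) powr (- \<rho>)"
  using assms norm_le_jap[of "x / T"] by (intro powr_mono2') auto
 also have "\<dots> = T powr \<rho> * \<bar>x\<bar> powr (- \<rho>)"
  by (simp add: powr_divide powr_minus divide_simps)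
 finally show ?thesis .
qed

text \<open>The kernel \<open>T / (1 + (T l)\<^sup>2)\<close> lives at scale \<open>1 / T\<close>. Rescaled, the weight becomes at most
\<open>T\<^sup>\<rho> |x|^(-\<rho>)\<close>, whose singularity is integrable because \<open>\<rho> < 1\<close>.\<close>

lemma kernel_weight_bound:
 fixes \<rho> :: real
 assumes "0 < \<rho>" "\<rho> < 1"
 shows "\<exists>C>0. \<forall>T N y. 0 < T \<longrightarrow> (\<integral>\<^sup>+ l. ennreal (jap (\<bar>l\<bar> - N) powr (- \<rho>) * (T / (1 + (T * (l - y))\<^sup>2))) \<partial>lborel)
   \<le> ennreal (C * T powr \<rho>)"
proof -
 obtain C where C: "C > 0" "(\<integral>\<^sup>+ l. ennreal (jap (l::real) powr (- 2)) \<partial>lborel) \<le> ennreal C"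
  using nn_integral_jap_powr[of 2] by auto
 define D where "D = 2 / (1 - \<rho>) + C"
 have D: "D > 0" using assms C by (auto simp: D_def intro!: add_pos_pos)
 have jap2: "jap x powr (- 2) = 1 / (1 + x\<^sup>2)" for x :: real
 proof -
  have "jap x powr (- 2) = 1 / jap x powr 2" by (simp add: powr_minus divide_simps)
  also have "jap x powr 2 = 1 + x\<^sup>2" using jap_pos[of x] by (simp add: jap_sq)
  finally show ?thesis .
 qed
 have one: "(\<integral>\<^sup>+ l. ennreal (jap (l - p) powr (- \<rho>) * (T / (1 + (T * (l - y))\<^sup>2))) \<partial>lborel) \<le> ennreal (D * T powr \<rho>)"
  if T: "0 < T" for T p y :: real
 proof -
  define z where "z = T * (y - p)"
  have "(\<integral>\<^sup>+ l. ennreal (jap (l - p) powr (- \<rho>) * (T / (1 + (T * (l - y))\<^sup>2))) \<partial>lborel)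
   = ennreal (1 / T) * (\<integral>\<^sup>+ x. ennreal (jap (x / T) powr (- \<rho>) * (T / (1 + (x - z)\<^sup>2))) \<partial>lborel)"
  proof -
   have "T * (p + x / T - y) = x - z" for x using T by (simp add: z_def field_simps)
   thus ?thesis
    using nn_integral_real_affine[of "\<lambda>l. ennreal (jap (l - p) powr (- \<rho>) * (T / (1 + (T * (l - y))\<^sup>2)))" "1 / T" p] T
    by (simp add: mult.commute)
  qed
  also have "\<dots> = (\<integral>\<^sup>+ x. ennreal (1 / T) * ennreal (jap (x / T) powr (- \<rho>) * (T / (1 + (x - z)\<^sup>2))) \<partial>lborel)"
   by (rule nn_integral_cmult[symmetric]) measurable
  also have "\<dots> \<le> (\<integral>\<^sup>+ x. ennreal (T powr \<rho>) * (ennreal (\<bar>x\<bar> powr (- \<rho>)) * indicator {-1..1} x + ennreal (jap (x - z) powr (- 2))) \<partial>lborel)"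
  proof (rule nn_integral_mono_AE)
   have "AE x in lborel. x \<noteq> (0::real)" by (rule AE_lborel_singleton)
   thus "AE x in lborel. ennreal (1 / T) * ennreal (jap (x / T) powr (- \<rho>) * (T / (1 + (x - z)\<^sup>2)))
     \<le> ennreal (T powr \<rho>) * (ennreal (\<bar>x\<bar> powr (- \<rho>)) * indicator {-1..1} x + ennreal (jap (x - z) powr (- 2)))"
   proof eventually_elim
    case (elim x)
    have j1: "jap (x - z) powr (- 2) \<le> 1" "0 \<le> jap (x - z) powr (- 2)"
     using powr_mono2'[of "-2" 1 "jap (x - z)"] jap_ge_1[of "x - z"] by auto
    have "\<bar>x\<bar> powr (- \<rho>) * jap (x - z) powr (- 2) \<le> \<bar>x\<bar> powr (- \<rho>) * indicator {-1..1} x + jap (x - z) powr (- 2)"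
    proof (cases "\<bar>x\<bar> \<le> 1")
     case True
     hence "\<bar>x\<bar> powr (- \<rho>) * jap (x - z) powr (- 2) \<le> \<bar>x\<bar> powr (- \<rho>) * 1" using j1 by (intro mult_left_mono) auto
     moreover have "indicator {-1..1} x = (1::real)" using True by (auto simp: indicator_def abs_le_iff)
     ultimately show ?thesis using j1(2) by (simp only: mult_1_right)
    next
     case False
     hence "\<bar>x\<bar> powr (- \<rho>) \<le> 1" using powr_mono2'[of "-\<rho>" 1 "\<bar>x\<bar>"] assms by simp
     hence "\<bar>x\<bar> powr (- \<rho>) * jap (x - z) powr (- 2) \<le> 1 * jap (x - z) powr (- 2)" using j1 by (intro mult_right_mono) auto
     moreover have "indicator {-1..1} x = (0::real)" using False by (auto simp: indicator_def abs_le_iff)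
     ultimately show ?thesis by simp
    qed
    hence "T powr \<rho> * (\<bar>x\<bar> powr (- \<rho>) * jap (x - z) powr (- 2)) \<le> T powr \<rho> * (\<bar>x\<bar> powr (- \<rho>) * indicator {-1..1} x + jap (x - z) powr (- 2))"
     by (intro mult_left_mono) auto
    moreover have "1 / T * (jap (x / T) powr (- \<rho>) * (T / (1 + (x - z)\<^sup>2))) \<le> T powr \<rho> * (\<bar>x\<bar> powr (- \<rho>) * jap (x - z) powr (- 2))"
    proof -
     have "jap (x / T) powr (- \<rho>) * jap (x - z) powr (- 2) \<le> T powr \<rho> * \<bar>x\<bar> powr (- \<rho>) * jap (x - z) powr (- 2)"
      using jap_powr_neg_le[OF T assms(1) elim] j1 by (intro mult_right_mono) auto
     moreover have "1 / T * (jap (x / T) powr (- \<rho>) * (T / (1 + (x - z)\<^sup>2))) = jap (x / T) powr (- \<rho>) * jap (x - z) powr (- 2)"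
      using T by (simp add: jap2)
     ultimately show ?thesis by (simp add: mult.assoc)
    qed
    ultimately have "1 / T * (jap (x / T) powr (- \<rho>) * (T / (1 + (x - z)\<^sup>2))) \<le> T powr \<rho> * (\<bar>x\<bar> powr (- \<rho>) * indicator {-1..1} x + jap (x - z) powr (- 2))"
     by linarith
    hence "ennreal (1 / T * (jap (x / T) powr (- \<rho>) * (T / (1 + (x - z)\<^sup>2)))) \<le> ennreal (T powr \<rho> * (\<bar>x\<bar> powr (- \<rho>) * indicator {-1..1} x + jap (x - z) powr (- 2)))"
     by (rule ennreal_leI)
    moreover have "ennreal (1 / T * (jap (x / T) powr (- \<rho>) * (T / (1 + (x - z)\<^sup>2)))) = ennreal (1 / T) * ennreal (jap (x / T) powr (- \<rho>) * (T / (1 + (x - z)\<^sup>2)))"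
     using T by (intro ennreal_mult) (auto intro!: mult_nonneg_nonneg divide_nonneg_nonneg)
    moreover have "ennreal (T powr \<rho> * (\<bar>x\<bar> powr (- \<rho>) * indicator {-1..1} x + jap (x - z) powr (- 2))) =
      ennreal (T powr \<rho>) * (ennreal (\<bar>x\<bar> powr (- \<rho>)) * indicator {-1..1} x + ennreal (jap (x - z) powr (- 2)))"
     by (simp add: ennreal_mult' ennreal_plus ennreal_indicator)
    ultimately show ?case by simp
   qed
  qed
  also have "\<dots> = ennreal (T powr \<rho>) * ((\<integral>\<^sup>+ x. ennreal (\<bar>x\<bar> powr (- \<rho>)) * indicator {-1..1} x \<partial>lborel) + (\<integral>\<^sup>+ x. ennreal (jap (x - z) powr (- 2)) \<partial>lborel))"
   by (subst nn_integral_cmult, measurable, subst nn_integral_add) auto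
  also have "(\<integral>\<^sup>+ x. ennreal (jap (x - z) powr (- 2)) \<partial>lborel) = (\<integral>\<^sup>+ x. ennreal (jap (x::real) powr (- 2)) \<partial>lborel)"
   using nn_integral_real_affine[of "\<lambda>l. ennreal (jap l powr (- 2))" 1 "-z"] by simp
  also have "ennreal (T powr \<rho>) * ((\<integral>\<^sup>+ x. ennreal (\<bar>x\<bar> powr (- \<rho>)) * indicator {-1..1} x \<partial>lborel) + (\<integral>\<^sup>+ x. ennreal (jap (x::real) powr (- 2)) \<partial>lborel))
    \<le> ennreal (T powr \<rho>) * (ennreal (2 / (1 - \<rho>)) + ennreal C)"
   using assms by (intro mult_left_mono add_mono C nn_integral_powr_near_0) auto
  also have "\<dots> = ennreal (D * T powr \<rho>)"
   using assms C by (simp add: D_def mult.commute flip: ennreal_plus ennreal_mult)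
  finally show ?thesis .
 qed
 show ?thesis
 proof (intro exI[of _ "D + D"] conjI allI impI)
  show "D + D > 0" using D by simp
  fix T N y :: real assume T: "0 < T"
  have k: "0 \<le> T / (1 + (T * (l - y))\<^sup>2)" for l using T by (intro divide_nonneg_nonneg) auto
  have "(\<integral>\<^sup>+ l. ennreal (jap (\<bar>l\<bar> - N) powr (- \<rho>) * (T / (1 + (T * (l - y))\<^sup>2))) \<partial>lborel) \<le>
   (\<integral>\<^sup>+ l. ennreal (jap (l - N) powr (- \<rho>) * (T / (1 + (T * (l - y))\<^sup>2))) + ennreal (jap (l - (-N)) powr (- \<rho>) * (T / (1 + (T * (l - y))\<^sup>2))) \<partial>lborel)"
  proof (rule nn_integral_mono)
   fix l :: real
   have "jap (- l - N) = jap (l - (- N))" by (simp add: jap_def norm_minus_commute power2_eq_square algebra_simps)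
   hence "jap (\<bar>l\<bar> - N) = jap (l - N) \<or> jap (\<bar>l\<bar> - N) = jap (l - (- N))" by (auto simp: abs_if)
   thus "ennreal (jap (\<bar>l\<bar> - N) powr (- \<rho>) * (T / (1 + (T * (l - y))\<^sup>2))) \<le> ennreal (jap (l - N) powr (- \<rho>) * (T / (1 + (T * (l - y))\<^sup>2))) + ennreal (jap (l - (-N)) powr (- \<rho>) * (T / (1 + (T * (l - y))\<^sup>2)))"
    by (elim disjE) (simp_all only: add_increasing add_increasing2 order_refl zero_le)
  qed
  also have "\<dots> \<le> ennreal (D * T powr \<rho>) + ennreal (D * T powr \<rho>)"
   by (subst nn_integral_add, measurable) (intro add_mono one T)
  also have "\<dots> = ennreal ((D + D) * T powr \<rho>)" using D by (simp add: distrib_right flip: ennreal_plus)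
  finally show "(\<integral>\<^sup>+ l. ennreal (jap (\<bar>l\<bar> - N) powr (- \<rho>) * (T / (1 + (T * (l - y))\<^sup>2))) \<partial>lborel) \<le> ennreal ((D + D) * T powr \<rho>)" .
 qed
qed

text \<open>Schur's test: Cauchy--Schwarz with respect to the measure \<open>k (x - y) dy\<close>, then Fubini.\<close>

lemma weighted_young:
 fixes k w :: "freqpt \<Rightarrow> real"
 assumes [measurable]: "fmeas k" "fmeas w" "fmeas r"
  and k: "\<And>q. 0 \<le> k q"
  and J: "\<And>y. (\<oint> x. ennreal (w x) * ennreal (k (x - y))) \<le> J"
 shows "(\<oint> x. ennreal (w x) * (conv (\<lambda>q. ennreal (k q)) r x)\<^sup>2) \<le>
   (\<oint> q. ennreal (k q)) * J * (\<oint> q. (r q)\<^sup>2)"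
proof -
 let ?K = "\<integral>\<^sup>+ q. ennreal (k q) \<partial>freq_measure"
 have sq: "ennreal (sqrt (k a)) * ennreal (sqrt (k a)) = ennreal (k a)" for a
  using k by (simp flip: ennreal_mult)
 have "(conv (\<lambda>q. ennreal (k q)) r x)\<^sup>2 \<le> ?K * conv (\<lambda>q. ennreal (k q)) (\<lambda>q. (r q)\<^sup>2) x" for x
 proof -
  have "conv (\<lambda>q. ennreal (k q)) r x = (\<oint> a. ennreal (sqrt (k a)) * (ennreal (sqrt (k a)) * r (x - a)))"
   by (simp add: conv_def mult.assoc[symmetric] sq)
  also have "\<dots>\<^sup>2 \<le> (\<oint> a. (ennreal (sqrt (k a)))\<^sup>2) * (\<oint> a. (ennreal (sqrt (k a)) * r (x - a))\<^sup>2)"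
   by (rule Cauchy_Schwarz_nn_integral) measurable
  also have "\<dots> = ?K * conv (\<lambda>q. ennreal (k q)) (\<lambda>q. (r q)\<^sup>2) x"
   by (simp add: conv_def power_mult_distrib sq power2_eq_square mult_ac flip: sq)
  finally show ?thesis .
 qed
 hence "(\<oint> x. ennreal (w x) * (conv (\<lambda>q. ennreal (k q)) r x)\<^sup>2) \<le>
  (\<oint> x. ?K * (conv (\<lambda>q. (r q)\<^sup>2) (\<lambda>q. ennreal (k q)) x * ennreal (w x)))"
  by (subst conv_commute, measurable) (intro nn_integral_mono, simp add: mult.left_commute mult.commute mult_left_mono)
 also have "\<dots> = ?K * (\<oint> x. conv (\<lambda>q. (r q)\<^sup>2) (\<lambda>q. ennreal (k q)) x * ennreal (w x))"
  by (rule nn_integral_cmult) measurable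
 finally have main: "(\<oint> x. ennreal (w x) * (conv (\<lambda>q. ennreal (k q)) r x)\<^sup>2) \<le>
  ?K * (\<oint> x. conv (\<lambda>q. (r q)\<^sup>2) (\<lambda>q. ennreal (k q)) x * ennreal (w x))" .
 have "(\<oint> x. conv (\<lambda>q. (r q)\<^sup>2) (\<lambda>q. ennreal (k q)) x * ennreal (w x))
   = (\<oint> a. (r a)\<^sup>2 * (\<oint> b. ennreal (k b) * ennreal (w (a + b))))"
  by (rule conv_integral) measurable
 also have "\<dots> \<le> (\<oint> a. (r a)\<^sup>2 * J)"
 proof (intro nn_integral_mono mult_left_mono)
  fix a
  have "(\<oint> b. ennreal (k b) * ennreal (w (a + b))) = (\<oint> x. ennreal (w x) * ennreal (k (x - a)))"
   using nn_integral_freq_shift[of "\<lambda>x. ennreal (w x) * ennreal (k (x - a))" a] by (simp add: ac_simps)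
  thus "(\<oint> b. ennreal (k b) * ennreal (w (a + b))) \<le> J" using J by simp
 qed simp
 also have "\<dots> = (\<oint> a. (r a)\<^sup>2) * J" by (rule nn_integral_multc) measurable
 finally have "?K * (\<oint> x. conv (\<lambda>q. (r q)\<^sup>2) (\<lambda>q. ennreal (k q)) x * ennreal (w x))
   \<le> ?K * ((\<oint> a. (r a)\<^sup>2) * J)" by (rule mult_left_mono) simp
 from order_trans[OF main this] show ?thesis by (simp only: ac_simps)
qed

lemma powr_add_le_twice:
 fixes u v p :: real
 assumes "0 \<le> u" "0 \<le> v" "0 \<le> p" "p \<le> 1"
 shows "(u + v) powr p \<le> 2 * (u powr p + v powr p)"
proof -
 have "(u + v) powr p \<le> (2 * max u v) powr p" using assms by (intro powr_mono2) auto
 also have "\<dots> = 2 powr p * (max u v) powr p" using assms by (simp add: powr_mult)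
 also have "\<dots> \<le> 2 powr 1 * (u powr p + v powr p)"
  using assms by (intro mult_mono powr_mono) (auto simp: max_def)
 finally show ?thesis by simp
qed

text \<open>The Fourier transform of a cutoff at scale \<open>T\<close> is concentrated on \<open>n = 0\<close> and \<open>|\<lambda>| \<le> 1 / T\<close>, so it
moves the modulation by at most about \<open>1 / T\<close>. Thus \<open>\<langle>\<sigma>\<rangle>^(-\<beta>)\<close> after the convolution, compared with \<open>\<langle>\<sigma>\<rangle>^(-2/5)\<close>
before it, leaves \<open>\<langle>\<sigma>\<rangle>^(-\<gamma>) + T^(-2/5) \<langle>\<sigma>\<rangle>^(-\<beta>)\<close> with \<open>\<gamma> = \<beta> - 2/5\<close>, and by \<open>kernel_weight_bound\<close> either term gains
\<open>T\<^sup>\<gamma>\<close>.\<close>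

lemma time_cutoff:
 fixes \<beta> s :: real
 assumes \<beta>: "2/5 < \<beta>" "\<beta> < 1/2"
 shows "\<exists>C>0. \<forall>T c K R. 0 < T \<longrightarrow> 0 \<le> c \<longrightarrow> fmeas K \<longrightarrow> fmeas R \<longrightarrow>
   (\<forall>q. K q \<le> ennreal (if snd q = 0 then c * (T / (1 + (T * fst q)\<^sup>2)\<^sup>2) else 0)) \<longrightarrow>
   EN s (- \<beta>) (conv K R) \<le> ennreal (C * c\<^sup>2 * T powr (2 * (\<beta> - 2/5))) * EN s (- 2/5) R"
proof -
 define \<gamma> where "\<gamma> = \<beta> - 2/5"
 obtain C1 where C1: "C1 > 0" "\<And>T N y. 0 < T \<Longrightarrow> (\<integral>\<^sup>+ l. ennreal (jap (\<bar>l\<bar> - N) powr (- (2 * \<gamma>)) * (T / (1 + (T * (l - y))\<^sup>2))) \<partial>lborel)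
   \<le> ennreal (C1 * T powr (2 * \<gamma>))"
  using kernel_weight_bound[of "2 * \<gamma>"] \<beta> by (auto simp: \<gamma>_def)
 obtain C2 where C2: "C2 > 0" "\<And>T N y. 0 < T \<Longrightarrow> (\<integral>\<^sup>+ l. ennreal (jap (\<bar>l\<bar> - N) powr (- (2 * \<beta>)) * (T / (1 + (T * (l - y))\<^sup>2))) \<partial>lborel)
   \<le> ennreal (C2 * T powr (2 * \<beta>))"
  using kernel_weight_bound[of "2 * \<beta>"] \<beta> by auto
 obtain C3 where C3: "C3 > 0" "(\<integral>\<^sup>+ l. ennreal (jap (l::real) powr (- 2)) \<partial>lborel) \<le> ennreal C3"
  using nn_integral_jap_powr[of 2] by auto
 show ?thesis
 proof (intro exI[of _ "8 * (C3 * (C1 + C2))"] conjI allI impI)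
  show "8 * (C3 * (C1 + C2)) > 0" using C1 C2 C3 by simp
  fix T c :: real and K R :: "freqpt \<Rightarrow> ennreal"
  assume T: "0 < T" and c: "0 \<le> c" and [measurable]: "fmeas K" "fmeas R"
   and K: "\<forall>q. K q \<le> ennreal (if snd q = 0 then c * (T / (1 + (T * fst q)\<^sup>2)\<^sup>2) else 0)"
  \<comment> \<open>one factor \<open>1 / (1 + (T * fst q)\<^sup>2)\<close> of the bound on \<open>K\<close> is kept back, against the growth of the modulation\<close>
  define k where "k = (\<lambda>q :: freqpt. if snd q = 0 then T / (1 + (T * fst q)\<^sup>2) else 0)"
  define r where "r = (\<lambda>q. ennreal (fq q powr s * md q powr (- 2/5)) * R q)"
  have [measurable]: "fmeas k" unfolding k_def by measurable
  have [measurable]: "fmeas r" unfolding r_def by measurable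
  have k0: "0 \<le> k q" for q using T by (auto simp: k_def)
  have int_k: "(\<oint> x. ennreal (w x) * ennreal (k (x - y))) =
    (\<integral>\<^sup>+ l. ennreal (w (l, snd y)) * ennreal (T / (1 + (T * (l - fst y))\<^sup>2)) \<partial>lborel)"
   if [measurable]: "fmeas w" for w y
  proof -
   have "(\<oint> x. ennreal (w x) * ennreal (k (x - y))) =
    (\<integral>\<^sup>+ n. (\<integral>\<^sup>+ l. ennreal (w (l, n)) * ennreal (k ((l, n) - y)) \<partial>lborel) \<partial>count_space UNIV)"
    by (rule nn_integral_freq) measurable
   also have "\<dots> = (\<integral>\<^sup>+ n. (\<integral>\<^sup>+ l. ennreal (w (l, n)) * ennreal (T / (1 + (T * (l - fst y))\<^sup>2)) \<partial>lborel) * indicator {snd y} n \<partial>count_space UNIV)"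
   proof (rule nn_integral_cong)
    fix n
    have "k ((l, n) - y) = (if n = snd y then T / (1 + (T * (l - fst y))\<^sup>2) else 0)" for l
     by (simp add: k_def)
    thus "(\<integral>\<^sup>+ l. ennreal (w (l, n)) * ennreal (k ((l, n) - y)) \<partial>lborel) =
     (\<integral>\<^sup>+ l. ennreal (w (l, n)) * ennreal (T / (1 + (T * (l - fst y))\<^sup>2)) \<partial>lborel) * indicator {snd y} n"
     by (cases "n = snd y") simp_all
   qed
   also have "\<dots> = (\<integral>\<^sup>+ l. ennreal (w (l, snd y)) * ennreal (T / (1 + (T * (l - fst y))\<^sup>2)) \<partial>lborel)"
    by (subst nn_integral_indicator_singleton) auto
   finally show ?thesis .
  qed
  have Kk: "(\<oint> q. ennreal (k q)) \<le> ennreal C3"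
  proof -
   have "(\<oint> q. ennreal (k q)) = (\<integral>\<^sup>+ l. ennreal (T / (1 + (T * l)\<^sup>2)) \<partial>lborel)"
    using int_k[of "\<lambda>_. 1" 0] by simp
   also have "\<dots> = ennreal (1 / T) * (\<integral>\<^sup>+ x. ennreal (T / (1 + x\<^sup>2)) \<partial>lborel)"
    using nn_integral_real_affine[of "\<lambda>l. ennreal (T / (1 + (T * l)\<^sup>2))" "1 / T" 0] T by simp
   also have "\<dots> = (\<integral>\<^sup>+ x. ennreal (1 / T) * ennreal (T / (1 + x\<^sup>2)) \<partial>lborel)"
    by (rule nn_integral_cmult[symmetric]) measurable
   also have "\<dots> = (\<integral>\<^sup>+ x. ennreal (jap (x::real) powr (- 2)) \<partial>lborel)"
   proof (rule nn_integral_cong)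
    fix x :: real
    have "jap x powr (- 2) = 1 / jap x powr 2" by (simp add: powr_minus divide_simps)
    also have "jap x powr 2 = 1 + x\<^sup>2" using jap_pos[of x] by (simp add: jap_sq)
    finally show "ennreal (1 / T) * ennreal (T / (1 + x\<^sup>2)) = ennreal (jap x powr (- 2))"
     using T by (simp flip: ennreal_mult)
   qed
   finally show ?thesis using C3 by simp
  qed
  have y: "(\<oint> x. ennreal (md x powr (- (2 * \<theta>))) * (conv (\<lambda>q. ennreal (k q)) r x)\<^sup>2) \<le>
    ennreal C3 * ennreal (D * T powr (2 * \<theta>)) * (\<oint> q. (r q)\<^sup>2)"
   if D: "\<And>T N y. 0 < T \<Longrightarrow> (\<integral>\<^sup>+ l. ennreal (jap (\<bar>l\<bar> - N) powr (- (2 * \<theta>)) * (T / (1 + (T * (l - y))\<^sup>2))) \<partial>lborel)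
    \<le> ennreal (D * T powr (2 * \<theta>))" for \<theta> D
  proof (rule order_trans[OF weighted_young[where J="ennreal (D * T powr (2 * \<theta>))"]])
   fix y
   have "(\<oint> x. ennreal (md x powr (- (2 * \<theta>))) * ennreal (k (x - y))) =
     (\<integral>\<^sup>+ l. ennreal (jap (\<bar>l\<bar> - jap (freq (snd y))) powr (- (2 * \<theta>)) * (T / (1 + (T * (l - fst y))\<^sup>2))) \<partial>lborel)"
    by (subst int_k) (auto simp: md_def ennreal_mult' simp del: times_divide_eq_right)
   also have "\<dots> \<le> ennreal (D * T powr (2 * \<theta>))" by (rule D[OF T])
   finally show "(\<oint> x. ennreal (md x powr (- (2 * \<theta>))) * ennreal (k (x - y))) \<le> ennreal (D * T powr (2 * \<theta>))" .
  qed (auto simp: k0 intro!: mult_right_mono Kk)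
  note y1 = y[OF C1(2)] and y2 = y[OF C2(2)]
  have pt: "ennreal (fq x powr s * md x powr (- \<beta>)) * (K a * R (x - a)) \<le>
    ennreal (2 * c * (md x powr (- \<gamma>) + T powr (- 2/5) * md x powr (- \<beta>))) * (ennreal (k a) * r (x - a))" for x a
  proof (cases "snd a = 0")
   case False
   hence "K a = 0" using K[rule_format, of a] by simp
   thus ?thesis by simp
  next
   case True
   have fqx: "fq (x - a) = fq x" using True by (simp add: fq_def)
   let ?t = "T * fst a"
   have Ka: "K a \<le> ennreal (c * (k a / (1 + ?t\<^sup>2)))"
    using K[rule_format, of a] True by (simp add: k_def power2_eq_square)
   have md_le: "md (x - a) \<le> md x + \<bar>fst a\<bar>"
   proof -
    have "jap u \<le> jap v + \<bar>u - v\<bar>" for u v :: real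
    proof -
     have "jap u = norm (1::real, v + (u - v))" by (simp add: jap_def norm_Pair)
     also have "\<dots> \<le> norm (1::real, v) + norm (0::real, u - v)"
      using norm_triangle_ineq[of "(1::real, v)" "(0, u - v)"] by simp
     finally show ?thesis by (simp add: jap_def norm_Pair)
    qed
    from this[of "\<bar>fst x - fst a\<bar> - jap (freq (snd x))" "\<bar>fst x\<bar> - jap (freq (snd x))"]
    have "md (x - a) \<le> md x + \<bar>\<bar>fst x - fst a\<bar> - \<bar>fst x\<bar>\<bar>" using True by (simp add: md_def)
    also have "\<bar>\<bar>fst x - fst a\<bar> - \<bar>fst x\<bar>\<bar> \<le> \<bar>fst a\<bar>" by linarith
    finally show ?thesis by simp
   qed
   have "md (x - a) powr (2/5) \<le> (md x + \<bar>fst a\<bar>) powr (2/5)"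
    using md_le md_pos[of "x - a"] by (intro powr_mono2) auto
   also have "\<dots> \<le> 2 * (md x powr (2/5) + \<bar>fst a\<bar> powr (2/5))"
    using md_pos[of x] by (intro powr_add_le_twice) auto
   finally have m1: "md (x - a) powr (2/5) \<le> 2 * (md x powr (2/5) + \<bar>fst a\<bar> powr (2/5))" .
   have t1: "\<bar>fst a\<bar> powr (2/5) \<le> T powr (- 2/5) * (1 + ?t\<^sup>2)"
   proof -
    have "\<bar>?t\<bar> powr (2/5) \<le> 1 + ?t\<^sup>2"
    proof (cases "\<bar>?t\<bar> \<le> 1")
     case True
     hence "\<bar>?t\<bar> powr (2/5) \<le> 1" by (intro powr_le1) auto
     thus ?thesis by (simp add: add_increasing2)
    next
     case False
     hence "\<bar>?t\<bar> powr (2/5) \<le> \<bar>?t\<bar> powr 2" by (intro powr_mono) auto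
     also have "\<bar>?t\<bar> powr 2 = ?t\<^sup>2" using False by simp
     finally show ?thesis by simp
    qed
    hence "T powr (- 2/5) * \<bar>?t\<bar> powr (2/5) \<le> T powr (- 2/5) * (1 + ?t\<^sup>2)" by (intro mult_left_mono) auto
    moreover have "T powr (- 2/5) * \<bar>?t\<bar> powr (2/5) = \<bar>fst a\<bar> powr (2/5)"
     using T by (simp add: abs_mult powr_mult mult.assoc[symmetric] flip: powr_add)
    ultimately show ?thesis by simp
   qed
   have p1: "0 < 1 + ?t\<^sup>2" by (simp add: add_pos_nonneg)
   have m2: "md (x - a) powr (2/5) / (1 + ?t\<^sup>2) \<le> 2 * (md x powr (2/5) + T powr (- 2/5))"
   proof -
    have "md (x - a) powr (2/5) \<le> 2 * (md x powr (2/5) * (1 + ?t\<^sup>2) + T powr (- 2/5) * (1 + ?t\<^sup>2))"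
    proof -
     have "md x powr (2/5) * 1 \<le> md x powr (2/5) * (1 + ?t\<^sup>2)" by (intro mult_left_mono) auto
     hence "md x powr (2/5) \<le> md x powr (2/5) * (1 + ?t\<^sup>2)" by (simp only: mult_1_right)
     thus ?thesis using t1 by (intro order_trans[OF m1] mult_left_mono add_mono) auto
    qed
    thus ?thesis using p1 by (simp add: pos_divide_le_eq distrib_right)
   qed
   have R_eq: "ennreal (fq x powr s) * R (x - a) = ennreal (md (x - a) powr (2/5)) * r (x - a)"
   proof -
    have "ennreal (md (x - a) powr (2/5)) * ennreal (md (x - a) powr (- 2/5)) = 1"
     using md_pos[of "x - a"] by (simp flip: ennreal_mult' powr_add)
    hence "ennreal (md (x - a) powr (2/5)) * ennreal (md (x - a) powr (- 2/5)) * (ennreal (fq x powr s) * R (x - a)) = ennreal (fq x powr s) * R (x - a)"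
     by (simp only: mult_1_left)
    thus ?thesis by (simp add: r_def fqx ennreal_mult' mult_ac)
   qed
   have real: "md x powr (- \<beta>) * (c * (k a / (1 + ?t\<^sup>2))) * md (x - a) powr (2/5) \<le>
     2 * c * (md x powr (- \<gamma>) + T powr (- 2/5) * md x powr (- \<beta>)) * k a"
   proof -
    have eq: "md x powr (- \<beta>) * md x powr (2/5) = md x powr (- \<gamma>)"
     by (simp add: \<gamma>_def flip: powr_add)
    have "md x powr (- \<beta>) * (c * (k a / (1 + ?t\<^sup>2))) * md (x - a) powr (2/5)
      = md x powr (- \<beta>) * c * k a * (md (x - a) powr (2/5) / (1 + ?t\<^sup>2))"
     by (simp add: mult_ac)
    also have "\<dots> \<le> md x powr (- \<beta>) * c * k a * (2 * (md x powr (2/5) + T powr (- 2/5)))"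
     using c k0 by (intro mult_left_mono m2) auto
    also have "\<dots> = 2 * c * (md x powr (- \<beta>) * md x powr (2/5) + T powr (- 2/5) * md x powr (- \<beta>)) * k a"
     by (simp only: distrib_left distrib_right ac_simps)
    finally show ?thesis unfolding eq .
   qed
   have "ennreal (fq x powr s * md x powr (- \<beta>)) * (K a * R (x - a)) = ennreal (md x powr (- \<beta>)) * K a * (ennreal (fq x powr s) * R (x - a))"
    by (simp add: ennreal_mult' mult_ac)
   also have "\<dots> \<le> ennreal (md x powr (- \<beta>)) * ennreal (c * (k a / (1 + ?t\<^sup>2))) * (ennreal (md (x - a) powr (2/5)) * r (x - a))"
    unfolding R_eq by (intro mult_left_mono mult_right_mono Ka) auto
   also have "\<dots> = ennreal (md x powr (- \<beta>) * (c * (k a / (1 + ?t\<^sup>2))) * md (x - a) powr (2/5)) * r (x - a)"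
   proof -
    have e3: "ennreal (u * v * w) = ennreal u * ennreal v * ennreal w" if "0 \<le> u" "0 \<le> v" "0 \<le> w" for u v w :: real
     using that by (simp add: ennreal_mult)
    have nn: "0 \<le> c * (k a / (1 + ?t\<^sup>2))"
     using c k0[of a] p1 by (intro mult_nonneg_nonneg divide_nonneg_nonneg) auto
    show ?thesis by (subst e3[OF _ nn]) (simp_all only: powr_ge_zero mult.assoc)
   qed
   also have "\<dots> \<le> ennreal (2 * c * (md x powr (- \<gamma>) + T powr (- 2/5) * md x powr (- \<beta>)) * k a) * r (x - a)"
    by (intro mult_right_mono ennreal_leI real) auto
   also have "\<dots> = ennreal (2 * c * (md x powr (- \<gamma>) + T powr (- 2/5) * md x powr (- \<beta>))) * (ennreal (k a) * r (x - a))"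
    using c by (simp add: ennreal_mult' mult.assoc)
   finally show ?thesis .
  qed
  have pt2: "(ennreal (fq x powr s * md x powr (- \<beta>)) * conv K R x)\<^sup>2 \<le>
    ennreal (8 * c\<^sup>2) * (ennreal (md x powr (- (2 * \<gamma>))) * (conv (\<lambda>q. ennreal (k q)) r x)\<^sup>2)
    + ennreal (8 * c\<^sup>2 * T powr (- 4/5)) * (ennreal (md x powr (- (2 * \<beta>))) * (conv (\<lambda>q. ennreal (k q)) r x)\<^sup>2)" for x
  proof -
   let ?m = "2 * c * (md x powr (- \<gamma>) + T powr (- 2/5) * md x powr (- \<beta>))"
   let ?cv = "conv (\<lambda>q. ennreal (k q)) r x"
   have "ennreal (fq x powr s * md x powr (- \<beta>)) * conv K R x = (\<oint> a. ennreal (fq x powr s * md x powr (- \<beta>)) * (K a * R (x - a)))"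
    unfolding conv_def by (rule nn_integral_cmult[symmetric]) measurable
   also have "\<dots> \<le> (\<oint> a. ennreal ?m * (ennreal (k a) * r (x - a)))"
    by (intro nn_integral_mono pt)
   also have "\<dots> = ennreal ?m * ?cv"
    unfolding conv_def by (rule nn_integral_cmult) measurable
   finally have "(ennreal (fq x powr s * md x powr (- \<beta>)) * conv K R x)\<^sup>2 \<le> (ennreal ?m * ?cv)\<^sup>2"
    by (intro power_mono) auto
   also have "\<dots> = ennreal (?m\<^sup>2) * ?cv\<^sup>2" using c by (simp add: power_mult_distrib ennreal_power)
   also have "\<dots> \<le> ennreal (8 * c\<^sup>2 * md x powr (- (2 * \<gamma>)) + 8 * c\<^sup>2 * T powr (- 4/5) * md x powr (- (2 * \<beta>))) * ?cv\<^sup>2"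
   proof (intro mult_right_mono ennreal_leI)
    have "(u + v)\<^sup>2 \<le> 2 * u\<^sup>2 + 2 * v\<^sup>2" for u v :: real
     using zero_le_power2[of "u - v"] by (simp add: power2_eq_square algebra_simps)
    from this[of "md x powr (- \<gamma>)" "T powr (- 2/5) * md x powr (- \<beta>)"]
    have "?m\<^sup>2 \<le> (2 * c)\<^sup>2 * (2 * (md x powr (- \<gamma>))\<^sup>2 + 2 * (T powr (- 2/5) * md x powr (- \<beta>))\<^sup>2)"
     unfolding power_mult_distrib[of "2 * c"] by (intro mult_left_mono) auto
    also have "\<dots> = 8 * c\<^sup>2 * md x powr (- (2 * \<gamma>)) + 8 * c\<^sup>2 * T powr (- 4/5) * md x powr (- (2 * \<beta>))"
     by (simp add: power_mult_distrib powr_square distrib_left mult.assoc)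
    finally show "?m\<^sup>2 \<le> 8 * c\<^sup>2 * md x powr (- (2 * \<gamma>)) + 8 * c\<^sup>2 * T powr (- 4/5) * md x powr (- (2 * \<beta>))" .
   qed simp
   also have "\<dots> = ennreal (8 * c\<^sup>2) * (ennreal (md x powr (- (2 * \<gamma>))) * ?cv\<^sup>2)
    + ennreal (8 * c\<^sup>2 * T powr (- 4/5)) * (ennreal (md x powr (- (2 * \<beta>))) * ?cv\<^sup>2)"
    by (simp add: ennreal_plus ennreal_mult' distrib_right mult.assoc)
   finally show ?thesis .
  qed
  have "EN s (- \<beta>) (conv K R) \<le> (\<oint> x. ennreal (8 * c\<^sup>2) * (ennreal (md x powr (- (2 * \<gamma>))) * (conv (\<lambda>q. ennreal (k q)) r x)\<^sup>2)
    + ennreal (8 * c\<^sup>2 * T powr (- 4/5)) * (ennreal (md x powr (- (2 * \<beta>))) * (conv (\<lambda>q. ennreal (k q)) r x)\<^sup>2))"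
   unfolding EN_def by (intro nn_integral_mono pt2)
  also have "\<dots> = ennreal (8 * c\<^sup>2) * (\<oint> x. ennreal (md x powr (- (2 * \<gamma>))) * (conv (\<lambda>q. ennreal (k q)) r x)\<^sup>2)
    + ennreal (8 * c\<^sup>2 * T powr (- 4/5)) * (\<oint> x. ennreal (md x powr (- (2 * \<beta>))) * (conv (\<lambda>q. ennreal (k q)) r x)\<^sup>2)"
   by (subst nn_integral_add, measurable, subst nn_integral_cmult, measurable, subst nn_integral_cmult, measurable)
  also have "\<dots> \<le> ennreal (8 * c\<^sup>2) * (ennreal C3 * ennreal (C1 * T powr (2 * \<gamma>)) * (\<oint> q. (r q)\<^sup>2))
    + ennreal (8 * c\<^sup>2 * T powr (- 4/5)) * (ennreal C3 * ennreal (C2 * T powr (2 * \<beta>)) * (\<oint> q. (r q)\<^sup>2))"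
   by (intro add_mono mult_left_mono y1 y2) auto
  also have "\<dots> = ennreal (8 * c\<^sup>2 * (C3 * (C1 * T powr (2 * \<gamma>))) + 8 * c\<^sup>2 * T powr (- 4/5) * (C3 * (C2 * T powr (2 * \<beta>)))) * (\<oint> q. (r q)\<^sup>2)"
   using C1(1) C2(1) C3(1) by (simp add: ennreal_mult' distrib_right mult.assoc)
  also have "8 * c\<^sup>2 * (C3 * (C1 * T powr (2 * \<gamma>))) + 8 * c\<^sup>2 * T powr (- 4/5) * (C3 * (C2 * T powr (2 * \<beta>)))
    = 8 * (C3 * (C1 + C2)) * c\<^sup>2 * T powr (2 * (\<beta> - 2/5))"
  proof -
   have "T powr (- 4/5) * T powr (2 * \<beta>) = T powr (2 * \<gamma>)" by (simp add: \<gamma>_def flip: powr_add)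
   hence "8 * c\<^sup>2 * T powr (- 4/5) * (C3 * (C2 * T powr (2 * \<beta>))) = 8 * c\<^sup>2 * (C3 * (C2 * T powr (2 * \<gamma>)))"
    by (simp add: mult_ac)
   thus ?thesis by (simp add: \<gamma>_def algebra_simps)
  qed
  also have "(\<oint> q. (r q)\<^sup>2) = EN s (- 2/5) R" by (simp add: EN_def r_def)
  finally show "EN s (- \<beta>) (conv K R) \<le> ennreal (8 * (C3 * (C1 + C2)) * c\<^sup>2 * T powr (2 * (\<beta> - 2/5))) * EN s (- 2/5) R" .
 qed
qed

section \<open>Closure properties of Schwartz functions\<close>

declare split_paired_All [simp del] split_paired_Ex [simp del]

definition pd :: "spacetime \<Rightarrow> (spacetime \<Rightarrow> complex) \<Rightarrow> spacetime \<Rightarrow> complex" where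
 "pd v f = (\<lambda>p. frechet_derivative f (at p) v)"

definition periodic :: "(spacetime \<Rightarrow> complex) \<Rightarrow> bool" where
 "periodic f \<longleftrightarrow> (\<forall>t x y. f (t, x + 2*pi, y) = f (t, x, y) \<and> f (t, x, y + 2*pi) = f (t, x, y))"

definition rapid :: "(spacetime \<Rightarrow> complex) \<Rightarrow> bool" where
 "rapid f \<longleftrightarrow> (\<forall>N. \<exists>M. \<forall>p. jap (fst p) ^ N * norm (f p) \<le> M)"

text \<open>The conditions on a Schwartz function that do not mention iterated derivatives.\<close>

definition good :: "(spacetime \<Rightarrow> complex) \<Rightarrow> bool" where
 "good f \<longleftrightarrow> (\<forall>p. f differentiable (at p)) \<and> periodic f \<and> rapid f"

lemma iter_deriv_Cons': "iter_deriv (v # vs) f = pd v (iter_deriv vs f)"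
 by (simp add: pd_def)

lemma iter_deriv_snoc: "iter_deriv vs (pd v f) = iter_deriv (vs @ [v]) f"
 by (induction vs) (simp_all add: pd_def)

text \<open>Coinduction for the Schwartz space: a set of functions that are differentiable, periodic and
rapidly decaying, and that is closed under partial derivatives, consists of Schwartz functions.\<close>

lemma schwartz_class:
 assumes "f \<in> S" and good: "\<And>g. g \<in> S \<Longrightarrow> good g"
  and closed: "\<And>g v. g \<in> S \<Longrightarrow> v \<in> Basis \<Longrightarrow> pd v g \<in> S"
 shows "f \<in> schwartz"
proof -
 have it: "iter_deriv vs f \<in> S" if "set vs \<subseteq> Basis" for vs
  using that by (induction vs) (auto simp: iter_deriv_Cons' assms simp del: iter_deriv.simps(2))
 have "smooth f" unfolding smooth_def
  using good[OF it] by (auto simp: good_def differentiable_on_def)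
 moreover have "periodic f" using good[OF assms(1)] by (simp add: good_def)
 moreover have "\<exists>M. \<forall>p. jap (fst p) ^ N * norm (iter_deriv vs f p) \<le> M" if "set vs \<subseteq> Basis" for N vs
  using good[OF it[OF that]] by (auto simp: good_def rapid_def)
 ultimately show ?thesis by (simp add: schwartz_def periodic_def)
qed

lemma schwartz_good: "f \<in> schwartz \<Longrightarrow> good f"
proof -
 assume f: "f \<in> schwartz"
 have s: "iter_deriv vs f differentiable_on UNIV" if "set vs \<subseteq> Basis" for vs
  using f that by (simp add: schwartz_def smooth_def)
 have d: "\<exists>M. \<forall>p. jap (fst p) ^ N * norm (iter_deriv vs f p) \<le> M" if "set vs \<subseteq> Basis" for N vs
  using f that by (simp add: schwartz_def)
 have "periodic f" using f by (simp add: schwartz_def periodic_def)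
 thus "good f" using s[of "[]"] d[of "[]"] by (simp add: good_def rapid_def differentiable_on_def)
qed

lemma has_derivative_shift:
 assumes "(f has_derivative f') (at (p + c))"
 shows "((\<lambda>q. f (q + c)) has_derivative f') (at p)"
proof -
 have "((\<lambda>q. q + c) has_derivative (\<lambda>h. h)) (at p)" by (auto intro!: derivative_eq_intros)
 from diff_chain_at[OF this, of f f'] assms show ?thesis by (simp add: o_def)
qed

lemma schwartz_pd:
 assumes f: "f \<in> schwartz" and v: "v \<in> Basis"
 shows "pd v f \<in> schwartz"
proof -
 have it: "iter_deriv vs (pd v f) = iter_deriv (vs @ [v]) f" for vs by (rule iter_deriv_snoc)
 have dif: "f differentiable (at p)" for p using schwartz_good[OF f] by (simp add: good_def)
 have per: "pd v f (p + c) = pd v f p" if "\<And>q. f (q + c) = f q" for p c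
 proof -
  have "(f has_derivative frechet_derivative f (at (p + c))) (at (p + c))"
   using dif frechet_derivative_works by blast
  from has_derivative_shift[OF this] that have "(f has_derivative frechet_derivative f (at (p + c))) (at p)" by simp
  from frechet_derivative_at[OF this] show ?thesis by (simp add: pd_def)
 qed
 have fp: "periodic f" using schwartz_good[OF f] by (simp add: good_def)
 have "f (q + (0, 2*pi, 0)) = f q" "f (q + (0, 0, 2*pi)) = f q" for q
  using fp by (cases q; simp add: periodic_def)+
 from per[OF this(1)] per[OF this(2)] have "periodic (pd v f)"
  unfolding periodic_def by (metis add.right_neutral add_Pair)
 thus ?thesis using f v unfolding schwartz_def smooth_def periodic_def by (auto simp: it)
qed

inductive_set lspan :: "(spacetime \<Rightarrow> complex) set \<Rightarrow> (spacetime \<Rightarrow> complex) set" for B where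
 base: "g \<in> B \<Longrightarrow> g \<in> lspan B"
| add: "g \<in> lspan B \<Longrightarrow> h \<in> lspan B \<Longrightarrow> (\<lambda>p. g p + h p) \<in> lspan B"

lemma good_add:
 assumes "good g" "good h"
 shows "good (\<lambda>p. g p + h p)"
proof -
 have "rapid (\<lambda>p. g p + h p)" unfolding rapid_def
 proof
  fix N
  obtain M1 M2 where M: "\<And>p. jap (fst p) ^ N * norm (g p) \<le> M1" "\<And>p. jap (fst p) ^ N * norm (h p) \<le> M2"
   using assms unfolding good_def rapid_def by meson
  have "jap (fst p) ^ N * norm (g p + h p) \<le> M1 + M2" for p
  proof -
   have "jap (fst p) ^ N * norm (g p + h p) \<le> jap (fst p) ^ N * (norm (g p) + norm (h p))"
    using jap_pos[of "fst p"] by (intro mult_left_mono norm_triangle_ineq) auto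
   thus ?thesis using M(1)[of p] M(2)[of p] by (simp add: distrib_left)
  qed
  thus "\<exists>M. \<forall>p. jap (fst p) ^ N * norm (g p + h p) \<le> M" by blast
 qed
 thus ?thesis using assms by (auto simp: good_def periodic_def)
qed

lemma pd_add:
 assumes "g differentiable (at p)" "h differentiable (at p)"
 shows "pd v (\<lambda>p. g p + h p) p = pd v g p + pd v h p"
proof -
 have "((\<lambda>p. g p + h p) has_derivative (\<lambda>x. frechet_derivative g (at p) x + frechet_derivative h (at p) x)) (at p)"
  using assms by (intro has_derivative_add) (simp_all flip: frechet_derivative_works)
 from frechet_derivative_at[OF this] show ?thesis unfolding pd_def by (metis (no_types))
qed

text \<open>A derivative of a product or of a composition is a sum of functions of the same kind; therefore
closedness up to finite sums is the convenient form of \<open>schwartz_class\<close>.\<close>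

lemma lspan_schwartz:
 assumes good: "\<And>g. g \<in> B \<Longrightarrow> good g"
  and closed: "\<And>g v. g \<in> B \<Longrightarrow> v \<in> Basis \<Longrightarrow> pd v g \<in> lspan B"
 shows "lspan B \<subseteq> schwartz"
proof
 fix f assume "f \<in> lspan B"
 moreover have g: "good g" if "g \<in> lspan B" for g
  using that by induction (auto intro: good good_add)
 moreover have "pd v g \<in> lspan B" if "g \<in> lspan B" "v \<in> Basis" for g v
  using that
 proof induction
  case (base g) thus ?case by (rule closed)
 next
  case (add g h)
  have "pd v (\<lambda>p. g p + h p) = (\<lambda>p. pd v g p + pd v h p)"
   using g[OF add.hyps(1)] g[OF add.hyps(2)] by (intro ext pd_add) (auto simp: good_def)
  thus ?case using add by (auto intro: lspan.add)
 qed
 ultimately show "f \<in> schwartz" by (rule schwartz_class)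
qed

lemma pd_mult:
 assumes "g differentiable (at p)" "h differentiable (at p)"
 shows "pd v (\<lambda>p. g p * h p) p = pd v g p * h p + g p * pd v h p"
proof -
 have "((\<lambda>p. g p * h p) has_derivative (\<lambda>x. g p * frechet_derivative h (at p) x + frechet_derivative g (at p) x * h p)) (at p)"
  using assms by (intro has_derivative_mult) (simp_all flip: frechet_derivative_works)
 from frechet_derivative_at[OF this, symmetric] show ?thesis by (simp add: pd_def)
qed

lemma pd_eqI: "(f has_derivative f') (at p) \<Longrightarrow> pd v f p = f' v"
 using frechet_derivative_at[of f f' p] by (simp add: pd_def)

lemma differentiable_has_pd:
 "f differentiable (at p) \<Longrightarrow> (f has_derivative (\<lambda>h. pd h f p)) (at p)"
 by (simp add: pd_def frechet_derivative_works flip: eta_contract_eq)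

lemma rapid_bounded_mult:
 assumes "rapid f" "\<And>p. norm (g p) \<le> C"
 shows "rapid (\<lambda>p. f p * g p)"
 unfolding rapid_def
proof
 fix N
 obtain M where M: "\<And>p. jap (fst p) ^ N * norm (f p) \<le> M" using assms(1) unfolding rapid_def by meson
 have C: "0 \<le> C" using order_trans[OF norm_ge_zero assms(2)[of undefined]] .
 have M0: "0 \<le> M" by (rule order_trans[OF _ M[of undefined]]) (auto intro!: mult_nonneg_nonneg zero_le_power less_imp_le[OF jap_pos])
 have "jap (fst p) ^ N * norm (f p * g p) \<le> M * C" for p
 proof -
  have "jap (fst p) ^ N * norm (f p * g p) = (jap (fst p) ^ N * norm (f p)) * norm (g p)" by (simp add: norm_mult)
  also have "\<dots> \<le> M * C"
   by (intro mult_mono M assms(2) M0) auto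
  finally show ?thesis .
 qed
 thus "\<exists>M. \<forall>p. jap (fst p) ^ N * norm (f p * g p) \<le> M" by blast
qed

lemma rapid_bounded: "rapid f \<Longrightarrow> \<exists>C. \<forall>p. norm (f p) \<le> C"
 unfolding rapid_def by (drule spec[of _ 0]) simp

lemma schwartz_bounded: "f \<in> schwartz \<Longrightarrow> \<exists>C. \<forall>p. norm (f p) \<le> C"
 using schwartz_good rapid_bounded by (auto simp: good_def)

lemma schwartz_mult:
 assumes "f \<in> schwartz" "g \<in> schwartz"
 shows "(\<lambda>p. f p * g p) \<in> schwartz"
proof -
 define B where "B = {\<lambda>p. f p * g p | f g. f \<in> schwartz \<and> g \<in> schwartz}"
 have "lspan B \<subseteq> schwartz"
 proof (rule lspan_schwartz)
  fix h assume "h \<in> B"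
  then obtain f g where fg: "h = (\<lambda>p. f p * g p)" "f \<in> schwartz" "g \<in> schwartz" by (auto simp: B_def)
  have gf: "good f" "good g" using fg schwartz_good by auto
  obtain C where "\<And>p. norm (g p) \<le> C" using schwartz_bounded[OF fg(3)] by blast
  hence "rapid h" using gf unfolding fg(1) good_def by (blast intro: rapid_bounded_mult)
  thus "good h" using gf unfolding fg(1) good_def periodic_def by auto
  fix v :: spacetime assume v: "v \<in> Basis"
  have "pd v h = (\<lambda>p. pd v f p * g p + f p * pd v g p)"
   unfolding fg(1) using gf by (intro ext pd_mult) (auto simp: good_def)
  moreover have "(\<lambda>p. f p * g p) \<in> B" if "f \<in> schwartz" "g \<in> schwartz" for f g
   using that unfolding B_def by blast
  ultimately show "pd v h \<in> lspan B"
   using schwartz_pd[OF fg(2) v] schwartz_pd[OF fg(3) v] fg by (simp add: lspan.add lspan.base)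
 qed
 moreover have "(\<lambda>p. f p * g p) \<in> lspan B" using assms unfolding B_def by (intro lspan.base) blast
 ultimately show ?thesis by blast
qed

lemma schwartz_char:
 assumes f: "f \<in> schwartz"
 shows "(\<lambda>p. c * f p * cis (l * fst p + freq n \<bullet> snd p)) \<in> schwartz"
proof -
 define e where "e = (\<lambda>p::spacetime. cis (l * fst p + freq n \<bullet> snd p))"
 define B where "B = {\<lambda>p. c * f p * e p | c f. f \<in> schwartz}"
 have e_der: "(e has_derivative (\<lambda>h. e p * (\<i> * of_real (l * fst h + freq n \<bullet> snd h)))) (at p)" for p
 proof -
  have "((\<lambda>p. l * fst p + freq n \<bullet> snd p) has_derivative (\<lambda>h. l * fst h + freq n \<bullet> snd h)) (at p)"
   by (auto intro!: derivative_eq_intros)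
  from has_derivative_compose[OF has_derivative_mult_right[OF has_derivative_of_real[OF this], of \<i>] DERIV_exp[unfolded has_field_derivative_def]]
  have "((\<lambda>p. exp (\<i> * of_real (l * fst p + freq n \<bullet> snd p))) has_derivative
    (\<lambda>h. exp (\<i> * of_real (l * fst p + freq n \<bullet> snd p)) * (\<i> * of_real (l * fst h + freq n \<bullet> snd h)))) (at p)" .
  thus ?thesis by (simp add: e_def cis_conv_exp)
 qed
 have e_norm: "norm (e p) = 1" for p by (simp add: e_def)
 have e_per: "periodic e"
 proof -
  have *: "cis (a + 2 * pi * of_int k) = cis a" for a k
   by (simp add: cis_mult[symmetric] cis_multiple_2pi)
  have "e (t, x + 2*pi, y) = e (t, x, y)" for t x y
   using *[of "l * t + (fst n * x + snd n * y)" "fst n"] by (simp add: e_def freq_def algebra_simps)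
  moreover have "e (t, x, y + 2*pi) = e (t, x, y)" for t x y
   using *[of "l * t + (fst n * x + snd n * y)" "snd n"] by (simp add: e_def freq_def algebra_simps)
  ultimately show ?thesis by (simp add: periodic_def)
 qed
 have "lspan B \<subseteq> schwartz"
 proof (rule lspan_schwartz)
  fix h assume "h \<in> B"
  then obtain c f where fg: "h = (\<lambda>p. c * f p * e p)" "f \<in> schwartz" by (auto simp: B_def)
  have gf: "good f" using fg schwartz_good by auto
  have "rapid (\<lambda>p. f p * (c * e p))"
   by (rule rapid_bounded_mult[where C="norm c"]) (use gf in \<open>auto simp: good_def norm_mult e_norm\<close>)
  hence "rapid h" unfolding fg(1) by (simp add: mult_ac)
  moreover have ed: "e differentiable (at p)" for p using e_der[of p] unfolding differentiable_def by blast
  ultimately show "good h" using gf e_per unfolding fg(1) good_def periodic_def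
   by (auto intro!: differentiable_mult differentiable_const)
  fix v :: spacetime assume v: "v \<in> Basis"
  let ?k = "\<i> * of_real (l * fst v + freq n \<bullet> snd v)"
  have "pd v h = (\<lambda>p. c * pd v f p * e p + (c * ?k) * f p * e p)"
  proof
   fix p
   have fd: "(f has_derivative (\<lambda>h. pd h f p)) (at p)"
    using gf by (intro differentiable_has_pd) (simp add: good_def)
   have "((\<lambda>p. (c * f p) * e p) has_derivative (\<lambda>h. (c * f p) * (e p * (\<i> * of_real (l * fst h + freq n \<bullet> snd h))) + (c * pd h f p) * e p)) (at p)"
    by (rule has_derivative_mult[OF has_derivative_mult_right[OF fd] e_der])
   from pd_eqI[OF this, of v] show "pd v h p = c * pd v f p * e p + (c * ?k) * f p * e p"
    unfolding fg(1) by (simp add: algebra_simps)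
  qed
  moreover have "(\<lambda>p. c * f p * e p) \<in> B" if "f \<in> schwartz" for c f
   using that unfolding B_def by blast
  ultimately show "pd v h \<in> lspan B"
   using schwartz_pd[OF fg(2) v] fg by (simp add: lspan.add lspan.base)
 qed
 moreover have "(\<lambda>p. c * f p * e p) \<in> lspan B" using assms unfolding B_def by (intro lspan.base) blast
 ultimately show ?thesis by (auto simp: e_def)
qed

lemma schwartz_cmult: "f \<in> schwartz \<Longrightarrow> (\<lambda>p. c * f p) \<in> schwartz"
 using schwartz_char[of f c 0 0] by (simp add: freq_def zero_prod_def[symmetric])

lemma schwartz_add:
 assumes "f \<in> schwartz" "g \<in> schwartz"
 shows "(\<lambda>p. f p + g p) \<in> schwartz"
proof -
 have "lspan schwartz \<subseteq> schwartz"
  by (rule lspan_schwartz) (auto intro: schwartz_good lspan.base schwartz_pd)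
 moreover have "(\<lambda>p. f p + g p) \<in> lspan schwartz" using assms by (intro lspan.intros)
 ultimately show ?thesis by blast
qed

lemma schwartz_diff:
 assumes "f \<in> schwartz" "g \<in> schwartz"
 shows "(\<lambda>p. f p - g p) \<in> schwartz"
 using schwartz_add[OF assms(1) schwartz_cmult[OF assms(2), of "-1"]] by simp

lemma jap_affine:
 fixes a b :: real
 assumes "a \<noteq> 0"
 shows "\<exists>K>0. \<forall>t. jap t \<le> K * jap (a * t + b)"
proof -
 have "jap t \<le> (1 + (1 + \<bar>b\<bar>) / \<bar>a\<bar>) * jap (a * t + b)" for t
 proof -
  let ?s = "a * t + b"
  have "t = (?s - b) / a" using assms by simp
  hence "\<bar>t\<bar> = \<bar>?s - b\<bar> / \<bar>a\<bar>" by (metis abs_divide)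
  also have "\<dots> \<le> (\<bar>?s\<bar> + \<bar>b\<bar>) / \<bar>a\<bar>" by (intro divide_right_mono) auto
  also have "\<dots> \<le> (jap ?s + \<bar>b\<bar> * jap ?s) / \<bar>a\<bar>"
   using norm_le_jap[of ?s] jap_ge_1[of ?s] mult_left_mono[of 1 "jap ?s" "\<bar>b\<bar>"] by (intro divide_right_mono) auto
  finally have "\<bar>t\<bar> \<le> (1 + \<bar>b\<bar>) / \<bar>a\<bar> * jap ?s" by (simp add: algebra_simps)
  moreover have "jap t \<le> 1 + \<bar>t\<bar>" using jap_le_1_plus[of t] by simp
  moreover have "1 \<le> jap ?s" by (rule jap_ge_1)
  ultimately show ?thesis by (simp add: distrib_right)
 qed
 moreover have "0 < 1 + (1 + \<bar>b\<bar>) / \<bar>a\<bar>" by (auto intro!: add_pos_nonneg divide_nonneg_nonneg)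
 ultimately show ?thesis by blast
qed

lemma schwartz_affine:
 fixes a b :: real
 assumes f: "f \<in> schwartz" and a: "a \<noteq> 0"
 shows "(\<lambda>p. f (a * fst p + b, snd p)) \<in> schwartz"
proof -
 define A where "A = (\<lambda>p::spacetime. (a * fst p + b, snd p))"
 define B where "B = {\<lambda>p. c * f (A p) | c f. f \<in> schwartz}"
 have A_der: "(A has_derivative (\<lambda>h. (a * fst h, snd h))) (at p)" for p
  unfolding A_def by (auto intro!: derivative_eq_intros)
 obtain K where K: "K > 0" "\<And>t. jap t \<le> K * jap (a * t + b)" using jap_affine[OF a] by blast
 have "lspan B \<subseteq> schwartz"
 proof (rule lspan_schwartz)
  fix h assume "h \<in> B"
  then obtain c f where fg: "h = (\<lambda>p. c * f (A p))" "f \<in> schwartz" by (auto simp: B_def)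
  have gf: "good f" using fg schwartz_good by auto
  have fd: "(f has_derivative (\<lambda>h. pd h f p)) (at p)" for p
   using gf by (intro differentiable_has_pd) (simp add: good_def)
  have hd: "(h has_derivative (\<lambda>k. c * pd (a * fst k, snd k) f (A p))) (at p)" for p
   unfolding fg(1) using has_derivative_mult_right[OF diff_chain_at[OF A_der fd], of c p] by (simp add: o_def)
  have "rapid h" unfolding rapid_def
  proof
   fix N
   obtain M where M: "\<And>p. jap (fst p) ^ N * norm (f p) \<le> M" using gf unfolding good_def rapid_def by meson
   have "jap (fst p) ^ N * norm (h p) \<le> K ^ N * norm c * M" for p
   proof -
    have "jap (fst p) ^ N \<le> (K * jap (fst (A p))) ^ N"
     using K(2)[of "fst p"] jap_pos[of "fst p"] by (intro power_mono) (auto simp: A_def)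
    hence "jap (fst p) ^ N * norm (h p) \<le> (K * jap (fst (A p))) ^ N * (norm c * norm (f (A p)))"
     unfolding fg(1) norm_mult by (intro mult_right_mono) auto
    also have "\<dots> = K ^ N * norm c * (jap (fst (A p)) ^ N * norm (f (A p)))" by (simp add: power_mult_distrib)
    also have "\<dots> \<le> K ^ N * norm c * M" using K by (intro mult_left_mono M) auto
    finally show ?thesis .
   qed
   thus "\<exists>M. \<forall>p. jap (fst p) ^ N * norm (h p) \<le> M" by blast
  qed
  moreover have "periodic h" using gf unfolding fg(1) good_def periodic_def A_def by simp
  ultimately show "good h" using hd by (auto simp: good_def differentiable_def)
  fix v :: spacetime assume v: "v \<in> Basis"
  have "v = (1, 0, 0) \<or> fst v = 0" using v by (auto simp: Basis_prod_def zero_prod_def)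
  then obtain k :: complex where k: "\<And>p. pd (a * fst v, snd v) f p = k * pd v f p"
  proof
   assume v1: "v = (1, 0, 0)"
   have "pd (a * fst v, snd v) f p = of_real a * pd v f p" for p
   proof -
    have "(a * fst v, snd v) = a *\<^sub>R v" using v1 by simp
    moreover have "linear (\<lambda>h. pd h f p)" using fd has_derivative_linear by blast
    ultimately show ?thesis
     using linear_scale[of "\<lambda>h. pd h f p" a v] by (simp add: scaleR_conv_of_real)
   qed
   thus ?thesis by (rule that[of "of_real a"])
  next
   assume v0: "fst v = 0"
   hence "(a * fst v, snd v) = v" by (simp add: prod_eq_iff)
   thus ?thesis using that[of 1] by simp
  qed
  have "pd v h = (\<lambda>p. (c * k) * pd v f (A p))"
  proof
   fix p show "pd v h p = (c * k) * pd v f (A p)" using pd_eqI[OF hd[of p], of v] by (simp add: k)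
  qed
  moreover have "(\<lambda>p. c * f (A p)) \<in> B" if "f \<in> schwartz" for c f
   using that unfolding B_def by blast
  ultimately show "pd v h \<in> lspan B"
   using schwartz_pd[OF fg(2) v] by (simp add: lspan.base)
 qed
 moreover have "(\<lambda>p. 1 * f (A p)) \<in> lspan B" using assms unfolding B_def by (intro lspan.base) blast
 ultimately show ?thesis by (auto simp: A_def)
qed

section \<open>A smooth cutoff\<close>

text \<open>The smooth function \<open>e^(-1/x)\<close> together with the factors \<open>x^(-k)\<close> that its derivatives produce.\<close>

definition flat :: "nat \<Rightarrow> real \<Rightarrow> real" where
 "flat k x = (if x > 0 then exp (- 1 / x) / x ^ k else 0)"

lemma flat_tendsto_0: "((\<lambda>x. flat k x) \<longlongrightarrow> 0) (at_right 0)"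
proof -
 have "((\<lambda>y::real. y ^ k / exp y) \<longlongrightarrow> 0) at_top" by (rule tendsto_power_div_exp_0)
 hence "((\<lambda>x::real. (inverse x) ^ k / exp (inverse x)) \<longlongrightarrow> 0) (at_right 0)"
  by (rule filterlim_compose[OF _ filterlim_inverse_at_top_right])
 moreover have "eventually (\<lambda>x::real. (inverse x) ^ k / exp (inverse x) = flat k x) (at_right 0)"
  by (rule eventually_at_right_less[THEN eventually_mono])
    (auto simp: flat_def exp_minus field_simps power_inverse)
 ultimately show ?thesis by (rule Lim_transform_eventually)
qed

lemma flat_deriv: "(flat k has_real_derivative flat (k + 2) x - real k * flat (k + 1) x) (at x)"
proof -
 consider "x < 0" | "x > 0" | "x = 0" by linarith
 thus ?thesis
 proof cases
  case 1
  have "((\<lambda>_. 0) has_real_derivative 0) (at x)" by simp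
  hence "(flat k has_real_derivative 0) (at x)"
   by (rule DERIV_cong_ev[THEN iffD1, OF refl _ refl, rotated])
     (use 1 eventually_nhds_in_open[of "{..<0::real}" x] in \<open>auto simp: flat_def elim!: eventually_mono\<close>)
  thus ?thesis using 1 by (simp add: flat_def)
 next
  case 2
  have d1: "((\<lambda>x. exp (- 1 / x)) has_real_derivative exp (- 1 / x) * inverse x ^ 2) (at x)"
   using 2 by (auto intro!: derivative_eq_intros simp: field_simps power2_eq_square)
  have d2: "((\<lambda>x. inverse x ^ k) has_real_derivative - real k * inverse x ^ (k + 1)) (at x)"
  proof (cases k)
   case (Suc m)
   have "((\<lambda>x. inverse x ^ Suc m) has_real_derivative (1 + real m) * (- (inverse x ^ Suc (Suc 0)) * inverse x ^ m)) (at x)"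
    using 2 by (intro DERIV_power_Suc DERIV_inverse) auto
   thus ?thesis by (simp add: Suc algebra_simps)
  qed simp
  have "((\<lambda>x. exp (- 1 / x) * inverse x ^ k) has_real_derivative
    exp (- 1 / x) * inverse x ^ 2 * inverse x ^ k + (- real k * inverse x ^ (k + 1)) * exp (- 1 / x)) (at x)"
   by (rule DERIV_mult[OF d1 d2])
  also have "exp (- 1 / x) * inverse x ^ 2 * inverse x ^ k + (- real k * inverse x ^ (k + 1)) * exp (- 1 / x)
    = flat (k + 2) x - real k * flat (k + 1) x"
   using 2 by (simp add: flat_def divide_inverse power_inverse power2_eq_square)
  finally have "((\<lambda>x. exp (- 1 / x) / x ^ k) has_real_derivative flat (k + 2) x - real k * flat (k + 1) x) (at x)"
   by (simp add: divide_inverse power_inverse)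
  moreover have "eventually (\<lambda>y. exp (- 1 / y) / y ^ k = flat k y) (nhds x)"
   using 2 eventually_nhds_in_open[of "{0<..}" x] by (auto simp: flat_def elim!: eventually_mono)
  ultimately show ?thesis by (rule DERIV_cong_ev[THEN iffD1, OF refl _ refl, rotated])
 next
  case 3
  have "((\<lambda>h. flat k h / h) \<longlongrightarrow> 0) (at 0)"
  proof (rule filterlim_split_at)
   have "eventually (\<lambda>h. 0 = flat k h / h) (at_left (0::real))"
    by (auto simp: eventually_at_filter flat_def)
   thus "((\<lambda>h. flat k h / h) \<longlongrightarrow> 0) (at_left 0)" by (rule Lim_transform_eventually[OF tendsto_const])
   have "eventually (\<lambda>h. flat (k + 1) h = flat k h / h) (at_right (0::real))"
    by (rule eventually_at_right_less[THEN eventually_mono]) (auto simp: flat_def)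
   with flat_tendsto_0[of "k + 1"] show "((\<lambda>h. flat k h / h) \<longlongrightarrow> 0) (at_right 0)" by (rule Lim_transform_eventually)
  qed
  thus ?thesis using 3 by (simp add: DERIV_def flat_def)
 qed
qed

inductive_set bumps :: "(real \<Rightarrow> real) set" where
 prod: "(\<lambda>x. flat j x * flat k (1 - x)) \<in> bumps"
| cmult: "g \<in> bumps \<Longrightarrow> (\<lambda>x. c * g x) \<in> bumps"
| add: "g \<in> bumps \<Longrightarrow> h \<in> bumps \<Longrightarrow> (\<lambda>x. g x + h x) \<in> bumps"

text \<open>Differentiation of \<open>flat\<close> only produces further functions \<open>flat\<close>, so smoothness of the bump needs no
calculus beyond \<open>flat_deriv\<close>.\<close>

lemma bumps_deriv:
 assumes "g \<in> bumps"
 shows "\<exists>g'\<in>bumps. \<forall>x. (g has_real_derivative g' x) (at x)"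
 using assms
proof induction
 case (prod j k)
 let ?g' = "\<lambda>x. (flat (j + 2) x * flat k (1 - x) + (- real j) * (flat (j + 1) x * flat k (1 - x)))
   + ((- 1) * (flat j x * flat (k + 2) (1 - x)) + real k * (flat j x * flat (k + 1) (1 - x)))"
 have "((\<lambda>x. flat k (1 - x)) has_real_derivative - (flat (k + 2) (1 - x) - real k * flat (k + 1) (1 - x))) (at x)" for x
 proof -
  have "((\<lambda>x. 1 - x) has_real_derivative -1) (at x)" by (auto intro!: derivative_eq_intros)
  from DERIV_chain2[where f="flat k" and g="\<lambda>x. 1 - x", OF flat_deriv this] show ?thesis by simp
 qed
 hence "((\<lambda>x. flat j x * flat k (1 - x)) has_real_derivative ?g' x) (at x)" for x
  by (auto intro!: derivative_eq_intros flat_deriv simp: algebra_simps)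
 moreover have "?g' \<in> bumps" by (intro bumps.intros)
 ultimately show ?case by (intro bexI[where x="?g'"] allI)
next
 case (cmult g c)
 then obtain g' where "g' \<in> bumps" "\<forall>x. (g has_real_derivative g' x) (at x)" by blast
 thus ?case by (intro bexI[of _ "\<lambda>x. c * g' x"]) (auto intro!: bumps.intros derivative_eq_intros)
next
 case (add g h)
 then obtain g' h' where "g' \<in> bumps" "\<forall>x. (g has_real_derivative g' x) (at x)" "h' \<in> bumps" "\<forall>x. (h has_real_derivative h' x) (at x)" by blast
 thus ?case by (intro bexI[of _ "\<lambda>x. g' x + h' x"]) (auto intro!: bumps.intros derivative_eq_intros)
qed

lemma bumps_support: "g \<in> bumps \<Longrightarrow> x \<notin> {0<..<1} \<Longrightarrow> g x = 0"
 by (induction rule: bumps.induct) (auto simp: flat_def not_less)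

lemma bumps_continuous: "g \<in> bumps \<Longrightarrow> continuous_on A g"
 using bumps_deriv[of g] by (auto intro!: continuous_at_imp_continuous_on DERIV_isCont)

definition bump_int :: "real \<Rightarrow> real" where
 "bump_int x = integral {-3..x} (\<lambda>s. flat 0 s * flat 0 (1 - s))"

lemma bump_in: "(\<lambda>s. flat 0 s * flat 0 (1 - s)) \<in> bumps" by (rule bumps.prod)

lemma bump_int_deriv:
 assumes "x > -3"
 shows "(bump_int has_real_derivative flat 0 x * flat 0 (1 - x)) (at x)"
proof -
 have "((\<lambda>u. integral {-3..u} (\<lambda>s. flat 0 s * flat 0 (1 - s))) has_real_derivative flat 0 x * flat 0 (1 - x)) (at x within {-3..x + 1})"
  using assms by (intro integral_has_real_derivative bumps_continuous[OF bump_in]) auto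
 moreover have "at x within {-3..x + 1} = at x" using assms by (intro at_within_Icc_at) auto
 ultimately show ?thesis by (simp add: bump_int_def[abs_def])
qed

lemma bump_int_0: "x \<le> 0 \<Longrightarrow> bump_int x = 0"
 unfolding bump_int_def
 by (subst integral_cong[where g="\<lambda>_. 0"], rule bumps_support[OF bump_in], auto)

lemma bump_int_const: "1 \<le> x \<Longrightarrow> bump_int x = bump_int 1"
proof -
 assume "1 \<le> x"
 have "integral {-3..1} (\<lambda>s. flat 0 s * flat 0 (1 - s)) + integral {1..x} (\<lambda>s. flat 0 s * flat 0 (1 - s)) = bump_int x"
  unfolding bump_int_def using \<open>1 \<le> x\<close>
  by (intro Henstock_Kurzweil_Integration.integral_combine integrable_continuous_real bumps_continuous[OF bump_in]) auto
 moreover have "integral {1..x} (\<lambda>s. flat 0 s * flat 0 (1 - s)) = 0"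
  by (subst integral_cong[where g="\<lambda>_. 0"], rule bumps_support[OF bump_in], auto)
 ultimately show ?thesis by (simp add: bump_int_def)
qed

lemma bump_int_1_pos: "bump_int 1 > 0"
proof -
 have nn: "0 \<le> flat 0 s * flat 0 (1 - s)" for s by (simp add: flat_def)
 have "bump_int 1 \<ge> 0" unfolding bump_int_def using nn
  by (intro integral_nonneg integrable_continuous_real bumps_continuous[OF bump_in]) auto
 moreover have "bump_int 1 \<noteq> 0"
 proof
  assume "bump_int 1 = 0"
  hence "flat 0 s * flat 0 (1 - s) = 0" if "s \<in> {-3..1}" for s
   using integral_eq_0_iff[of "-3" 1 "\<lambda>s. flat 0 s * flat 0 (1 - s)"] bumps_continuous[OF bump_in] nn that
   unfolding bump_int_def by auto
  from this[of "1/2"] show False by (simp add: flat_def)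
 qed
 ultimately show ?thesis by simp
qed

text \<open>A difference of translated integrals of a bump: equal to \<open>1\<close> on \<open>[0,1]\<close>, and \<open>0\<close> outside \<open>[-1,2]\<close>.\<close>

definition plateau :: "real \<Rightarrow> real" where
 "plateau t = (if -2 \<le> t \<and> t \<le> 3 then (bump_int (t + 1) - bump_int (t - 1)) / bump_int 1 else 0)"

lemma plateau_1: "0 \<le> t \<Longrightarrow> t \<le> 1 \<Longrightarrow> plateau t = 1"
 using bump_int_const[of "t + 1"] bump_int_0[of "t - 1"] bump_int_1_pos by (simp add: plateau_def)

lemma plateau_0: "t \<le> -1 \<or> t \<ge> 2 \<Longrightarrow> plateau t = 0"
 using bump_int_const[of "t + 1"] bump_int_const[of "t - 1"] bump_int_0[of "t - 1"] bump_int_0[of "t + 1"]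
 by (auto simp: plateau_def)

definition plateau' :: "real \<Rightarrow> real" where
 "plateau' t = (flat 0 (t + 1) * flat 0 (1 - (t + 1)) - flat 0 (t - 1) * flat 0 (1 - (t - 1))) / bump_int 1"

lemma plateau_deriv: "(plateau has_real_derivative plateau' t) (at t)"
proof -
 consider "t < -1" | "t > 2" | "-2 < t \<and> t < 3" by linarith
 thus ?thesis
 proof cases
  case 1
  have "((\<lambda>_. 0) has_real_derivative 0) (at t)" by simp
  hence "(plateau has_real_derivative 0) (at t)"
   by (rule DERIV_cong_ev[THEN iffD1, OF refl _ refl, rotated])
     (use 1 eventually_nhds_in_open[of "{..<-1::real}" t] in \<open>auto simp: plateau_0 elim!: eventually_mono\<close>)
  thus ?thesis using 1 by (simp add: plateau'_def flat_def)
 next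
  case 2
  have "((\<lambda>_. 0) has_real_derivative 0) (at t)" by simp
  hence "(plateau has_real_derivative 0) (at t)"
   by (rule DERIV_cong_ev[THEN iffD1, OF refl _ refl, rotated])
     (use 2 eventually_nhds_in_open[of "{2<..}" t] in \<open>auto simp: plateau_0 elim!: eventually_mono\<close>)
  thus ?thesis using 2 by (simp add: plateau'_def flat_def)
 next
  case 3
  have d1: "((\<lambda>t. bump_int (t + 1)) has_real_derivative flat 0 (t + 1) * flat 0 (1 - (t + 1))) (at t)"
  proof -
   have "((\<lambda>t. t + 1) has_real_derivative 1) (at t)" by (auto intro!: derivative_eq_intros)
   from DERIV_chain2[where f=bump_int and g="\<lambda>t. t + 1", OF bump_int_deriv this] show ?thesis using 3 by simp
  qed
  have d2: "((\<lambda>t. bump_int (t - 1)) has_real_derivative flat 0 (t - 1) * flat 0 (1 - (t - 1))) (at t)"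
  proof -
   have "((\<lambda>t. t - 1) has_real_derivative 1) (at t)" by (auto intro!: derivative_eq_intros)
   from DERIV_chain2[where f=bump_int and g="\<lambda>t. t - 1", OF bump_int_deriv this] show ?thesis using 3 by simp
  qed
  have "((\<lambda>t. (bump_int (t + 1) - bump_int (t - 1)) / bump_int 1) has_real_derivative plateau' t) (at t)"
   unfolding plateau'_def by (intro DERIV_cdivide DERIV_diff d1 d2)
  thus ?thesis
   by (rule DERIV_cong_ev[THEN iffD1, OF refl _ refl, rotated])
     (use 3 eventually_nhds_in_open[of "{-2<..<3}" t] in \<open>auto simp: plateau_def elim!: eventually_mono\<close>)
 qed
qed

definition cutoff :: "spacetime \<Rightarrow> complex" where
 "cutoff p = of_real (plateau (fst p))"

text \<open>All derivatives of the plateau are differences of translates of members of \<open>bumps\<close>, supported in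
\<open>[-1,2]\<close>.\<close>

lemma cutoff_schwartz: "cutoff \<in> schwartz"
proof -
 define L where "L = (\<lambda>(h::real \<Rightarrow> real) (p::spacetime). complex_of_real (h (fst p)))"
 define A where "A = {h :: real \<Rightarrow> real. \<exists>g\<in>bumps. \<exists>c. h = (\<lambda>t. g (t + c)) \<and> \<bar>c\<bar> \<le> 1} \<union> {\<lambda>_. 0}"
 define B where "B = insert cutoff (L ` A)"
 have supp: "h t = 0" if "h \<in> insert plateau A" "t \<notin> {-1..2}" for h t
 proof -
  from that(1) consider "h = plateau" | "h = (\<lambda>_. 0)" | g c where "g \<in> bumps" "h = (\<lambda>t. g (t + c))" "\<bar>c\<bar> \<le> 1"
   unfolding A_def by blast
  thus ?thesis
  proof cases
   case 1
   have "t \<le> -1 \<or> t \<ge> 2" using that(2) by auto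
   thus ?thesis using 1 by (simp add: plateau_0)
  next
   case 3
   have "t + c \<notin> {0<..<1}" using that(2) 3(3) by (auto simp: abs_le_iff)
   thus ?thesis using bumps_support[OF 3(1)] 3(2) by simp
  qed simp
 qed
 have mem: "(\<lambda>t. g (t + c)) \<in> A" if "g \<in> bumps" "\<bar>c\<bar> \<le> 1" for g c
  using that unfolding A_def by blast
 have der: "\<exists>h1\<in>A. \<exists>h2\<in>A. \<forall>t. (h has_real_derivative h1 t + h2 t) (at t)" if "h \<in> insert plateau A" for h
 proof (cases "h = plateau")
  case True
  let ?g = "\<lambda>s. flat 0 s * flat 0 (1 - s)"
  have b1: "(\<lambda>s. (1 / bump_int 1) * ?g s) \<in> bumps" and b2: "(\<lambda>s. (- 1 / bump_int 1) * ?g s) \<in> bumps"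
   by (intro bumps.cmult bump_in)+
  have m1: "(\<lambda>t. (1 / bump_int 1) * ?g (t + 1)) \<in> A" and m2: "(\<lambda>t. (- 1 / bump_int 1) * ?g (t + (- 1))) \<in> A"
   using mem[OF b1, of 1] mem[OF b2, of "-1"] by simp_all
  have "plateau' t = (1 / bump_int 1) * ?g (t + 1) + (- 1 / bump_int 1) * ?g (t + (- 1))" for t
   by (simp add: plateau'_def diff_divide_distrib)
  hence "\<forall>t. (h has_real_derivative (1 / bump_int 1) * ?g (t + 1) + (- 1 / bump_int 1) * ?g (t + (- 1))) (at t)"
   using plateau_deriv unfolding True by simp
  thus ?thesis using m1 m2 by (intro bexI)
 next
  case False
  have z: "(\<lambda>_. 0) \<in> A" by (simp add: A_def)
  from False that consider "h = (\<lambda>_. 0)" | g c where "g \<in> bumps" "h = (\<lambda>t. g (t + c))" "\<bar>c\<bar> \<le> 1"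
   using that unfolding A_def by blast
  thus ?thesis
  proof cases
   case 1 thus ?thesis using z by (intro bexI[of _ "\<lambda>_. 0"]) auto
  next
   case 2
   obtain g' where g': "g' \<in> bumps" "\<And>x. (g has_real_derivative g' x) (at x)" using bumps_deriv[OF 2(1)] by blast
   have "(h has_real_derivative g' (t + c) + 0) (at t)" for t
    unfolding 2(2) 
   proof -
    have "((\<lambda>t. t + c) has_real_derivative 1) (at t)" by (auto intro!: derivative_eq_intros)
    from DERIV_chain2[where f=g and g="\<lambda>t. t + c", OF g'(2) this] show "((\<lambda>t. g (t + c)) has_real_derivative g' (t + c) + 0) (at t)" by simp
   qed
   moreover have "(\<lambda>t. g' (t + c)) \<in> A" using g'(1) 2(3) by (rule mem)
   ultimately show ?thesis using z by (intro bexI[where x="\<lambda>_. 0"] bexI[where x="\<lambda>t. g' (t + c)"] allI)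
  qed
 qed
 have B_eq: "B = L ` insert plateau A" by (auto simp: B_def L_def cutoff_def fun_eq_iff)
 have "lspan B \<subseteq> schwartz"
 proof (rule lspan_schwartz)
  fix f assume "f \<in> B"
  then obtain h where h: "f = L h" "h \<in> insert plateau A" by (auto simp: B_eq)
  obtain h1 h2 where h12: "h1 \<in> A" "h2 \<in> A" "\<And>t. (h has_real_derivative h1 t + h2 t) (at t)" using der[OF h(2)] by blast
  have fd: "(f has_derivative (\<lambda>k. of_real ((h1 (fst p) + h2 (fst p)) * fst k))) (at p)" for p
  proof -
   have "(h has_derivative (\<lambda>k. (h1 (fst p) + h2 (fst p)) * k)) (at (fst p))"
    using h12(3)[of "fst p"] by (simp add: has_field_derivative_def)
   hence "((\<lambda>p. h (fst p)) has_derivative (\<lambda>k. (h1 (fst p) + h2 (fst p)) * fst k)) (at p)"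
    using diff_chain_at[OF has_derivative_fst[OF has_derivative_ident], of h _ p] by (simp add: o_def)
   thus ?thesis unfolding h(1) L_def by (rule has_derivative_of_real)
  qed
  have cont: "continuous_on {-1..2} (\<lambda>t. jap t ^ N * \<bar>h t\<bar>)" for N
  proof -
   have "continuous_on {-1..2} h" using h12(3) by (auto intro!: continuous_at_imp_continuous_on DERIV_isCont)
   thus ?thesis unfolding jap_real by (intro continuous_intros)
  qed
  have "rapid f" unfolding rapid_def
  proof
   fix N
   have "bounded ((\<lambda>t. jap t ^ N * \<bar>h t\<bar>) ` {-1..2})"
    by (intro compact_imp_bounded compact_continuous_image cont compact_Icc)
   then obtain M where M0: "\<forall>y\<in>(\<lambda>t. jap t ^ N * \<bar>h t\<bar>) ` {-1..2}. norm y \<le> M"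
    unfolding bounded_iff by blast
   have M: "jap t ^ N * \<bar>h t\<bar> \<le> M" if "t \<in> {-1..2}" for t
    using M0[rule_format, OF imageI[OF that]] by simp
   have "jap (fst p) ^ N * norm (f p) \<le> max M 0" for p
    using M[of "fst p"] supp[OF h(2), of "fst p"] by (cases "fst p \<in> {-1..2}") (auto simp: h(1) L_def)
   thus "\<exists>M. \<forall>p. jap (fst p) ^ N * norm (f p) \<le> M" by blast
  qed
  moreover have "periodic f" by (simp add: periodic_def h(1) L_def)
  ultimately show "good f" using fd by (auto simp: good_def differentiable_def)
  fix v :: spacetime assume v: "v \<in> Basis"
  have "fst v = 1 \<or> fst v = 0" using v by (auto simp: Basis_prod_def)
  moreover have "pd v f = (\<lambda>p. of_real ((h1 (fst p) + h2 (fst p)) * fst v))" by (rule ext, rule pd_eqI[OF fd])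
  ultimately have "pd v f = (\<lambda>p. L h1 p + L h2 p) \<or> pd v f = L (\<lambda>_. 0)" by (auto simp: L_def)
  moreover have LB: "L h \<in> lspan B" if "h \<in> A" for h using that by (intro lspan.base) (simp add: B_eq)
  have "(\<lambda>p. L h1 p + L h2 p) \<in> lspan B" by (rule lspan.add) (rule LB, rule h12)+
  moreover have "L (\<lambda>_. 0) \<in> lspan B" by (rule LB) (simp add: A_def)
  ultimately show "pd v f \<in> lspan B" by metis
 qed
 thus ?thesis by (auto simp: B_def intro: lspan.base)
qed

section \<open>Integration over \<open>\<real> \<times> \<T>\<^sup>2\<close>\<close>

text \<open>Lebesgue measure on \<open>\<real> \<times> [0,2\<pi>]\<^sup>2\<close>, the fundamental domain of \<open>\<real> \<times> \<T>\<^sup>2\<close>.\<close>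

definition stm :: "spacetime measure" where
 "stm = restrict_space lborel (UNIV \<times> torus_cell)"

lemma torus_cell_closed: "closed torus_cell" and strip_closed: "closed (UNIV \<times> torus_cell :: spacetime set)"
 unfolding torus_cell_def by (intro closed_Times closed_real_atLeastAtMost closed_UNIV)+

lemma torus_cell_borel[measurable]: "torus_cell \<in> sets borel"
 using torus_cell_closed by (rule borel_closed)

lemma strip_borel[measurable]: "(UNIV \<times> torus_cell :: spacetime set) \<in> sets borel"
 using strip_closed by (rule borel_closed)

lemma space_stm: "space stm = UNIV \<times> torus_cell"
 by (simp add: stm_def space_restrict_space)

lemma sigma_finite_stm: "sigma_finite_measure stm"
 unfolding stm_def by (rule sigma_finite_measure_restrict_space) (auto intro: sigma_finite_lborel)

interpretation stm: sigma_finite_measure stm by (rule sigma_finite_stm)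
interpretation freq_stm: pair_sigma_finite freq_measure stm ..

lemma measurable_stm: "f \<in> measurable borel N \<Longrightarrow> f \<in> measurable stm N"
 unfolding stm_def by (intro measurable_restrict_space1) simp

lemma measurable_stm_ident[measurable]: "(\<lambda>p. p) \<in> measurable stm borel"
 by (rule measurable_stm) simp

lemma spacetime_fst_borel[measurable]: "fst \<in> borel_measurable (borel :: spacetime measure)"
 by (intro borel_measurable_continuous_onI continuous_intros)

lemma space_coords_borel[measurable]:
 "(\<lambda>p::spacetime. fst (snd p)) \<in> borel_measurable borel" "(\<lambda>p::spacetime. snd (snd p)) \<in> borel_measurable borel"
 "(\<lambda>p. fst (snd p)) \<in> borel_measurable stm" "(\<lambda>p. snd (snd p)) \<in> borel_measurable stm"
 by (intro measurable_stm borel_measurable_continuous_onI continuous_intros)+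

abbreviation smeas :: "(spacetime \<Rightarrow> 'b::topological_space) \<Rightarrow> bool" where
 "smeas f \<equiv> f \<in> borel_measurable stm"

lemma measurable_stm_fst[measurable]: "smeas fst"
 by (rule measurable_stm) (intro borel_measurable_continuous_onI continuous_intros)

lemma measurable_stm_snd[measurable]: "smeas snd"
 by (rule measurable_stm) (intro borel_measurable_continuous_onI continuous_intros)

lemma lint_stm: "(LINT p:UNIV \<times> torus_cell|lborel. f p) = integral\<^sup>L stm (f :: spacetime \<Rightarrow> complex)"
 unfolding stm_def set_lebesgue_integral_def by (subst integral_restrict_space) auto

lemma nn_integral_stm:
 assumes [measurable]: "f \<in> borel_measurable borel"
 shows "(\<integral>\<^sup>+ p. f p \<partial>stm) = (\<integral>\<^sup>+ t. (\<integral>\<^sup>+ z. f (t, z) * indicator torus_cell z \<partial>lborel) \<partial>lborel)"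
proof -
 have "(\<integral>\<^sup>+ p. f p \<partial>stm) = (\<integral>\<^sup>+ p. f p * indicator (UNIV \<times> torus_cell) p \<partial>lborel)"
  unfolding stm_def by (rule nn_integral_restrict_space) simp
 also have "\<dots> = (\<integral>\<^sup>+ p. f p * indicator (UNIV \<times> torus_cell) p \<partial>(lborel \<Otimes>\<^sub>M lborel))"
  by (simp add: lborel_prod)
 also have "\<dots> = (\<integral>\<^sup>+ t. (\<integral>\<^sup>+ z. f (t, z) * indicator (UNIV \<times> torus_cell) (t, z) \<partial>lborel) \<partial>lborel)"
  by (rule lborel.nn_integral_fst[symmetric]) (simp add: lborel_prod)
 finally show ?thesis by (simp add: indicator_def)
qed

lemma emeasure_torus_cell: "emeasure lborel torus_cell = ennreal ((2*pi)\<^sup>2)"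
proof -
 have "emeasure lborel torus_cell = emeasure (lborel \<Otimes>\<^sub>M lborel) ({0..2*pi} \<times> {0..2*pi} :: (real \<times> real) set)"
  by (simp add: lborel_prod torus_cell_def)
 also have "\<dots> = emeasure lborel {0..2*pi} * emeasure lborel {0..2*pi}"
  by (rule lborel.emeasure_pair_measure_Times) auto
 also have "\<dots> = ennreal (2*pi) * ennreal (2*pi)" by (simp only: emeasure_lborel_Icc_eq) simp
 also have "\<dots> = ennreal ((2*pi)\<^sup>2)" unfolding power2_eq_square by (rule ennreal_mult[symmetric]) auto
 finally show ?thesis .
qed

lemma jap_powr_m2: "jap x powr (- 2) = 1 / (jap x)\<^sup>2"
proof -
 have "jap x powr (- 2) = 1 / jap x powr 2" by (simp add: powr_minus divide_simps)
 also have "jap x powr 2 = (jap x)\<^sup>2" using jap_pos[of x] by simp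
 finally show ?thesis .
qed

lemma rapid_nn_integral:
 assumes "rapid f"
 shows "\<exists>C. (\<integral>\<^sup>+ p. ennreal (norm (f p)) \<partial>stm) \<le> ennreal C"
proof -
 obtain C where C: "C > 0" "(\<integral>\<^sup>+ l. ennreal (jap (l::real) powr (- 2)) \<partial>lborel) \<le> ennreal C"
  using nn_integral_jap_powr[of 2] by auto
 obtain M where M: "\<And>p. jap (fst p) ^ 2 * norm (f p) \<le> M" using assms unfolding rapid_def by meson
 have M0: "0 \<le> M" by (rule order_trans[OF _ M[of undefined]]) (auto intro!: mult_nonneg_nonneg)
 have bd: "norm (f p) \<le> M * jap (fst p) powr (- 2)" for p
 proof -
  have "norm (f p) \<le> M / (jap (fst p))\<^sup>2"
   using M[of p] jap_pos[of "fst p"] by (simp add: pos_le_divide_eq mult.commute)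
  thus ?thesis unfolding jap_powr_m2 by simp
 qed
 have "(\<integral>\<^sup>+ p. ennreal (norm (f p)) \<partial>stm) \<le> (\<integral>\<^sup>+ p. ennreal (M * jap (fst p) powr (- 2)) \<partial>stm)"
  by (intro nn_integral_mono ennreal_leI bd)
 also have "\<dots> = (\<integral>\<^sup>+ t. (\<integral>\<^sup>+ z. ennreal (M * jap (t::real) powr (- 2)) * indicator torus_cell z \<partial>lborel) \<partial>lborel)"
  by (subst nn_integral_stm) simp_all
 also have "\<dots> = (\<integral>\<^sup>+ t. ennreal (M * (2*pi)\<^sup>2) * ennreal (jap (t::real) powr (- 2)) \<partial>lborel)"
 proof (rule nn_integral_cong)
  fix t :: real
  have e: "ennreal (M * x) * ennreal y = ennreal (M * y) * ennreal x" if "0 \<le> x" "0 \<le> y" for x y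
   using that M0 by (simp add: ennreal_mult mult_ac)
  have "(\<integral>\<^sup>+ z. ennreal (M * jap t powr (- 2)) * indicator torus_cell z \<partial>lborel) = ennreal (M * jap t powr (- 2)) * ennreal ((2*pi)\<^sup>2)"
   unfolding emeasure_torus_cell[symmetric] by (rule nn_integral_cmult_indicator) simp
  also have "\<dots> = ennreal (M * (2*pi)\<^sup>2) * ennreal (jap t powr (- 2))"
   by (rule e) auto
  finally show "(\<integral>\<^sup>+ z. ennreal (M * jap t powr (- 2)) * indicator torus_cell z \<partial>lborel) = ennreal (M * (2*pi)\<^sup>2) * ennreal (jap t powr (- 2))" .
 qed
 also have "\<dots> \<le> ennreal (M * (2*pi)\<^sup>2) * ennreal C"
  by (subst nn_integral_cmult, measurable) (intro mult_left_mono C, simp)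
 also have "\<dots> = ennreal (M * (2*pi)\<^sup>2 * C)" using M0 C by (simp add: ennreal_mult)
 finally show ?thesis by blast
qed

lemma schwartz_continuous: "f \<in> schwartz \<Longrightarrow> continuous_on A f"
 using schwartz_good unfolding good_def
 by (auto intro!: continuous_at_imp_continuous_on differentiable_imp_continuous_within)

lemma schwartz_borel: "f \<in> schwartz \<Longrightarrow> f \<in> borel_measurable borel"
 by (intro borel_measurable_continuous_onI schwartz_continuous)

lemma schwartz_integrable: 
 assumes "f \<in> schwartz" shows "integrable stm f"
proof (rule integrableI_bounded)
 show "smeas f" by (intro measurable_stm schwartz_borel assms)
 have "rapid f" using schwartz_good[OF assms] by (simp add: good_def)
 then obtain C where "(\<integral>\<^sup>+ p. ennreal (norm (f p)) \<partial>stm) \<le> ennreal C" using rapid_nn_integral by blast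
 thus "(\<integral>\<^sup>+ p. ennreal (norm (f p)) \<partial>stm) < \<infinity>" by (rule order_le_less_trans) simp
qed

lemma integral_stm_iterated:
 assumes f: "integrable stm (f :: spacetime \<Rightarrow> complex)" 
 defines "h \<equiv> (\<lambda>t z. indicator torus_cell z *\<^sub>R f (t, z))"
 shows "integrable (lborel \<Otimes>\<^sub>M lborel) (case_prod h)" 
  and "integral\<^sup>L stm f = (\<integral>z. (\<integral>t. h t z \<partial>lborel) \<partial>lborel)"
  and "integral\<^sup>L stm f = (\<integral>t. (\<integral>z. h t z \<partial>lborel) \<partial>lborel)"
proof -
 have eq: "case_prod h = (\<lambda>p. indicator (UNIV \<times> torus_cell) p *\<^sub>R f p)"
  by (auto simp: h_def fun_eq_iff indicator_def)
 have "integrable lborel (\<lambda>p. indicator (UNIV \<times> torus_cell) p *\<^sub>R f p)"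
  using f unfolding stm_def by (subst (asm) integrable_restrict_space) (simp_all)
 thus int: "integrable (lborel \<Otimes>\<^sub>M lborel) (case_prod h)" unfolding eq lborel_prod .
 have i: "integral\<^sup>L stm f = integral\<^sup>L (lborel \<Otimes>\<^sub>M lborel) (case_prod h)"
  unfolding eq lborel_prod stm_def by (subst integral_restrict_space) simp_all
 show "integral\<^sup>L stm f = (\<integral>z. (\<integral>t. h t z \<partial>lborel) \<partial>lborel)"
  unfolding i by (rule lborel_pair.integral_snd[OF int, symmetric])
 show "integral\<^sup>L stm f = (\<integral>t. (\<integral>z. h t z \<partial>lborel) \<partial>lborel)"
  unfolding i by (rule lborel_pair.integral_fst[OF int, symmetric])
qed

lemma pd_vector_derivative:
 assumes "good g"
 shows "((\<lambda>s. g (p + s *\<^sub>R v)) has_vector_derivative pd v g (p + s *\<^sub>R v)) (at s within A)"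
proof -
 have gd: "(g has_derivative (\<lambda>h. pd h g (p + s *\<^sub>R v))) (at (p + s *\<^sub>R v))"
  using assms by (intro differentiable_has_pd) (simp add: good_def)
 have "((\<lambda>s. p + s *\<^sub>R v) has_derivative (\<lambda>h. h *\<^sub>R v)) (at s)" by (auto intro!: derivative_eq_intros)
 from diff_chain_at[OF this gd] have "((\<lambda>s. g (p + s *\<^sub>R v)) has_derivative (\<lambda>h. pd (h *\<^sub>R v) g (p + s *\<^sub>R v))) (at s)"
  by (simp add: o_def)
 moreover have "linear (\<lambda>h. pd h g (p + s *\<^sub>R v))" using gd by (rule has_derivative_linear)
 hence "pd (h *\<^sub>R v) g (p + s *\<^sub>R v) = h *\<^sub>R pd v g (p + s *\<^sub>R v)" for h
  using linear_scale[of "\<lambda>h. pd h g (p + s *\<^sub>R v)" h v] by simp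
 ultimately show ?thesis
  unfolding has_vector_derivative_def by (auto intro: has_derivative_at_withinI)
qed

lemma rapid_section_tendsto_0:
 assumes "rapid g" "filterlim (\<lambda>t. \<bar>t\<bar>) at_top F"
 shows "((\<lambda>t. g (t, z)) \<longlongrightarrow> 0) F"
proof -
 obtain M where M: "\<And>p. jap (fst p) ^ 1 * norm (g p) \<le> M" using assms(1) unfolding rapid_def by meson
 have "((\<lambda>t. M / \<bar>t\<bar>) \<longlongrightarrow> 0) F"
  by (rule tendsto_divide_0[OF tendsto_const]) (rule filterlim_at_top_imp_at_infinity[OF assms(2)])
 moreover have "eventually (\<lambda>t. norm (g (t, z)) \<le> M / \<bar>t\<bar>) F"
  using filterlim_at_top_dense[THEN iffD1, OF assms(2), rule_format, of 0]
 proof eventually_elim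
  case (elim t)
  have "\<bar>t\<bar> * norm (g (t, z)) \<le> jap t * norm (g (t, z))"
   using norm_le_jap[of t] by (intro mult_right_mono) auto
  also have "\<dots> \<le> M" using M[of "(t, z)"] by simp
  finally show ?case using elim by (simp add: field_simps)
 qed
 ultimately show ?thesis by (rule Lim_null_comparison[rotated])
qed

text \<open>In the time direction the boundary terms vanish at infinity, in the space directions they cancel
by periodicity.\<close>

lemma integral_pd_zero:
 assumes g: "g \<in> schwartz" and v: "v \<in> Basis"
 shows "integral\<^sup>L stm (pd v g) = 0"
proof -
 have gg: "good g" by (rule schwartz_good[OF g])
 have dS: "pd v g \<in> schwartz" by (rule schwartz_pd[OF g v])
 have int: "integrable stm (pd v g)" by (rule schwartz_integrable[OF dS])
 have per: "periodic g" using gg by (simp add: good_def)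
 have cont: "continuous_on A (\<lambda>s. pd v g (p + s *\<^sub>R w))" for A p w
  by (rule continuous_on_compose2[OF schwartz_continuous[OF dS, of UNIV]]) (auto intro!: continuous_intros)
 consider "v = (1, 0, 0)" | "v = (0, 1, 0)" | "v = (0, 0, 1)"
  using v by (auto simp: Basis_prod_def zero_prod_def)
 thus ?thesis
 proof cases
  case 1
  have inner: "(\<integral>t. pd v g (t, z) \<partial>lborel) = 0" for z
  proof -
   have eq: "((0, z) + t *\<^sub>R v) = (t, z)" for t by (simp add: 1 zero_prod_def[symmetric])
   have vd: "((\<lambda>t. g (t, z)) has_vector_derivative pd v g (t, z)) (at t)" for t
    using pd_vector_derivative[OF gg, of "(0, z)" v t UNIV] unfolding eq .
   have c: "isCont (\<lambda>t. pd v g (t, z)) t" for t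
    using cont[of UNIV "(0, z)" v] unfolding eq by (simp add: continuous_on_eq_continuous_at)
   have si: "integrable lborel (\<lambda>t. pd v g (t, z))"
   proof (rule integrableI_bounded)
    show "(\<lambda>t. pd v g (t, z)) \<in> borel_measurable lborel"
     using c by (simp add: borel_measurable_continuous_onI continuous_on_eq_continuous_at)
    obtain C where C: "C > 0" "(\<integral>\<^sup>+ l. ennreal (jap (l::real) powr (- 2)) \<partial>lborel) \<le> ennreal C"
     using nn_integral_jap_powr[of 2] by auto
    have "rapid (pd v g)" using schwartz_good[OF dS] by (simp add: good_def)
    then obtain M where M: "\<And>p. jap (fst p) ^ 2 * norm (pd v g p) \<le> M" unfolding rapid_def by meson
    have M0: "0 \<le> M" by (rule order_trans[OF _ M[of undefined]]) (auto intro!: mult_nonneg_nonneg)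
    have bd: "norm (pd v g (t, z)) \<le> M * jap t powr (- 2)" for t
    proof -
     have "norm (pd v g (t, z)) \<le> M / (jap t)\<^sup>2"
      using M[of "(t, z)"] jap_pos[of t] by (simp add: pos_le_divide_eq mult.commute)
     thus ?thesis unfolding jap_powr_m2 by simp
    qed
    have "(\<integral>\<^sup>+ t. ennreal (norm (pd v g (t, z))) \<partial>lborel) \<le> (\<integral>\<^sup>+ t. ennreal M * ennreal (jap (t::real) powr (- 2)) \<partial>lborel)"
     by (intro nn_integral_mono) (use M0 bd in \<open>simp add: ennreal_leI flip: ennreal_mult\<close>)
    also have "\<dots> \<le> ennreal M * ennreal C" by (subst nn_integral_cmult, measurable) (intro mult_left_mono C, simp)
    also have "\<dots> < \<infinity>" by (simp add: ennreal_mult_less_top)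
    finally show "(\<integral>\<^sup>+ t. ennreal (norm (pd v g (t, z))) \<partial>lborel) < \<infinity>" .
   qed
   have rg: "rapid g" using gg by (simp add: good_def)
   have "(LBINT t=-\<infinity>..\<infinity>. pd v g (t, z)) = 0 - 0"
   proof (rule interval_integral_FTC_integrable[where F="\<lambda>t. g (t, z)"])
    show "set_integrable lborel (einterval (-\<infinity>) \<infinity>) (\<lambda>t. pd v g (t, z))"
     using si by (simp add: set_integrable_def einterval_def)
    show "(((\<lambda>t. g (t, z)) \<circ> real_of_ereal) \<longlongrightarrow> 0) (at_right (-\<infinity>))"
     unfolding ereal_tendsto_simps by (rule rapid_section_tendsto_0[OF rg]) (rule filterlim_at_infinity_imp_norm_at_top[OF filterlim_at_bot_imp_at_infinity[OF filterlim_ident], unfolded real_norm_def])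
    show "(((\<lambda>t. g (t, z)) \<circ> real_of_ereal) \<longlongrightarrow> 0) (at_left \<infinity>)"
     unfolding ereal_tendsto_simps by (rule rapid_section_tendsto_0[OF rg]) (rule filterlim_at_infinity_imp_norm_at_top[OF filterlim_at_top_imp_at_infinity[OF filterlim_ident], unfolded real_norm_def])
   qed (auto intro: vd c)
   thus ?thesis by (simp add: interval_lebesgue_integral_def set_lebesgue_integral_def einterval_def)
  qed
  have "integral\<^sup>L stm (pd v g) = (\<integral>z. (\<integral>t. indicator torus_cell z *\<^sub>R pd v g (t, z) \<partial>lborel) \<partial>lborel)"
   by (rule integral_stm_iterated(2)[OF int])
  also have "\<dots> = 0" by (simp add: inner)
  finally show ?thesis .
 next
  case 2
  have inner: "(\<integral>x. indicator {0..2*pi} x *\<^sub>R pd v g (t, x, y) \<partial>lborel) = 0" for t y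
  proof -
   have eq: "((t, 0, y) + x *\<^sub>R v) = (t, x, y)" for x by (simp add: 2)
   have "(\<integral>x. indicator {0..2*pi} x *\<^sub>R pd v g (t, x, y) \<partial>lborel) = g (t, 2*pi, y) - g (t, 0, y)"
    using pd_vector_derivative[OF gg, of "(t, 0, y)" v] cont[of "{0..2*pi}" "(t, 0, y)" v] unfolding eq
    by (intro integral_FTC_Icc) auto
   also have "\<dots> = 0" using per[unfolded periodic_def, rule_format, of t 0 y] by simp
   finally show ?thesis .
  qed
  have "(\<integral>z. indicator torus_cell z *\<^sub>R pd v g (t, z) \<partial>lborel) = 0" for t
  proof (cases "integrable lborel (\<lambda>z. indicator torus_cell z *\<^sub>R pd v g (t, z))")
   case True
   have eq: "(\<lambda>z. indicator torus_cell z *\<^sub>R pd v g (t, z)) = (\<lambda>(x, y). indicator {0..2*pi} y *\<^sub>R (indicator {0..2*pi} x *\<^sub>R pd v g (t, x, y)))"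
    by (auto simp: fun_eq_iff torus_cell_def indicator_def)
   have i: "integrable (lborel \<Otimes>\<^sub>M lborel) (\<lambda>(x, y). indicator {0..2*pi} y *\<^sub>R (indicator {0..2*pi} x *\<^sub>R pd v g (t, x, y)))"
    using True unfolding eq lborel_prod .
   have "(\<integral>z. indicator torus_cell z *\<^sub>R pd v g (t, z) \<partial>lborel) = integral\<^sup>L (lborel \<Otimes>\<^sub>M lborel) (\<lambda>(x, y). indicator {0..2*pi} y *\<^sub>R (indicator {0..2*pi} x *\<^sub>R pd v g (t, x, y)))"
    unfolding eq lborel_prod ..
   also have "\<dots> = (\<integral>y. (\<integral>x. indicator {0..2*pi} y *\<^sub>R (indicator {0..2*pi} x *\<^sub>R pd v g (t, x, y)) \<partial>lborel) \<partial>lborel)"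
    by (rule lborel_pair.integral_snd[OF i, symmetric])
   also have "\<dots> = 0" by (simp only: integral_scaleR_right inner scaleR_zero_right) simp
   finally show ?thesis .
  qed (rule not_integrable_integral_eq)
  thus ?thesis by (subst integral_stm_iterated(3)[OF int]) simp
 next
  case 3
  have inner: "(\<integral>y. indicator {0..2*pi} y *\<^sub>R pd v g (t, x, y) \<partial>lborel) = 0" for t x
  proof -
   have eq: "((t, x, 0) + y *\<^sub>R v) = (t, x, y)" for y by (simp add: 3)
   have "(\<integral>y. indicator {0..2*pi} y *\<^sub>R pd v g (t, x, y) \<partial>lborel) = g (t, x, 2*pi) - g (t, x, 0)"
    using pd_vector_derivative[OF gg, of "(t, x, 0)" v] cont[of "{0..2*pi}" "(t, x, 0)" v] unfolding eq
    by (intro integral_FTC_Icc) auto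
   also have "\<dots> = 0" using per[unfolded periodic_def, rule_format, of t x 0] by simp
   finally show ?thesis .
  qed
  have "(\<integral>z. indicator torus_cell z *\<^sub>R pd v g (t, z) \<partial>lborel) = 0" for t
  proof (cases "integrable lborel (\<lambda>z. indicator torus_cell z *\<^sub>R pd v g (t, z))")
   case True
   have eq: "(\<lambda>z. indicator torus_cell z *\<^sub>R pd v g (t, z)) = (\<lambda>(x, y). indicator {0..2*pi} x *\<^sub>R (indicator {0..2*pi} y *\<^sub>R pd v g (t, x, y)))"
    by (auto simp: fun_eq_iff torus_cell_def indicator_def)
   have i: "integrable (lborel \<Otimes>\<^sub>M lborel) (\<lambda>(x, y). indicator {0..2*pi} x *\<^sub>R (indicator {0..2*pi} y *\<^sub>R pd v g (t, x, y)))"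
    using True unfolding eq lborel_prod .
   have "(\<integral>z. indicator torus_cell z *\<^sub>R pd v g (t, z) \<partial>lborel) = integral\<^sup>L (lborel \<Otimes>\<^sub>M lborel) (\<lambda>(x, y). indicator {0..2*pi} x *\<^sub>R (indicator {0..2*pi} y *\<^sub>R pd v g (t, x, y)))"
    unfolding eq lborel_prod ..
   also have "\<dots> = (\<integral>x. (\<integral>y. indicator {0..2*pi} x *\<^sub>R (indicator {0..2*pi} y *\<^sub>R pd v g (t, x, y)) \<partial>lborel) \<partial>lborel)"
    by (rule lborel_pair.integral_fst[OF i, symmetric])
   also have "\<dots> = 0" by (simp only: integral_scaleR_right inner scaleR_zero_right) simp
   finally show ?thesis .
  qed (rule not_integrable_integral_eq)
  thus ?thesis by (subst integral_stm_iterated(3)[OF int]) simp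
 qed
qed

section \<open>The Fourier transform of Schwartz functions\<close>

lemma cis_borel[measurable]: "cis \<in> borel_measurable borel"
 by (intro borel_measurable_continuous_onI continuous_intros)

text \<open>The character of \<open>\<real> \<times> \<T>\<^sup>2\<close> with frequency \<open>q\<close>, and the Fourier transform as a function of pairs.\<close>

definition chr :: "freqpt \<Rightarrow> spacetime \<Rightarrow> complex" where
 "chr q p = cis (fst q * fst p + freq (snd q) \<bullet> snd p)"

definition ft :: "(spacetime \<Rightarrow> complex) \<Rightarrow> freqpt \<Rightarrow> complex" where
 "ft f q = fourier f (fst q) (snd q)"

lemma norm_chr[simp]: "norm (chr q p) = 1" by (simp add: chr_def)

lemma chr_uminus: "chr (- q) p = cnj (chr q p)"
 by (simp add: chr_def cis_cnj algebra_simps)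

lemma chr_add: "chr (q + r) p = chr q p * chr r p"
 by (simp add: chr_def cis_mult freq_add inner_add_left algebra_simps)

lemma ft_eq: "ft f q = (\<integral>p. f p * chr (- q) p \<partial>stm)"
 unfolding ft_def fourier_def lint_stm chr_def by (simp add: algebra_simps)

lemma chr_measurable2[measurable]: "(\<lambda>x. chr (fst x) (snd x)) \<in> borel_measurable (freq_measure \<Otimes>\<^sub>M stm)"
proof -
 have [measurable]: "(\<lambda>x. freq (snd (fst x))) \<in> borel_measurable (freq_measure \<Otimes>\<^sub>M stm)"
  by (rule measurable_compose[OF measurable_compose[OF measurable_fst measurable_freq_snd]]) simp
 show ?thesis unfolding chr_def by measurable
qed

lemma chr_measurable_stm[measurable]: "smeas (chr q)"
 unfolding chr_def by (rule measurable_stm) (intro borel_measurable_continuous_onI continuous_intros)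

lemma chr_measurable_freq[measurable]: "fmeas (\<lambda>q. chr q p)"
proof -
 have [measurable]: "fmeas (\<lambda>x. freq (snd x))"
  by (rule measurable_compose[OF measurable_freq_snd]) simp
 show ?thesis unfolding chr_def by measurable
qed

lemma integrable_chr:
 assumes "integrable stm f"
 shows "integrable stm (\<lambda>p. f p * chr q p)"
 using assms by (rule Bochner_Integration.integrable_bound)
  (auto simp: norm_mult intro!: borel_measurable_times[OF borel_measurable_integrable[OF assms] chr_measurable_stm])

lemma norm_ft_le:
 assumes "integrable stm f"
 shows "norm (ft f q) \<le> (\<integral>p. norm (f p) \<partial>stm)"
proof -
 have "norm (ft f q) \<le> (\<integral>p. norm (f p * chr (- q) p) \<partial>stm)"
  unfolding ft_eq by (rule integral_norm_bound)
 thus ?thesis by (simp add: norm_mult)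
qed

lemma ft_measurable[measurable]:
 assumes [measurable]: "smeas f"
 shows "fmeas (ft f)"
proof -
 have m: "(\<lambda>x. chr (- fst x) (snd x)) \<in> borel_measurable (freq_measure \<Otimes>\<^sub>M stm)"
  using measurable_compose[OF _ chr_measurable2, of "\<lambda>x. (- fst x, snd x)"] by simp
 have "fmeas (\<lambda>q. \<integral>p. f p * chr (- q) p \<partial>stm)"
  by (rule stm.borel_measurable_lebesgue_integral) (use m in \<open>simp add: split_beta'\<close>)
 thus ?thesis by (simp add: ft_eq[abs_def])
qed

lemma ft_add:
 assumes "integrable stm f" "integrable stm g"
 shows "ft (\<lambda>p. f p + g p) q = ft f q + ft g q"
 using assms unfolding ft_eq distrib_right by (intro Bochner_Integration.integral_add integrable_chr)

lemma ft_diff: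
 assumes "integrable stm f" "integrable stm g"
 shows "ft (\<lambda>p. f p - g p) q = ft f q - ft g q"
 using assms unfolding ft_eq left_diff_distrib by (intro Bochner_Integration.integral_diff integrable_chr)

lemma ft_pd:
 assumes f: "f \<in> schwartz" and v: "v \<in> Basis"
 shows "ft (pd v f) q = (\<i> * of_real (fst q * fst v + freq (snd q) \<bullet> snd v)) * ft f q"
proof -
 let ?k = "\<i> * of_real (fst q * fst v + freq (snd q) \<bullet> snd v)"
 define e where "e = (\<lambda>p. chr (- q) p)"
 define g where "g = (\<lambda>p. f p * e p)"
 have gS: "g \<in> schwartz"
  using schwartz_char[OF f, of 1 "- fst q" "- snd q"] by (simp add: g_def e_def chr_def)
 have e_der: "(e has_derivative (\<lambda>h. e p * (\<i> * of_real (- fst q * fst h + freq (- snd q) \<bullet> snd h)))) (at p)" for p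
 proof -
  have "((\<lambda>p. - fst q * fst p + freq (- snd q) \<bullet> snd p) has_derivative (\<lambda>h. - fst q * fst h + freq (- snd q) \<bullet> snd h)) (at p)"
   by (auto intro!: derivative_eq_intros)
  from has_derivative_compose[OF has_derivative_mult_right[OF has_derivative_of_real[OF this], of \<i>] DERIV_exp[unfolded has_field_derivative_def]]
  show ?thesis unfolding e_def chr_def fst_uminus snd_uminus cis_conv_exp .
 qed
 have "pd v g p = pd v f p * e p - ?k * (f p * e p)" for p
 proof -
  have fd: "(f has_derivative (\<lambda>h. pd h f p)) (at p)"
   using schwartz_good[OF f] by (intro differentiable_has_pd) (simp add: good_def)
  from pd_eqI[OF has_derivative_mult[OF fd e_der], of v]
  show ?thesis unfolding g_def by (simp add: algebra_simps)
 qed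
 hence "pd v g = (\<lambda>p. pd v f p * e p - ?k * (f p * e p))" by (rule ext)
 hence "0 = (\<integral>p. pd v f p * e p - ?k * (f p * e p) \<partial>stm)"
  using integral_pd_zero[OF gS v] by simp
 also have "\<dots> = ft (pd v f) q - ?k * ft f q"
 proof -
  have "integrable stm (\<lambda>p. pd v f p * e p)" "integrable stm (\<lambda>p. ?k * (f p * e p))"
   unfolding e_def by (intro integrable_mult_right integrable_chr schwartz_integrable schwartz_pd f v)+
  thus ?thesis by (simp add: Bochner_Integration.integral_diff ft_eq e_def)
 qed
 finally show ?thesis by simp
qed

text \<open>The operator \<open>1 + \<partial>\<^sub>v\<^sup>4\<close>, whose symbol has no zeros.\<close>

definition Lam :: "spacetime \<Rightarrow> (spacetime \<Rightarrow> complex) \<Rightarrow> spacetime \<Rightarrow> complex" where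
 "Lam v f = (\<lambda>p. f p + pd v (pd v (pd v (pd v f))) p)"

lemma Lam_schwartz: "f \<in> schwartz \<Longrightarrow> v \<in> Basis \<Longrightarrow> Lam v f \<in> schwartz"
 unfolding Lam_def by (intro schwartz_add schwartz_pd)

lemma ft_Lam:
 assumes f: "f \<in> schwartz" and v: "v \<in> Basis"
 shows "ft (Lam v f) q = of_real (1 + (fst q * fst v + freq (snd q) \<bullet> snd v) ^ 4) * ft f q"
proof -
 have "ft (Lam v f) q = ft f q + ft (pd v (pd v (pd v (pd v f)))) q"
  unfolding Lam_def by (intro ft_add schwartz_integrable schwartz_pd f v)
 also have "ft (pd v (pd v (pd v (pd v f)))) q = (\<i> * of_real (fst q * fst v + freq (snd q) \<bullet> snd v)) ^ 4 * ft f q"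
  by (simp add: ft_pd schwartz_pd f v power4_eq_xxxx mult.assoc)
 also have "(\<i> * of_real (fst q * fst v + freq (snd q) \<bullet> snd v)) ^ 4 = complex_of_real ((fst q * fst v + freq (snd q) \<bullet> snd v) ^ 4)"
  by (simp add: power_mult_distrib)
 finally show ?thesis by (simp add: distrib_right)
qed

definition dec :: "freqpt \<Rightarrow> real" where
 "dec q = 1 / (jap (fst q) ^ 2 * (jap (real_of_int (fst (snd q))) ^ 2 * jap (real_of_int (snd (snd q))) ^ 2))"

lemma jap4: "jap (x::real) ^ 4 \<le> 2 * (1 + x ^ 4)"
proof -
 have "jap x ^ 4 = ((jap x)\<^sup>2)\<^sup>2" by (simp flip: power_mult)
 also have "\<dots> = (1 + x\<^sup>2)\<^sup>2" by (simp only: jap_sq) simp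
 also have "\<dots> \<le> 2 * (1 + x ^ 4)"
  using zero_le_power2[of "1 - x\<^sup>2"] by (simp add: power2_eq_square power4_eq_xxxx algebra_simps)
 finally show ?thesis .
qed

text \<open>\<open>1 + \<partial>\<^sub>v\<^sup>4\<close> acts on the Fourier transform as multiplication by \<open>1 + \<xi>\<^sub>v\<^sup>4\<close>. Applied in all three directions, it
divides a bounded function by a multiple of \<open>dec^(-2)\<close>.\<close>

lemma ft_decay:
 assumes f: "f \<in> schwartz"
 shows "\<exists>C\<ge>0. \<forall>q. norm (ft f q) \<le> C * (dec q)\<^sup>2"
proof -
 define u :: spacetime where "u = (1, 0, 0)"
 define v :: spacetime where "v = (0, 1, 0)"
 define w :: spacetime where "w = (0, 0, 1)"
 have b: "u \<in> Basis" "v \<in> Basis" "w \<in> Basis"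
  by (auto simp: u_def v_def w_def Basis_prod_def zero_prod_def)
 define g where "g = Lam u (Lam v (Lam w f))"
 have gS: "g \<in> schwartz" unfolding g_def by (intro Lam_schwartz f b)
 define C where "C = (\<integral>p. norm (g p) \<partial>stm)"
 have C0: "0 \<le> C" by (simp add: C_def)
 have "norm (ft f q) \<le> 8 * C * (dec q)\<^sup>2" for q
 proof -
  let ?l = "fst q" and ?a = "real_of_int (fst (snd q))" and ?b = "real_of_int (snd (snd q))"
  have "ft g q = of_real ((1 + ?l ^ 4) * ((1 + ?a ^ 4) * (1 + ?b ^ 4))) * ft f q"
   unfolding g_def by (simp add: ft_Lam Lam_schwartz f b) (simp add: u_def v_def w_def freq_def mult.assoc)
  hence "norm (ft g q) = (1 + ?l ^ 4) * ((1 + ?a ^ 4) * (1 + ?b ^ 4)) * norm (ft f q)"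
   by (simp only: norm_mult norm_of_real) (simp add: abs_mult)
  hence 1: "(1 + ?l ^ 4) * ((1 + ?a ^ 4) * (1 + ?b ^ 4)) * norm (ft f q) \<le> C"
   using norm_ft_le[OF schwartz_integrable[OF gS], of q] by (simp add: C_def)
  have d: "1 / (dec q)\<^sup>2 = jap ?l ^ 4 * (jap ?a ^ 4 * jap ?b ^ 4)"
   by (simp add: dec_def power_mult_distrib power_divide flip: power_mult)
  have dp: "(dec q)\<^sup>2 > 0" unfolding dec_def
   by (intro zero_less_power divide_pos_pos mult_pos_pos jap_pos) simp
  have "jap ?l ^ 4 * (jap ?a ^ 4 * jap ?b ^ 4) \<le> (2 * (1 + ?l ^ 4)) * ((2 * (1 + ?a ^ 4)) * (2 * (1 + ?b ^ 4)))"
   using jap_pos by (intro mult_mono jap4) (auto intro!: mult_nonneg_nonneg zero_le_power less_imp_le add_nonneg_nonneg)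
  moreover have "(2 * x) * ((2 * y) * (2 * z)) = 8 * (x * (y * z))" for x y z :: real by simp
  ultimately have "jap ?l ^ 4 * (jap ?a ^ 4 * jap ?b ^ 4) \<le> 8 * ((1 + ?l ^ 4) * ((1 + ?a ^ 4) * (1 + ?b ^ 4)))" by (simp only:)
  hence "1 / (dec q)\<^sup>2 * norm (ft f q) \<le> 8 * ((1 + ?l ^ 4) * ((1 + ?a ^ 4) * (1 + ?b ^ 4))) * norm (ft f q)"
   unfolding d by (intro mult_right_mono) simp_all
  also have "\<dots> \<le> 8 * C" using 1 by simp
  finally show ?thesis using dp by (simp add: field_simps)
 qed
 thus ?thesis using C0 by (intro exI[of _ "8 * C"]) auto
qed

lemma dec_measurable[measurable]: "fmeas dec"
proof -
 have [measurable]: "fmeas (\<lambda>x. real_of_int (fst (snd x)))" "fmeas (\<lambda>x. real_of_int (snd (snd x)))"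
  by (rule measurable_compose[OF measurable_freq_snd], simp)+
 show ?thesis unfolding dec_def by measurable
qed

lemma dec_pos: "0 < dec q" and dec_le_1: "dec q \<le> 1"
proof -
 show "0 < dec q" unfolding dec_def by (intro divide_pos_pos mult_pos_pos zero_less_power jap_pos) simp
 have p: "1 \<le> jap x ^ 2" for x :: real by (rule one_le_power[OF jap_ge_1])
 have "1 \<le> jap (fst q) ^ 2 * (jap (real_of_int (fst (snd q))) ^ 2 * jap (real_of_int (snd (snd q))) ^ 2)"
  using mult_mono[OF p[of "fst q"] mult_mono[OF p[of "real_of_int (fst (snd q))"] p[of "real_of_int (snd (snd q))"]]] by simp
 thus "dec q \<le> 1" unfolding dec_def by simp
qed

lemma dec_integral: "(\<oint> q. ennreal (dec q)) < \<infinity>"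
proof -
 obtain C where C: "C > 0" "(\<integral>\<^sup>+ l. ennreal (jap (l::real) powr (- 2)) \<partial>lborel) \<le> ennreal C"
  using nn_integral_jap_powr[of 2] by auto
 obtain K where K: "K > 0" "\<And>S :: int set. finite S \<Longrightarrow> (\<Sum>k\<in>S. (1 + (real_of_int k)\<^sup>2) powr (- 1)) \<le> K"
  using sum_int_powr_bounded[of 1] by auto
 define j where "j = (\<lambda>x::real. 1 / jap x ^ 2)"
 have j1: "j x = jap x powr (- 2)" for x
  using jap_pos[of x] by (simp add: j_def powr_minus divide_simps)
 have j2: "j x = (1 + x\<^sup>2) powr (- 1)" for x
  using jap_sq[of x] by (simp add: j_def powr_minus divide_simps add_pos_nonneg)
 have jpos: "0 \<le> j x" for x by (simp add: j_def)
 have [measurable]: "j \<in> borel_measurable borel" unfolding j_def by measurable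
 have sum: "(\<integral>\<^sup>+ k. ennreal (j (real_of_int k)) \<partial>count_space UNIV) \<le> ennreal K"
  by (rule nn_integral_count_le) (use K in \<open>simp_all add: j2\<close>)
 have "(\<oint> q. ennreal (dec q)) = (\<integral>\<^sup>+ n. (\<integral>\<^sup>+ l. ennreal (j (real_of_int (fst n)) * j (real_of_int (snd n))) * ennreal (j l) \<partial>lborel) \<partial>count_space UNIV)"
  by (subst nn_integral_freq) (auto intro!: nn_integral_cong simp: dec_def j_def simp flip: ennreal_mult)
 also have "\<dots> \<le> (\<integral>\<^sup>+ n. ennreal (j (real_of_int (fst n)) * j (real_of_int (snd n))) * ennreal C \<partial>count_space UNIV)"
  using C(2) by (subst nn_integral_cmult, measurable) (intro nn_integral_mono mult_left_mono, auto simp: j1)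
 also have "\<dots> = (\<integral>\<^sup>+ a. (\<integral>\<^sup>+ b. (ennreal (j (real_of_int a)) * ennreal C) * ennreal (j (real_of_int b)) \<partial>count_space UNIV) \<partial>count_space UNIV)"
  by (subst nn_integral_fst_count_space[symmetric]) (simp add: ennreal_mult jpos mult_ac)
 also have "\<dots> \<le> (\<integral>\<^sup>+ a. (ennreal K * ennreal C) * ennreal (j (real_of_int a)) \<partial>count_space UNIV)"
 proof (subst nn_integral_cmult, simp, rule nn_integral_mono)
  fix a
  show "ennreal (j (real_of_int a)) * ennreal C * (\<integral>\<^sup>+ b. ennreal (j (real_of_int b)) \<partial>count_space UNIV)
    \<le> (ennreal K * ennreal C) * ennreal (j (real_of_int a))"
   using mult_left_mono[OF sum, of "ennreal (j (real_of_int a)) * ennreal C"] by (simp add: mult_ac)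
 qed
 also have "\<dots> \<le> (ennreal K * ennreal C) * ennreal K"
  by (subst nn_integral_cmult, simp) (intro mult_left_mono sum, simp)
 also have "\<dots> < \<infinity>" by (simp add: ennreal_mult_less_top)
 finally show ?thesis .
qed

lemma ft_integrable: 
 assumes "f \<in> schwartz" shows "fint (ft f)"
proof (rule integrableI_bounded)
 show "fmeas (ft f)"
  by (intro ft_measurable measurable_stm schwartz_borel assms)
 obtain C where C: "C \<ge> 0" "\<And>q. norm (ft f q) \<le> C * (dec q)\<^sup>2" using ft_decay[OF assms] by blast
 have "norm (ft f q) \<le> C * dec q" for q
 proof -
  have "(dec q)\<^sup>2 \<le> dec q" using dec_pos[of q] dec_le_1[of q] by (simp add: power2_eq_square mult_left_le)
  thus ?thesis using C(2)[of q] C(1) mult_left_mono order_trans by blast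
 qed
 hence "(\<oint> q. ennreal (norm (ft f q))) \<le> (\<oint> q. ennreal C * ennreal (dec q))"
  using C(1) by (intro nn_integral_mono) (simp add: ennreal_leI flip: ennreal_mult')
 also have "\<dots> = ennreal C * (\<oint> q. ennreal (dec q))" by (rule nn_integral_cmult) measurable
 also have "\<dots> < \<infinity>" using dec_integral by (simp add: ennreal_mult_less_top)
 finally show "(\<oint> q. ennreal (norm (ft f q))) < \<infinity>" .
qed

lemma schwartz_EN_finite:
 assumes f: "f \<in> schwartz" and sb: "s \<le> 1" "b \<le> 1"
 shows "EN s b (amp (ft f)) < \<infinity>"
proof -
 obtain C where C: "C \<ge> 0" "\<And>q. norm (ft f q) \<le> C * (dec q)\<^sup>2" using ft_decay[OF f] by blast
 have bd: "(fq q powr s * md q powr b) * norm (ft f q) \<le> 3 * C * dec q" for q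
 proof -
  let ?l = "fst q" and ?a = "real_of_int (fst (snd q))" and ?b = "real_of_int (snd (snd q))"
  have fq2: "fq q \<le> jap ?a * jap ?b"
  proof -
   have "(fq q)\<^sup>2 = 1 + ?a\<^sup>2 + ?b\<^sup>2" by (simp add: fq_def jap_freq)
   also have "\<dots> \<le> (1 + ?a\<^sup>2) * (1 + ?b\<^sup>2)" by (simp add: algebra_simps)
   also have "\<dots> = (jap ?a * jap ?b)\<^sup>2" by (simp add: power_mult_distrib jap_sq)
   finally show ?thesis by (rule power2_le_imp_le) (intro mult_nonneg_nonneg less_imp_le[OF jap_pos])
  qed
  have md2: "md q \<le> 3 * (jap ?l * fq q)"
  proof -
   have "md q \<le> 1 + (\<bar>?l\<bar> + fq q)"
    using jap_le_1_plus[of "\<bar>?l\<bar> - jap (freq (snd q))"] fq_pos[of q] by (simp add: md_def fq_def)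
   moreover have "(jap ?l - 1) * (fq q - 1) \<ge> 0" using jap_ge_1[of ?l] fq_ge_1[of q] by simp
   hence "jap ?l + fq q \<le> 1 + jap ?l * fq q" by (simp add: algebra_simps)
   moreover have "1 \<le> jap ?l * fq q" using mult_mono[OF jap_ge_1[of ?l] fq_ge_1[of q]] jap_pos[of ?l] by simp
   moreover have "\<bar>?l\<bar> \<le> jap ?l" using norm_le_jap[of ?l] by simp
   ultimately show ?thesis by linarith
  qed
  have "fq q powr s * md q powr b \<le> fq q powr 1 * md q powr 1"
   using sb fq_ge_1[of q] md_ge_1[of q] by (intro mult_mono powr_mono) auto
  also have "\<dots> = fq q * md q" using fq_pos[of q] md_pos[of q] by simp
  also have "\<dots> \<le> fq q * (3 * (jap ?l * fq q))" using md2 fq_pos[of q] by (intro mult_left_mono) auto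
  also have "\<dots> = 3 * (jap ?l * (fq q * fq q))" by simp
  also have "\<dots> \<le> 3 * (jap ?l ^ 2 * ((jap ?a * jap ?b) * (jap ?a * jap ?b)))"
   using fq2 fq_pos[of q] jap_pos[of ?l] jap_ge_1[of ?l]
   by (intro mult_left_mono mult_mono) (auto simp: power2_eq_square)
  also have "\<dots> = 3 / dec q" by (simp add: dec_def power2_eq_square mult_ac)
  finally have "(fq q powr s * md q powr b) * norm (ft f q) \<le> 3 / dec q * (C * (dec q)\<^sup>2)"
   using C dec_pos[of q] by (intro mult_mono) auto
  also have "\<dots> = 3 * C * dec q" using dec_pos[of q] by (simp add: power2_eq_square)
  finally show ?thesis .
 qed
 have "EN s b (amp (ft f)) \<le> (\<oint> q. ennreal ((3 * C)\<^sup>2) * ennreal (dec q))"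
  unfolding EN_def
 proof (rule nn_integral_mono)
  fix q
  have "(ennreal (fq q powr s * md q powr b) * ennreal (norm (ft f q)))\<^sup>2 = ennreal (((fq q powr s * md q powr b) * norm (ft f q))\<^sup>2)"
   by (subst ennreal_mult[symmetric]) (auto simp: ennreal_power)
  also have "\<dots> \<le> ennreal ((3 * C * dec q)\<^sup>2)" by (intro ennreal_leI power_mono bd) auto
  also have "\<dots> \<le> ennreal ((3 * C)\<^sup>2 * dec q)"
  proof (rule ennreal_leI)
   have "(dec q)\<^sup>2 \<le> dec q" using dec_pos[of q] dec_le_1[of q] by (simp add: power2_eq_square mult_left_le)
   hence "(3 * C)\<^sup>2 * (dec q)\<^sup>2 \<le> (3 * C)\<^sup>2 * dec q" by (rule mult_left_mono) simp
   thus "(3 * C * dec q)\<^sup>2 \<le> (3 * C)\<^sup>2 * dec q" by (simp only: power_mult_distrib)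
  qed
  finally show "(ennreal (fq q powr s * md q powr b) * ennreal (norm (ft f q)))\<^sup>2 \<le> ennreal ((3 * C)\<^sup>2) * ennreal (dec q)"
   using dec_pos[of q] by (simp add: ennreal_mult)
 qed
 also have "\<dots> = ennreal ((3 * C)\<^sup>2) * (\<oint> q. ennreal (dec q))" by (rule nn_integral_cmult) measurable
 also have "\<dots> < \<infinity>" using dec_integral by (simp add: ennreal_mult_less_top)
 finally show ?thesis .
qed

section \<open>Summability kernels\<close>

text \<open>The Gaussian multiplier in \<open>\<lambda>\<close> and its Fourier transform, an approximate identity as \<open>\<kappa> \<rightarrow> 0\<close>.\<close>

definition gk :: "real \<Rightarrow> real \<Rightarrow> real" where
 "gk \<kappa> l = sqrt (2 * pi) * std_normal_density (\<kappa> * l)"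

definition GK :: "real \<Rightarrow> real \<Rightarrow> real" where
 "GK \<kappa> s = 2 * pi / \<kappa> * std_normal_density (s / \<kappa>)"

lemma gk_exp: "gk \<kappa> l = exp (- (\<kappa> * l)\<^sup>2 / 2)"
 by (simp add: gk_def std_normal_density_def)

lemma gk_nonneg: "0 \<le> gk \<kappa> l" and gk_le_1: "gk \<kappa> l \<le> 1" by (simp_all add: gk_exp)

lemma GK_nonneg: "0 < \<kappa> \<Longrightarrow> 0 \<le> GK \<kappa> s" by (simp add: GK_def)

lemma gk_measurable[measurable]: "gk \<kappa> \<in> borel_measurable borel" unfolding gk_def by measurable
lemma GK_measurable[measurable]: "GK \<kappa> \<in> borel_measurable borel" unfolding GK_def by measurable

lemma std_normal_integrable: "integrable lborel std_normal_density"
 using integrable_std_normal_moment[of 0] by simp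

lemma std_normal_integral: "integral\<^sup>L lborel std_normal_density = 1"
 using integral_std_normal_moment_even[of 0] by simp

lemma gk_integrable: "\<kappa> > 0 \<Longrightarrow> integrable lborel (gk \<kappa>)"
 using lborel_integrable_real_affine[OF std_normal_integrable, of \<kappa> 0] unfolding gk_def by simp

lemma std_normal_ft: "(\<integral>x. std_normal_density x *\<^sub>R cis (t * x) \<partial>lborel) = of_real (exp (- t\<^sup>2 / 2))"
proof -
 have "char std_normal_distribution t = (\<integral>x. std_normal_density x *\<^sub>R iexp (t * x) \<partial>lborel)"
  unfolding char_def by (subst integral_density) auto
 thus ?thesis by (simp add: char_std_normal_distribution cis_conv_exp)
qed

lemma gk_ft:
 assumes \<kappa>: "\<kappa> > 0"
 shows "(\<integral>l. of_real (gk \<kappa> l) * cis (l * s) \<partial>lborel) = complex_of_real (GK \<kappa> s)"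
proof -
 have "(\<integral>l. of_real (gk \<kappa> l) * cis (l * s) \<partial>lborel) = (1 / \<kappa>) *\<^sub>R (\<integral>x. of_real (gk \<kappa> (0 + (1 / \<kappa>) * x)) * cis ((0 + (1 / \<kappa>) * x) * s) \<partial>lborel)"
  using lborel_integral_real_affine[of "1 / \<kappa>" "\<lambda>l. of_real (gk \<kappa> l) * cis (l * s)" 0] \<kappa> by simp
 also have "(\<integral>x. of_real (gk \<kappa> (0 + (1 / \<kappa>) * x)) * cis ((0 + (1 / \<kappa>) * x) * s) \<partial>lborel)
   = (\<integral>x. of_real (sqrt (2 * pi)) * (std_normal_density x *\<^sub>R cis (s / \<kappa> * x)) \<partial>lborel)"
  using \<kappa> by (intro Bochner_Integration.integral_cong) (auto simp: gk_def scaleR_conv_of_real mult_ac)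
 also have "\<dots> = of_real (sqrt (2 * pi)) * of_real (exp (- (s / \<kappa>)\<^sup>2 / 2))"
  by (simp only: integral_mult_right_zero std_normal_ft)
 also have "(1 / \<kappa>) *\<^sub>R \<dots> = complex_of_real (GK \<kappa> s)"
  using \<kappa> by (simp add: GK_def std_normal_density_def scaleR_conv_of_real real_sqrt_mult field_simps flip: of_real_mult)
 finally show ?thesis .
qed

lemma nn_integral_GK:
 assumes \<kappa>: "\<kappa> > 0"
 shows "(\<integral>\<^sup>+ s. ennreal (GK \<kappa> (t - s)) \<partial>lborel) = ennreal (2 * pi)"
  and "(\<integral>\<^sup>+ s. ennreal (\<bar>t - s\<bar> * GK \<kappa> (t - s)) \<partial>lborel) = ennreal (\<kappa> * (2 * pi * (\<integral>x. std_normal_density x * \<bar>x\<bar> \<partial>lborel)))"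
proof -
 have nn: "(\<integral>\<^sup>+ x. ennreal (std_normal_density x) \<partial>lborel) = 1"
  by (subst nn_integral_eq_integral[OF std_normal_integrable]) (auto simp: std_normal_integral)
 have nn1: "(\<integral>\<^sup>+ x. ennreal (std_normal_density x * \<bar>x\<bar>) \<partial>lborel) = ennreal (\<integral>x. std_normal_density x * \<bar>x\<bar> \<partial>lborel)"
  using integrable_std_normal_moment_abs[of 1] by (subst nn_integral_eq_integral) auto
 have "(\<integral>\<^sup>+ s. ennreal (GK \<kappa> (t - s)) \<partial>lborel) = ennreal \<kappa> * (\<integral>\<^sup>+ x. ennreal (2 * pi / \<kappa>) * ennreal (std_normal_density x) \<partial>lborel)"
 proof -
  have "ennreal (GK \<kappa> (\<kappa> * x)) = ennreal (2 * pi / \<kappa>) * ennreal (std_normal_density x)" for x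
   using \<kappa> by (simp add: GK_def flip: ennreal_mult)
  thus ?thesis
   using nn_integral_real_affine[of "\<lambda>s. ennreal (GK \<kappa> (t - s))" "- \<kappa>" t] \<kappa> by simp
 qed
 also have "\<dots> = ennreal \<kappa> * ennreal (2 * pi / \<kappa>)" by (subst nn_integral_cmult) (auto simp: nn)
 also have "\<dots> = ennreal (2 * pi)" using \<kappa> by (simp flip: ennreal_mult)
 finally show "(\<integral>\<^sup>+ s. ennreal (GK \<kappa> (t - s)) \<partial>lborel) = ennreal (2 * pi)" .
 have "(\<integral>\<^sup>+ s. ennreal (\<bar>t - s\<bar> * GK \<kappa> (t - s)) \<partial>lborel) = ennreal \<kappa> * (\<integral>\<^sup>+ x. ennreal (2 * pi) * ennreal (std_normal_density x * \<bar>x\<bar>) \<partial>lborel)"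
 proof -
  have "ennreal (\<bar>\<kappa> * x\<bar> * GK \<kappa> (\<kappa> * x)) = ennreal (2 * pi) * ennreal (std_normal_density x * \<bar>x\<bar>)" for x
   using \<kappa> by (simp add: GK_def abs_mult mult_ac flip: ennreal_mult)
  thus ?thesis
   using nn_integral_real_affine[of "\<lambda>s. ennreal (\<bar>t - s\<bar> * GK \<kappa> (t - s))" "- \<kappa>" t] \<kappa> by simp
 qed
 also have "\<dots> = ennreal \<kappa> * (ennreal (2 * pi) * ennreal (\<integral>x. std_normal_density x * \<bar>x\<bar> \<partial>lborel))"
  by (subst nn_integral_cmult) (auto simp: nn1)
 also have "\<dots> = ennreal (\<kappa> * (2 * pi * (\<integral>x. std_normal_density x * \<bar>x\<bar> \<partial>lborel)))"
  using \<kappa> by (simp add: ennreal_mult integral_nonneg_AE)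
 finally show "(\<integral>\<^sup>+ s. ennreal (\<bar>t - s\<bar> * GK \<kappa> (t - s)) \<partial>lborel) = ennreal (\<kappa> * (2 * pi * (\<integral>x. std_normal_density x * \<bar>x\<bar> \<partial>lborel)))" .
qed

text \<open>The triangular multiplier \<open>max 0 (1 - |n| / N)\<close>, written as a count of pairs, and its Fourier series,
the Fejer kernel.\<close>

definition wN :: "nat \<Rightarrow> int \<Rightarrow> real" where
 "wN N n = real (card {jk \<in> {..<N} \<times> {..<N}. int (fst jk) - int (snd jk) = n}) / real N"

definition FJ :: "nat \<Rightarrow> real \<Rightarrow> real" where
 "FJ N \<theta> = (norm (\<Sum>k<N. cis (real k * \<theta>)))\<^sup>2 / real N"

lemma FJ_nonneg: "0 \<le> FJ N \<theta>" by (simp add: FJ_def)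

lemma FJ_continuous: "continuous_on A (FJ N)"
 unfolding FJ_def by (cases "N = 0") (auto intro!: continuous_intros)

lemma FJ_measurable[measurable]: "FJ N \<in> borel_measurable borel"
 by (intro borel_measurable_continuous_onI FJ_continuous)

lemma wN_nonneg: "0 \<le> wN N n" by (simp add: wN_def)

lemma wN_card: "card {jk \<in> {..<N} \<times> {..<N}. int (fst jk) - int (snd jk) = n} = N - nat \<bar>n\<bar>"
proof (cases "0 \<le> n")
 case True
 have "bij_betw (\<lambda>k. (k + nat n, k)) {..<N - nat \<bar>n\<bar>} {jk \<in> {..<N} \<times> {..<N}. int (fst jk) - int (snd jk) = n}"
  using True by (intro bij_betw_byWitness[where f'=snd]) auto
 from bij_betw_same_card[OF this] show ?thesis by simp
next
 case False
 have "bij_betw (\<lambda>k. (k, k + nat (- n))) {..<N - nat \<bar>n\<bar>} {jk \<in> {..<N} \<times> {..<N}. int (fst jk) - int (snd jk) = n}"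
  using False by (intro bij_betw_byWitness[where f'=fst]) auto
 from bij_betw_same_card[OF this] show ?thesis by simp
qed

lemma wN_le_1: "wN N n \<le> 1"
 unfolding wN_def wN_card by (cases "N = 0") auto

lemma wN_zero: "nat \<bar>n\<bar> \<ge> N \<Longrightarrow> wN N n = 0"
 unfolding wN_def wN_card by simp

lemma wN_tendsto: "(\<lambda>N. wN (Suc N) n) \<longlonglongrightarrow> 1"
proof -
 have "(\<lambda>N. 1 - real (nat \<bar>n\<bar>) / real (Suc N)) \<longlonglongrightarrow> 1 - 0"
  by (intro tendsto_diff tendsto_const LIMSEQ_Suc[OF lim_const_over_n])
 moreover have "eventually (\<lambda>N. 1 - real (nat \<bar>n\<bar>) / real (Suc N) = wN (Suc N) n) sequentially"
  using eventually_ge_at_top[of "nat \<bar>n\<bar>"]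
 proof eventually_elim
  case (elim N)
  thus ?case unfolding wN_def wN_card by (subst of_nat_diff) (auto simp: diff_divide_distrib simp del: of_nat_Suc)
 qed
 ultimately show ?thesis using Lim_transform_eventually by force
qed

lemma FJ_double_sum: "complex_of_real (FJ N \<theta>) = (\<Sum>jk\<in>{..<N}\<times>{..<N}. cis (real_of_int (int (fst jk) - int (snd jk)) * \<theta>)) / of_nat N"
proof -
 have "complex_of_real ((norm (\<Sum>k<N. cis (real k * \<theta>)))\<^sup>2) = (\<Sum>k<N. cis (real k * \<theta>)) * cnj (\<Sum>k<N. cis (real k * \<theta>))"
  by (rule complex_norm_square)
 also have "\<dots> = (\<Sum>j<N. \<Sum>k<N. cis (real j * \<theta>) * cis (- (real k * \<theta>)))"
  by (simp add: sum_product cis_cnj)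
 also have "\<dots> = (\<Sum>jk\<in>{..<N}\<times>{..<N}. cis (real_of_int (int (fst jk) - int (snd jk)) * \<theta>))"
  by (simp add: sum.cartesian_product cis_mult algebra_simps split_beta')
 finally show ?thesis by (simp add: FJ_def)
qed

text \<open>\<open>|\<Sum>_(k<N) e^(ik\<theta>)|\<^sup>2 / N\<close> expands into a sum over pairs \<open>(j, k)\<close>, which are grouped by their difference.\<close>

lemma wN_sum:
 assumes "finite D" "{- int N..int N} \<subseteq> D"
 shows "(\<Sum>n\<in>D. of_real (wN N n) * cis (real_of_int n * \<theta>)) = complex_of_real (FJ N \<theta>)"
proof -
 let ?S = "{..<N} \<times> {..<N}" and ?d = "\<lambda>jk::nat\<times>nat. int (fst jk) - int (snd jk)"
 have "of_nat N * (of_real (wN N n) * cis (real_of_int n * \<theta>)) = (\<Sum>jk | jk \<in> ?S \<and> ?d jk = n. cis (real_of_int (?d jk) * \<theta>))" for n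
 proof -
  have "(\<Sum>jk | jk \<in> ?S \<and> ?d jk = n. cis (real_of_int (?d jk) * \<theta>)) = (\<Sum>jk | jk \<in> ?S \<and> ?d jk = n. cis (real_of_int n * \<theta>))"
   by (rule sum.cong) auto
  thus ?thesis by (cases "N = 0") (simp_all add: wN_def)
 qed
 hence "of_nat N * (\<Sum>n\<in>D. of_real (wN N n) * cis (real_of_int n * \<theta>)) = (\<Sum>n\<in>D. \<Sum>jk | jk \<in> ?S \<and> ?d jk = n. cis (real_of_int (?d jk) * \<theta>))"
  unfolding sum_distrib_left by (intro sum.cong refl) blast
 also have "\<dots> = (\<Sum>jk\<in>?S. cis (real_of_int (?d jk) * \<theta>))"
 proof (rule sum.group)
  show "?d ` ?S \<subseteq> D" using assms(2) by (auto intro!: subsetD[OF assms(2)])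
 qed (use assms in auto)
 finally show ?thesis by (cases "N = 0") (auto simp: FJ_double_sum field_simps wN_def)
qed

lemma nn_integral_FJ:
 assumes N: "N > 0"
 shows "(\<integral>\<^sup>+ y. ennreal (FJ N (x - y)) * indicator {0..2*pi} y \<partial>lborel) = ennreal (2 * pi)"
proof -
 let ?S = "{..<N} \<times> {..<N}" and ?d = "\<lambda>jk::nat\<times>nat. real_of_int (int (fst jk) - int (snd jk))"
 define A where "A = (\<lambda>y. (\<Sum>jk\<in>?S. if fst jk = snd jk then y else - sin (?d jk * (x - y)) / ?d jk) / real N)"
 have FJ_cos: "FJ N \<theta> = (\<Sum>jk\<in>?S. cos (?d jk * \<theta>)) / real N" for \<theta>
  using arg_cong[OF FJ_double_sum[of N \<theta>], of Re] by simp
 have "(\<integral>\<^sup>+ y. ennreal (FJ N (x - y)) * indicator {0..2*pi} y \<partial>lborel) = ennreal (A (2*pi) - A 0)"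
 proof (rule nn_integral_FTC_Icc)
  show "DERIV A y :> FJ N (x - y)" for y
  proof -
   have "((\<lambda>y. if fst jk = snd jk then y else - sin (?d jk * (x - y)) / ?d jk) has_real_derivative cos (?d jk * (x - y))) (at y)" for jk
   proof (cases "fst jk = snd jk")
    case False
    define d where "d = ?d jk"
    have "d \<noteq> 0" using False by (simp add: d_def)
    hence "((\<lambda>y. - sin (d * (x - y)) / d) has_real_derivative cos (d * (x - y))) (at y)"
     by (auto intro!: derivative_eq_intros)
    thus ?thesis using False by (simp add: d_def)
   qed simp
   thus ?thesis unfolding A_def FJ_cos by (intro DERIV_cdivide DERIV_sum)
  qed
 qed (auto simp: FJ_nonneg)
 also have "A (2*pi) - A 0 = (\<Sum>jk\<in>?S. if fst jk = snd jk then 2 * pi else 0) / real N"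
 proof -
  have "sin (?d jk * (x - 2*pi)) = sin (?d jk * (x - 0))" for jk
  proof -
   have "sin (?d jk * x - 2 * pi * of_int (int (fst jk) - int (snd jk))) = sin (?d jk * x)"
    by (simp only: sin_diff cos_int_2pin sin_int_2pin)
   thus ?thesis by (simp add: algebra_simps)
  qed
  thus ?thesis unfolding A_def
   by (simp add: diff_divide_distrib[symmetric] sum_subtractf[symmetric] if_distrib cong: if_cong)
 qed
 also have "(\<Sum>jk\<in>?S. if fst jk = snd jk then 2 * pi else 0) = (\<Sum>j<N. \<Sum>k<N. if j = k then 2 * pi else 0)"
  unfolding sum.cartesian_product by (intro sum.cong) auto
 also have "\<dots> = real N * (2 * pi)" by simp
 finally show ?thesis using N by simp
qed

text \<open>The length of the chord between two points of the circle at angular distance \<open>\<theta>\<close>.\<close>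

definition cd :: "real \<Rightarrow> real" where
 "cd \<theta> = norm (cis \<theta> - 1)"

lemma cd_measurable[measurable]: "cd \<in> borel_measurable borel"
 unfolding cd_def by (intro borel_measurable_continuous_onI continuous_intros)

text \<open>By the geometric series, \<open>|\<Sum>_(k<N) z\<^sup>k| |z - 1| = |z\<^sup>N - 1| \<le> 2\<close>.\<close>

lemma cd_FJ:
 assumes "N > 0"
 shows "cd \<theta> * FJ N \<theta> \<le> 2" and "cd \<theta> > 0 \<Longrightarrow> cd \<theta> * FJ N \<theta> \<le> 4 / (real N * cd \<theta>)"
proof -
 define z where "z = cis \<theta>"
 have z: "norm z = 1" by (simp add: z_def)
 have sum: "(\<Sum>k<N. cis (real k * \<theta>)) = (\<Sum>k<N. z ^ k)"
  by (intro sum.cong refl) (simp add: z_def Complex.DeMoivre)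
 have geo: "(\<Sum>k<N. z ^ k) * (z - 1) = z ^ N - 1"
  using power_diff_1_eq[of z N] by (simp add: mult.commute)
 have "norm (z ^ N - 1) \<le> norm (z ^ N) + norm (1::complex)" by (rule norm_triangle_ineq4)
 hence le2: "norm (z ^ N - 1) \<le> 2" by (simp add: norm_power z)
 have FJ: "FJ N \<theta> = (norm (\<Sum>k<N. z ^ k))\<^sup>2 / real N" by (simp add: FJ_def sum)
 have S: "norm (\<Sum>k<N. z ^ k) \<le> real N"
  using norm_sum[of "\<lambda>k. z ^ k" "{..<N}"] by (simp add: norm_power z)
 have g2: "norm (\<Sum>k<N. z ^ k) * cd \<theta> = norm (z ^ N - 1)"
  by (simp add: cd_def z_def[symmetric] flip: geo norm_mult)
 have e: "cd \<theta> * FJ N \<theta> = norm (\<Sum>k<N. z ^ k) * (norm (\<Sum>k<N. z ^ k) * cd \<theta>) / real N"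
  by (simp add: FJ power2_eq_square)
 also have "\<dots> \<le> real N * 2 / real N"
  unfolding g2 using S le2 by (intro divide_right_mono mult_mono) auto
 finally show "cd \<theta> * FJ N \<theta> \<le> 2" using assms by simp
 assume c: "cd \<theta> > 0"
 have "cd \<theta> * FJ N \<theta> = (norm (\<Sum>k<N. z ^ k) * cd \<theta>)\<^sup>2 / (real N * cd \<theta>)"
  using c by (simp add: FJ power2_eq_square)
 also have "\<dots> \<le> 2\<^sup>2 / (real N * cd \<theta>)"
  unfolding g2 using le2 c by (intro divide_right_mono power_mono) auto
 finally show "cd \<theta> * FJ N \<theta> \<le> 4 / (real N * cd \<theta>)" by simp
qed

lemma cd_zero_countable: "AE y in lborel. cd (x - y) > 0"
proof -
 have "{y. cd (x - y) = 0} \<subseteq> (\<lambda>n::int. x - of_int n * (2 * pi)) ` UNIV"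
 proof
  fix y assume "y \<in> {y. cd (x - y) = 0}"
  hence "cis (x - y) = 1" by (simp add: cd_def)
  hence "cos (x - y) = 1" by (simp add: complex_eq_iff)
  then obtain n :: int where "x - y = of_int n * 2 * pi" using cos_one_2pi_int by blast
  thus "y \<in> (\<lambda>n::int. x - of_int n * (2 * pi)) ` UNIV" by (intro image_eqI[of _ _ n]) auto
 qed
 hence "countable {y. cd (x - y) = 0}" by (rule countable_subset) auto
 hence "AE y in lborel. y \<notin> {y. cd (x - y) = 0}" by (intro AE_not_in countable_imp_null_set_lborel)
 thus ?thesis by eventually_elim (auto simp: cd_def)
qed

lemma cd_FJ_tendsto: "(\<lambda>N. \<integral>\<^sup>+ y. ennreal (cd (x - y) * FJ (Suc N) (x - y)) * indicator {0..2*pi} y \<partial>lborel) \<longlonglongrightarrow> 0"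
proof -
 have "(\<lambda>N. \<integral>\<^sup>+ y. ennreal (cd (x - y) * FJ (Suc N) (x - y)) * indicator {0..2*pi} y \<partial>lborel) \<longlonglongrightarrow> (\<integral>\<^sup>+ y. 0 \<partial>(lborel :: real measure))"
 proof (rule nn_integral_dominated_convergence[where w="\<lambda>y. 2 * indicator {0..2*pi} y"])
  show "AE y in lborel. ennreal (cd (x - y) * FJ (Suc N) (x - y)) * indicator {0..2*pi} y \<le> 2 * indicator {0..2*pi} y" for N
   using cd_FJ(1)[of "Suc N"] by (intro AE_I2 mult_right_mono) (auto simp: ennreal_le_iff2 simp flip: ennreal_numeral intro!: ennreal_leI)
  show "(\<integral>\<^sup>+ y. 2 * indicator {0..2*pi} y \<partial>lborel) < \<infinity>"
   by (subst nn_integral_cmult_indicator) (auto simp: ennreal_mult_less_top)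
  show "AE y in lborel. (\<lambda>N. ennreal (cd (x - y) * FJ (Suc N) (x - y)) * indicator {0..2*pi} y) \<longlonglongrightarrow> 0"
   using cd_zero_countable[of x]
  proof eventually_elim
   case (elim y)
   let ?c = "cd (x - y)"
   have "(\<lambda>N. 4 / (real (Suc N) * ?c)) \<longlonglongrightarrow> 0"
    using LIMSEQ_Suc[OF lim_const_over_n[of "4 / ?c"]] elim by (simp add: field_simps)
   hence "(\<lambda>N. ?c * FJ (Suc N) (x - y)) \<longlonglongrightarrow> 0"
    by (rule Lim_null_comparison[rotated]) (use cd_FJ(2)[OF _ elim] elim FJ_nonneg in \<open>auto intro!: always_eventually simp del: of_nat_Suc\<close>)
   hence "(\<lambda>N. ennreal (?c * FJ (Suc N) (x - y))) \<longlonglongrightarrow> ennreal 0" by (rule tendsto_ennrealI)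
   thus ?case by (cases "y \<in> {0..2*pi}") auto
  qed
 qed auto
 thus ?thesis by simp
qed

section \<open>Fourier inversion\<close>

lemma sin_ge_linear:
 fixes u :: real
 assumes "0 \<le> u" "u \<le> pi / 2"
 shows "2 / pi * u \<le> sin u"
proof -
 have cv: "convex_on {0..pi} (\<lambda>u. - sin u)"
 proof (rule f''_ge0_imp_convex)
  show "DERIV (\<lambda>u. - sin u) x :> - cos x" for x by (auto intro!: derivative_eq_intros)
  show "DERIV (\<lambda>u. - cos u) x :> sin x" for x by (auto intro!: derivative_eq_intros)
  show "0 \<le> sin x" if "x \<in> {0..pi}" for x using that by (auto intro: sin_ge_zero)
 qed simp
 define t where "t = 2 * u / pi"
 have t: "0 \<le> t" "t \<le> 1" using assms by (auto simp: t_def field_simps)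
 have u: "u = (1 - t) *\<^sub>R 0 + t *\<^sub>R (pi / 2)" by (simp add: t_def field_simps)
 have "- sin u \<le> (1 - t) * (- sin 0) + t * (- sin (pi / 2))"
  using convex_onD[OF cv t, of 0 "pi/2"] by (simp only: u[symmetric]) simp
 thus ?thesis by (simp add: t_def)
qed

lemma cd_ge:
 assumes "\<bar>\<theta>\<bar> \<le> pi"
 shows "2 / pi * \<bar>\<theta>\<bar> \<le> cd \<theta>"
proof -
 have "(cd \<theta>)\<^sup>2 = (cos \<theta> - 1)\<^sup>2 + (sin \<theta>)\<^sup>2" by (simp add: cd_def cmod_power2)
 also have "\<dots> = 2 - 2 * cos \<theta>" using sin_cos_squared_add[of \<theta>] by (simp add: power2_eq_square algebra_simps)
 also have "cos \<theta> = 1 - 2 * (sin (\<theta> / 2))\<^sup>2" using cos_double_sin[of "\<theta> / 2"] by simp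
 finally have "(cd \<theta>)\<^sup>2 = (2 * \<bar>sin (\<theta> / 2)\<bar>)\<^sup>2" by (simp add: power_mult_distrib)
 hence e: "cd \<theta> = 2 * \<bar>sin (\<theta> / 2)\<bar>" by (rule power2_eq_imp_eq) (auto simp: cd_def)
 have "sin (\<bar>\<theta>\<bar> / 2) \<le> \<bar>sin (\<theta> / 2)\<bar>" by (simp add: abs_if)
 moreover have "2 / pi * (\<bar>\<theta>\<bar> / 2) \<le> sin (\<bar>\<theta>\<bar> / 2)" using assms by (intro sin_ge_linear) auto
 ultimately have "2 / pi * (\<bar>\<theta>\<bar> / 2) \<le> \<bar>sin (\<theta> / 2)\<bar>" by linarith
 thus ?thesis unfolding e by (simp add: field_simps)
qed

text \<open>Distances on the torus are measured by the chord \<open>cd\<close>, because \<open>cd_FJ_tendsto\<close> controls its mean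
against the Fejer kernel.\<close>

lemma schwartz_lipschitz:
 assumes f: "f \<in> schwartz"
 shows "\<exists>L\<ge>0. \<forall>t t' x x' y y'. x \<in> {0..2*pi} \<longrightarrow> x' \<in> {0..2*pi} \<longrightarrow> y \<in> {0..2*pi} \<longrightarrow> y' \<in> {0..2*pi} \<longrightarrow>
   norm (f (t', x', y') - f (t, x, y)) \<le> L * (\<bar>t - t'\<bar> + cd (x - x') + cd (y - y'))"
proof -
 have gf: "good f" by (rule schwartz_good[OF f])
 have per: "f (t, x + 2*pi, y) = f (t, x, y)" "f (t, x, y + 2*pi) = f (t, x, y)" for t x y
  using gf by (auto simp: good_def periodic_def)
 have ex: "\<exists>B\<ge>0. \<forall>p s. norm (f (p + s *\<^sub>R v) - f p) \<le> B * \<bar>s\<bar>" if v: "v \<in> Basis" for v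
 proof -
  obtain B where B: "\<And>p. norm (pd v f p) \<le> B" using schwartz_bounded[OF schwartz_pd[OF f v]] by blast
  have B0: "0 \<le> B" by (rule order_trans[OF norm_ge_zero B])
  have "norm (f (p + s *\<^sub>R v) - f p) \<le> B * \<bar>s\<bar>" for p s
  proof -
   have "norm ((\<lambda>s. f (p + s *\<^sub>R v)) s - (\<lambda>s. f (p + s *\<^sub>R v)) 0) \<le> B * norm (s - 0)"
   proof (rule differentiable_bound[of UNIV _ "\<lambda>s h. h *\<^sub>R pd v f (p + s *\<^sub>R v)"])
    show "((\<lambda>s. f (p + s *\<^sub>R v)) has_derivative (\<lambda>h. h *\<^sub>R pd v f (p + r *\<^sub>R v))) (at r)" for r
     using pd_vector_derivative[OF gf, of p v r UNIV] by (simp add: has_vector_derivative_def)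
    show "onorm (\<lambda>h. h *\<^sub>R pd v f (p + r *\<^sub>R v)) \<le> B" for r :: real
     by (rule onorm_le) (simp add: mult.commute[of B] mult_left_mono[OF B])
   qed auto
   thus ?thesis by simp
  qed
  thus ?thesis using B0 by blast
 qed
 obtain A where A: "A \<ge> 0" "\<And>p s. norm (f (p + s *\<^sub>R (1,0,0)) - f p) \<le> A * \<bar>s\<bar>"
  using ex[of "(1,0,0)"] by (auto simp: Basis_prod_def zero_prod_def)
 obtain B where B: "B \<ge> 0" "\<And>p s. norm (f (p + s *\<^sub>R (0,1,0)) - f p) \<le> B * \<bar>s\<bar>"
  using ex[of "(0,1,0)"] by (auto simp: Basis_prod_def zero_prod_def)
 obtain C where C: "C \<ge> 0" "\<And>p s. norm (f (p + s *\<^sub>R (0,0,1)) - f p) \<le> C * \<bar>s\<bar>"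
  using ex[of "(0,0,1)"] by (auto simp: Basis_prod_def zero_prod_def)
 have circ: "norm (g x' - g x) \<le> K * (pi / 2) * cd (x - x')"
  if g: "\<And>x s. norm (g (x + s) - g x) \<le> K * \<bar>s\<bar>" "\<And>x. g (x + 2*pi) = g x" "K \<ge> 0"
   and x: "x \<in> {0..2*pi}" "x' \<in> {0..2*pi}" for g :: "real \<Rightarrow> complex" and K x x'
 proof -
  have main: "norm (g x' - g x) \<le> K * (pi / 2) * cd (x - x')"
   if "\<bar>\<theta>\<bar> \<le> pi" "g x' = g (x + \<theta>)" "cd \<theta> = cd (x - x')" for \<theta>
  proof -
   have "norm (g x' - g x) \<le> K * \<bar>\<theta>\<bar>" using g(1)[of x \<theta>] that by simp
   also have "\<bar>\<theta>\<bar> \<le> pi / 2 * cd \<theta>" using cd_ge[OF that(1)] by (simp add: field_simps)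
   hence "K * \<bar>\<theta>\<bar> \<le> K * (pi / 2 * cd \<theta>)" using g(3) by (rule mult_left_mono)
   finally show ?thesis by (simp add: that(3) mult.assoc)
  qed
  have cdm: "cd (- \<theta>) = cd \<theta>" for \<theta>
  proof -
   have "cis (- \<theta>) - 1 = cnj (cis \<theta> - 1)" by (simp add: cis_cnj)
   thus ?thesis unfolding cd_def by (simp only: complex_mod_cnj)
  qed
  have cdp: "cd (\<theta> + 2*pi) = cd \<theta>" for \<theta> by (simp add: cd_def flip: cis_mult)
  consider "\<bar>x' - x\<bar> \<le> pi" | "x' - x > pi" | "x' - x < - pi" by linarith
  thus ?thesis
  proof cases
   case 1 thus ?thesis using main[of "x' - x"] cdm[of "x' - x"] by simp
  next
   case 2
   have "cd (x' - x - 2*pi) = cd (x - x')"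
    using cdp[of "x' - x - 2*pi"] cdm[of "x' - x"] by simp
   thus ?thesis using main[of "x' - x - 2*pi"] g(2)[of "x' - 2*pi"] 2 x by (auto simp: abs_le_iff)
  next
   case 3
   have "cd (x' - x + 2*pi) = cd (x - x')"
    using cdp[of "x' - x"] cdm[of "x' - x"] by simp
   thus ?thesis using main[of "x' - x + 2*pi"] g(2)[of "x'"] 3 x by (auto simp: abs_le_iff)
  qed
 qed
 define L where "L = A + B * (pi/2) + C * (pi/2)"
 have L: "L \<ge> 0" "A \<le> L" "B * (pi/2) \<le> L" "C * (pi/2) \<le> L" using A(1) B(1) C(1) by (auto simp: L_def)
 have "norm (f (t', x', y') - f (t, x, y)) \<le> L * (\<bar>t - t'\<bar> + cd (x - x') + cd (y - y'))"
  if xy: "x \<in> {0..2*pi}" "x' \<in> {0..2*pi}" "y \<in> {0..2*pi}" "y' \<in> {0..2*pi}" for t t' x x' y y'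
 proof -
  have 1: "norm (f (t', x', y') - f (t, x', y')) \<le> A * \<bar>t - t'\<bar>"
   using A(2)[of "(t, x', y')" "t' - t"] by (simp add: abs_minus_commute)
  have 2: "norm (f (t, x', y') - f (t, x, y')) \<le> B * (pi/2) * cd (x - x')"
  proof (rule circ[where g="\<lambda>x. f (t, x, y')"])
   show "norm (f (t, x + s, y') - f (t, x, y')) \<le> B * \<bar>s\<bar>" for x s using B(2)[of "(t, x, y')" s] by simp
  qed (use per B xy in auto)
  have 3: "norm (f (t, x, y') - f (t, x, y)) \<le> C * (pi/2) * cd (y - y')"
  proof (rule circ[where g="\<lambda>y. f (t, x, y)"])
   show "norm (f (t, x, y + s) - f (t, x, y)) \<le> C * \<bar>s\<bar>" for y s using C(2)[of "(t, x, y)" s] by simp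
  qed (use per C xy in auto)
  have "norm (f (t', x', y') - f (t, x, y)) \<le> A * \<bar>t - t'\<bar> + B * (pi/2) * cd (x - x') + C * (pi/2) * cd (y - y')"
   by (rule norm_diff_triangle_le[OF norm_diff_triangle_le[OF 1 2] 3])
  also have "\<dots> \<le> L * \<bar>t - t'\<bar> + L * cd (x - x') + L * cd (y - y')"
   using L by (intro add_mono mult_right_mono) (auto simp: cd_def)
  finally show ?thesis by (simp add: distrib_left)
 qed
 thus ?thesis using L(1) by blast
qed

lemma nn_integral_stm_product:
 assumes [measurable]: "a \<in> borel_measurable borel" "b \<in> borel_measurable borel" "c \<in> borel_measurable borel"
 shows "(\<integral>\<^sup>+ p. a (fst p) * b (fst (snd p)) * c (snd (snd p)) \<partial>stm) =
   (\<integral>\<^sup>+ t. a t \<partial>lborel) * (\<integral>\<^sup>+ x. b x * indicator {0..2*pi} x \<partial>lborel) * (\<integral>\<^sup>+ y. c y * indicator {0..2*pi} y \<partial>lborel)"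
proof -
 let ?b = "\<lambda>x. b x * indicator {0..2*pi} x" and ?c = "\<lambda>y. c y * indicator {0..2*pi} y"
 have "(\<integral>\<^sup>+ p. a (fst p) * b (fst (snd p)) * c (snd (snd p)) \<partial>stm) = (\<integral>\<^sup>+ t. (\<integral>\<^sup>+ z. a t * (b (fst z) * c (snd z) * indicator torus_cell z) \<partial>lborel) \<partial>lborel)"
  by (subst nn_integral_stm) (auto simp: mult.assoc)
 also have "\<dots> = (\<integral>\<^sup>+ t. (\<integral>\<^sup>+ z. a t * (?b (fst z) * ?c (snd z)) \<partial>(lborel \<Otimes>\<^sub>M lborel)) \<partial>lborel)"
  unfolding lborel_prod by (intro nn_integral_cong) (auto simp: torus_cell_def indicator_def)
 also have "\<dots> = (\<integral>\<^sup>+ t. a t * (\<integral>\<^sup>+ z. (?b (fst z) * ?c (snd z)) \<partial>(lborel \<Otimes>\<^sub>M lborel)) \<partial>lborel)"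
  by (subst nn_integral_cmult) auto
 also have "\<dots> = (\<integral>\<^sup>+ t. a t \<partial>lborel) * (\<integral>\<^sup>+ z. (?b (fst z) * ?c (snd z)) \<partial>(lborel \<Otimes>\<^sub>M lborel))"
  by (rule nn_integral_multc) measurable
 also have "(\<integral>\<^sup>+ z. (?b (fst z) * ?c (snd z)) \<partial>(lborel \<Otimes>\<^sub>M lborel)) = (\<integral>\<^sup>+ x. (\<integral>\<^sup>+ y. ?b x * ?c y \<partial>lborel) \<partial>lborel)"
  by (subst lborel.nn_integral_fst[symmetric]) auto
 also have "\<dots> = (\<integral>\<^sup>+ x. ?b x * (\<integral>\<^sup>+ y. ?c y \<partial>lborel) \<partial>lborel)"
  by (subst nn_integral_cmult) auto
 also have "\<dots> = (\<integral>\<^sup>+ x. ?b x \<partial>lborel) * (\<integral>\<^sup>+ y. ?c y \<partial>lborel)"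
  by (rule nn_integral_multc) measurable
 finally show ?thesis by (simp add: mult.assoc)
qed

lemma (in pair_sigma_finite) integrable_product:
 fixes f :: "'a \<Rightarrow> complex" and g :: "'b \<Rightarrow> complex"
 assumes f: "integrable M1 f" and g: "integrable M2 g"
 shows "integrable (M1 \<Otimes>\<^sub>M M2) (\<lambda>p. f (fst p) * g (snd p))"
  and "(\<integral>p. f (fst p) * g (snd p) \<partial>(M1 \<Otimes>\<^sub>M M2)) = (\<integral>x. f x \<partial>M1) * (\<integral>y. g y \<partial>M2)"
proof -
 have [measurable]: "f \<in> borel_measurable M1" "g \<in> borel_measurable M2" using f g by auto
 show i: "integrable (M1 \<Otimes>\<^sub>M M2) (\<lambda>p. f (fst p) * g (snd p))"
 proof (rule Fubini_integrable)
  show "integrable M1 (\<lambda>x. \<integral>y. norm (f (fst (x, y)) * g (snd (x, y))) \<partial>M2)"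
   using f by (simp add: norm_mult integrable_norm)
  show "AE x in M1. integrable M2 (\<lambda>y. f (fst (x, y)) * g (snd (x, y)))"
   using g by simp
 qed measurable
 show "(\<integral>p. f (fst p) * g (snd p) \<partial>(M1 \<Otimes>\<^sub>M M2)) = (\<integral>x. f x \<partial>M1) * (\<integral>y. g y \<partial>M2)"
  by (subst integral_fst'[OF i, symmetric]) simp
qed

text \<open>The product of the multipliers in all three frequencies, and its inverse transform.\<close>

definition KN :: "nat \<Rightarrow> freqpt \<Rightarrow> complex" where
 "KN N q = of_real (gk (1 / real N) (fst q)) * of_real (wN N (fst (snd q)) * wN N (snd (snd q)))"

definition kN :: "nat \<Rightarrow> real \<times> real \<times> real \<Rightarrow> real" where
 "kN N s = GK (1 / real N) (fst s) * FJ N (fst (snd s)) * FJ N (snd (snd s))"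

lemma KN_finite_support: "finite {n. complex_of_real (wN N (fst n) * wN N (snd n)) * h n \<noteq> 0}"
proof (rule finite_subset)
 show "{n. complex_of_real (wN N (fst n) * wN N (snd n)) * h n \<noteq> 0} \<subseteq> {- int N..int N} \<times> {- int N..int N}"
  using wN_zero[of N] by (force simp: mem_Times_iff)
qed simp

lemma KN_integral:
 assumes N: "N > 0"
 shows "fint (\<lambda>q. KN N q * chr q s)"
  and "(\<integral>q. KN N q * chr q s \<partial>freq_measure) = of_real (kN N s)"
proof -
 define a where "a = (\<lambda>l. of_real (gk (1 / real N) l) * cis (l * fst s))"
 define b where "b = (\<lambda>n. of_real (wN N (fst n) * wN N (snd n)) * cis (freq n \<bullet> snd s))"
 have eq: "(\<lambda>q. KN N q * chr q s) = (\<lambda>q. a (fst q) * b (snd q))"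
  by (auto simp: KN_def chr_def a_def b_def fun_eq_iff mult_ac cis_mult[symmetric])
 have ia: "integrable lborel a"
  unfolding a_def
  by (rule Bochner_Integration.integrable_bound[OF gk_integrable[of "1 / real N"]])
    (use N in \<open>auto simp: norm_mult intro!: borel_measurable_times borel_measurable_of_real borel_measurable_continuous_onI[of "\<lambda>l. cis (l * c)" for c] continuous_intros\<close>)
 have fin: "finite {n. b n \<noteq> 0}" unfolding b_def by (rule KN_finite_support)
 have ib: "integrable (count_space UNIV) b" 
  by (rule integrableI_bounded) (use fin in \<open>auto simp: nn_integral_count_space\<close>)
 have intb: "(\<integral>n. b n \<partial>count_space UNIV) = of_real (FJ N (fst (snd s)) * FJ N (snd (snd s)))"
 proof -
  let ?D = "{- int N..int N}"
  have "(\<integral>n. b n \<partial>count_space UNIV) = (\<Sum>n | n \<in> UNIV \<and> b n \<noteq> 0. b n)"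
   by (rule lebesgue_integral_count_space_finite_support) (use fin in simp)
  also have "\<dots> = (\<Sum>n\<in>?D \<times> ?D. b n)"
  proof (rule sum.mono_neutral_left)
   show "{n. n \<in> UNIV \<and> b n \<noteq> 0} \<subseteq> ?D \<times> ?D" using wN_zero[of N] by (force simp: mem_Times_iff b_def)
  qed auto
  also have "\<dots> = (\<Sum>i\<in>?D. \<Sum>j\<in>?D. (of_real (wN N i) * cis (real_of_int i * fst (snd s))) * (of_real (wN N j) * cis (real_of_int j * snd (snd s))))"
   by (simp add: sum.cartesian_product split_beta' b_def freq_def inner_prod_def cis_mult[symmetric] mult_ac)
  also have "\<dots> = of_real (FJ N (fst (snd s))) * of_real (FJ N (snd (snd s)))"
   by (simp add: sum_product[symmetric] wN_sum)
  finally show ?thesis by simp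
 qed
 show "fint (\<lambda>q. KN N q * chr q s)"
  unfolding eq freq_measure_def by (rule freq_pair.integrable_product(1)[OF ia ib])
 have "(\<integral>q. KN N q * chr q s \<partial>freq_measure) = (\<integral>l. a l \<partial>lborel) * (\<integral>n. b n \<partial>count_space UNIV)"
  unfolding eq freq_measure_def by (rule freq_pair.integrable_product(2)[OF ia ib])
 also have "\<dots> = of_real (kN N s)"
  using N by (simp add: intb a_def gk_ft kN_def)
 finally show "(\<integral>q. KN N q * chr q s \<partial>freq_measure) = of_real (kN N s)" .
qed

lemma KN_bound: "norm (KN N q) \<le> 1"
 unfolding KN_def norm_mult norm_of_real
 using gk_nonneg gk_le_1 wN_nonneg wN_le_1 by (simp add: abs_mult mult_le_one)

lemma KN_tendsto: "(\<lambda>N. KN (Suc N) q) \<longlonglongrightarrow> 1"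
proof -
 have "(\<lambda>N. gk (1 / real (Suc N)) (fst q)) \<longlonglongrightarrow> exp (- (0 * fst q)\<^sup>2 / 2)"
  unfolding gk_exp by (intro tendsto_intros LIMSEQ_Suc[OF lim_const_over_n]) auto
 hence "(\<lambda>N. complex_of_real (gk (1 / real (Suc N)) (fst q)) * of_real (wN (Suc N) (fst (snd q)) * wN (Suc N) (snd (snd q)))) \<longlonglongrightarrow> of_real 1 * of_real (1 * 1)"
  by (intro tendsto_intros wN_tendsto) simp
 thus ?thesis by (simp add: KN_def)
qed

lemma kN_nonneg: "N > 0 \<Longrightarrow> 0 \<le> kN N s"
 unfolding kN_def by (intro mult_nonneg_nonneg GK_nonneg FJ_nonneg) auto

lemma kN_measurable[measurable]: "kN N \<in> borel_measurable borel"
proof -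
 show ?thesis unfolding kN_def by measurable
qed

lemma kN_total:
 assumes N: "N > 0"
 shows "(\<integral>\<^sup>+ p'. ennreal (kN N (p - p')) \<partial>stm) = ennreal ((2*pi)^3)"
proof -
 have "(\<integral>\<^sup>+ p'. ennreal (kN N (p - p')) \<partial>stm) = (\<integral>\<^sup>+ p'. ennreal (GK (1 / real N) (fst p - fst p')) * ennreal (FJ N (fst (snd p) - fst (snd p'))) * ennreal (FJ N (snd (snd p) - snd (snd p'))) \<partial>stm)"
  using N by (simp add: kN_def ennreal_mult GK_nonneg FJ_nonneg)
 also have "\<dots> = ennreal (2*pi) * ennreal (2*pi) * ennreal (2*pi)"
  by (subst nn_integral_stm_product[of "\<lambda>t. ennreal (GK (1 / real N) (fst p - t))" "\<lambda>x. ennreal (FJ N (fst (snd p) - x))" "\<lambda>y. ennreal (FJ N (snd (snd p) - y))"])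
    (use N in \<open>auto simp: nn_integral_GK(1) nn_integral_FJ\<close>)
 also have "\<dots> = ennreal ((2*pi)^3)"
  unfolding power3_eq_cube by (subst ennreal_mult[symmetric], simp, simp, subst ennreal_mult[symmetric]) auto
 finally show ?thesis .
qed

lemma chr_diff: "chr q (p - p') = chr q p * chr (- q) p'"
 by (simp add: chr_def cis_mult inner_diff_right freq_minus algebra_simps)

lemma chr_0[simp]: "chr 0 p = 1" "chr q 0 = 1"
 by (simp_all add: chr_def freq_def inner_prod_def)

lemma cnj_borel[measurable]: "cnj \<in> borel_measurable borel"
 by (intro borel_measurable_continuous_onI continuous_intros)

lemma distr_freq_reflect: "distr freq_measure freq_measure (\<lambda>q. a - q) = freq_measure"
proof (rule measure_eqI)
 fix A assume "A \<in> sets (distr freq_measure freq_measure (\<lambda>q. a - q))"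
 hence A[measurable]: "A \<in> sets freq_measure" by simp
 have "emeasure (distr freq_measure freq_measure (\<lambda>q. a - q)) A = (\<integral>\<^sup>+ q. indicator A q \<partial>distr freq_measure freq_measure (\<lambda>q. a - q))"
  by simp
 also have "\<dots> = (\<oint> q. indicator A (a - q))" by (rule nn_integral_distr) measurable
 also have "\<dots> = emeasure freq_measure A" by (subst nn_integral_freq_reflect) auto
 finally show "emeasure (distr freq_measure freq_measure (\<lambda>q. a - q)) A = emeasure freq_measure A" .
qed simp

lemma integral_freq_reflect:
 fixes G :: "freqpt \<Rightarrow> 'b::{banach, second_countable_topology}"
 assumes [measurable]: "fmeas G"
 shows "(\<integral>q. G (a - q) \<partial>freq_measure) = (\<integral>q. G q \<partial>freq_measure)"
proof -
 have "(\<integral>q. G q \<partial>distr freq_measure freq_measure (\<lambda>q. a - q)) = (\<integral>q. G (a - q) \<partial>freq_measure)"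
  by (rule integral_distr) measurable
 thus ?thesis by (simp add: distr_freq_reflect)
qed

lemma integrable_freq_reflect:
 fixes G :: "freqpt \<Rightarrow> 'b::{banach, second_countable_topology}"
 assumes "fint G"
 shows "fint (\<lambda>q. G (a - q))"
proof -
 have [measurable]: "fmeas G" using assms by auto
 have "integrable (distr freq_measure freq_measure (\<lambda>q. a - q)) G = fint (\<lambda>q. G (a - q))"
  by (rule integrable_distr_eq) measurable
 thus ?thesis using assms by (simp add: distr_freq_reflect)
qed

lemma integrable_freq_chr:
 fixes G :: "freqpt \<Rightarrow> complex"
 assumes "fint G"
 shows "fint (\<lambda>q. G q * chr q p)"
 using assms by (rule Bochner_Integration.integrable_bound) (use assms in \<open>auto simp: norm_mult\<close>)

text \<open>The common source of Parseval's identity and of the inversion formula: only an exchange of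
integrals.\<close>

lemma fubini_ft:
 assumes G: "fint G" and r: "integrable stm r"
 shows "(\<integral>q. G q * ft r q \<partial>freq_measure) = (\<integral>p. r p * (\<integral>q. G q * chr (- q) p \<partial>freq_measure) \<partial>stm)"
proof -
 have [measurable]: "fmeas G" "smeas r" using G r by auto
 have i: "integrable (freq_measure \<Otimes>\<^sub>M stm) (\<lambda>(q, p). G q * r p * chr (- q) p)"
 proof (rule Bochner_Integration.integrable_bound[OF freq_stm.integrable_product(1)[OF G r]])
  have "(\<lambda>x. G (fst x) * r (snd x) * cnj (chr (fst x) (snd x))) \<in> borel_measurable (freq_measure \<Otimes>\<^sub>M stm)" by measurable
  thus "(\<lambda>(q, p). G q * r p * chr (- q) p) \<in> borel_measurable (freq_measure \<Otimes>\<^sub>M stm)" by (simp add: split_beta' chr_uminus)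
 qed (auto simp: norm_mult)
 have "(\<integral>q. G q * ft r q \<partial>freq_measure) = (\<integral>q. (\<integral>p. G q * r p * chr (- q) p \<partial>stm) \<partial>freq_measure)"
  by (simp add: ft_eq mult.assoc)
 also have "\<dots> = (\<integral>p. (\<integral>q. G q * r p * chr (- q) p \<partial>freq_measure) \<partial>stm)"
  by (rule freq_stm.Fubini_integral[OF i, symmetric])
 also have "\<dots> = (\<integral>p. (\<integral>q. r p * (G q * chr (- q) p) \<partial>freq_measure) \<partial>stm)"
  by (simp only: mult_ac)
 finally show ?thesis by simp
qed

definition ift :: "(freqpt \<Rightarrow> complex) \<Rightarrow> spacetime \<Rightarrow> complex" where
 "ift G p = (\<integral>q. G q * chr q p \<partial>freq_measure)"

lemma parseval:
 assumes G: "fint G" and r: "integrable stm r"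
 shows "(\<integral>p. r p * ift G p \<partial>stm) = (\<integral>q. G q * ft r (- q) \<partial>freq_measure)"
proof -
 have [measurable]: "fmeas G" "smeas r" using G r by auto
 have i: "fint (\<lambda>q. G (- q))" using integrable_freq_reflect[OF G, of 0] by simp
 have "(\<integral>q. G (- q) * chr (- q) p \<partial>freq_measure) = ift G p" for p
  unfolding ift_def using integral_freq_reflect[of "\<lambda>q. G q * chr q p" 0] by simp
 hence "(\<integral>p. r p * ift G p \<partial>stm) = (\<integral>q. G (- q) * ft r q \<partial>freq_measure)"
  using fubini_ft[OF i r] by simp
 also have "\<dots> = (\<integral>q. G q * ft r (- q) \<partial>freq_measure)"
  using integral_freq_reflect[of "\<lambda>q. G q * ft r (- q)" 0] by simp
 finally show ?thesis .
qed

lemma ift_smoothed: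
 assumes f: "f \<in> schwartz" and N: "N > 0"
 shows "(\<integral>q. KN N q * (ft f q * chr q p) \<partial>freq_measure) = (\<integral>p'. f p' * of_real (kN N (p - p')) \<partial>stm)"
proof -
 have "(\<integral>q. KN N q * (ft f q * chr q p) \<partial>freq_measure) = (\<integral>q. (KN N q * chr q p) * ft f q \<partial>freq_measure)"
  by (simp only: mult_ac)
 also have "\<dots> = (\<integral>p'. f p' * (\<integral>q. KN N q * chr q p * chr (- q) p' \<partial>freq_measure) \<partial>stm)"
  by (rule fubini_ft[OF KN_integral(1)[OF N] schwartz_integrable[OF f]])
 also have "\<dots> = (\<integral>p'. f p' * of_real (kN N (p - p')) \<partial>stm)"
  by (simp add: mult.assoc flip: chr_diff KN_integral(2)[OF N])
 finally show ?thesis .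
qed

text \<open>The kernel is a product, and in each of the three coordinates the mean distance from \<open>p\<close> tends to \<open>0\<close>.\<close>

lemma kN_concentrates:
 assumes p: "p \<in> space stm"
 shows "(\<lambda>N. \<integral>\<^sup>+ p'. ennreal ((\<bar>fst p - fst p'\<bar> + cd (fst (snd p) - fst (snd p')) + cd (snd (snd p) - snd (snd p'))) * kN (Suc N) (p - p')) \<partial>stm) \<longlonglongrightarrow> 0"
proof -
 obtain t x y where pe: "p = (t, x, y)" by (cases p) auto
 define a0 where "a0 = (\<lambda>N s. ennreal (GK (1 / real (Suc N)) (t - s)))"
 define a1 where "a1 = (\<lambda>N s. ennreal (\<bar>t - s\<bar> * GK (1 / real (Suc N)) (t - s)))"
 define b0 where "b0 = (\<lambda>N z s. ennreal (FJ (Suc N) (z - s)))"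
 define b1 where "b1 = (\<lambda>N z s. ennreal (cd (z - s) * FJ (Suc N) (z - s)))"
 have m[measurable]: "a0 N \<in> borel_measurable borel" "a1 N \<in> borel_measurable borel" "b0 N z \<in> borel_measurable borel" "b1 N z \<in> borel_measurable borel" for N z
  unfolding a0_def a1_def b0_def b1_def by measurable
 define m where "m = (\<integral>x. std_normal_density x * \<bar>x\<bar> \<partial>lborel)"
 define X where "X = (\<lambda>z N. \<integral>\<^sup>+ s. b1 N z s * indicator {0..2*pi} s \<partial>lborel)"
 let ?c = "ennreal (2*pi)"
 have I: "(\<integral>\<^sup>+ s. a0 N s \<partial>lborel) = ?c" "(\<integral>\<^sup>+ s. a1 N s \<partial>lborel) = ennreal (1 / real (Suc N) * (2*pi*m))"
  "(\<integral>\<^sup>+ s. b0 N z s * indicator {0..2*pi} s \<partial>lborel) = ?c" for N z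
  unfolding a0_def a1_def b0_def m_def by (simp_all only: nn_integral_GK zero_less_divide_iff zero_less_one of_nat_0_less_iff zero_less_Suc simp_thms nn_integral_FJ)
 have E: "(\<integral>\<^sup>+ p'. ennreal ((\<bar>fst p - fst p'\<bar> + cd (fst (snd p) - fst (snd p')) + cd (snd (snd p) - snd (snd p'))) * kN (Suc N) (p - p')) \<partial>stm)
   = (?c * ?c) * ennreal (1 / real (Suc N) * (2*pi*m)) + (?c * ?c) * X x N + (?c * ?c) * X y N" for N
 proof -
  have "ennreal ((\<bar>fst p - fst p'\<bar> + cd (fst (snd p) - fst (snd p')) + cd (snd (snd p) - snd (snd p'))) * kN (Suc N) (p - p'))
   = a1 N (fst p') * b0 N x (fst (snd p')) * b0 N y (snd (snd p')) + a0 N (fst p') * b1 N x (fst (snd p')) * b0 N y (snd (snd p'))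
    + a0 N (fst p') * b0 N x (fst (snd p')) * b1 N y (snd (snd p'))" for p'
  proof -
   have g: "0 \<le> GK (1 / real (Suc N)) (t - fst p')" by (rule GK_nonneg) simp
   have c: "0 \<le> cd u" for u by (simp add: cd_def)
   show ?thesis unfolding pe kN_def a0_def a1_def b0_def b1_def using g c FJ_nonneg
    by (simp add: algebra_simps flip: ennreal_mult ennreal_plus del: of_nat_Suc)
  qed
  hence "(\<integral>\<^sup>+ p'. ennreal ((\<bar>fst p - fst p'\<bar> + cd (fst (snd p) - fst (snd p')) + cd (snd (snd p) - snd (snd p'))) * kN (Suc N) (p - p')) \<partial>stm)
   = (\<integral>\<^sup>+ p'. a1 N (fst p') * b0 N x (fst (snd p')) * b0 N y (snd (snd p')) \<partial>stm) + (\<integral>\<^sup>+ p'. a0 N (fst p') * b1 N x (fst (snd p')) * b0 N y (snd (snd p')) \<partial>stm)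
    + (\<integral>\<^sup>+ p'. a0 N (fst p') * b0 N x (fst (snd p')) * b1 N y (snd (snd p')) \<partial>stm)"
   by (simp add: nn_integral_add)
  hence "(\<integral>\<^sup>+ p'. ennreal ((\<bar>fst p - fst p'\<bar> + cd (fst (snd p) - fst (snd p')) + cd (snd (snd p) - snd (snd p'))) * kN (Suc N) (p - p')) \<partial>stm)
   = ennreal (1 / real (Suc N) * (2*pi*m)) * ?c * ?c + ?c * X x N * ?c + ?c * ?c * X y N"
   unfolding nn_integral_stm_product[OF m(2) m(3) m(3)] nn_integral_stm_product[OF m(1) m(4) m(3)] nn_integral_stm_product[OF m(1) m(3) m(4)] I X_def .
  thus ?thesis by (simp only: mult_ac)
 qed
 have cf: "?c * ?c < top" by (simp add: ennreal_mult_less_top)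
 have X0: "X z \<longlonglongrightarrow> 0" for z unfolding X_def b1_def by (rule cd_FJ_tendsto)
 have "(\<lambda>N. 1 / real (Suc N) * (2*pi*m)) \<longlonglongrightarrow> 0 * (2*pi*m)"
  by (intro tendsto_mult tendsto_const LIMSEQ_Suc[OF lim_const_over_n])
 hence A0: "(\<lambda>N. ennreal (1 / real (Suc N) * (2*pi*m))) \<longlonglongrightarrow> 0"
  using tendsto_ennrealI by fastforce
 have "(\<lambda>N. (?c * ?c) * ennreal (1 / real (Suc N) * (2*pi*m)) + (?c * ?c) * X x N + (?c * ?c) * X y N) \<longlonglongrightarrow> (?c * ?c) * 0 + (?c * ?c) * 0 + (?c * ?c) * 0"
  by (intro tendsto_add ennreal_tendsto_cmult cf A0 X0)
 thus ?thesis unfolding E by simp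
qed

text \<open>Inserting the multiplier \<open>KN\<close>, which tends to \<open>1\<close>, turns the inversion integral into a mean of \<open>f\<close>
with respect to \<open>(2\<pi>)\<^sup>3\<close> times a probability density that concentrates at \<open>p\<close>.\<close>

lemma fourier_inversion:
 assumes f: "f \<in> schwartz" and p: "p \<in> space stm"
 shows "f p = of_real (1 / (2*pi)^3) * ift (ft f) p"
proof -
 define S where "S = (\<lambda>N. \<integral>q. KN (Suc N) q * (ft f q * chr q p) \<partial>freq_measure)"
 have fti: "fint (ft f)" by (rule ft_integrable[OF f])
 hence [measurable]: "fmeas (ft f)" by auto
 have [measurable]: "smeas f" by (intro measurable_stm schwartz_borel f)
 have K[measurable]: "fmeas (KN N)" if "N > 0" for N
  using KN_integral(1)[OF that, of 0] by auto
 have "S \<longlonglongrightarrow> ift (ft f) p" unfolding S_def ift_def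
 proof (rule integral_dominated_convergence)
  show "fint (\<lambda>q. norm (ft f q))" using fti by simp
  show "AE q in freq_measure. (\<lambda>N. KN (Suc N) q * (ft f q * chr q p)) \<longlonglongrightarrow> ft f q * chr q p"
   using tendsto_mult[OF KN_tendsto tendsto_const] by (intro AE_I2) fastforce
  show "AE q in freq_measure. norm (KN (Suc N) q * (ft f q * chr q p)) \<le> norm (ft f q)" for N
   using KN_bound by (intro AE_I2) (simp add: norm_mult mult_left_le_one_le)
 qed measurable
 moreover have "S \<longlonglongrightarrow> of_real ((2*pi)^3) * f p"
 proof -
  obtain L where L: "L \<ge> 0" "\<And>t t' x x' y y'. x \<in> {0..2*pi} \<Longrightarrow> x' \<in> {0..2*pi} \<Longrightarrow> y \<in> {0..2*pi} \<Longrightarrow> y' \<in> {0..2*pi} \<Longrightarrow>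
   norm (f (t', x', y') - f (t, x, y)) \<le> L * (\<bar>t - t'\<bar> + cd (x - x') + cd (y - y'))"
   using schwartz_lipschitz[OF f] by blast
  define W where "W = (\<lambda>p'. \<bar>fst p - fst p'\<bar> + cd (fst (snd p) - fst (snd p')) + cd (snd (snd p) - snd (snd p')))"
  define J where "J = (\<lambda>N. \<integral>\<^sup>+ p'. ennreal (W p' * kN (Suc N) (p - p')) \<partial>stm)"
  have LW: "norm (f p' - f p) \<le> L * W p'" if "p' \<in> space stm" for p'
   using L(2)[of "fst (snd p)" "fst (snd p')" "snd (snd p)" "snd (snd p')" "fst p'" "fst p"] that p
   by (auto simp: space_stm torus_cell_def W_def mem_Times_iff)
  have [measurable]: "(\<lambda>p'. kN N (p - p')) \<in> borel_measurable stm" "smeas W" for N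
  proof -
   show "(\<lambda>p'. kN N (p - p')) \<in> borel_measurable stm" by (intro measurable_stm) measurable
   show "smeas W" unfolding W_def by measurable
  qed
  have bd: "ennreal (norm (S N - of_real ((2*pi)^3) * f p)) \<le> ennreal L * J N" for N
  proof -
   let ?k = "\<lambda>p'. kN (Suc N) (p - p')"
   have k0: "0 \<le> ?k p'" for p' by (rule kN_nonneg) simp
   have kt: "(\<integral>\<^sup>+ p'. ennreal (?k p') \<partial>stm) = ennreal ((2*pi)^3)" by (rule kN_total) simp
   have ki: "integrable stm ?k" by (rule integrableI_nonneg) (use k0 kt in \<open>auto\<close>)
   have kI: "(\<integral>p'. ?k p' \<partial>stm) = (2*pi)^3"
    using nn_integral_eq_integral[OF ki] k0 kt by (simp add: integral_nonneg_AE)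
   obtain B where B: "\<And>p. norm (f p) \<le> B" using schwartz_bounded[OF f] by blast
   have fk: "integrable stm (\<lambda>p'. f p' * of_real (?k p'))"
    by (rule Bochner_Integration.integrable_bound[OF integrable_mult_right[OF ki, of B]])
      (use B k0 in \<open>auto simp: norm_mult intro!: mult_right_mono order_trans[OF _ abs_ge_self]\<close>)
   have ck: "integrable stm (\<lambda>p'. f p * of_real (?k p'))" using ki by auto
   have "S N - of_real ((2*pi)^3) * f p = (\<integral>p'. f p' * of_real (?k p') \<partial>stm) - (\<integral>p'. f p * of_real (?k p') \<partial>stm)"
   proof -
    have "S N = (\<integral>p'. f p' * of_real (?k p') \<partial>stm)" unfolding S_def by (rule ift_smoothed[OF f]) simp
    moreover have "(\<integral>p'. f p * of_real (?k p') \<partial>stm) = f p * of_real ((2*pi)^3)"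
     unfolding kI[symmetric] by simp
    ultimately show ?thesis by (simp only: mult.commute)
   qed
   also have "\<dots> = (\<integral>p'. (f p' - f p) * of_real (?k p') \<partial>stm)"
    unfolding left_diff_distrib by (rule Bochner_Integration.integral_diff[OF fk ck, symmetric])
   finally have "ennreal (norm (S N - of_real ((2*pi)^3) * f p)) \<le> (\<integral>\<^sup>+ p'. ennreal (norm ((f p' - f p) * of_real (?k p'))) \<partial>stm)"
    using integral_norm_bound_ennreal[of stm "\<lambda>p'. (f p' - f p) * of_real (?k p')"] fk ck by (simp add: left_diff_distrib)
   also have "\<dots> \<le> (\<integral>\<^sup>+ p'. ennreal L * ennreal (W p' * ?k p') \<partial>stm)"
   proof (rule nn_integral_mono)
    fix p' assume p': "p' \<in> space stm"
    have "norm ((f p' - f p) * of_real (?k p')) \<le> L * W p' * ?k p'"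
     using mult_right_mono[OF LW[OF p'] k0] k0 by (simp add: norm_mult)
    moreover have "0 \<le> W p'" by (simp add: W_def cd_def)
    ultimately show "ennreal (norm ((f p' - f p) * of_real (?k p'))) \<le> ennreal L * ennreal (W p' * ?k p')"
     using L(1) k0 by (simp add: mult.assoc flip: ennreal_mult)
   qed
   also have "\<dots> = ennreal L * J N" unfolding J_def by (rule nn_integral_cmult) measurable
   finally show ?thesis .
  qed
  have "(\<lambda>N. ennreal L * J N) \<longlonglongrightarrow> ennreal L * 0"
   unfolding J_def W_def by (intro ennreal_tendsto_cmult kN_concentrates[OF p]) simp
  hence "(\<lambda>N. ennreal L * J N) \<longlonglongrightarrow> 0" by simp
  hence "(\<lambda>N. ennreal (norm (S N - of_real ((2*pi)^3) * f p))) \<longlonglongrightarrow> 0"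
  proof (rule tendsto_sandwich[where f="\<lambda>_. 0" and h="\<lambda>N. ennreal L * J N", rotated 3])
   show "\<forall>\<^sub>F N in sequentially. 0 \<le> ennreal (norm (S N - of_real ((2*pi)^3) * f p))" by simp
   show "\<forall>\<^sub>F N in sequentially. ennreal (norm (S N - of_real ((2*pi)^3) * f p)) \<le> ennreal L * J N"
    by (intro always_eventually allI bd)
  qed simp_all
  hence "(\<lambda>N. norm (S N - of_real ((2*pi)^3) * f p)) \<longlonglongrightarrow> 0"
   using tendsto_ennreal_iff[of "\<lambda>N. norm (S N - of_real ((2*pi)^3) * f p)" sequentially 0] by simp
  thus ?thesis by (simp add: tendsto_norm_zero_iff LIM_zero_iff)
 qed
 ultimately have "ift (ft f) p = of_real ((2*pi)^3) * f p" by (rule LIMSEQ_unique)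
 thus ?thesis by (simp add: field_simps)
qed

lemma integrable_mult_bounded:
 fixes r g :: "'a \<Rightarrow> complex"
 assumes r: "integrable M r" and [measurable]: "g \<in> borel_measurable M" and g: "\<And>x. norm (g x) \<le> B"
 shows "integrable M (\<lambda>x. r x * g x)"
proof (rule Bochner_Integration.integrable_bound[OF integrable_mult_right[OF integrable_norm[OF r], of B]])
 have "0 \<le> B" by (rule order_trans[OF norm_ge_zero g])
 thus "AE x in M. norm (r x * g x) \<le> norm (B * norm (r x))"
  using g by (intro AE_I2) (simp add: norm_mult mult.commute[of "norm (r _)"] mult_right_mono)
qed (use r in measurable)

lemma integral_schwartz_product:
 assumes r: "integrable stm r" and f: "f \<in> schwartz"
 shows "(\<integral>p. r p * f p \<partial>stm) = of_real (1 / (2*pi)^3) * (\<integral>q. ft f q * ft r (- q) \<partial>freq_measure)"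
proof -
 have "(\<integral>p. r p * f p \<partial>stm) = (\<integral>p. of_real (1 / (2*pi)^3) * (r p * ift (ft f) p) \<partial>stm)"
  using fourier_inversion[OF f] by (intro Bochner_Integration.integral_cong) (auto simp: mult_ac)
 also have "\<dots> = of_real (1 / (2*pi)^3) * (\<integral>p. r p * ift (ft f) p \<partial>stm)" by simp
 finally show ?thesis by (simp only: parseval[OF ft_integrable[OF f] r])
qed

text \<open>An integrable function need not have an integrable Fourier transform; but it is tested against
Schwartz functions, and these can be inverted.\<close>

lemma has_fourier_dist_of:
 assumes r: "integrable stm r"
 shows "has_fourier (dist_of r) (ft r)"
 unfolding has_fourier_def
proof (intro conjI ballI)
 have [measurable]: "smeas r" using r by auto
 show m[measurable]: "fmeas (ft r)" by simp
 fix \<phi> :: "spacetime \<Rightarrow> complex" assume \<phi>: "\<phi> \<in> schwartz"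
 have i: "fint (ft \<phi>)" by (rule ft_integrable[OF \<phi>])
 hence [measurable]: "fmeas (ft \<phi>)" by auto
 have eq: "(\<lambda>(l, n). ft r (l, n) * fourier \<phi> (- l) (- n)) = (\<lambda>q. ft \<phi> (0 - q) * ft r q)"
  by (auto simp: ft_def fun_eq_iff mult.commute)
 show "fint (\<lambda>(l, n). ft r (l, n) * fourier \<phi> (- l) (- n))"
  unfolding eq by (rule integrable_mult_bounded[OF integrable_freq_reflect[OF i] _ norm_ft_le[OF r]]) measurable
 have "dist_of r \<phi> = (\<integral>p. r p * \<phi> p \<partial>stm)" unfolding dist_of_def lint_stm ..
 also have "\<dots> = of_real (1 / (2*pi)^3) * (\<integral>q. ft \<phi> q * ft r (- q) \<partial>freq_measure)"
  by (rule integral_schwartz_product[OF r \<phi>])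
 also have "(\<integral>q. ft \<phi> q * ft r (- q) \<partial>freq_measure) = (\<integral>q. ft \<phi> (0 - q) * ft r q \<partial>freq_measure)"
  using integral_freq_reflect[of "\<lambda>q. ft \<phi> q * ft r (- q)" 0] by simp
 finally show "dist_of r \<phi> = of_real (1 / (2*pi)^3) * (\<integral>q. (case q of (l, n) \<Rightarrow> ft r (l, n) * fourier \<phi> (- l) (- n)) \<partial>freq_measure)"
  unfolding eq[symmetric] by simp
qed

lemma ft_times_chr: "ft (\<lambda>p. r p * chr a p) q = ft r (q - a)"
 unfolding ft_eq by (simp add: mult.assoc flip: chr_add)

lemma norm_ft_mult_le:
 assumes r: "integrable stm r" and f: "f \<in> schwartz"
 shows "ennreal (norm (ft (\<lambda>p. r p * f p) q)) \<le> ennreal (1 / (2*pi)^3) * conv (amp (ft f)) (amp (ft r)) q"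
proof -
 have i: "fint (ft f)" by (rule ft_integrable[OF f])
 have rc: "integrable stm (\<lambda>p. r p * chr (- q) p)" by (rule integrable_chr[OF r])
 have "fint (\<lambda>a. ft f a * ft r (q - a))"
 proof (rule integrable_mult_bounded[OF i])
  have [measurable]: "smeas r" using r by auto
  show "fmeas (\<lambda>a. ft r (q - a))" by measurable
 qed (rule norm_ft_le[OF r])
 hence *: "ennreal (norm (\<integral>a. ft f a * ft r (q - a) \<partial>freq_measure)) \<le> (\<oint> a. ennreal (norm (ft f a * ft r (q - a))))"
  by (rule integral_norm_bound_ennreal)
 have "ft (\<lambda>p. r p * f p) q = (\<integral>p. (r p * chr (- q) p) * f p \<partial>stm)" unfolding ft_eq by (simp only: mult_ac)
 also have "\<dots> = of_real (1 / (2*pi)^3) * (\<integral>a. ft f a * ft (\<lambda>p. r p * chr (- q) p) (- a) \<partial>freq_measure)"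
  by (rule integral_schwartz_product[OF rc f])
 also have "\<dots> = of_real (1 / (2*pi)^3) * (\<integral>a. ft f a * ft r (q - a) \<partial>freq_measure)"
  by (simp add: ft_times_chr)
 finally have "ennreal (norm (ft (\<lambda>p. r p * f p) q)) = ennreal (1 / (2*pi)^3) * ennreal (norm (\<integral>a. ft f a * ft r (q - a) \<partial>freq_measure))"
  by (simp add: norm_mult norm_divide norm_power flip: ennreal_mult)
 also have "\<dots> \<le> ennreal (1 / (2*pi)^3) * conv (amp (ft f)) (amp (ft r)) q"
  unfolding conv_def using * by (intro mult_left_mono) (auto simp: norm_mult ennreal_mult)
 finally show ?thesis .
qed

section \<open>Time cutoffs\<close>


lemma ft_affine:
 assumes f: "f \<in> schwartz" and c: "c > 0"
 shows "ft (\<lambda>p. f (c * fst p + b, snd p)) q = of_real (1 / c) * cis (fst q * b / c) * ft f (fst q / c, snd q)"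
proof -
 define q' where "q' = (fst q / c, snd q)"
 define g where "g = (\<lambda>t z. indicator torus_cell z *\<^sub>R (f (t, z) * chr (- q') (t, z)))"
 have i1: "integrable stm (\<lambda>p. f (c * fst p + b, snd p) * chr (- q) p)"
  using c by (intro integrable_chr schwartz_integrable schwartz_affine[OF f]) simp
 have i2: "integrable stm (\<lambda>p. f p * chr (- q') p)" by (intro integrable_chr schwartz_integrable f)
 have e: "indicator torus_cell z *\<^sub>R (f (c * fst (t, z) + b, snd (t, z)) * chr (- q) (t, z)) = cis (fst q * b / c) * g (b + c * t) z" for t z
 proof -
  have "chr (- q) (t, z) = cis (fst q * b / c) * chr (- q') (b + c * t, z)"
  proof -
   have "fst q / c * (b + c * t) = fst q * b / c + fst q * t" using c by (simp add: field_simps)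
   thus ?thesis by (simp add: chr_def cis_mult q'_def)
  qed
  thus ?thesis by (simp add: g_def add.commute)
 qed
 have "ft (\<lambda>p. f (c * fst p + b, snd p)) q = (\<integral>z. (\<integral>t. cis (fst q * b / c) * g (b + c * t) z \<partial>lborel) \<partial>lborel)"
  unfolding ft_eq integral_stm_iterated(2)[OF i1] e ..
 also have "\<dots> = (\<integral>z. of_real (1 / c) * cis (fst q * b / c) * (\<integral>t. g t z \<partial>lborel) \<partial>lborel)"
 proof (intro Bochner_Integration.integral_cong refl)
  fix z
  have "(\<integral>t. g t z \<partial>lborel) = c *\<^sub>R (\<integral>t. g (b + c * t) z \<partial>lborel)"
   using lborel_integral_real_affine[of c "\<lambda>t. g t z" b] c by simp
  thus "(\<integral>t. cis (fst q * b / c) * g (b + c * t) z \<partial>lborel) = of_real (1 / c) * cis (fst q * b / c) * (\<integral>t. g t z \<partial>lborel)"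
   using c by (simp add: scaleR_conv_of_real)
 qed
 also have "\<dots> = of_real (1 / c) * cis (fst q * b / c) * ft f q'"
  unfolding ft_eq integral_stm_iterated(2)[OF i2] g_def by (rule Bochner_Integration.integral_mult_right_zero)
 finally show ?thesis by (simp add: q'_def)
qed

text \<open>The cutoff does not depend on \<open>x\<close>, so a derivative in \<open>x\<close> shows that its transform vanishes off \<open>n = 0\<close>.\<close>

lemma ft_cutoff_zero:
 assumes "snd q \<noteq> 0"
 shows "ft cutoff q = 0"
proof -
 have *: "ft cutoff q = 0" if v: "v \<in> Basis" "fst v = 0" "freq (snd q) \<bullet> snd v \<noteq> 0" for v :: spacetime
 proof -
  have "pd v cutoff p = 0" for p
  proof -
   have "((\<lambda>s. cutoff (p + s *\<^sub>R v)) has_vector_derivative pd v cutoff (p + 0 *\<^sub>R v)) (at 0)"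
    by (rule pd_vector_derivative[OF schwartz_good[OF cutoff_schwartz]])
   moreover have "(\<lambda>s. cutoff (p + s *\<^sub>R v)) = (\<lambda>s. cutoff p)" using v by (simp add: cutoff_def)
   ultimately have "((\<lambda>s::real. cutoff p) has_vector_derivative pd v cutoff p) (at 0)" by simp
   thus ?thesis using vector_derivative_unique_at[OF _ has_vector_derivative_const] by blast
  qed
  hence "pd v cutoff = (\<lambda>p. 0)" by blast
  hence "ft (pd v cutoff) q = 0" by (simp add: ft_eq)
  thus ?thesis using ft_pd[OF cutoff_schwartz v(1), of q] v by simp
 qed
 have "fst (snd q) \<noteq> 0 \<or> snd (snd q) \<noteq> 0" using assms by (auto simp: prod_eq_iff)
 thus ?thesis
 proof
  assume "fst (snd q) \<noteq> 0"
  thus ?thesis using *[of "(0,1,0)"] by (auto simp: Basis_prod_def zero_prod_def freq_def)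
 next
  assume "snd (snd q) \<noteq> 0"
  thus ?thesis using *[of "(0,0,1)"] by (auto simp: Basis_prod_def zero_prod_def freq_def)
 qed
qed

definition cutT :: "real \<Rightarrow> spacetime \<Rightarrow> complex" where
 "cutT T p = cutoff (1 / T * fst p + 0, snd p)"

lemma cutT_schwartz: "T > 0 \<Longrightarrow> cutT T \<in> schwartz"
 unfolding cutT_def using schwartz_affine[OF cutoff_schwartz, of "1 / T" 0] by simp

lemma cutT_1: "0 \<le> fst p \<Longrightarrow> fst p \<le> T \<Longrightarrow> T > 0 \<Longrightarrow> cutT T p = 1"
 by (simp add: cutT_def cutoff_def plateau_1)

lemma ft_cutT_bound:
 shows "\<exists>c\<ge>0. \<forall>T>0. \<forall>q. norm (ft (cutT T) q) \<le> (if snd q = 0 then c * (T / (1 + (T * fst q)\<^sup>2)\<^sup>2) else 0)"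
proof -
 obtain C where C: "C \<ge> 0" "\<And>q. norm (ft cutoff q) \<le> C * (dec q)\<^sup>2" using ft_decay[OF cutoff_schwartz] by blast
 have "norm (ft (cutT T) q) \<le> (if snd q = 0 then C * (T / (1 + (T * fst q)\<^sup>2)\<^sup>2) else 0)" if T: "T > 0" for T q
 proof -
  have "norm (ft (cutT T) q) = T * norm (ft cutoff (T * fst q, snd q))"
   using ft_affine[OF cutoff_schwartz, of "1 / T" 0 q] T by (simp add: cutT_def[abs_def] norm_mult mult.commute)
  moreover have bd: "norm (ft cutoff (T * fst q, snd q)) \<le> C * (1 / (1 + (T * fst q)\<^sup>2)\<^sup>2)" if "snd q = 0"
  proof -
   have "(dec (T * fst q, snd q))\<^sup>2 = 1 / ((jap (T * fst q))\<^sup>2)\<^sup>2"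
    using that by (simp add: dec_def jap_def power_divide)
   also have "(jap (T * fst q))\<^sup>2 = 1 + (T * fst q)\<^sup>2" by (simp add: jap_sq)
   finally show ?thesis using C(2)[of "(T * fst q, snd q)"] by (simp only: times_divide_eq_right mult_1_right)
  qed
  moreover have "T * norm (ft cutoff (T * fst q, snd q)) \<le> C * (T / (1 + (T * fst q)\<^sup>2)\<^sup>2)" if "snd q = 0"
  proof -
   have "T * norm (ft cutoff (T * fst q, snd q)) \<le> T * (C * (1 / (1 + (T * fst q)\<^sup>2)\<^sup>2))"
    by (rule mult_left_mono[OF bd[OF that]]) (use T in simp)
   thus ?thesis by (simp add: mult.commute)
  qed
  ultimately show ?thesis using ft_cutoff_zero[of "(T * fst q, snd q)"] by simp
 qed
 thus ?thesis using C(1) by blast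
qed

section \<open>Uniqueness of the Fourier transform\<close>

text \<open>The positive and the negative part of \<open>g\<close>, made strictly positive by adding a Gaussian, are after
normalisation two probability densities with the same characteristic function.\<close>

lemma real_ft_zero:
 fixes g :: "real \<Rightarrow> real"
 assumes g: "integrable lborel g" and zero: "\<And>b. (\<integral>x. of_real (g x) * cis (b * x) \<partial>lborel) = (0::complex)"
 shows "AE x in lborel. g x = 0"
proof -
 have [measurable]: "g \<in> borel_measurable borel" using g by auto
 define P where "P = (\<lambda>x. max 0 (g x) + std_normal_density x)"
 define Q where "Q = (\<lambda>x. max 0 (- g x) + std_normal_density x)"
 have P0: "0 \<le> P x" "0 \<le> Q x" for x by (auto simp: P_def Q_def)
 have [measurable]: "P \<in> borel_measurable borel" "Q \<in> borel_measurable borel" unfolding P_def Q_def by measurable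
 have PQ: "integrable lborel P" "integrable lborel Q" unfolding P_def Q_def
  using g by (intro Bochner_Integration.integrable_add Bochner_Integration.integrable_max std_normal_integrable; simp)+
 define c where "c = integral\<^sup>L lborel P"
 have diff: "P x - Q x = g x" for x by (auto simp: P_def Q_def)
 have "complex_of_real (integral\<^sup>L lborel g) = 0" using zero[of 0] by simp
 hence "integral\<^sup>L lborel g = 0" by simp
 hence cQ: "integral\<^sup>L lborel Q = c" using Bochner_Integration.integral_diff[OF PQ] by (simp add: c_def diff)
 have "integral\<^sup>L lborel std_normal_density \<le> c" unfolding c_def
  by (rule integral_mono[OF std_normal_integrable PQ(1)]) (simp add: P_def)
 hence "1 \<le> c" by (simp add: std_normal_integral)
 hence c: "c > 0" by simp
 define D where "D = (\<lambda>R::real \<Rightarrow> real. density lborel (\<lambda>x. ennreal (R x / c)))"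
 have rd: "real_distribution (D R)" if R: "integrable lborel R" "\<And>x. 0 \<le> R x" "integral\<^sup>L lborel R = c" for R
 proof -
  have [measurable]: "R \<in> borel_measurable borel" using R by auto
  have "emeasure (D R) (space (D R)) = (\<integral>\<^sup>+ x. ennreal (R x / c) \<partial>lborel)"
   unfolding D_def by (simp add: emeasure_density)
  also have "\<dots> = ennreal (\<integral>x. R x / c \<partial>lborel)" using R c by (intro nn_integral_eq_integral) auto
  finally have "emeasure (D R) (space (D R)) = 1" using R c by simp
  thus ?thesis by (intro real_distribution.intro prob_spaceI real_distribution_axioms.intro) (auto simp: D_def)
 qed
 have ch: "char (D R) b = (1 / c) *\<^sub>R (\<integral>x. of_real (R x) * cis (b * x) \<partial>lborel)"
  if R: "R \<in> borel_measurable borel" "\<And>x. 0 \<le> R x" for R b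
 proof -
  have "char (D R) b = (\<integral>x. (R x / c) *\<^sub>R iexp (b * x) \<partial>lborel)"
   unfolding char_def D_def using R c by (subst integral_density) auto
  also have "\<dots> = (\<integral>x. (1 / c) *\<^sub>R (of_real (R x) * cis (b * x)) \<partial>lborel)"
   by (intro Bochner_Integration.integral_cong) (auto simp: cis_conv_exp scaleR_conv_of_real)
  finally show ?thesis by simp
 qed
 have "char (D P) b = char (D Q) b" for b
 proof -
  have i: "integrable lborel (\<lambda>x. of_real (R x) * cis (b * x))" if "integrable lborel R" for R :: "real \<Rightarrow> real"
  proof (rule Bochner_Integration.integrable_bound[OF that])
   have [measurable]: "(\<lambda>x. cis (b * x)) \<in> borel_measurable borel" by (intro borel_measurable_continuous_onI continuous_intros)
   have [measurable]: "R \<in> borel_measurable borel" using that by auto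
   show "(\<lambda>x. of_real (R x) * cis (b * x)) \<in> borel_measurable lborel" by measurable
  qed (auto simp: norm_mult)
  have "(\<integral>x. of_real (P x) * cis (b * x) \<partial>lborel) - (\<integral>x. of_real (Q x) * cis (b * x) \<partial>lborel) = (\<integral>x. of_real (g x) * cis (b * x) \<partial>lborel)"
   unfolding diff[symmetric] of_real_diff left_diff_distrib by (rule Bochner_Integration.integral_diff[OF i[OF PQ(1)] i[OF PQ(2)], symmetric])
  thus ?thesis using ch[of P] ch[of Q] P0 zero[of b] by simp
 qed
 hence "D P = D Q"
  by (intro Levy_uniqueness rd PQ P0 cQ ext) (simp_all add: c_def)
 hence "AE x in lborel. ennreal (P x / c) = ennreal (Q x / c)"
 proof (subst finite_density_unique[symmetric])
  have "(\<integral>\<^sup>+ x. ennreal (P x / c) \<partial>lborel) = ennreal (\<integral>x. P x / c \<partial>lborel)" using PQ P0 c by (intro nn_integral_eq_integral) auto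
  thus "(\<integral>\<^sup>+ x. ennreal (P x / c) \<partial>lborel) \<noteq> \<infinity>" by simp
 qed (auto simp: D_def)
 thus ?thesis
 proof eventually_elim
  case (elim x)
  hence "P x = Q x" using P0 c by (simp add: divide_nonneg_pos)
  thus ?case using diff[of x] by simp
 qed
qed

lemma complex_ft_zero:
 fixes g :: "real \<Rightarrow> complex"
 assumes g: "integrable lborel g" and zero: "\<And>b. (\<integral>x. g x * cis (b * x) \<partial>lborel) = 0"
 shows "AE x in lborel. g x = 0"
proof -
 have [measurable]: "g \<in> borel_measurable borel" using g by auto
 have mc: "(\<lambda>x. cis (b * x)) \<in> borel_measurable lborel" for b :: real by measurable
 have i: "integrable lborel (\<lambda>x. g x * cis (b * x))" for b
  by (rule integrable_mult_bounded[OF g mc, of _ 1]) simp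
 have cz: "(\<integral>x. cnj (g x) * cis (b * x) \<partial>lborel) = 0" for b
 proof -
  have "(\<integral>x. cnj (g x) * cis (b * x) \<partial>lborel) = (\<integral>x. cnj (g x * cis (- b * x)) \<partial>lborel)"
   by (intro Bochner_Integration.integral_cong) (auto simp: cis_cnj)
  also have "\<dots> = cnj (\<integral>x. g x * cis (- b * x) \<partial>lborel)" by (rule Bochner_Integration.integral_cnj)
  finally show ?thesis using zero[of "- b"] by simp
 qed
 have ic: "integrable lborel (\<lambda>x. cnj (g x) * cis (b * x))" for b
  by (rule integrable_mult_bounded[OF _ mc, of _ _ 1]) (use g in auto)
 have r: "(\<integral>x. of_real (Re (g x)) * cis (b * x) \<partial>lborel) = (0::complex)" for b
 proof -
  have "(\<integral>x. of_real (Re (g x)) * cis (b * x) \<partial>lborel) = (\<integral>x. (1/2) * (g x * cis (b * x) + cnj (g x) * cis (b * x)) \<partial>lborel)"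
   by (intro Bochner_Integration.integral_cong refl) (simp add: complex_add_cnj flip: distrib_right)
  also have "\<dots> = 0" using zero cz by (simp add: Bochner_Integration.integral_add[OF i ic])
  finally show ?thesis .
 qed
 have m: "(\<integral>x. of_real (Im (g x)) * cis (b * x) \<partial>lborel) = (0::complex)" for b
 proof -
  have "of_real (Im z) = (- \<i> / 2) * (z - cnj z)" for z by (simp add: complex_eq_iff)
  hence "(\<integral>x. of_real (Im (g x)) * cis (b * x) \<partial>lborel) = (\<integral>x. (- \<i> / 2) * (g x * cis (b * x) - cnj (g x) * cis (b * x)) \<partial>lborel)"
   by (intro Bochner_Integration.integral_cong refl) (simp add: left_diff_distrib mult.assoc)
  also have "\<dots> = 0" using zero cz by (simp add: Bochner_Integration.integral_diff[OF i ic])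
  finally show ?thesis .
 qed
 have "AE x in lborel. Re (g x) = 0" "AE x in lborel. Im (g x) = 0"
  using real_ft_zero[OF _ r] real_ft_zero[OF _ m] g by auto
 thus ?thesis by eventually_elim (simp add: complex_eq_iff)
qed

lemma nn_integral_ft_cutoff_pos: "(\<oint> q. ennreal (norm (ft cutoff q))) \<noteq> 0"
proof
 have i: "fint (ft cutoff)" by (rule ft_integrable[OF cutoff_schwartz])
 hence [measurable]: "fmeas (ft cutoff)" by auto
 assume "(\<oint> q. ennreal (norm (ft cutoff q))) = 0"
 hence "AE q in freq_measure. ft cutoff q = 0" by (subst (asm) nn_integral_0_iff_AE) auto
 hence "ift (ft cutoff) 0 = 0" unfolding ift_def by (intro integral_eq_zero_AE) auto
 hence "cutoff 0 = 0" using fourier_inversion[OF cutoff_schwartz, of 0] by (auto simp: space_stm torus_cell_def zero_prod_def)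
 thus False by (simp add: cutoff_def plateau_1)
qed

text \<open>Testing with a translated and modulated cutoff shows that \<open>b \<mapsto> \<integral> D(\<lambda>,n) k(a - \<lambda>) e^(ib\<lambda>) d\<lambda>\<close> vanishes, where \<open>k\<close>
is the transform of the cutoff. Hence \<open>D k(a - \<cdot>) = 0\<close> almost everywhere for every \<open>a\<close>, and integrating
over \<open>a\<close> removes the factor \<open>k\<close>, which is not identically zero.\<close>

lemma annihilator_zero:
 assumes m[measurable]: "fmeas D"
  and i: "\<And>\<phi>. \<phi> \<in> schwartz \<Longrightarrow> fint (\<lambda>q. D q * ft \<phi> (- q))"
  and z: "\<And>\<phi>. \<phi> \<in> schwartz \<Longrightarrow> (\<integral>q. D q * ft \<phi> (- q) \<partial>freq_measure) = 0"
 shows "AE q in freq_measure. D q = 0"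
proof -
 let ?k = "ft cutoff"
 have [measurable]: "fmeas ?k" using ft_integrable[OF cutoff_schwartz] by auto
 have sec: "AE q in freq_measure. D q * ?k (a - q) = 0" for a
 proof -
  define h where "h = (\<lambda>q. D q * ?k (a - q))"
  have hm[measurable]: "fmeas h" unfolding h_def by measurable
  have *: "fint h \<and> (\<integral>q. h q * cis (b * fst q) \<partial>freq_measure) = 0" for b
  proof -
   define \<phi> where "\<phi> = (\<lambda>p. cutoff (1 * fst p + (- b), snd p) * chr (- a) p)"
   have af: "(\<lambda>p. cutoff (1 * fst p + (- b), snd p)) \<in> schwartz" by (rule schwartz_affine[OF cutoff_schwartz]) simp
   have \<phi>: "\<phi> \<in> schwartz"
    using schwartz_char[OF af, of 1 "- fst a" "- snd a"] by (simp add: \<phi>_def chr_def)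
   have e: "D q * ft \<phi> (- q) = cis (- (fst a * b)) * (h q * cis (b * fst q))" for q
    unfolding \<phi>_def ft_times_chr ft_affine[OF cutoff_schwartz zero_less_one] h_def
    by (simp add: cis_mult algebra_simps prod_eq_iff minus_prod_def)
   have "fint (\<lambda>q. cis (fst a * b) * (D q * ft \<phi> (- q)) * cis (- b * fst q))"
    by (rule integrable_mult_bounded[OF integrable_mult_right[OF i[OF \<phi>]], of _ 1]) auto
   hence "fint h" unfolding e by (simp add: mult_ac cis_mult)
   moreover have "cis (- (fst a * b)) * (\<integral>q. h q * cis (b * fst q) \<partial>freq_measure) = 0"
    using z[OF \<phi>] unfolding e by simp
   ultimately show ?thesis by simp
  qed
  hence hi: "integrable (lborel \<Otimes>\<^sub>M count_space UNIV) h" by (simp add: freq_measure_def)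
  define n where "n = snd a"
  have hn: "h (l, m) = 0" if "m \<noteq> n" for l m
   using that by (simp add: h_def ft_cutoff_zero n_def)
  have cs: "(\<integral>m. h (l, m) * c \<partial>count_space UNIV) = h (l, n) * c" for l c
  proof -
   have fin: "finite {m. h (l, m) * c \<noteq> 0}"
    by (rule finite_subset[of _ "{n}"]) (use hn in auto)
   have "(\<integral>m. h (l, m) * c \<partial>count_space UNIV) = (\<Sum>m | m \<in> UNIV \<and> h (l, m) * c \<noteq> 0. h (l, m) * c)"
    by (rule lebesgue_integral_count_space_finite_support) (use fin in simp)
   also have "\<dots> = (\<Sum>m\<in>{n}. h (l, m) * c)"
    by (rule sum.mono_neutral_left) (use hn in auto)
   finally show ?thesis by simp
  qed
  have hin: "integrable lborel (\<lambda>l. h (l, n))"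
   using freq_pair.integrable_fst'[OF hi] cs[of _ 1] by simp
  have "AE l in lborel. h (l, n) = 0"
  proof (rule complex_ft_zero[OF hin])
   fix b
   have i: "integrable (lborel \<Otimes>\<^sub>M count_space UNIV) (\<lambda>q. h q * cis (b * fst q))"
    unfolding freq_measure_def[symmetric] by (rule integrable_mult_bounded[of _ _ _ 1]) (use * in auto)
   have "(\<integral>l. h (l, n) * cis (b * l) \<partial>lborel) = (\<integral>l. (\<integral>m. h (l, m) * cis (b * fst (l, m)) \<partial>count_space UNIV) \<partial>lborel)"
    by (simp only: cs fst_conv)
   also have "\<dots> = (\<integral>q. h q * cis (b * fst q) \<partial>freq_measure)"
    unfolding freq_measure_def by (rule freq_pair.integral_fst'[OF i])
   finally show "(\<integral>l. h (l, n) * cis (b * l) \<partial>lborel) = 0" using * by simp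
  qed
  hence "AE l in lborel. AE m in count_space UNIV. h (l, m) = 0"
   by eventually_elim (use hn in \<open>auto simp: AE_count_space, metis\<close>)
  hence "AE q in lborel \<Otimes>\<^sub>M count_space UNIV. h q = 0"
   by (intro freq_pair.AE_pair_measure) (use hm in \<open>auto simp: freq_measure_def\<close>)
  thus ?thesis by (simp only: freq_measure_def h_def)
 qed
 let ?I = "\<integral>\<^sup>+ q. ennreal (norm (?k q)) \<partial>freq_measure"
 have shift: "(\<oint> a. ennreal (norm (?k (a - q)))) = ?I" for q
  using nn_integral_freq_shift[of "\<lambda>q. ennreal (norm (?k q))" "- q"] by simp
 have "(\<oint> q. ennreal (norm (D q)) * ?I) = (\<oint> q. (\<oint> a. ennreal (norm (D q)) * ennreal (norm (?k (a - q)))))"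
  by (simp add: nn_integral_cmult shift)
 also have "\<dots> = (\<oint> a. (\<oint> q. ennreal (norm (D q)) * ennreal (norm (?k (a - q)))))"
  by (rule freq2.Fubini') measurable
 also have "\<dots> = (\<oint> a. 0)"
 proof (rule nn_integral_cong)
  fix a
  show "(\<oint> q. ennreal (norm (D q)) * ennreal (norm (?k (a - q)))) = 0"
   using sec[of a] by (subst nn_integral_0_iff_AE) auto
 qed
 finally have "(\<oint> q. ennreal (norm (D q)) * ?I) = 0" by simp
 hence "AE q in freq_measure. ennreal (norm (D q)) * ?I = 0"
  by (subst (asm) nn_integral_0_iff_AE) auto
 thus ?thesis using nn_integral_ft_cutoff_pos by simp
qed

lemma has_fourier_unique:
 assumes F: "has_fourier u F" and G: "has_fourier u G"
 shows "AE q in freq_measure. F q = G q"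
proof -
 have ext: "(\<lambda>(l, n). H (l, n) * fourier \<phi> (- l) (- n)) = (\<lambda>q. H q * ft \<phi> (- q))" for H \<phi>
  by (auto simp: fun_eq_iff ft_def)
 have [measurable]: "fmeas F" "fmeas G" using F G by (auto simp: has_fourier_def)
 have i: "fint (\<lambda>q. F q * ft \<phi> (- q))" "fint (\<lambda>q. G q * ft \<phi> (- q))"
  and e: "(\<integral>q. F q * ft \<phi> (- q) \<partial>freq_measure) = (\<integral>q. G q * ft \<phi> (- q) \<partial>freq_measure)" if "\<phi> \<in> schwartz" for \<phi>
 proof -
  show "fint (\<lambda>q. F q * ft \<phi> (- q))" "fint (\<lambda>q. G q * ft \<phi> (- q))"
   using F G that unfolding has_fourier_def ext by blast+
  have "u \<phi> = of_real (1 / (2*pi)^3) * (\<integral>q. F q * ft \<phi> (- q) \<partial>freq_measure)"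
   using F that unfolding has_fourier_def ext by blast
  moreover have "u \<phi> = of_real (1 / (2*pi)^3) * (\<integral>q. G q * ft \<phi> (- q) \<partial>freq_measure)"
   using G that unfolding has_fourier_def ext by blast
  ultimately show "(\<integral>q. F q * ft \<phi> (- q) \<partial>freq_measure) = (\<integral>q. G q * ft \<phi> (- q) \<partial>freq_measure)" by simp
 qed
 have "AE q in freq_measure. F q - G q = 0"
  by (rule annihilator_zero) (auto simp: left_diff_distrib i e)
 thus ?thesis by simp
qed

section \<open>Square integrability of inverse Fourier transforms\<close>

lemma fatou_le:
 fixes f :: "nat \<Rightarrow> 'a \<Rightarrow> ennreal"
 assumes [measurable]: "\<And>n. f n \<in> borel_measurable M" "g \<in> borel_measurable M"
  and lim: "AE x in M. (\<lambda>n. f n x) \<longlonglongrightarrow> g x" and bd: "\<And>n. (\<integral>\<^sup>+ x. f n x \<partial>M) \<le> B"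
 shows "(\<integral>\<^sup>+ x. g x \<partial>M) \<le> B"
proof -
 have "(\<integral>\<^sup>+ x. g x \<partial>M) = (\<integral>\<^sup>+ x. liminf (\<lambda>n. f n x) \<partial>M)"
 proof (rule nn_integral_cong_AE)
  show "AE x in M. g x = liminf (\<lambda>n. f n x)"
   using lim by eventually_elim (rule lim_imp_Liminf[symmetric], simp_all)
 qed
 also have "\<dots> \<le> liminf (\<lambda>n. \<integral>\<^sup>+ x. f n x \<partial>M)" by (rule nn_integral_liminf) simp
 also have "\<dots> \<le> limsup (\<lambda>n. \<integral>\<^sup>+ x. f n x \<partial>M)" by (rule Liminf_le_Limsup) simp
 also have "\<dots> \<le> B" using bd by (intro Limsup_bounded) simp
 finally show ?thesis .
qed

lemma ift_norm_le:
 assumes "fint G"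
 shows "norm (ift G p) \<le> (\<integral>q. norm (G q) \<partial>freq_measure)"
proof -
 have "norm (ift G p) \<le> (\<integral>q. norm (G q * chr q p) \<partial>freq_measure)" unfolding ift_def by (rule integral_norm_bound)
 thus ?thesis by (simp add: norm_mult)
qed

lemma ift_measurable[measurable]:
 assumes [measurable]: "fmeas G"
 shows "smeas (ift G)"
proof -
 have "(\<lambda>x. chr (fst (snd x, fst x)) (snd (snd x, fst x))) \<in> borel_measurable (stm \<Otimes>\<^sub>M freq_measure)"
  by (rule measurable_compose[OF _ chr_measurable2]) measurable
 hence [measurable]: "(\<lambda>x. chr (snd x) (fst x)) \<in> borel_measurable (stm \<Otimes>\<^sub>M freq_measure)" by simp
 have "(\<lambda>x. G (snd x) * chr (snd x) (fst x)) \<in> borel_measurable (stm \<Otimes>\<^sub>M freq_measure)" by measurable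
 hence "(\<lambda>(p, q). G q * chr q p) \<in> borel_measurable (stm \<Otimes>\<^sub>M freq_measure)" by (simp add: split_beta')
 thus ?thesis unfolding ift_def[abs_def] by (rule freq.borel_measurable_lebesgue_integral)
qed

text \<open>\<open>xy \<le> x\<^sup>2 + y\<^sup>2\<close> in place of Cauchy--Schwarz; the constant does not matter.\<close>

lemma schur_bound:
 assumes [measurable]: "fmeas g" "fmeas k"
 shows "(\<oint> q. g q * conv g k q) \<le> 2 * (\<oint> q. k q) * (\<oint> q. (g q)\<^sup>2)"
proof -
 let ?K = "\<integral>\<^sup>+ q. k q \<partial>freq_measure"
 have amgm: "x * y \<le> x\<^sup>2 + y\<^sup>2" for x y :: ennreal
  using mult_mono[of x y y y] mult_mono[of x x y x]
  by (cases "x \<le> y") (auto simp: power2_eq_square intro: add_increasing add_increasing2)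
 have "(\<oint> q. g q * conv g k q) = (\<oint> q. (\<oint> a. g q * g a * k (q - a)))"
  unfolding conv_def by (simp add: nn_integral_cmult mult.assoc)
 also have "\<dots> \<le> (\<oint> q. (\<oint> a. (g q)\<^sup>2 * k (q - a) + (g a)\<^sup>2 * k (q - a)))"
  unfolding distrib_right[symmetric] by (intro nn_integral_mono mult_right_mono amgm) simp
 also have "\<dots> = (\<oint> q. (\<oint> a. (g q)\<^sup>2 * k (q - a))) + (\<oint> q. (\<oint> a. (g a)\<^sup>2 * k (q - a)))"
  by (simp add: nn_integral_add)
 also have "(\<oint> q. (\<oint> a. (g a)\<^sup>2 * k (q - a))) = (\<oint> a. (\<oint> q. (g a)\<^sup>2 * k (q - a)))"
  by (rule freq2.Fubini') measurable
 also have "\<dots> = (\<oint> a. (g a)\<^sup>2 * ?K)"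
  using nn_integral_freq_shift[of k "- a" for a] by (simp add: nn_integral_cmult)
 also have "(\<oint> q. (\<oint> a. (g q)\<^sup>2 * k (q - a))) = (\<oint> a. (g a)\<^sup>2 * ?K)"
  by (simp add: nn_integral_cmult nn_integral_freq_reflect)
 also have "(\<oint> a. (g a)\<^sup>2 * ?K) = (\<oint> a. (g a)\<^sup>2) * ?K"
  by (rule nn_integral_multc) measurable
 finally show ?thesis by (simp add: mult_ac mult_2 distrib_right distrib_left)
qed

text \<open>With a weight \<open>X\<close> in front, \<open>\<integral> X |ift G|\<^sup>2\<close> is absolutely convergent. Using \<open>parseval\<close> twice rewrites it as
\<open>\<integral>\<integral> G(q) \<cdot> cnj (G a) \<cdot> k(q - a)\<close> with \<open>k\<close> the transform of \<open>X\<close> up to reflection and conjugation.\<close>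

lemma ift_L2_localized:
 assumes G: "fint G" and X: "X \<in> schwartz" "\<And>p. X p = of_real (x p)" "\<And>p. 0 \<le> x p"
 shows "(\<integral>\<^sup>+ p. ennreal (x p * (norm (ift G p))\<^sup>2) \<partial>stm)
  \<le> 2 * (\<oint> q. ennreal (norm (ft X q))) * (\<oint> q. (ennreal (norm (G q)))\<^sup>2)"
proof -
 have [measurable]: "fmeas G" using G by auto
 have Xi: "integrable stm X" by (rule schwartz_integrable[OF X(1)])
 have [measurable]: "fmeas (ft X)" using ft_integrable[OF X(1)] by auto
 define h where "h = ift G"
 have hm[measurable]: "smeas h" unfolding h_def by simp
 have hb: "norm (h p) \<le> (\<integral>q. norm (G q) \<partial>freq_measure)" for p unfolding h_def by (rule ift_norm_le[OF G])
 let ?g = "\<lambda>q. ennreal (norm (G q))" and ?k = "\<lambda>q. ennreal (norm (ft X q))"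
 define r where "r = (\<lambda>p. X p * cnj (h p))"
 have r: "integrable stm r" unfolding r_def by (rule integrable_mult_bounded[OF Xi]) (use hb in \<open>auto\<close>)
 have ftr: "ennreal (norm (ft r (- q))) \<le> conv ?g ?k q" for q
 proof -
  have r2: "integrable stm (\<lambda>p. X p * chr (- q) p)" by (rule integrable_chr[OF Xi])
  have "ft r (- q) = (\<integral>p. cnj (X p * chr (- q) p * h p) \<partial>stm)"
   unfolding ft_eq r_def by (intro Bochner_Integration.integral_cong) (auto simp: X(2) chr_uminus mult_ac)
  also have "\<dots> = cnj (\<integral>p. X p * chr (- q) p * ift G p \<partial>stm)" unfolding h_def by (rule Bochner_Integration.integral_cnj)
  also have "(\<integral>p. X p * chr (- q) p * ift G p \<partial>stm) = (\<integral>a. G a * ft X (q - a) \<partial>freq_measure)"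
   unfolding parseval[OF G r2] ft_times_chr by simp
  finally have "norm (ft r (- q)) = norm (\<integral>a. G a * ft X (q - a) \<partial>freq_measure)" by simp
  moreover have ia: "fint (\<lambda>a. G a * ft X (q - a))"
   by (rule integrable_mult_bounded[OF G _ norm_ft_le[OF Xi]]) measurable
  ultimately have "ennreal (norm (ft r (- q))) \<le> (\<oint> a. ennreal (norm (G a * ft X (q - a))))"
   using integral_norm_bound_ennreal[OF ia] by simp
  thus ?thesis by (simp add: conv_def norm_mult ennreal_mult)
 qed
 have rh: "r p * h p = of_real (x p * (norm (h p))\<^sup>2)" for p
  unfolding r_def X(2) by (simp only: mult.assoc mult.commute[of "cnj _"] complex_norm_square[symmetric] of_real_mult)
 have i: "integrable stm (\<lambda>p. r p * h p)" by (rule integrable_mult_bounded[OF r hm hb])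
 have ir: "integrable stm (\<lambda>p. x p * (norm (h p))\<^sup>2)" using integrable_Re[OF i] unfolding rh by simp
 have "(\<integral>\<^sup>+ p. ennreal (x p * (norm (h p))\<^sup>2) \<partial>stm) = ennreal (\<integral>p. x p * (norm (h p))\<^sup>2 \<partial>stm)"
  using X(3) by (intro nn_integral_eq_integral[OF ir]) auto
 also have "(\<integral>p. x p * (norm (h p))\<^sup>2 \<partial>stm) = norm (complex_of_real (\<integral>p. x p * (norm (h p))\<^sup>2 \<partial>stm))"
  using X(3) by (simp add: integral_nonneg_AE)
 also have "complex_of_real (\<integral>p. x p * (norm (h p))\<^sup>2 \<partial>stm) = (\<integral>p. r p * h p \<partial>stm)"
  unfolding rh by (simp only: integral_complex_of_real)
 also have "\<dots> = (\<integral>q. G q * ft r (- q) \<partial>freq_measure)" unfolding h_def by (rule parseval[OF G r])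
 also have "ennreal (norm \<dots>) \<le> (\<oint> q. ennreal (norm (G q * ft r (- q))))"
 proof (rule integral_norm_bound_ennreal, rule integrable_mult_bounded[OF G _ norm_ft_le[OF r]])
  have [measurable]: "smeas r" using r by auto
  show "fmeas (\<lambda>q. ft r (- q))" by measurable
 qed
 also have "\<dots> \<le> (\<oint> q. ?g q * conv ?g ?k q)"
  by (intro nn_integral_mono) (simp add: norm_mult ennreal_mult ftr mult_left_mono)
 also have "\<dots> \<le> 2 * (\<oint> q. ?k q) * (\<oint> q. (?g q)\<^sup>2)"
  by (rule schur_bound) measurable
 finally show ?thesis by (simp add: h_def)
qed

text \<open>The weight of \<open>ift_L2_localized\<close> is a dilated cutoff, which tends to \<open>1\<close>. Dilation does not change the
\<open>L\<^sup>1\<close> norm of its transform.\<close>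

lemma ift_L2: "\<exists>A>0. \<forall>G. fint G \<longrightarrow>
  (\<integral>\<^sup>+ p. ennreal ((norm (ift G p))\<^sup>2) \<partial>stm) \<le> ennreal A * (\<oint> q. (ennreal (norm (G q)))\<^sup>2)"
proof -
 \<comment> \<open>squared, because the weight must be nonnegative\<close>
 define X where "X = (\<lambda>p. cutoff p * cutoff p)"
 have X: "X \<in> schwartz" unfolding X_def by (intro schwartz_mult cutoff_schwartz)
 have k[measurable]: "fmeas (ft X)" using ft_integrable[OF X] by auto
 define K where "K = (\<integral>q. norm (ft X q) \<partial>freq_measure)"
 have K: "(\<oint> q. ennreal (norm (ft X q))) = ennreal K"
  unfolding K_def using ft_integrable[OF X] by (intro nn_integral_eq_integral) auto
 have K0: "0 \<le> K" by (simp add: K_def)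
 define Y where "Y = (\<lambda>N p. X (1 / real (Suc N) * fst p + 1/2, snd p))"
 define y where "y = (\<lambda>N p::spacetime. (plateau (1 / real (Suc N) * fst p + 1/2))\<^sup>2)"
 have Y: "Y N \<in> schwartz" "Y N p = of_real (y N p)" "0 \<le> y N p" for N p
  unfolding Y_def y_def using schwartz_affine[OF X, of "1 / real (Suc N)" "1/2"]
  by (simp_all add: X_def cutoff_def power2_eq_square)
 have ym[measurable]: "smeas (y N)" for N
 proof -
  have "(\<lambda>p. Re (Y N p)) \<in> borel_measurable stm" using schwartz_integrable[OF Y(1)] by measurable
  thus ?thesis by (simp add: Y(2))
 qed
 have KY: "(\<oint> q. ennreal (norm (ft (Y N) q))) = ennreal K" for N
 proof -
  define c where "c = 1 / real (Suc N)"
  have c: "c > 0" by (simp add: c_def)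
  have n: "norm (ft (Y N) q) = 1 / c * norm (ft X (fst q / c, snd q))" for q
   unfolding Y_def c_def[symmetric] ft_affine[OF X c] using c by (simp add: norm_mult norm_divide)
  have [measurable]: "(\<lambda>l. norm (ft X (l, m))) \<in> borel_measurable borel" for m
  proof -
   have "(\<lambda>l. (l, m)) \<in> measurable borel freq_measure" unfolding freq_measure_def by measurable
   from measurable_compose[OF this k] show ?thesis by measurable
  qed
  have [measurable]: "fmeas (ft (Y N))" using ft_integrable[OF Y(1)] by auto
  have "(\<oint> q. ennreal (norm (ft (Y N) q))) = (\<integral>\<^sup>+ m. (\<integral>\<^sup>+ l. ennreal (1 / c) * ennreal (norm (ft X (l / c, m))) \<partial>lborel) \<partial>count_space UNIV)"
   using c by (subst nn_integral_freq) (auto simp: n simp flip: ennreal_mult)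
  also have "\<dots> = (\<integral>\<^sup>+ m. (\<integral>\<^sup>+ l. ennreal (norm (ft X (l, m))) \<partial>lborel) \<partial>count_space UNIV)"
  proof (rule nn_integral_cong)
   fix m
   have "(\<integral>\<^sup>+ l. ennreal (norm (ft X (l / c, m))) \<partial>lborel) = ennreal c * (\<integral>\<^sup>+ l. ennreal (norm (ft X (l, m))) \<partial>lborel)"
    using nn_integral_real_affine[of "\<lambda>l. ennreal (norm (ft X (l / c, m)))" c 0] c by simp
   moreover have "ennreal (1 / c) * (ennreal c * z) = z" for z
    using c by (simp flip: ennreal_mult mult.assoc)
   ultimately show "(\<integral>\<^sup>+ l. ennreal (1 / c) * ennreal (norm (ft X (l / c, m))) \<partial>lborel) = (\<integral>\<^sup>+ l. ennreal (norm (ft X (l, m))) \<partial>lborel)"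
    by (subst nn_integral_cmult) auto
  qed
  also have "\<dots> = ennreal K" unfolding K[symmetric] by (subst nn_integral_freq) auto
  finally show ?thesis .
 qed
 have "(\<integral>\<^sup>+ p. ennreal ((norm (ift G p))\<^sup>2) \<partial>stm) \<le> ennreal (2 * K + 1) * (\<oint> q. (ennreal (norm (G q)))\<^sup>2)"
  if G: "fint G" for G
 proof -
  have [measurable]: "fmeas G" using G by auto
  have "(\<integral>\<^sup>+ p. ennreal ((norm (ift G p))\<^sup>2) \<partial>stm) \<le> ennreal (2 * K) * (\<oint> q. (ennreal (norm (G q)))\<^sup>2)"
  proof (rule fatou_le[of "\<lambda>N p. ennreal (y N p * (norm (ift G p))\<^sup>2)"])
   show "(\<integral>\<^sup>+ p. ennreal (y N p * (norm (ift G p))\<^sup>2) \<partial>stm) \<le> ennreal (2 * K) * (\<oint> q. (ennreal (norm (G q)))\<^sup>2)" for N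
    using ift_L2_localized[OF G Y, of N] K0 by (simp add: KY ennreal_mult)
   have "(\<lambda>N. y N p) \<longlonglongrightarrow> 1" for p
   proof (rule tendsto_eventually)
    have "(\<lambda>N. fst p / real (Suc N)) \<longlonglongrightarrow> 0" by (rule LIMSEQ_Suc[OF lim_const_over_n])
    hence "\<forall>\<^sub>F N in sequentially. dist (fst p / real (Suc N)) 0 < 1/2" by (rule tendstoD) simp
    thus "\<forall>\<^sub>F N in sequentially. y N p = 1"
    proof eventually_elim
     case (elim N)
     hence a: "\<bar>fst p / real (Suc N)\<bar> < 1/2" by (simp only: dist_real_def diff_zero)
     have "plateau (fst p / real (Suc N) + 1/2) = 1"
      by (rule plateau_1) (use a in \<open>linarith+\<close>)
     thus ?case by (simp add: y_def del: of_nat_Suc)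
    qed
   qed
   hence "(\<lambda>N. y N p * (norm (ift G p))\<^sup>2) \<longlonglongrightarrow> 1 * (norm (ift G p))\<^sup>2" for p by (intro tendsto_mult tendsto_const)
   hence "(\<lambda>N. ennreal (y N p * (norm (ift G p))\<^sup>2)) \<longlonglongrightarrow> ennreal (1 * (norm (ift G p))\<^sup>2)" for p by (rule tendsto_ennrealI)
   thus "AE p in stm. (\<lambda>N. ennreal (y N p * (norm (ift G p))\<^sup>2)) \<longlonglongrightarrow> ennreal ((norm (ift G p))\<^sup>2)" by simp
  qed measurable
  also have "\<dots> \<le> ennreal (2 * K + 1) * (\<oint> q. (ennreal (norm (G q)))\<^sup>2)"
   by (intro mult_right_mono ennreal_leI) auto
  finally show ?thesis .
 qed
 thus ?thesis using K0 by (intro exI[of _ "2 * K + 1"]) auto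
qed

section \<open>Convolutions\<close>

definition cnv :: "(freqpt \<Rightarrow> complex) \<Rightarrow> (freqpt \<Rightarrow> complex) \<Rightarrow> freqpt \<Rightarrow> complex" where
 "cnv G H q = (\<integral>a. G a * H (q - a) \<partial>freq_measure)"

lemma integral_freq_shift:
 fixes G :: "freqpt \<Rightarrow> 'b::{banach, second_countable_topology}"
 assumes G: "fint G"
 shows "fint (\<lambda>q. G (q - a))" "(\<integral>q. G (q - a) \<partial>freq_measure) = (\<integral>q. G q \<partial>freq_measure)"
proof -
 have [measurable]: "fmeas G" using G by auto
 have i: "fint (\<lambda>q. G (- q))" using integrable_freq_reflect[OF G, of 0] by simp
 show "fint (\<lambda>q. G (q - a))" using integrable_freq_reflect[OF i, of a] by simp
 show "(\<integral>q. G (q - a) \<partial>freq_measure) = (\<integral>q. G q \<partial>freq_measure)"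
  using integral_freq_reflect[of "\<lambda>q. G (- q)" a] integral_freq_reflect[of G 0] by simp
qed

lemma
 assumes G: "fint G" and H: "fint H"
 shows cnv_integrable: "fint (cnv G H)"
  and ift_cnv: "ift (cnv G H) p = ift G p * ift H p"
proof -
 have [measurable]: "fmeas G" "fmeas H" using G H by auto
 have i: "integrable (freq_measure \<Otimes>\<^sub>M freq_measure) (\<lambda>(a, q). G a * H (q - a))"
 proof (rule freq2.Fubini_integrable)
  show "fint (\<lambda>a. \<integral>q. norm (case (a, q) of (a, q) \<Rightarrow> G a * H (q - a)) \<partial>freq_measure)"
   using G integral_freq_shift(2)[OF integrable_norm[OF H]] by (simp add: norm_mult)
  show "AE a in freq_measure. fint (\<lambda>q. case (a, q) of (a, q) \<Rightarrow> G a * H (q - a))"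
   using integral_freq_shift(1)[OF H] by simp
 qed measurable
 show "fint (cnv G H)"
  unfolding cnv_def[abs_def] by (rule freq2.integrable_snd[OF i])
 have ic: "integrable (freq_measure \<Otimes>\<^sub>M freq_measure) (\<lambda>(a, q). G a * H (q - a) * chr q p)"
  by (rule Bochner_Integration.integrable_bound[OF i]) (auto simp: norm_mult)
 have "ift (cnv G H) p = (\<integral>q. (\<integral>a. G a * H (q - a) * chr q p \<partial>freq_measure) \<partial>freq_measure)"
  unfolding ift_def cnv_def by simp
 also have "\<dots> = (\<integral>a. (\<integral>q. G a * H (q - a) * chr q p \<partial>freq_measure) \<partial>freq_measure)"
  by (rule freq2.Fubini_integral[OF ic])
 also have "\<dots> = (\<integral>a. (G a * chr a p) * (\<integral>q. H (q - a) * chr (q - a) p \<partial>freq_measure) \<partial>freq_measure)"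
 proof (intro Bochner_Integration.integral_cong refl)
  fix a
  have "G a * H (q - a) * chr q p = (G a * chr a p) * (H (q - a) * chr (q - a) p)" for q
   using chr_add[of a "q - a" p] by simp
  thus "(\<integral>q. G a * H (q - a) * chr q p \<partial>freq_measure) = (G a * chr a p) * (\<integral>q. H (q - a) * chr (q - a) p \<partial>freq_measure)"
   by (simp only: integral_mult_right_zero)
 qed
 also have "\<dots> = ift G p * ift H p"
  unfolding integral_freq_shift(2)[OF integrable_freq_chr[OF H]] by (simp add: ift_def)
 finally show "ift (cnv G H) p = ift G p * ift H p" .
qed

lemma norm_cnv_le: "ennreal (norm (cnv G H q)) \<le> conv (amp G) (amp H) q"
proof (cases "fint (\<lambda>a. G a * H (q - a))")
 case True
 thus ?thesis unfolding cnv_def conv_def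
  using integral_norm_bound_ennreal[OF True] by (simp add: norm_mult ennreal_mult)
qed (simp add: cnv_def not_integrable_integral_eq)

text \<open>\<open>(ift G)\<^sup>2\<close> is the inverse transform of \<open>G * G\<close>, to which \<open>ift_L2\<close> applies.\<close>

lemma ift_L4: "\<exists>A>0. \<forall>G. fint G \<longrightarrow>
  (\<integral>\<^sup>+ p. ennreal ((norm (ift G p)) ^ 4) \<partial>stm)
   \<le> ennreal A * (\<oint> q. (conv (amp G) (amp G) q)\<^sup>2)"
proof -
 obtain A where A: "A > 0" and bd: "\<And>G. fint G \<Longrightarrow>
  (\<integral>\<^sup>+ p. ennreal ((norm (ift G p))\<^sup>2) \<partial>stm) \<le> ennreal A * (\<oint> q. (ennreal (norm (G q)))\<^sup>2)"
  using ift_L2 by blast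
 have "(\<integral>\<^sup>+ p. ennreal ((norm (ift G p)) ^ 4) \<partial>stm)
   \<le> ennreal A * (\<oint> q. (conv (amp G) (amp G) q)\<^sup>2)"
  if G: "fint G" for G
 proof -
  have "(\<integral>\<^sup>+ p. ennreal ((norm (ift G p)) ^ 4) \<partial>stm) = (\<integral>\<^sup>+ p. ennreal ((norm (ift (cnv G G) p))\<^sup>2) \<partial>stm)"
   unfolding ift_cnv[OF G G] by (simp add: norm_mult power2_eq_square power4_eq_xxxx mult.assoc)
  also have "\<dots> \<le> ennreal A * (\<oint> q. (ennreal (norm (cnv G G q)))\<^sup>2)"
   by (rule bd[OF cnv_integrable[OF G G]])
  also have "\<dots> \<le> ennreal A * (\<oint> q. (conv (amp G) (amp G) q)\<^sup>2)"
   by (intro mult_left_mono nn_integral_mono power_mono norm_cnv_le) auto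
  finally show ?thesis .
 qed
 thus ?thesis using A by blast
qed

section \<open>The embedding into \<open>L\<^sup>3\<close>\<close>

text \<open>Convexity of the cube at \<open>x / (1 - r)\<close> and \<open>y / r\<close> with weights \<open>1 - r\<close> and \<open>r\<close>.\<close>

lemma two_cubes:
 fixes x y r :: real
 assumes "0 \<le> x" "0 \<le> y" "0 < r" "r < 1"
 shows "(x + y) ^ 3 \<le> x ^ 3 / (1 - r)\<^sup>2 + y ^ 3 / r\<^sup>2"
proof -
 define u where "u = x / (1 - r)"
 define v where "v = y / r"
 have uv: "0 \<le> u" "0 \<le> v" "x = (1 - r) * u" "y = r * v" using assms by (auto simp: u_def v_def)
 have "(1 - r) * u ^ 3 + r * v ^ 3 - ((1 - r) * u + r * v) ^ 3 = (1 - r) * r * (u - v)\<^sup>2 * ((2 - r) * u + (1 + r) * v)"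
  by (simp add: power2_eq_square power3_eq_cube algebra_simps)
 moreover have "0 \<le> (1 - r) * r * (u - v)\<^sup>2 * ((2 - r) * u + (1 + r) * v)"
  using assms uv by (intro mult_nonneg_nonneg add_nonneg_nonneg) auto
 moreover have "x ^ 3 / (1 - r)\<^sup>2 = (1 - r) * u ^ 3" "y ^ 3 / r\<^sup>2 = r * v ^ 3"
  using assms by (simp_all add: u_def v_def power2_eq_square power3_eq_cube)
 ultimately show ?thesis unfolding uv(3,4) by linarith
qed

text \<open>Hoelder's inequality with geometric weights. It turns a bound for the terms of a series in \<open>L\<^sup>3\<close>
that decays geometrically into a bound for its sum.\<close>

lemma weighted_cube_sum:
 fixes a :: "nat \<Rightarrow> real"
 assumes a: "\<And>j. 0 \<le> a j" and r: "0 < r" "r < 1"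
 shows "(\<Sum>j<n. a j) ^ 3 \<le> (1 / (1 - r)\<^sup>2) * (\<Sum>j<n. a j ^ 3 / (r ^ j)\<^sup>2)"
 using a
proof (induction n arbitrary: a)
 case (Suc n)
 let ?T = "\<Sum>j<n. a (Suc j)"
 have "(\<Sum>j<Suc n. a j) ^ 3 = (a 0 + ?T) ^ 3" by (simp only: sum.lessThan_Suc_shift)
 also have "\<dots> \<le> a 0 ^ 3 / (1 - r)\<^sup>2 + ?T ^ 3 / r\<^sup>2" using Suc.prems r by (intro two_cubes sum_nonneg) auto
 also have "?T ^ 3 / r\<^sup>2 \<le> (1 / (1 - r)\<^sup>2 * (\<Sum>j<n. a (Suc j) ^ 3 / (r ^ j)\<^sup>2)) / r\<^sup>2"
  by (intro divide_right_mono Suc.IH Suc.prems) simp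
 also have "\<dots> = 1 / (1 - r)\<^sup>2 * (\<Sum>j<n. a (Suc j) ^ 3 / (r ^ Suc j)\<^sup>2)"
  unfolding times_divide_eq_right[symmetric] sum_divide_distrib by (simp add: power_mult_distrib mult.commute)
 finally show ?case unfolding sum.lessThan_Suc_shift by (simp add: distrib_left add_divide_distrib)
qed simp

text \<open>\<open>\<parallel>h\<parallel>\<^sub>3\<^sup>3 \<le> \<parallel>h\<parallel>\<^sub>2 \<parallel>h\<parallel>\<^sub>4\<^sup>2\<close> for \<open>h = ift G\<close>, where the \<open>L\<^sup>4\<close> norm comes from the bilinear bound at the cost of \<open>R^(3/4+eps)\<close>.\<close>

lemma L3_band:
 fixes eps :: real
 assumes eps: "0 < eps" "eps < 1/5"
 shows "\<exists>D>0. \<forall>G R N. fint G \<longrightarrow> R > 0 \<longrightarrow> N > 0 \<longrightarrow> (\<forall>q. G q \<noteq> 0 \<longrightarrow> fq q \<le> 2 * R) \<longrightarrow>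
   NL (amp G) \<le> ennreal N \<longrightarrow>
   (\<integral>\<^sup>+ p. ennreal (norm (ift G p) ^ 3) \<partial>stm) \<le> ennreal (D * R powr (3/4 + eps) * N powr (3/2))"
proof -
 obtain A2 where A2: "A2 > 0" and L2: "\<And>G. fint G \<Longrightarrow>
  (\<integral>\<^sup>+ p. ennreal ((norm (ift G p))\<^sup>2) \<partial>stm) \<le> ennreal A2 * (\<oint> q. (ennreal (norm (G q)))\<^sup>2)"
  using ift_L2 by blast
 obtain A4 where A4: "A4 > 0" and L4: "\<And>G. fint G \<Longrightarrow> (\<integral>\<^sup>+ p. ennreal ((norm (ift G p)) ^ 4) \<partial>stm)
   \<le> ennreal A4 * (\<oint> q. (conv (amp G) (amp G) q)\<^sup>2)"
  using ift_L4 by blast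
 obtain C where C: "C > 0" and bil: "\<And>F G. fmeas F \<Longrightarrow> fmeas G \<Longrightarrow>
   (\<oint> x. (conv (lo eps F) G x)\<^sup>2) \<le> ennreal C * (NL F * NL G)"
  using bilinear[OF eps] by blast
 define \<kappa> where "\<kappa> = 3/4 + eps"
 define D where "D = A2 + A4 * C * (2 powr \<kappa>)\<^sup>2"
 have D: "D > 0" unfolding D_def using A2 A4 C by (intro add_pos_nonneg) auto
 have "(\<integral>\<^sup>+ p. ennreal (norm (ift G p) ^ 3) \<partial>stm) \<le> ennreal (D * R powr \<kappa> * N powr (3/2))"
  if G: "fint G" and R: "R > 0" and N: "N > 0" and supp: "\<And>q. G q \<noteq> 0 \<Longrightarrow> fq q \<le> 2 * R"
   and NL: "NL (amp G) \<le> ennreal N" for G R N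
 proof -
  have [measurable]: "fmeas G" using G by auto
  let ?g = "\<lambda>q. ennreal (norm (G q))" and ?h = "\<lambda>p. norm (ift G p)"
  have I2: "(\<integral>\<^sup>+ p. ennreal ((?h p)\<^sup>2) \<partial>stm) \<le> ennreal (A2 * N)"
  proof -
   have "(\<oint> q. (?g q)\<^sup>2) \<le> NL ?g"
    unfolding NL_def
   proof (intro nn_integral_mono power_mono)
    fix q
    have "1 * ?g q \<le> ennreal (md q powr (2/5)) * ?g q"
     using md_ge_1[of q] by (intro mult_right_mono) (auto simp: ge_one_powr_ge_zero)
    thus "?g q \<le> ennreal (md q powr (2/5)) * ?g q" by simp
   qed simp
   hence "ennreal A2 * (\<oint> q. (?g q)\<^sup>2) \<le> ennreal A2 * ennreal N"
    using NL by (intro mult_left_mono) auto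
   thus ?thesis using L2[OF G] A2 N by (simp add: ennreal_mult order_trans)
  qed
  have I4: "(\<integral>\<^sup>+ p. ennreal ((?h p) ^ 4) \<partial>stm) \<le> ennreal (A4 * C * (2 powr \<kappa>)\<^sup>2 * (R powr \<kappa>)\<^sup>2 * N\<^sup>2)"
  proof -
   let ?c = "ennreal ((2 * R) powr \<kappa>)"
   have gl: "?g q \<le> ?c * lo eps ?g q" for q
   proof (cases "G q = 0")
    case False
    have "1 \<le> (2 * R) powr \<kappa> * fq q powr (- \<kappa>)"
     using powr_mono2[of \<kappa> "fq q" "2 * R"] supp[OF False] fq_pos[of q] eps R
     by (simp add: powr_minus field_simps \<kappa>_def)
    hence "1 * ?g q \<le> ennreal ((2 * R) powr \<kappa> * fq q powr (- \<kappa>)) * ?g q"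
     by (intro mult_right_mono) auto
    thus ?thesis by (simp add: lo_def \<kappa>_def ennreal_mult mult.assoc)
   qed (simp add: lo_def)
   have "conv ?g ?g x \<le> ?c * conv (lo eps ?g) ?g x" for x
   proof -
    have "conv ?g ?g x \<le> conv (\<lambda>q. ?c * lo eps ?g q) ?g x" by (intro conv_mono gl order_refl)
    also have "\<dots> = ?c * conv (lo eps ?g) ?g x" unfolding conv_def by (simp add: mult.assoc nn_integral_cmult)
    finally show ?thesis .
   qed
   hence "(\<oint> q. (conv ?g ?g q)\<^sup>2) \<le> (\<oint> q. (?c * conv (lo eps ?g) ?g q)\<^sup>2)"
    by (intro nn_integral_mono power_mono) auto
   also have "\<dots> = ?c\<^sup>2 * (\<oint> q. (conv (lo eps ?g) ?g q)\<^sup>2)"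
    unfolding power_mult_distrib by (rule nn_integral_cmult) measurable
   also have "\<dots> \<le> ?c\<^sup>2 * (ennreal C * (ennreal N * ennreal N))"
   proof (rule mult_left_mono)
    have "(\<oint> q. (conv (lo eps ?g) ?g q)\<^sup>2) \<le> ennreal C * (NL ?g * NL ?g)" by (rule bil) measurable
    also have "\<dots> \<le> ennreal C * (ennreal N * ennreal N)" by (intro mult_left_mono mult_mono NL) auto
    finally show "(\<oint> q. (conv (lo eps ?g) ?g q)\<^sup>2) \<le> ennreal C * (ennreal N * ennreal N)" .
   qed simp
   also have "\<dots> = ennreal (((2 * R) powr \<kappa>)\<^sup>2 * (C * (N * N)))"
    using C N by (simp add: ennreal_mult ennreal_power)
   finally have "ennreal A4 * (\<oint> q. (conv ?g ?g q)\<^sup>2) \<le> ennreal A4 * ennreal (((2 * R) powr \<kappa>)\<^sup>2 * (C * (N * N)))"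
    by (rule mult_left_mono) simp
   also have "\<dots> = ennreal (A4 * C * (2 powr \<kappa>)\<^sup>2 * (R powr \<kappa>)\<^sup>2 * N\<^sup>2)"
    using A4 R C N by (simp add: powr_mult power_mult_distrib mult_ac power2_eq_square flip: ennreal_mult)
   finally show ?thesis using L4[OF G] by (rule order_trans[rotated])
  qed
  \<comment> \<open>the parameter for which the two terms of the Young inequality balance\<close>
  define \<mu> where "\<mu> = R powr \<kappa> * N powr (1/2)"
  have \<mu>: "\<mu> > 0" using R N by (simp add: \<mu>_def)
  have pt: "ennreal (?h p ^ 3) \<le> ennreal \<mu> * ennreal ((?h p)\<^sup>2) + ennreal (1 / \<mu>) * ennreal ((?h p) ^ 4)" for p
  proof -
   have "0 \<le> (?h p)\<^sup>2 * (\<mu> - ?h p)\<^sup>2" by simp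
   hence "\<mu> * ?h p ^ 3 \<le> \<mu> * \<mu> * (?h p)\<^sup>2 + ?h p ^ 4 - \<mu> * ?h p ^ 3"
    by (simp add: power2_eq_square power3_eq_cube power4_eq_xxxx algebra_simps)
   moreover have "0 \<le> \<mu> * ?h p ^ 3" using \<mu> by simp
   ultimately have "\<mu> * ?h p ^ 3 \<le> \<mu> * \<mu> * (?h p)\<^sup>2 + ?h p ^ 4" by linarith
   hence "\<mu> * ?h p ^ 3 \<le> \<mu> * (\<mu> * (?h p)\<^sup>2 + 1 / \<mu> * ?h p ^ 4)" using \<mu> by (simp add: distrib_left mult.assoc)
   hence "?h p ^ 3 \<le> \<mu> * (?h p)\<^sup>2 + 1 / \<mu> * ?h p ^ 4" using \<mu> by (rule mult_left_le_imp_le)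
   thus ?thesis using \<mu> by (simp flip: ennreal_mult ennreal_plus)
  qed
  have "(\<integral>\<^sup>+ p. ennreal (?h p ^ 3) \<partial>stm) \<le> (\<integral>\<^sup>+ p. ennreal \<mu> * ennreal ((?h p)\<^sup>2) + ennreal (1 / \<mu>) * ennreal ((?h p) ^ 4) \<partial>stm)"
   by (intro nn_integral_mono pt)
  also have "\<dots> = ennreal \<mu> * (\<integral>\<^sup>+ p. ennreal ((?h p)\<^sup>2) \<partial>stm) + ennreal (1 / \<mu>) * (\<integral>\<^sup>+ p. ennreal ((?h p) ^ 4) \<partial>stm)"
   by (simp add: nn_integral_add nn_integral_cmult)
  also have "\<dots> \<le> ennreal \<mu> * ennreal (A2 * N) + ennreal (1 / \<mu>) * ennreal (A4 * C * (2 powr \<kappa>)\<^sup>2 * (R powr \<kappa>)\<^sup>2 * N\<^sup>2)"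
   by (intro add_mono mult_left_mono I2 I4) auto
  also have "\<dots> = ennreal (\<mu> * (A2 * N) + 1 / \<mu> * (A4 * C * (2 powr \<kappa>)\<^sup>2 * (R powr \<kappa>)\<^sup>2 * N\<^sup>2))"
   using \<mu> A2 A4 C N by (simp flip: ennreal_mult ennreal_plus)
  also have "\<mu> * (A2 * N) + 1 / \<mu> * (A4 * C * (2 powr \<kappa>)\<^sup>2 * (R powr \<kappa>)\<^sup>2 * N\<^sup>2) = D * R powr \<kappa> * N powr (3/2)"
  proof -
   have n1: "N powr (3/2) = N powr (1/2) * N" using powr_add[of N "1/2" 1] N by simp
   have n2: "N powr (1/2) * N powr (1/2) = N" using powr_add[of N "1/2" "1/2"] N by simp
   have "1 / \<mu> * ((R powr \<kappa>)\<^sup>2 * N\<^sup>2) = R powr \<kappa> * (N powr (1/2) * N)"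
   proof -
    have "(R powr \<kappa>)\<^sup>2 * N\<^sup>2 = \<mu> * (R powr \<kappa> * (N powr (1/2) * N))"
    proof -
     have "\<mu> * (R powr \<kappa> * (N powr (1/2) * N)) = (R powr \<kappa>)\<^sup>2 * ((N powr (1/2) * N powr (1/2)) * N)"
      unfolding \<mu>_def power2_eq_square by (simp only: mult_ac)
     thus ?thesis unfolding n2 by (simp only: power2_eq_square mult_ac)
    qed
    thus ?thesis using \<mu> by simp
   qed
   hence "1 / \<mu> * (A4 * C * (2 powr \<kappa>)\<^sup>2 * (R powr \<kappa>)\<^sup>2 * N\<^sup>2) = A4 * C * (2 powr \<kappa>)\<^sup>2 * (R powr \<kappa> * (N powr (1/2) * N))"
    by (simp only: mult.assoc mult.left_commute[of "1 / \<mu>"])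
   moreover have "\<mu> * (A2 * N) = A2 * (R powr \<kappa> * (N powr (1/2) * N))" by (simp add: \<mu>_def mult_ac)
   ultimately show ?thesis by (simp only: D_def n1 distrib_right mult.assoc)
  qed
  finally show ?thesis .
 qed
 thus ?thesis using D unfolding \<kappa>_def by blast
qed

text \<open>In the band \<open>\<langle>n\<rangle> \<approx> R\<close> with \<open>R = 2\<^sup>j\<close> one may take \<open>N = R^(-1/2 - 2 eps) E\<close>, so \<open>L3_band\<close> gives
\<open>R^(3/4 + eps) N^(3/2) = R^(-2 eps) E^(3/2)\<close>. The weights \<open>r\<^sup>j = R^(-eps/2)\<close> of
\<open>weighted_cube_sum\<close> cost \<open>R^eps\<close> and leave a convergent
series.\<close>

lemma L3_embedding:
 fixes eps :: real
 assumes eps: "0 < eps" "eps < 1/5"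
 shows "\<exists>D>0. \<forall>G E. fint G \<longrightarrow> E > 0 \<longrightarrow> EN (1/4 + eps) (2/5) (amp G) \<le> ennreal E \<longrightarrow>
   (\<integral>\<^sup>+ p. ennreal (norm (ift G p) ^ 3) \<partial>stm) \<le> ennreal (D * E powr (3/2))"
proof -
 obtain D where D: "D > 0" and band: "\<And>G R N. fint G \<Longrightarrow> R > 0 \<Longrightarrow> N > 0 \<Longrightarrow> (\<And>q. G q \<noteq> 0 \<Longrightarrow> fq q \<le> 2 * R) \<Longrightarrow>
   NL (amp G) \<le> ennreal N \<Longrightarrow>
   (\<integral>\<^sup>+ p. ennreal (norm (ift G p) ^ 3) \<partial>stm) \<le> ennreal (D * R powr (3/4 + eps) * N powr (3/2))"
  using L3_band[OF eps] by blast
 define r where "r = 2 powr (- eps / 2)"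
 have r: "0 < r" "r < 1" using eps by (auto simp: r_def powr_less_one)
 define W where "W = 1 / (1 - r)"
 have W: "W > 0" using r by (simp add: W_def)
 have geo: "(\<Sum>j<n. r ^ j) \<le> W" for n
 proof -
  have "(\<Sum>j<n. r ^ j) * (1 - r) = 1 - r ^ n" using one_diff_power_eq[of r n] by (simp add: mult.commute)
  also have "\<dots> \<le> 1" using r by simp
  finally show ?thesis using r by (simp add: W_def pos_le_divide_eq)
 qed
 have p2: "(2::real) ^ j = 2 powr real j" for j by (simp add: powr_realpow)
 have "(\<integral>\<^sup>+ p. ennreal (norm (ift G p) ^ 3) \<partial>stm) \<le> ennreal (W ^ 3 * D * E powr (3/2))"
  if G: "fint G" and E: "E > 0" and EN: "EN (1/4 + eps) (2/5) (amp G) \<le> ennreal E" for G E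
 proof -
  have [measurable]: "fmeas G" using G by auto
  define S where "S = (\<lambda>J q. if fq q < 2 ^ J then G q else 0)"
  define P where "P = (\<lambda>j q. if 2 ^ j \<le> fq q \<and> fq q < 2 ^ Suc j then G q else 0)"
  have [measurable]: "fmeas (S J)" "fmeas (P J)" for J
   unfolding S_def P_def by measurable
  have Si: "fint (S J)" for J
   by (rule Bochner_Integration.integrable_bound[OF G]) (auto simp: S_def)
  have Pi: "fint (P j)" for j
   by (rule Bochner_Integration.integrable_bound[OF G]) (auto simp: P_def)
  have iS: "ift (S J) p = (\<Sum>j<J. ift (P j) p)" for J p
  proof (induction J)
   case 0
   have "S 0 q = 0" for q using fq_ge_1[of q] by (simp add: S_def)
   thus ?case by (simp add: ift_def)
  next
   case (Suc J)
   have "S (Suc J) q = S J q + P J q" for q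
   proof -
    have "fq q < 2 ^ Suc J" if "fq q < 2 ^ J" using that by (rule less_le_trans) simp
    thus ?thesis unfolding S_def P_def by (auto simp del: power_Suc)
   qed
   hence "ift (S (Suc J)) p = ift (S J) p + ift (P J) p"
    unfolding ift_def by (simp add: distrib_right Bochner_Integration.integral_add[OF integrable_freq_chr[OF Si] integrable_freq_chr[OF Pi]])
   thus ?case using Suc by simp
  qed
  have P3: "(\<integral>\<^sup>+ p. ennreal (norm (ift (P j) p) ^ 3) \<partial>stm) \<le> ennreal (D * E powr (3/2) * (r ^ j) ^ 4)" for j
  proof -
   define N where "N = 2 powr (- (real j * (1/2 + 2*eps))) * E"
   have N: "N > 0" using E by (simp add: N_def)
   have pt: "(ennreal (md q powr (2/5)) * ennreal (norm (P j q)))\<^sup>2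
    \<le> ennreal (2 powr (- (real j * (1/2 + 2*eps)))) * (ennreal (fq q powr (1/4+eps) * md q powr (2/5)) * ennreal (norm (G q)))\<^sup>2" for q
   proof (cases "2 ^ j \<le> fq q")
    case True
    have "1 \<le> 2 powr (- (real j * (1/2 + 2*eps))) * (fq q powr (1/4+eps))\<^sup>2"
    proof -
     have "(2 powr real j) powr (1/4+eps) \<le> fq q powr (1/4+eps)"
      using True eps by (intro powr_mono2) (auto simp: p2)
     hence le: "((2 powr real j) powr (1/4+eps))\<^sup>2 \<le> (fq q powr (1/4+eps))\<^sup>2" by (intro power_mono) auto
     have eq: "((2 powr real j) powr (1/4+eps))\<^sup>2 = 2 powr (real j * (1/2 + 2*eps))"
      by (simp add: power2_eq_square powr_powr algebra_simps flip: powr_add)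
     have "1 = 2 powr (- (real j * (1/2 + 2*eps))) * 2 powr (real j * (1/2 + 2*eps))" by (simp flip: powr_add)
     also have "\<dots> \<le> 2 powr (- (real j * (1/2 + 2*eps))) * (fq q powr (1/4+eps))\<^sup>2"
      by (rule mult_left_mono[OF le[unfolded eq]]) simp
     finally show ?thesis .
    qed
    hence "1 * (md q powr (2/5) * norm (G q))\<^sup>2 \<le> (2 powr (- (real j * (1/2 + 2*eps))) * (fq q powr (1/4+eps))\<^sup>2) * (md q powr (2/5) * norm (G q))\<^sup>2"
     by (rule mult_right_mono) simp
    moreover have "(md q powr (2/5) * norm (P j q))\<^sup>2 \<le> (md q powr (2/5) * norm (G q))\<^sup>2"
     by (intro power_mono mult_left_mono) (auto simp: P_def)
    ultimately have "(md q powr (2/5) * norm (P j q))\<^sup>2 \<le> 2 powr (- (real j * (1/2 + 2*eps))) * (fq q powr (1/4+eps) * md q powr (2/5) * norm (G q))\<^sup>2"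
     by (simp add: power_mult_distrib mult_ac)
    thus ?thesis by (simp add: ennreal_power flip: ennreal_mult)
   qed (simp add: P_def)
   have "NL (amp (P j)) \<le> ennreal (2 powr (- (real j * (1/2 + 2*eps)))) * EN (1/4 + eps) (2/5) (amp G)"
    unfolding NL_def EN_def by (subst nn_integral_cmult[symmetric]) (auto intro!: nn_integral_mono pt)
   also have "\<dots> \<le> ennreal (2 powr (- (real j * (1/2 + 2*eps)))) * ennreal E" by (intro mult_left_mono EN) simp
   also have "\<dots> = ennreal N" using E by (simp add: N_def ennreal_mult)
   finally have "(\<integral>\<^sup>+ p. ennreal (norm (ift (P j) p) ^ 3) \<partial>stm) \<le> ennreal (D * (2 ^ j) powr (3/4 + eps) * N powr (3/2))"
    by (intro band Pi N) (auto simp: P_def split: if_splits)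
   also have "D * (2 ^ j) powr (3/4 + eps) * N powr (3/2) = D * E powr (3/2) * (r ^ j) ^ 4"
   proof -
    have "(2 ^ j) powr (3/4 + eps) * N powr (3/2) = E powr (3/2) * 2 powr (real j * (3/4 + eps) + (- (real j * (1/2 + 2*eps))) * (3/2))"
    proof -
     have "(2 ^ j :: real) powr (3/4 + eps) = 2 powr (real j * (3/4 + eps))" by (simp only: p2 powr_powr)
     moreover have "N powr (3/2) = 2 powr ((- (real j * (1/2 + 2*eps))) * (3/2)) * E powr (3/2)"
      unfolding N_def using E by (subst powr_mult) (simp_all only: powr_powr powr_ge_zero less_imp_le)
     ultimately show ?thesis by (simp only: powr_add mult_ac)
    qed
    also have "real j * (3/4 + eps) + (- (real j * (1/2 + 2*eps))) * (3/2) = (- eps / 2) * real (j * 4)"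
     by (simp add: field_simps)
    also have "2 powr \<dots> = (r ^ j) ^ 4" by (simp add: r_def powr_power flip: power_mult)
    finally show ?thesis by (simp add: mult.assoc)
   qed
   finally show ?thesis .
  qed
  have S3: "(\<integral>\<^sup>+ p. ennreal (norm (ift (S J) p) ^ 3) \<partial>stm) \<le> ennreal (W ^ 3 * D * E powr (3/2))" for J
  proof -
   have "ennreal (norm (ift (S J) p) ^ 3) \<le> (\<Sum>j<J. ennreal (W\<^sup>2 / (r ^ j)\<^sup>2) * ennreal (norm (ift (P j) p) ^ 3))" for p
   proof -
    have "norm (ift (S J) p) ^ 3 \<le> (\<Sum>j<J. norm (ift (P j) p)) ^ 3" unfolding iS by (intro power_mono norm_sum) auto
    also have "\<dots> \<le> (1 / (1 - r)\<^sup>2) * (\<Sum>j<J. norm (ift (P j) p) ^ 3 / (r ^ j)\<^sup>2)"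
     by (rule weighted_cube_sum[OF _ r]) simp
    also have "\<dots> = (\<Sum>j<J. W\<^sup>2 / (r ^ j)\<^sup>2 * norm (ift (P j) p) ^ 3)"
     by (simp add: W_def sum_distrib_left power_divide)
    finally show ?thesis by (simp add: ennreal_leI flip: ennreal_mult)
   qed
   hence "(\<integral>\<^sup>+ p. ennreal (norm (ift (S J) p) ^ 3) \<partial>stm) \<le> (\<integral>\<^sup>+ p. (\<Sum>j<J. ennreal (W\<^sup>2 / (r ^ j)\<^sup>2) * ennreal (norm (ift (P j) p) ^ 3)) \<partial>stm)"
    by (intro nn_integral_mono)
   also have "\<dots> = (\<Sum>j<J. ennreal (W\<^sup>2 / (r ^ j)\<^sup>2) * (\<integral>\<^sup>+ p. ennreal (norm (ift (P j) p) ^ 3) \<partial>stm))"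
    by (subst nn_integral_sum) (auto simp: nn_integral_cmult)
   also have "\<dots> \<le> (\<Sum>j<J. ennreal (W\<^sup>2 / (r ^ j)\<^sup>2) * ennreal (D * E powr (3/2) * (r ^ j) ^ 4))"
    by (intro sum_mono mult_left_mono P3) auto
   also have "\<dots> = ennreal (\<Sum>j<J. W\<^sup>2 / (r ^ j)\<^sup>2 * (D * E powr (3/2) * (r ^ j) ^ 4))"
   proof -
    have "(\<Sum>j<J. ennreal (W\<^sup>2 / (r ^ j)\<^sup>2) * ennreal (D * E powr (3/2) * (r ^ j) ^ 4)) = (\<Sum>j<J. ennreal (W\<^sup>2 / (r ^ j)\<^sup>2 * (D * E powr (3/2) * (r ^ j) ^ 4)))"
     by (intro sum.cong refl ennreal_mult[symmetric]) (use D in auto)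
    also have "\<dots> = ennreal (\<Sum>j<J. W\<^sup>2 / (r ^ j)\<^sup>2 * (D * E powr (3/2) * (r ^ j) ^ 4))"
     by (rule sum_ennreal) (use D in auto)
    finally show ?thesis .
   qed
   also have "\<dots> \<le> ennreal (W ^ 3 * D * E powr (3/2))"
   proof (rule ennreal_leI)
    have "(\<Sum>j<J. W\<^sup>2 / (r ^ j)\<^sup>2 * (D * E powr (3/2) * (r ^ j) ^ 4)) \<le> (\<Sum>j<J. W\<^sup>2 * (D * E powr (3/2)) * r ^ j)"
    proof (intro sum_mono)
     fix j
     have "W\<^sup>2 / (r ^ j)\<^sup>2 * (D * E powr (3/2) * (r ^ j) ^ 4) = W\<^sup>2 * (D * E powr (3/2)) * (r ^ j)\<^sup>2"
      using r by (simp add: power2_eq_square power4_eq_xxxx)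
     also have "(r ^ j)\<^sup>2 \<le> r ^ j" using r by (simp add: power2_eq_square power_le_one mult_left_le_one_le)
     hence "W\<^sup>2 * (D * E powr (3/2)) * (r ^ j)\<^sup>2 \<le> W\<^sup>2 * (D * E powr (3/2)) * r ^ j" using D by (intro mult_left_mono) auto
     finally show "W\<^sup>2 / (r ^ j)\<^sup>2 * (D * E powr (3/2) * (r ^ j) ^ 4) \<le> W\<^sup>2 * (D * E powr (3/2)) * r ^ j" .
    qed
    also have "\<dots> = W\<^sup>2 * (D * E powr (3/2)) * (\<Sum>j<J. r ^ j)" by (simp add: sum_distrib_left)
    also have "\<dots> \<le> W\<^sup>2 * (D * E powr (3/2)) * W" using D by (intro mult_left_mono geo) auto
    finally show "(\<Sum>j<J. W\<^sup>2 / (r ^ j)\<^sup>2 * (D * E powr (3/2) * (r ^ j) ^ 4)) \<le> W ^ 3 * D * E powr (3/2)"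
     by (simp add: power2_eq_square power3_eq_cube mult_ac)
   qed
   finally show ?thesis .
  qed
  show ?thesis
  proof (rule fatou_le[of "\<lambda>J p. ennreal (norm (ift (S J) p) ^ 3)"])
   have "(\<lambda>J. ift (S J) p) \<longlonglongrightarrow> ift G p" for p unfolding ift_def
   proof (rule integral_dominated_convergence[where w="\<lambda>q. norm (G q)"])
    show "AE q in freq_measure. (\<lambda>J. S J q * chr q p) \<longlonglongrightarrow> G q * chr q p"
    proof (intro AE_I2 tendsto_mult tendsto_const tendsto_eventually)
     fix q
     obtain J0 where J0: "fq q < 2 ^ J0" using real_arch_pow[of 2 "fq q"] by auto
     show "\<forall>\<^sub>F J in sequentially. S J q = G q"
      using eventually_ge_at_top[of J0]
     proof eventually_elim
      case (elim J)
      hence "(2::real) ^ J0 \<le> 2 ^ J" by (intro power_increasing) auto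
      from less_le_trans[OF J0 this] show ?case by (simp add: S_def)
     qed
    qed
   qed (use G in \<open>auto simp: norm_mult S_def\<close>)
   hence "(\<lambda>J. norm (ift (S J) p) ^ 3) \<longlonglongrightarrow> norm (ift G p) ^ 3" for p by (intro tendsto_power tendsto_norm)
   thus "AE p in stm. (\<lambda>J. ennreal (norm (ift (S J) p) ^ 3)) \<longlonglongrightarrow> ennreal (norm (ift G p) ^ 3)"
    by (intro AE_I2 tendsto_ennrealI)
  qed (use S3 in \<open>auto\<close>)
 qed
 thus ?thesis using W D by (intro exI[of _ "W ^ 3 * D"]) (auto simp: mult.assoc)
qed

section \<open>Weighted norms\<close>

definition cEN :: "real \<Rightarrow> real \<Rightarrow> (freqpt \<Rightarrow> complex) \<Rightarrow> ennreal" where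
 "cEN s b F = EN s b (amp F)"

lemma ennsqrt_sq: "(ennsqrt x)\<^sup>2 = x"
proof (cases "x = \<infinity>")
 case True thus ?thesis by (simp add: ennsqrt_def power2_eq_square ennreal_top_mult)
next
 case False
 then obtain r where "x = ennreal r" "r \<ge> 0" by (cases x) auto
 thus ?thesis by (simp add: ennsqrt_def ennreal_power)
qed

lemma ennsqrt_le_iff: "ennsqrt x \<le> ennsqrt y \<longleftrightarrow> x \<le> y"
proof
 assume "ennsqrt x \<le> ennsqrt y"
 hence "(ennsqrt x)\<^sup>2 \<le> (ennsqrt y)\<^sup>2" by (rule power_mono) simp
 thus "x \<le> y" by (simp add: ennsqrt_sq)
next
 assume xy: "x \<le> y"
 show "ennsqrt x \<le> ennsqrt y"
 proof (cases "y = \<infinity>")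
  case False
  hence "x \<noteq> \<infinity>" using xy by (auto simp: top_unique)
  thus ?thesis using False xy by (auto simp: ennsqrt_def intro!: ennreal_leI enn2real_mono simp: less_top)
 qed (simp add: ennsqrt_def)
qed

lemma ennsqrt_ennreal_sq: "0 \<le> c \<Longrightarrow> ennsqrt (ennreal (c\<^sup>2)) = ennreal c"
 by (simp add: ennsqrt_def)

lemma weighted_L2_eq: "weighted_L2 s b F = ennsqrt (cEN s b F)"
proof -
 have "(\<lambda>(l, n). ennreal ((jap (freq n) powr s * jap (abs l - jap (freq n)) powr b * norm (F (l, n)))\<^sup>2))
   = (\<lambda>q. (ennreal (fq q powr s * md q powr b) * ennreal (norm (F q)))\<^sup>2)"
  by (auto simp: fun_eq_iff fq_def md_def ennreal_power simp flip: ennreal_mult)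
 thus ?thesis unfolding weighted_L2_def cEN_def EN_def by simp
qed

lemma weighted_L2_le_iff: "0 \<le> c \<Longrightarrow> weighted_L2 s b F \<le> ennreal c \<longleftrightarrow> cEN s b F \<le> ennreal (c\<^sup>2)"
 using ennsqrt_le_iff[of "cEN s b F" "ennreal (c\<^sup>2)"] by (simp add: weighted_L2_eq ennsqrt_ennreal_sq)

lemma EN_mono: "(\<And>q. F q \<le> G q) \<Longrightarrow> EN s b F \<le> EN s b G"
 unfolding EN_def by (intro nn_integral_mono power_mono mult_left_mono) auto

lemma EN_mono_weight:
 assumes "s \<le> s'" "b \<le> b'"
 shows "EN s b F \<le> EN s' b' F"
proof -
 have "fq q powr s * md q powr b \<le> fq q powr s' * md q powr b'" for q
  using assms fq_ge_1[of q] md_ge_1[of q] by (intro mult_mono powr_mono) auto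
 thus ?thesis unfolding EN_def by (intro nn_integral_mono power_mono mult_right_mono ennreal_leI) auto
qed

lemma cEN_cong_AE: "AE q in freq_measure. F q = G q \<Longrightarrow> cEN s b F = cEN s b G"
 unfolding cEN_def EN_def by (intro nn_integral_cong_AE) auto

lemma cEN_le_sum:
 assumes [measurable]: "fmeas F" "fmeas G"
  and H: "\<And>q. norm (H q) \<le> norm (F q) + norm (G q)"
 shows "cEN s b H \<le> 2 * cEN s b F + 2 * cEN s b G"
proof -
 have "cEN s b H \<le> (\<oint> q. 2 * (ennreal (fq q powr s * md q powr b) * ennreal (norm (F q)))\<^sup>2 + 2 * (ennreal (fq q powr s * md q powr b) * ennreal (norm (G q)))\<^sup>2)"
  unfolding cEN_def EN_def
 proof (rule nn_integral_mono)
  fix q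
  let ?w = "ennreal (fq q powr s * md q powr b)"
  have "(?w * ennreal (norm (H q)))\<^sup>2 \<le> (?w * ennreal (norm (F q)) + ?w * ennreal (norm (G q)))\<^sup>2"
   unfolding distrib_left[symmetric] using H[of q] by (intro power_mono mult_left_mono) (auto simp flip: ennreal_plus intro!: ennreal_leI)
  also have "\<dots> \<le> 2 * (?w * ennreal (norm (F q)))\<^sup>2 + 2 * (?w * ennreal (norm (G q)))\<^sup>2" by (rule ennreal_sq_add_le)
  finally show "(?w * ennreal (norm (H q)))\<^sup>2 \<le> 2 * (?w * ennreal (norm (F q)))\<^sup>2 + 2 * (?w * ennreal (norm (G q)))\<^sup>2" .
 qed
 also have "\<dots> = 2 * cEN s b F + 2 * cEN s b G"
  unfolding cEN_def EN_def by (simp add: nn_integral_add nn_integral_cmult)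
 finally show ?thesis .
qed

lemma two_pi_cube: "1 / (2*pi)^3 \<le> 1"
proof (rule divide_le_eq_1_pos[THEN iffD2])
 have "1 \<le> 2 * pi" using pi_gt3 by simp
 thus "1 \<le> (2*pi)^3" by (rule one_le_power)
qed simp

lemma has_fourier_iff: "has_fourier u F \<longleftrightarrow> F \<in> borel_measurable freq_measure \<and>
  (\<forall>\<phi>\<in>schwartz. fint (\<lambda>q. F q * ft \<phi> (- q)) \<and> u \<phi> = of_real (1 / (2*pi)^3) * (\<integral>q. F q * ft \<phi> (- q) \<partial>freq_measure))"
proof -
 have "(\<lambda>(l, n). F (l, n) * fourier \<phi> (- l) (- n)) = (\<lambda>q. F q * ft \<phi> (- q))" for \<phi>
  by (auto simp: fun_eq_iff ft_def)
 thus ?thesis unfolding has_fourier_def by simp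
qed

lemma has_fourier_add:
 assumes "has_fourier u F" "has_fourier v G"
 shows "has_fourier (\<lambda>\<phi>. u \<phi> + v \<phi>) (\<lambda>q. F q + G q)"
 using assms unfolding has_fourier_iff by (auto simp: distrib_right distrib_left)

lemma has_fourier_diff:
 assumes "has_fourier u F" "has_fourier v G"
 shows "has_fourier (\<lambda>\<phi>. u \<phi> - v \<phi>) (\<lambda>q. F q - G q)"
 using assms unfolding has_fourier_iff by (auto simp: left_diff_distrib right_diff_distrib)

lemma has_fourier_from_diff:
 assumes "has_fourier (\<lambda>\<phi>. u \<phi> - dist_of f \<phi>) G" "integrable stm f"
 shows "has_fourier u (\<lambda>q. G q + ft f q)"
 using has_fourier_add[OF assms(1) has_fourier_dist_of[OF assms(2)]] by simp

text \<open>Cauchy--Schwarz; since \<open>s\<close> and \<open>b\<close> are nonnegative, the weighted norm dominates the \<open>L\<^sup>2\<close> norm.\<close>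

lemma fourier_pairing_bound:
 assumes \<phi>: "\<phi> \<in> schwartz" and sb: "0 \<le> s" "0 \<le> b"
 shows "\<exists>C>0. \<forall>u G e. has_fourier u G \<longrightarrow> 0 \<le> e \<longrightarrow> weighted_L2 s b G \<le> ennreal e \<longrightarrow> norm (u \<phi>) \<le> C * e"
proof -
 have m[measurable]: "fmeas (ft \<phi>)" using ft_integrable[OF \<phi>] by auto
 define c where "c = enn2real (EN 0 0 (\<lambda>q. ennreal (norm (ft \<phi> q))))"
 have fin: "EN 0 0 (\<lambda>q. ennreal (norm (ft \<phi> q))) = ennreal c"
  using schwartz_EN_finite[OF \<phi>, of 0 0] by (simp add: c_def)
 have c: "0 \<le> c" by (simp add: c_def)
 have refl: "(\<oint> q. (ennreal (norm (ft \<phi> (- q))))\<^sup>2) = ennreal c"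
  unfolding fin[symmetric] EN_def using nn_integral_freq_reflect[of "\<lambda>q. (ennreal (norm (ft \<phi> q)))\<^sup>2" 0]
   fq_pos md_pos by (simp add: less_imp_neq[symmetric])
 have "norm (u \<phi>) \<le> (sqrt c + 1) * e" if F: "has_fourier u G" and e: "0 \<le> e" "weighted_L2 s b G \<le> ennreal e" for u G e
 proof -
  have [measurable]: "fmeas G" using F by (simp add: has_fourier_def)
  have i: "fint (\<lambda>q. G q * ft \<phi> (- q))" and u: "u \<phi> = of_real (1 / (2*pi)^3) * (\<integral>q. G q * ft \<phi> (- q) \<partial>freq_measure)"
   using F \<phi> unfolding has_fourier_iff by blast+
  have pi1: "1 / (2*pi)^3 \<le> 1" by (rule two_pi_cube)
  have "norm (u \<phi>) \<le> 1 * norm (\<integral>q. G q * ft \<phi> (- q) \<partial>freq_measure)"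
   unfolding u norm_mult using pi1 by (intro mult_right_mono) (auto simp: norm_divide norm_power)
  hence "ennreal (norm (u \<phi>)) \<le> ennreal (norm (\<integral>q. G q * ft \<phi> (- q) \<partial>freq_measure))" by (simp add: ennreal_leI)
  also have "\<dots> \<le> (\<oint> q. ennreal (norm (G q * ft \<phi> (- q))))" by (rule integral_norm_bound_ennreal[OF i])
  finally have "(ennreal (norm (u \<phi>)))\<^sup>2 \<le> (\<oint> q. ennreal (norm (G q)) * ennreal (norm (ft \<phi> (- q))))\<^sup>2"
   by (intro power_mono) (simp_all add: norm_mult ennreal_mult)
  also have "\<dots> \<le> (\<oint> q. (ennreal (norm (G q)))\<^sup>2) * (\<oint> q. (ennreal (norm (ft \<phi> (- q))))\<^sup>2)"
   by (rule Cauchy_Schwarz_nn_integral) measurable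
  also have "\<dots> \<le> ennreal (e\<^sup>2) * ennreal c"
  proof (intro mult_mono)
   have "(\<oint> q. (ennreal (norm (G q)))\<^sup>2) = cEN 0 0 G"
    unfolding cEN_def EN_def using fq_pos md_pos by (simp add: less_imp_neq[symmetric])
   also have "\<dots> \<le> cEN s b G" unfolding cEN_def using sb by (intro EN_mono_weight) auto
   also have "\<dots> \<le> ennreal (e\<^sup>2)" using e by (simp add: weighted_L2_le_iff)
   finally show "(\<oint> q. (ennreal (norm (G q)))\<^sup>2) \<le> ennreal (e\<^sup>2)" .
  qed (simp_all add: refl)
  also have "\<dots> = ennreal ((sqrt c * e)\<^sup>2)" using c by (simp add: power_mult_distrib mult.commute flip: ennreal_mult)
  finally have "ennreal ((norm (u \<phi>))\<^sup>2) \<le> ennreal ((sqrt c * e)\<^sup>2)" by (simp only: ennreal_power norm_ge_zero)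
  hence "(norm (u \<phi>))\<^sup>2 \<le> (sqrt c * e)\<^sup>2" by (rule ennreal_le_iff[THEN iffD1, rotated]) simp
  hence "norm (u \<phi>) \<le> sqrt c * e" by (rule power2_le_imp_le) (use c e(1) in simp)
  thus ?thesis using e by (simp add: distrib_right)
 qed
 thus ?thesis using c by (intro exI[of _ "sqrt c + 1"]) (auto intro: add_nonneg_pos)
qed

lemma schwartz_L3:
 fixes eps b :: real
 assumes eps: "0 < eps" "eps < 1/5" and b: "2/5 \<le> b"
 shows "\<exists>D>0. \<forall>f E. f \<in> schwartz \<longrightarrow> E > 0 \<longrightarrow> cEN (1/4 + eps) b (ft f) \<le> ennreal E \<longrightarrow>
   (\<integral>\<^sup>+ p. ennreal (norm (f p) ^ 3) \<partial>stm) \<le> ennreal (D * E powr (3/2))"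
proof -
 obtain D where D: "D > 0" and L3: "\<And>G E. fint G \<Longrightarrow> E > 0 \<Longrightarrow> EN (1/4 + eps) (2/5) (amp G) \<le> ennreal E \<Longrightarrow>
   (\<integral>\<^sup>+ p. ennreal (norm (ift G p) ^ 3) \<partial>stm) \<le> ennreal (D * E powr (3/2))"
  using L3_embedding[OF eps] by blast
 have "(\<integral>\<^sup>+ p. ennreal (norm (f p) ^ 3) \<partial>stm) \<le> ennreal (D * E powr (3/2))"
  if f: "f \<in> schwartz" and E: "E > 0" and EN: "cEN (1/4 + eps) b (ft f) \<le> ennreal E" for f E
 proof -
  have "norm (f p) \<le> norm (ift (ft f) p)" if p: "p \<in> space stm" for p
  proof -
   have pi1: "1 / (2*pi)^3 \<le> 1" by (rule two_pi_cube)
   have "norm (f p) = 1 / (2*pi)^3 * norm (ift (ft f) p)"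
    unfolding fourier_inversion[OF f p] norm_mult by (simp add: norm_divide norm_power)
   also have "\<dots> \<le> 1 * norm (ift (ft f) p)" by (rule mult_right_mono[OF pi1]) simp
   finally show ?thesis by simp
  qed
  hence "(\<integral>\<^sup>+ p. ennreal (norm (f p) ^ 3) \<partial>stm) \<le> (\<integral>\<^sup>+ p. ennreal (norm (ift (ft f) p) ^ 3) \<partial>stm)"
   by (intro nn_integral_mono ennreal_leI power_mono) auto
  also have "\<dots> \<le> ennreal (D * E powr (3/2))"
  proof (rule L3[OF ft_integrable[OF f] E])
   have "EN (1/4 + eps) (2/5) (amp (ft f)) \<le> cEN (1/4 + eps) b (ft f)"
    unfolding cEN_def using b by (intro EN_mono_weight) auto
   thus "EN (1/4 + eps) (2/5) (amp (ft f)) \<le> ennreal E" using EN by (rule order_trans)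
  qed
  finally show ?thesis .
 qed
 thus ?thesis using D by blast
qed

section \<open>The estimate for Schwartz functions\<close>

text \<open>The product to be estimated, cut off in time.\<close>

definition PR :: "real \<Rightarrow> (spacetime \<Rightarrow> complex) \<Rightarrow> (spacetime \<Rightarrow> complex) \<Rightarrow> (spacetime \<Rightarrow> complex) \<Rightarrow> spacetime \<Rightarrow> complex" where
 "PR T f g h = (\<lambda>p. f p * g p * h p * cutT T p)"

lemma PR_schwartz: "T > 0 \<Longrightarrow> f \<in> schwartz \<Longrightarrow> g \<in> schwartz \<Longrightarrow> h \<in> schwartz \<Longrightarrow> PR T f g h \<in> schwartz"
 unfolding PR_def by (intro schwartz_mult cutT_schwartz)

lemma norm_ft_mult_le_conv:
 assumes "integrable stm r" "f \<in> schwartz"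
 shows "ennreal (norm (ft (\<lambda>p. r p * f p) q)) \<le> conv (amp (ft f)) (amp (ft r)) q"
proof -
 have pi1: "1 / (2*pi)^3 \<le> 1" by (rule two_pi_cube)
 have "ennreal (1 / (2*pi)^3) * conv (amp (ft f)) (amp (ft r)) q \<le> 1 * conv (amp (ft f)) (amp (ft r)) q"
  using pi1 by (intro mult_right_mono) (auto simp: ennreal_le_1)
 thus ?thesis using norm_ft_mult_le[OF assms, of q] by simp
qed

text \<open>The transform of the product is at most the convolution of the moduli, so \<open>trilinear_freq\<close> and
\<open>time_cutoff\<close> with \<open>\<beta> = 1/2 - \<delta>\<close> apply. As \<open>\<delta> < 1/18\<close>, the gain \<open>T\<close> to the power \<open>2 (\<beta> - 2/5)\<close> is at least \<open>T^(2/25)\<close>,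
with an exponent that does not depend on \<open>\<delta>\<close>.\<close>

lemma schwartz_product_estimate:
 fixes eps \<delta> :: real
 assumes eps: "0 < eps" "eps < 1/12" and \<delta>: "0 < \<delta>" "\<delta> < 2/3 * eps"
 shows "\<exists>C>0. \<forall>T f g h. 0 < T \<longrightarrow> T \<le> 1 \<longrightarrow> f \<in> schwartz \<longrightarrow> g \<in> schwartz \<longrightarrow> h \<in> schwartz \<longrightarrow>
   cEN (- 3/4 + eps) (- 1/2 + \<delta>) (ft (PR T f g h))
    \<le> ennreal (C * T powr (2/25)) * (cEN (1/4 + eps) (1/2 + \<delta>) (ft f) * cEN (1/4 + eps) (1/2 + \<delta>) (ft g) * cEN (1/4 + eps) (1/2 + \<delta>) (ft h))"
proof -
 define \<beta> where "\<beta> = 1/2 - \<delta>"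
 have \<beta>: "2/5 < \<beta>" "\<beta> < 1/2" "2/25 \<le> 2 * (\<beta> - 2/5)" using eps \<delta> by (auto simp: \<beta>_def)
 have b: "- 1/2 + \<delta> = - \<beta>" by (simp add: \<beta>_def)
 obtain C1 where C1: "C1 > 0" and tri: "\<And>F G H. fmeas F \<Longrightarrow> fmeas G \<Longrightarrow> fmeas H \<Longrightarrow>
   EN (- 3/4 + eps) (- 2/5) (conv (conv F G) H) \<le> ennreal C1 * (EN (1/4 + eps) (2/5) F * EN (1/4 + eps) (2/5) G * EN (1/4 + eps) (2/5) H)"
  using trilinear_freq[of eps] eps by force
 obtain C2 where C2: "C2 > 0" and cut: "\<And>T c K R. 0 < T \<Longrightarrow> 0 \<le> c \<Longrightarrow> fmeas K \<Longrightarrow> fmeas R \<Longrightarrow>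
   (\<And>q. K q \<le> ennreal (if snd q = 0 then c * (T / (1 + (T * fst q)\<^sup>2)\<^sup>2) else 0)) \<Longrightarrow>
   EN (- 3/4 + eps) (- \<beta>) (conv K R) \<le> ennreal (C2 * c\<^sup>2 * T powr (2 * (\<beta> - 2/5))) * EN (- 3/4 + eps) (- 2/5) R"
  using time_cutoff[OF \<beta>(1,2), of "- 3/4 + eps"] by blast
 obtain c where c: "c \<ge> 0" and cutb: "\<And>T q. T > 0 \<Longrightarrow> norm (ft (cutT T) q) \<le> (if snd q = 0 then c * (T / (1 + (T * fst q)\<^sup>2)\<^sup>2) else 0)"
  using ft_cutT_bound by blast
 define C where "C = (C2 * c\<^sup>2 + 1) * C1"
 have C: "C > 0" unfolding C_def using C1 C2 by (intro mult_pos_pos add_nonneg_pos) auto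
 have "cEN (- 3/4 + eps) (- 1/2 + \<delta>) (ft (PR T f g h))
    \<le> ennreal (C * T powr (2/25)) * (cEN (1/4 + eps) (1/2 + \<delta>) (ft f) * cEN (1/4 + eps) (1/2 + \<delta>) (ft g) * cEN (1/4 + eps) (1/2 + \<delta>) (ft h))"
  if T: "0 < T" "T \<le> 1" and f: "f \<in> schwartz" and g: "g \<in> schwartz" and h: "h \<in> schwartz" for T f g h
 proof -
  have k: "cutT T \<in> schwartz" by (rule cutT_schwartz[OF T(1)])
  have [measurable]: "fmeas (ft f)" "fmeas (ft g)" "fmeas (ft h)" "fmeas (ft (cutT T))"
   using ft_integrable[OF f] ft_integrable[OF g] ft_integrable[OF h] ft_integrable[OF k] by auto
  let ?n = "\<lambda>f q. ennreal (norm (ft f q))"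
  let ?R = "conv (conv (?n g) (?n f)) (?n h)"
  have fg: "(\<lambda>p. f p * g p) \<in> schwartz" "(\<lambda>p. f p * g p * h p) \<in> schwartz" by (intro schwartz_mult f g h)+
  have b1: "?n (\<lambda>p. f p * g p) q \<le> conv (?n g) (?n f) q" for q by (rule norm_ft_mult_le_conv[OF schwartz_integrable[OF f] g])
  have b2: "?n (\<lambda>p. f p * g p * h p) q \<le> ?R q" for q
  proof -
   have "?n (\<lambda>p. f p * g p * h p) q \<le> conv (?n h) (?n (\<lambda>p. f p * g p)) q" by (rule norm_ft_mult_le_conv[OF schwartz_integrable[OF fg(1)] h])
   also have "\<dots> \<le> conv (?n h) (conv (?n g) (?n f)) q" by (intro conv_mono b1 order_refl)
   also have "\<dots> = ?R q" by (subst conv_commute) auto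
   finally show ?thesis .
  qed
  have b3: "?n (PR T f g h) q \<le> conv (?n (cutT T)) ?R q" for q
  proof -
   have "?n (PR T f g h) q \<le> conv (?n (cutT T)) (?n (\<lambda>p. f p * g p * h p)) q"
    unfolding PR_def by (rule norm_ft_mult_le_conv[OF schwartz_integrable[OF fg(2)] k])
   also have "\<dots> \<le> conv (?n (cutT T)) ?R q" by (intro conv_mono b2 order_refl)
   finally show ?thesis .
  qed
  have w: "EN (1/4 + eps) (2/5) (?n f) \<le> cEN (1/4 + eps) (1/2 + \<delta>) (ft f)" for f
   unfolding cEN_def using \<delta> by (intro EN_mono_weight) auto
  have "cEN (- 3/4 + eps) (- 1/2 + \<delta>) (ft (PR T f g h)) \<le> EN (- 3/4 + eps) (- \<beta>) (conv (?n (cutT T)) ?R)"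
   unfolding cEN_def b by (intro EN_mono b3)
  also have "\<dots> \<le> ennreal (C2 * c\<^sup>2 * T powr (2 * (\<beta> - 2/5))) * EN (- 3/4 + eps) (- 2/5) ?R"
  proof (rule cut[OF T(1) c])
   show "?n (cutT T) q \<le> ennreal (if snd q = 0 then c * (T / (1 + (T * fst q)\<^sup>2)\<^sup>2) else 0)" for q
    by (rule ennreal_leI[OF cutb[OF T(1)]])
  qed measurable
  also have "\<dots> \<le> ennreal ((C2 * c\<^sup>2 + 1) * T powr (2/25)) * (ennreal C1 * (EN (1/4 + eps) (2/5) (?n g) * EN (1/4 + eps) (2/5) (?n f) * EN (1/4 + eps) (2/5) (?n h)))"
  proof (intro mult_mono ennreal_leI tri)
   show "T powr (2 * (\<beta> - 2/5)) \<le> T powr (2/25)" using T \<beta> by (intro powr_mono') auto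
  qed (use C2 in \<open>auto\<close>)
  also have "\<dots> \<le> ennreal ((C2 * c\<^sup>2 + 1) * T powr (2/25)) * (ennreal C1 * (cEN (1/4 + eps) (1/2 + \<delta>) (ft g) * cEN (1/4 + eps) (1/2 + \<delta>) (ft f) * cEN (1/4 + eps) (1/2 + \<delta>) (ft h)))"
   by (intro mult_mono w order_refl) auto
  also have "\<dots> = ennreal (C * T powr (2/25)) * (cEN (1/4 + eps) (1/2 + \<delta>) (ft f) * cEN (1/4 + eps) (1/2 + \<delta>) (ft g) * cEN (1/4 + eps) (1/2 + \<delta>) (ft h))"
  proof -
   have "ennreal (C * T powr (2/25)) = ennreal ((C2 * c\<^sup>2 + 1) * T powr (2/25)) * ennreal C1"
    using C1 C2 by (simp add: C_def mult_ac flip: ennreal_mult)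
   thus ?thesis by (simp only: mult_ac)
  qed
  finally show ?thesis .
 qed
 thus ?thesis using C by blast
qed

lemma ft_PR_diff:
 assumes T: "T > 0" and s: "f1 \<in> schwartz" "f2 \<in> schwartz" "g1 \<in> schwartz" "g2 \<in> schwartz" "h1 \<in> schwartz" "h2 \<in> schwartz"
 shows "ft (PR T f1 g1 h1) q - ft (PR T f2 g2 h2) q =
   ft (PR T (\<lambda>p. f1 p - f2 p) g1 h1) q + ft (PR T f2 (\<lambda>p. g1 p - g2 p) h1) q + ft (PR T f2 g2 (\<lambda>p. h1 p - h2 p)) q"
proof -
 let ?A = "PR T (\<lambda>p. f1 p - f2 p) g1 h1" and ?B = "PR T f2 (\<lambda>p. g1 p - g2 p) h1" and ?C = "PR T f2 g2 (\<lambda>p. h1 p - h2 p)"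
 have i: "integrable stm ?A" "integrable stm ?B" "integrable stm ?C" "integrable stm (PR T f2 g2 h2)"
  by (intro schwartz_integrable PR_schwartz T schwartz_diff s)+
 have e: "PR T f1 g1 h1 = (\<lambda>p. ?A p + ?B p + ?C p + PR T f2 g2 h2 p)"
  by (simp add: PR_def fun_eq_iff algebra_simps)
 show ?thesis unfolding e using i by (simp add: ft_add)
qed

section \<open>Absolutely convergent series in \<open>L\<^sup>3\<close>\<close>

text \<open>The partial sums of \<open>\<Sum>|a\<^sub>j|\<close> are bounded in \<open>L\<^sup>3\<close> by \<open>weighted_cube_sum\<close> with \<open>r = 1/2\<close>, as \<open>4\<^sup>j 16^(-j)\<close> is summable.
By monotone convergence they are bounded almost everywhere, and the full sum is the majorant.\<close>

lemma cube_summable_dominated: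
 fixes a :: "nat \<Rightarrow> 'a \<Rightarrow> complex"
 assumes m[measurable]: "\<And>j. a j \<in> borel_measurable M" and B: "B \<ge> 0"
  and bd: "\<And>j. (\<integral>\<^sup>+ p. ennreal (norm (a j p) ^ 3) \<partial>M) \<le> ennreal (B * (1/16) ^ j)"
 shows "\<exists>d. d \<in> borel_measurable M \<and> (\<forall>p. 0 \<le> d p) \<and> (\<integral>\<^sup>+ p. ennreal (d p ^ 3) \<partial>M) < \<infinity> \<and>
   (AE p in M. summable (\<lambda>j. a j p) \<and> (\<forall>n. norm (\<Sum>j<n. a j p) \<le> d p))"
proof -
 define D where "D = (\<lambda>n p. \<Sum>j<n. norm (a j p))"
 have [measurable]: "D n \<in> borel_measurable M" for n unfolding D_def by measurable
 have D0: "0 \<le> D n p" for n p by (auto simp: D_def intro: sum_nonneg)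
 have Dmono: "D n p \<le> D (Suc n) p" for n p by (simp add: D_def)
 have D3: "(\<integral>\<^sup>+ p. ennreal (D n p ^ 3) \<partial>M) \<le> ennreal (8 * B)" for n
 proof -
  have "ennreal (D n p ^ 3) \<le> (\<Sum>j<n. ennreal (4 * 4 ^ j) * ennreal (norm (a j p) ^ 3))" for p
  proof -
   have "D n p ^ 3 \<le> (1 / (1 - 1/2)\<^sup>2) * (\<Sum>j<n. norm (a j p) ^ 3 / ((1/2) ^ j)\<^sup>2)"
    unfolding D_def by (rule weighted_cube_sum) auto
   also have "\<dots> = (\<Sum>j<n. 4 * 4 ^ j * norm (a j p) ^ 3)"
   proof -
    have "((1/2::real) ^ j)\<^sup>2 = (1/4) ^ j" for j by (simp add: power2_eq_square flip: power_mult_distrib)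
    hence "norm (a j p) ^ 3 / ((1/2) ^ j)\<^sup>2 = 4 ^ j * norm (a j p) ^ 3" for j by (simp only: power_one_over) simp
    thus ?thesis by (simp add: sum_distrib_left power2_eq_square mult.assoc)
   qed
   finally show ?thesis by (simp add: ennreal_leI flip: ennreal_mult)
  qed
  hence "(\<integral>\<^sup>+ p. ennreal (D n p ^ 3) \<partial>M) \<le> (\<integral>\<^sup>+ p. (\<Sum>j<n. ennreal (4 * 4 ^ j) * ennreal (norm (a j p) ^ 3)) \<partial>M)"
   by (intro nn_integral_mono)
  also have "\<dots> = (\<Sum>j<n. ennreal (4 * 4 ^ j) * (\<integral>\<^sup>+ p. ennreal (norm (a j p) ^ 3) \<partial>M))"
   by (subst nn_integral_sum) (auto simp: nn_integral_cmult)
  also have "\<dots> \<le> (\<Sum>j<n. ennreal (4 * 4 ^ j) * ennreal (B * (1/16) ^ j))"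
   by (intro sum_mono mult_left_mono bd) auto
  also have "\<dots> = (\<Sum>j<n. ennreal (4 * 4 ^ j * (B * (1/16) ^ j)))"
   by (intro sum.cong refl ennreal_mult[symmetric]) (use B in auto)
  also have "\<dots> = ennreal (\<Sum>j<n. 4 * 4 ^ j * (B * (1/16) ^ j))"
   by (rule sum_ennreal) (use B in auto)
  also have "(\<Sum>j<n. 4 * 4 ^ j * (B * (1/16) ^ j)) = 4 * B * (\<Sum>j<n. (1/4) ^ j)"
  proof -
   have "4 ^ j * (1/16 :: real) ^ j = (1/4) ^ j" for j by (subst power_mult_distrib[symmetric]) simp
   hence "4 * 4 ^ j * (B * (1/16) ^ j) = 4 * B * (1/4) ^ j" for j by (metis mult.assoc mult.left_commute)
   thus ?thesis by (simp only: sum_distrib_left)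
  qed
  also have "\<dots> \<le> 4 * B * 2"
  proof (intro mult_left_mono)
   have "(\<Sum>j<n. (1/4::real) ^ j) * (3/4) = 1 - (1/4) ^ n" using one_diff_power_eq[of "1/4::real" n] by (simp add: mult.commute)
   moreover have "0 \<le> (1/4::real) ^ n" by simp
   ultimately show "(\<Sum>j<n. (1/4::real) ^ j) \<le> 2" by linarith
  qed (use B in auto)
  finally show ?thesis by (simp add: ennreal_leI mult.commute)
 qed
 have "(\<integral>\<^sup>+ p. (SUP n. ennreal (D n p ^ 3)) \<partial>M) = (SUP n. \<integral>\<^sup>+ p. ennreal (D n p ^ 3) \<partial>M)"
  by (rule nn_integral_monotone_convergence_SUP) (auto intro!: incseq_SucI le_funI ennreal_leI power_mono Dmono D0)
 also have "\<dots> \<le> ennreal (8 * B)" by (intro SUP_least D3)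
 finally have "(\<integral>\<^sup>+ p. (SUP n. ennreal (D n p ^ 3)) \<partial>M) \<noteq> \<infinity>" by (auto simp: top_unique)
 hence "AE p in M. (SUP n. ennreal (D n p ^ 3)) \<noteq> \<infinity>" by (intro nn_integral_noteq_infinite) measurable
 hence sm: "AE p in M. summable (\<lambda>j. norm (a j p))"
 proof eventually_elim
  case (elim p)
  define x where "x = enn2real (SUP n. ennreal (D n p ^ 3))"
  have xx: "(SUP n. ennreal (D n p ^ 3)) = ennreal x"
   unfolding x_def using elim by (intro ennreal_enn2real[symmetric]) (simp only: less_top[symmetric] infinity_ennreal_def not_False_eq_True)
  have x0: "0 \<le> x" by (simp add: x_def)
  have "D n p \<le> 1 + x" for n
  proof -
   have "ennreal (D n p ^ 3) \<le> ennreal x" unfolding xx[symmetric] by (rule SUP_upper) simp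
   hence "D n p ^ 3 \<le> x" using x0 by (simp add: ennreal_le_iff)
   moreover have "D n p \<le> D n p ^ 3" if "D n p \<ge> 1" using that power_increasing[of 1 3 "D n p"] by simp
   ultimately show ?thesis using x0 by (cases "D n p \<ge> 1") auto
  qed
  thus ?case by (intro summableI_nonneg_bounded[of _ "1 + x"]) (auto simp: D_def)
 qed
 define d where "d = (\<lambda>p. max 0 (suminf (\<lambda>j. norm (a j p))))"
 have dm[measurable]: "d \<in> borel_measurable M" unfolding d_def by measurable
 have "(\<integral>\<^sup>+ p. ennreal (d p ^ 3) \<partial>M) \<le> ennreal (8 * B)"
 proof (rule fatou_le[OF _ _ _ D3])
  show "AE p in M. (\<lambda>n. ennreal (D n p ^ 3)) \<longlonglongrightarrow> ennreal (d p ^ 3)"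
   using sm
  proof eventually_elim
   case (elim p)
   have "d p = suminf (\<lambda>j. norm (a j p))" using suminf_nonneg[OF elim] by (simp add: d_def)
   hence "(\<lambda>n. D n p) \<longlonglongrightarrow> d p" unfolding D_def using summable_LIMSEQ[OF elim] by simp
   thus ?case by (intro tendsto_ennrealI tendsto_power)
  qed
 qed measurable
 hence "(\<integral>\<^sup>+ p. ennreal (d p ^ 3) \<partial>M) < \<infinity>" by (rule le_less_trans) simp
 moreover have "AE p in M. summable (\<lambda>j. a j p) \<and> (\<forall>n. norm (\<Sum>j<n. a j p) \<le> d p)"
  using sm
 proof eventually_elim
  case (elim p)
  have "norm (\<Sum>j<n. a j p) \<le> d p" for n
  proof -
   have "norm (\<Sum>j<n. a j p) \<le> (\<Sum>j<n. norm (a j p))" by (rule norm_sum)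
   also have "\<dots> \<le> suminf (\<lambda>j. norm (a j p))" by (rule sum_le_suminf[OF elim]) auto
   finally show ?thesis by (simp add: d_def)
  qed
  thus ?case using summable_norm_cancel[OF elim] by blast
 qed
 ultimately show ?thesis by (intro exI[of _ d]) (auto simp: d_def)
qed

section \<open>Elements of \<open>X\<^sup>s\<^sup>,\<^sup>b\<close> as functions\<close>

text \<open>The data on \<open>U\<close> that the product estimate uses: Schwartz approximants \<open>f\<close> with quantitative
convergence in the norm, their pointwise limit \<open>g\<close>, and a majorant \<open>d\<close> in \<open>L\<^sup>3\<close>.\<close>

definition approximates :: "real \<Rightarrow> real \<Rightarrow> functional \<Rightarrow> (nat \<Rightarrow> spacetime \<Rightarrow> complex) \<Rightarrow> (spacetime \<Rightarrow> complex) \<Rightarrow> (spacetime \<Rightarrow> real) \<Rightarrow> bool" where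
 "approximates s b U f g d \<longleftrightarrow>
   (\<forall>k. f k \<in> schwartz) \<and> X_norm s b U < \<infinity> \<and>
   (\<forall>j k. j \<le> k \<longrightarrow> cEN s b (ft (\<lambda>p. f k p - f j p)) \<le> ennreal ((1/16) ^ j)) \<and>
   (\<forall>M\<ge>0. X_norm s b U < ennreal M \<longrightarrow> (\<forall>k. cEN s b (ft (f k)) \<le> ennreal (2 * M\<^sup>2 + 2 * (1/16) ^ k))) \<and>
   (\<forall>\<phi>\<in>schwartz. (\<lambda>k. dist_of (f k) \<phi>) \<longlonglongrightarrow> U \<phi>) \<and>
   smeas g \<and> d \<in> borel_measurable stm \<and> (\<forall>p. 0 \<le> d p) \<and> (\<integral>\<^sup>+ p. ennreal (d p ^ 3) \<partial>stm) < \<infinity> \<and>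
   (AE p in stm. (\<forall>k. norm (f k p) \<le> d p) \<and> (\<lambda>k. f k p) \<longlonglongrightarrow> g p)"

lemma approximatesD:
 assumes "approximates s b U f g d"
 shows "f k \<in> schwartz" "X_norm s b U < \<infinity>"
  "j \<le> k \<Longrightarrow> cEN s b (ft (\<lambda>p. f k p - f j p)) \<le> ennreal ((1/16) ^ j)"
  "M \<ge> 0 \<Longrightarrow> X_norm s b U < ennreal M \<Longrightarrow> cEN s b (ft (f k)) \<le> ennreal (2 * M\<^sup>2 + 2 * (1/16) ^ k)"
  "smeas g" "smeas d" "0 \<le> d p"
  "AE p in stm. (\<forall>k. norm (f k p) \<le> d p) \<and> (\<lambda>k. f k p) \<longlonglongrightarrow> g p"
  "(\<integral>\<^sup>+ p. ennreal (d p ^ 3) \<partial>stm) < \<infinity>"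
  "\<phi> \<in> schwartz \<Longrightarrow> (\<lambda>k. dist_of (f k) \<phi>) \<longlonglongrightarrow> U \<phi>"
 using assms unfolding approximates_def by blast+

lemma approximates_cube_integrable:
 assumes "approximates s b U f g d"
 shows "integrable stm (\<lambda>p. d p ^ 3)"
 by (rule integrableI_bounded) (use approximatesD(6,7,9)[OF assms] in auto)

lemma le_1_plus_cube: "0 \<le> x \<Longrightarrow> x \<le> 1 + x ^ 3" for x :: real
proof (cases "x \<le> 1")
 case True
 assume "0 \<le> x"
 hence "0 \<le> x ^ 3" by simp
 thus ?thesis using True by linarith
qed (use power_increasing[of 1 3 x] in simp)

lemma X_space_close:
 assumes U: "U \<in> X_space s b" and e: "e > 0"
 shows "\<exists>f G. f \<in> schwartz \<and> has_fourier (\<lambda>\<phi>. U \<phi> - dist_of f \<phi>) G \<and> weighted_L2 s b G < ennreal e"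
proof -
 obtain h where h: "\<And>k. h k \<in> schwartz" and lim: "(\<lambda>k. X_norm s b (\<lambda>\<phi>. U \<phi> - dist_of (h k) \<phi>)) \<longlonglongrightarrow> (0 :: ennreal)"
  using U unfolding X_space_def by (simp only: mem_Collect_eq) metis
 have "\<forall>\<^sub>F k in sequentially. X_norm s b (\<lambda>\<phi>. U \<phi> - dist_of (h k) \<phi>) < ennreal e"
  by (rule order_tendstoD(2)[OF lim]) (use e in simp)
 then obtain k where "X_norm s b (\<lambda>\<phi>. U \<phi> - dist_of (h k) \<phi>) < ennreal e"
  using eventually_happens trivial_limit_sequentially by blast
 then obtain G where "has_fourier (\<lambda>\<phi>. U \<phi> - dist_of (h k) \<phi>) G" "weighted_L2 s b G < ennreal e"
  unfolding X_norm_def Inf_less_iff by blast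
 thus ?thesis using h by blast
qed

lemma X_norm_le: "has_fourier u F \<Longrightarrow> X_norm s b u \<le> weighted_L2 s b F"
 unfolding X_norm_def by (rule Inf_lower) blast

text \<open>Approximants \<open>f\<^sub>k\<close> are chosen with error \<open>4^(-k) / 2\<close>. By uniqueness of the Fourier transform, the
transforms of \<open>f\<^sub>k - f\<^sub>j\<close> are differences of the errors, and \<open>L3_embedding\<close> makes the series of the
increments converge in \<open>L\<^sup>3\<close> as required by \<open>cube_summable_dominated\<close>.\<close>

lemma X_space_approximates:
 fixes eps \<delta> :: real
 defines "s \<equiv> 1/4 + eps" and "b \<equiv> 1/2 + \<delta>"
 assumes eps: "0 < eps" "eps < 1/12" and \<delta>: "0 < \<delta>" "\<delta> < 2/3 * eps" and U: "U \<in> X_space s b"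
 shows "\<exists>f g d. approximates s b U f g d"
proof -
 \<comment> \<open>the squared errors \<open>16^(-k) / 4\<close> leave \<open>16^(-k)\<close> for a difference of two errors\<close>
 define e where "e = (\<lambda>k::nat. (1/4::real) ^ k / 2)"
 have e: "e k > 0" "(e k)\<^sup>2 = (1/16) ^ k / 4" for k
 proof -
  have "((1/4::real) ^ k)\<^sup>2 = ((1/4)\<^sup>2) ^ k" by (simp only: power_mult[symmetric] mult.commute)
  thus "e k > 0" "(e k)\<^sup>2 = (1/16) ^ k / 4" by (simp_all add: e_def power_divide power2_eq_square)
 qed
 have "\<forall>k. \<exists>fG. fst fG \<in> schwartz \<and> has_fourier (\<lambda>\<phi>. U \<phi> - dist_of (fst fG) \<phi>) (snd fG) \<and> weighted_L2 s b (snd fG) < ennreal (e k)"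
 proof
  fix k
  obtain f G where "f \<in> schwartz" "has_fourier (\<lambda>\<phi>. U \<phi> - dist_of f \<phi>) G" "weighted_L2 s b G < ennreal (e k)"
   using X_space_close[OF U e(1)] by blast
  thus "\<exists>fG. fst fG \<in> schwartz \<and> has_fourier (\<lambda>\<phi>. U \<phi> - dist_of (fst fG) \<phi>) (snd fG) \<and> weighted_L2 s b (snd fG) < ennreal (e k)"
   by (intro exI[of _ "(f, G)"]) simp
 qed
 then obtain fG where fG: "\<forall>k. fst (fG k) \<in> schwartz \<and> has_fourier (\<lambda>\<phi>. U \<phi> - dist_of (fst (fG k)) \<phi>) (snd (fG k)) \<and> weighted_L2 s b (snd (fG k)) < ennreal (e k)"
  by (rule choice[THEN exE])
 define f where "f = (\<lambda>k. fst (fG k))"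
 define G where "G = (\<lambda>k. snd (fG k))"
 have f: "f k \<in> schwartz" and hG: "has_fourier (\<lambda>\<phi>. U \<phi> - dist_of (f k) \<phi>) (G k)" and wG: "weighted_L2 s b (G k) < ennreal (e k)" for k
  using fG by (simp_all add: f_def G_def)
 have fi: "integrable stm (f k)" for k by (rule schwartz_integrable[OF f])
 have Gm[measurable]: "fmeas (G k)" for k using hG[of k] by (simp add: has_fourier_def)
 have [measurable]: "fmeas (ft (f k))" for k using ft_integrable[OF f] by auto
 have EG: "cEN s b (G k) \<le> ennreal ((1/16) ^ k / 4)" for k
  using less_imp_le[OF wG[of k]] weighted_L2_le_iff[of "e k" s b "G k"] e[of k] by simp
 have full: "has_fourier U (\<lambda>q. G k q + ft (f k) q)" for k by (rule has_fourier_from_diff[OF hG fi])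
 have Xfin: "X_norm s b U < \<infinity>"
 proof -
  have "cEN s b (\<lambda>q. G 0 q + ft (f 0) q) \<le> 2 * cEN s b (G 0) + 2 * cEN s b (ft (f 0))"
   by (rule cEN_le_sum) (auto intro: norm_triangle_ineq)
  also have "\<dots> < \<infinity>"
  proof -
   have "cEN s b (G 0) < \<infinity>" by (rule le_less_trans[OF EG]) simp
   moreover have "cEN s b (ft (f 0)) < \<infinity>" unfolding cEN_def using eps \<delta> by (intro schwartz_EN_finite f) (auto simp: s_def b_def)
   ultimately show ?thesis by (simp add: ennreal_mult_less_top)
  qed
  finally have "ennsqrt (cEN s b (\<lambda>q. G 0 q + ft (f 0) q)) < \<infinity>" by (simp add: ennsqrt_def)
  hence "weighted_L2 s b (\<lambda>q. G 0 q + ft (f 0) q) < \<infinity>" by (simp only: weighted_L2_eq)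
  thus ?thesis using X_norm_le[OF full] by (rule le_less_trans[rotated])
 qed
 have cauchy: "cEN s b (ft (\<lambda>p. f k p - f j p)) \<le> ennreal ((1/16) ^ j)" if jk: "j \<le> k" for j k
 proof -
  have "AE q in freq_measure. G k q + ft (f k) q = G j q + ft (f j) q" by (rule has_fourier_unique[OF full full])
  hence "AE q in freq_measure. ft (\<lambda>p. f k p - f j p) q = G j q - G k q"
   by eventually_elim (simp add: ft_diff[OF fi fi] algebra_simps)
  hence "cEN s b (ft (\<lambda>p. f k p - f j p)) = cEN s b (\<lambda>q. G j q - G k q)" by (rule cEN_cong_AE)
  also have "\<dots> \<le> 2 * cEN s b (G j) + 2 * cEN s b (G k)" by (rule cEN_le_sum) (auto intro: norm_triangle_ineq4)
  also have "\<dots> \<le> 2 * ennreal ((1/16) ^ j / 4) + 2 * ennreal ((1/16) ^ k / 4)" by (intro add_mono mult_left_mono EG) auto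
  also have "\<dots> = ennreal (2 * ((1/16) ^ j / 4) + 2 * ((1/16) ^ k / 4))"
   by (simp only: ennreal_plus[symmetric] ennreal_numeral[symmetric] ennreal_mult[symmetric]) (simp flip: ennreal_plus ennreal_mult ennreal_numeral)
  also have "\<dots> \<le> ennreal ((1/16) ^ j)"
  proof (rule ennreal_leI)
   have "(1/16::real) ^ k \<le> (1/16) ^ j" using jk by (intro power_decreasing) auto
   thus "2 * ((1/16::real) ^ j / 4) + 2 * ((1/16) ^ k / 4) \<le> (1/16) ^ j" by linarith
  qed
  finally show ?thesis .
 qed
 have bdd: "cEN s b (ft (f k)) \<le> ennreal (2 * M\<^sup>2 + 2 * (1/16) ^ k)" if M: "M \<ge> 0" "X_norm s b U < ennreal M" for M k
 proof -
  obtain F where F: "has_fourier U F" "weighted_L2 s b F < ennreal M"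
   using M(2) unfolding X_norm_def Inf_less_iff by blast
  have [measurable]: "fmeas F" using F by (simp add: has_fourier_def)
  have EF: "cEN s b F \<le> ennreal (M\<^sup>2)" using less_imp_le[OF F(2)] weighted_L2_le_iff[OF M(1), of s b F] by simp
  have "AE q in freq_measure. F q = G k q + ft (f k) q" by (rule has_fourier_unique[OF F(1) full])
  hence "AE q in freq_measure. ft (f k) q = F q - G k q" by eventually_elim simp
  hence "cEN s b (ft (f k)) = cEN s b (\<lambda>q. F q - G k q)" by (rule cEN_cong_AE)
  also have "\<dots> \<le> 2 * cEN s b F + 2 * cEN s b (G k)" by (rule cEN_le_sum) (auto intro: norm_triangle_ineq4)
  also have "\<dots> \<le> 2 * ennreal (M\<^sup>2) + 2 * ennreal ((1/16) ^ k / 4)" by (intro add_mono mult_left_mono EG EF) auto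
  also have "\<dots> = ennreal (2 * M\<^sup>2 + 2 * ((1/16) ^ k / 4))"
   by (simp flip: ennreal_plus ennreal_mult ennreal_numeral)
  also have "\<dots> \<le> ennreal (2 * M\<^sup>2 + 2 * (1/16) ^ k)" by (intro ennreal_leI) simp
  finally show ?thesis .
 qed
 have dist: "(\<lambda>k. dist_of (f k) \<phi>) \<longlonglongrightarrow> U \<phi>" if \<phi>: "\<phi> \<in> schwartz" for \<phi>
 proof -
  have sb: "0 \<le> s" "0 \<le> b" using eps \<delta> by (auto simp: s_def b_def)
  obtain C where C: "C > 0" "\<And>u G e. has_fourier u G \<Longrightarrow> 0 \<le> e \<Longrightarrow> weighted_L2 s b G \<le> ennreal e \<Longrightarrow> norm (u \<phi>) \<le> C * e"
   using fourier_pairing_bound[OF \<phi> sb] by blast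
  have "norm (U \<phi> - dist_of (f k) \<phi>) \<le> C * e k" for k
   using C(2)[OF hG[of k] _ less_imp_le[OF wG]] e(1)[of k] by simp
  moreover have "(\<lambda>k. C * e k) \<longlonglongrightarrow> C * (0 / 2)" unfolding e_def by (intro tendsto_intros LIMSEQ_realpow_zero) auto
  ultimately have "(\<lambda>k. U \<phi> - dist_of (f k) \<phi>) \<longlonglongrightarrow> 0"
   by (intro Lim_null_comparison[of "\<lambda>k. U \<phi> - dist_of (f k) \<phi>" "\<lambda>k. C * e k"]) auto
  hence "(\<lambda>k. U \<phi> - (U \<phi> - dist_of (f k) \<phi>)) \<longlonglongrightarrow> U \<phi> - 0" by (intro tendsto_diff tendsto_const)
  thus ?thesis by simp
 qed
 \<comment> \<open>the increments after the first approximant, so that the partial sums are the \<open>f k\<close>\<close>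
 define a where "a = (\<lambda>j. case j of 0 \<Rightarrow> f 0 | Suc j \<Rightarrow> (\<lambda>p. f (Suc j) p - f j p))"
 have a: "a 0 = f 0" "a (Suc j) = (\<lambda>p. f (Suc j) p - f j p)" for j by (simp_all add: a_def)
 have as: "a j \<in> schwartz" for j by (cases j) (auto simp: a intro: schwartz_diff f)
 have asum: "(\<Sum>j<Suc n. a j p) = f n p" for n p by (induction n) (simp_all add: a)
 obtain D where D: "D > 0" and L3: "\<And>f E. f \<in> schwartz \<Longrightarrow> E > 0 \<Longrightarrow> cEN s b (ft f) \<le> ennreal E \<Longrightarrow>
   (\<integral>\<^sup>+ p. ennreal (norm (f p) ^ 3) \<partial>stm) \<le> ennreal (D * E powr (3/2))"
  using schwartz_L3[of eps b] eps \<delta> unfolding s_def b_def by auto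
 define E0 where "E0 = enn2real (cEN s b (ft (f 0))) + 1"
 have E0: "E0 > 0" "cEN s b (ft (f 0)) \<le> ennreal E0"
 proof -
  have "cEN s b (ft (f 0)) < \<infinity>" unfolding cEN_def using eps \<delta> by (intro schwartz_EN_finite f) (auto simp: s_def b_def)
  hence "cEN s b (ft (f 0)) = ennreal (enn2real (cEN s b (ft (f 0))))" by simp
  also have "\<dots> \<le> ennreal E0" by (intro ennreal_leI) (simp add: E0_def)
  finally show "cEN s b (ft (f 0)) \<le> ennreal E0" .
  show "E0 > 0" unfolding E0_def by (intro add_nonneg_pos) auto
 qed
 define B where "B = D * E0 powr (3/2) + 16 * D"
 have B: "B \<ge> 0" using D by (simp add: B_def)
 have a3: "(\<integral>\<^sup>+ p. ennreal (norm (a j p) ^ 3) \<partial>stm) \<le> ennreal (B * (1/16) ^ j)" for j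
 proof (cases j)
  case 0
  have "(\<integral>\<^sup>+ p. ennreal (norm (a 0 p) ^ 3) \<partial>stm) \<le> ennreal (D * E0 powr (3/2))" unfolding a by (rule L3[OF f E0])
  also have "\<dots> \<le> ennreal B" using D by (intro ennreal_leI) (simp add: B_def)
  finally show ?thesis using 0 by simp
 next
  case (Suc i)
  have "(\<integral>\<^sup>+ p. ennreal (norm (a j p) ^ 3) \<partial>stm) \<le> ennreal (D * ((1/16) ^ i) powr (3/2))"
   unfolding Suc by (rule L3[OF as]) (use cauchy[of i "Suc i"] in \<open>auto simp: a\<close>)
  also have "\<dots> \<le> ennreal (B * (1/16) ^ j)"
  proof (rule ennreal_leI)
   have "((1/16::real) ^ i) powr (3/2) \<le> ((1/16) ^ i) powr 1" by (intro powr_mono') (auto simp: power_le_one)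
   hence "D * ((1/16) ^ i) powr (3/2) \<le> D * (1/16) ^ i" using D by (intro mult_left_mono) auto
   also have "\<dots> = 16 * D * (1/16) ^ j" by (simp add: Suc)
   also have "\<dots> \<le> B * (1/16) ^ j" using D by (intro mult_right_mono) (auto simp: B_def)
   finally show "D * ((1/16) ^ i) powr (3/2) \<le> B * (1/16) ^ j" .
  qed
  finally show ?thesis .
 qed
 have am[measurable]: "smeas (a j)" for j using schwartz_integrable[OF as] by auto
 obtain d where d: "smeas d" "\<forall>p. 0 \<le> d p" "(\<integral>\<^sup>+ p. ennreal (d p ^ 3) \<partial>stm) < \<infinity>"
  "AE p in stm. summable (\<lambda>j. a j p) \<and> (\<forall>n. norm (\<Sum>j<n. a j p) \<le> d p)"
  using cube_summable_dominated[OF am B a3] by blast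
 define g where "g = (\<lambda>p. suminf (\<lambda>j. a j p))"
 have "smeas g" unfolding g_def by measurable
 moreover have "AE p in stm. (\<forall>k. norm (f k p) \<le> d p) \<and> (\<lambda>k. f k p) \<longlonglongrightarrow> g p"
  using d(4)
 proof eventually_elim
  case (elim p)
  have "(\<lambda>k. f k p) \<longlonglongrightarrow> g p"
   using LIMSEQ_Suc[OF summable_LIMSEQ[OF elim[THEN conjunct1]]] unfolding asum g_def .
  moreover have "norm (f k p) \<le> d p" for k using elim[THEN conjunct2, rule_format, of "Suc k"] unfolding asum .
  ultimately show ?case by blast
 qed
 ultimately have "approximates s b U f g d"
  unfolding approximates_def using f Xfin cauchy bdd dist d(1-3) by blast
 thus ?thesis by blast
qed

text \<open>Dominated convergence with the majorant \<open>d |\<phi>| \<le> (1 + d\<^sup>3) |\<phi>|\<close>.\<close>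

lemma approximates_dist_of:
 assumes a: "approximates s b U f g d" and \<phi>: "\<phi> \<in> schwartz"
 shows "dist_of g \<phi> = U \<phi>"
proof -
 note f = approximatesD(1)[OF a] and [measurable] = approximatesD(5,6)[OF a] and d0 = approximatesD(7)[OF a]
  and ae = approximatesD(8)[OF a] and lim = approximatesD(10)[OF a \<phi>] and di = approximates_cube_integrable[OF a]
 have [measurable]: "smeas \<phi>" "smeas (f k)" for k
  using schwartz_integrable[OF \<phi>] schwartz_integrable[OF f] by auto
 obtain B where B: "\<And>p. norm (\<phi> p) \<le> B" using schwartz_bounded[OF \<phi>] by blast
 define w where "w = (\<lambda>p. norm (\<phi> p) + B * d p ^ 3)"
 have "(\<lambda>k. \<integral>p. f k p * \<phi> p \<partial>stm) \<longlonglongrightarrow> (\<integral>p. g p * \<phi> p \<partial>stm)"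
 proof (rule integral_dominated_convergence[where w=w])
  show "integrable stm w" unfolding w_def using schwartz_integrable[OF \<phi>] di by auto
  show "AE p in stm. (\<lambda>k. f k p * \<phi> p) \<longlonglongrightarrow> g p * \<phi> p"
   using ae by eventually_elim (auto intro: tendsto_intros)
  show "AE p in stm. norm (f k p * \<phi> p) \<le> w p" for k
   using ae
  proof eventually_elim
   case (elim p)
   have "d p \<le> 1 + d p ^ 3" using d0 by (rule le_1_plus_cube)
   hence "norm (f k p) * norm (\<phi> p) \<le> (1 + d p ^ 3) * norm (\<phi> p)"
    using elim by (intro mult_right_mono) (auto intro: order_trans)
   also have "\<dots> \<le> w p" unfolding w_def distrib_right
    using B[of p] d0[of p] by (auto simp: mult.commute[of B] intro!: mult_left_mono)
   finally show ?case by (simp add: norm_mult)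
  qed
 qed measurable
 hence "(\<lambda>k. dist_of (f k) \<phi>) \<longlonglongrightarrow> dist_of g \<phi>" by (simp add: dist_of_def lint_stm)
 thus ?thesis using lim by (rule LIMSEQ_unique)
qed

lemma set_integrable_strip:
 assumes "integrable stm (\<lambda>p. indicator ({0..T} \<times> UNIV) p *\<^sub>R (g p :: complex))"
 shows "set_integrable lborel ({0..T} \<times> torus_cell) g"
proof -
 have "integrable lborel (\<lambda>p. indicator (UNIV \<times> torus_cell) p *\<^sub>R (indicator ({0..T} \<times> UNIV) p *\<^sub>R g p))"
  using assms unfolding stm_def by (subst (asm) integrable_restrict_space) simp_all
 moreover have "(\<lambda>p. indicator (UNIV \<times> torus_cell) p *\<^sub>R (indicator ({0..T} \<times> UNIV) p *\<^sub>R g p)) = (\<lambda>p. indicator ({0..T} \<times> torus_cell) p *\<^sub>R g p)"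
  by (auto simp: fun_eq_iff indicator_def)
 ultimately show ?thesis unfolding set_integrable_def by simp
qed

lemma strip_measurable[measurable]: "{0..T::real} \<times> (UNIV :: (real \<times> real) set) \<in> sets borel"
 by (intro borel_closed closed_Times) auto

lemma approximates_set_integrable:
 assumes a: "approximates s b U f g d" and T: "T > 0"
 shows "set_integrable lborel ({0..T} \<times> torus_cell) g"
proof (rule set_integrable_strip)
 note [measurable] = approximatesD(5,6)[OF a] and d0 = approximatesD(7)[OF a] and ae = approximatesD(8)[OF a]
  and di = approximates_cube_integrable[OF a]
 have [measurable]: "(\<lambda>p. indicator ({0..T} \<times> UNIV) p :: real) \<in> borel_measurable stm" by (intro measurable_stm) simp
 show "integrable stm (\<lambda>p. indicator ({0..T} \<times> UNIV) p *\<^sub>R g p)"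
 proof (rule Bochner_Integration.integrable_bound[where f="\<lambda>p. norm (cutT T p) + d p ^ 3"])
  show "integrable stm (\<lambda>p. norm (cutT T p) + d p ^ 3)"
   using schwartz_integrable[OF cutT_schwartz[OF T]] di by auto
  show "AE p in stm. norm (indicator ({0..T} \<times> UNIV) p *\<^sub>R g p) \<le> norm (norm (cutT T p) + d p ^ 3)"
   using ae
  proof eventually_elim
   case (elim p)
   have "norm (g p) \<le> d p"
    by (rule LIMSEQ_le_const2[OF tendsto_norm[OF elim[THEN conjunct2]]]) (use elim in auto)
   moreover have "d p \<le> 1 + d p ^ 3" using d0 by (rule le_1_plus_cube)
   ultimately have "norm (g p) \<le> 1 + d p ^ 3" by linarith
   moreover have "0 \<le> d p ^ 3" using d0[of p] by simp
   ultimately show ?case using cutT_1[of p T] T by (cases "p \<in> {0..T} \<times> UNIV") (auto simp: mem_Times_iff)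
  qed
 qed measurable
qed

lemma dist_of_tempered:
 assumes r: "integrable stm r"
 shows "tempered (dist_of r)"
proof -
 have ri: "integrable stm (\<lambda>p. r p * \<phi> p)" if \<phi>: "\<phi> \<in> schwartz" for \<phi>
 proof -
  obtain B where B: "\<And>p. norm (\<phi> p) \<le> B" using schwartz_bounded[OF \<phi>] by blast
  show ?thesis by (rule integrable_mult_bounded[OF r _ B]) (use schwartz_integrable[OF \<phi>] in auto)
 qed
 define C where "C = (\<integral>p. norm (r p) \<partial>stm)"
 have "norm (dist_of r \<phi>) \<le> C * M" if \<phi>: "\<phi> \<in> schwartz"
  and M: "\<forall>vs p. set vs \<subseteq> Basis \<and> length vs \<le> 0 \<longrightarrow> jap (fst p) ^ 0 * norm (iter_deriv vs \<phi> p) \<le> M" for \<phi> M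
 proof -
  have M': "norm (\<phi> p) \<le> M" for p using M[rule_format, of "[]" p] by simp
  have "norm (dist_of r \<phi>) \<le> (\<integral>p. norm (r p * \<phi> p) \<partial>stm)" unfolding dist_of_def lint_stm by (rule integral_norm_bound)
  also have "\<dots> \<le> (\<integral>p. norm (r p) * M \<partial>stm)"
  proof (rule integral_mono[OF integrable_norm[OF ri[OF \<phi>]]])
   show "norm (r p * \<phi> p) \<le> norm (r p) * M" for p unfolding norm_mult using M' by (intro mult_left_mono) auto
  qed (use r in auto)
  finally show ?thesis by (simp add: C_def)
 qed
 thus ?thesis unfolding tempered_def
  by (intro conjI exI[of _ C] exI[of _ 0]) (auto simp: dist_of_def lint_stm distrib_left ri mult.left_commute[of "r _"])
qed

section \<open>The product of three elements of \<open>X\<^sup>s\<^sup>,\<^sup>b\<close>\<close>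

lemma approximates_uniform_bound:
 assumes "approximates s b U f g d" "s \<le> 1" "b \<le> 1"
 shows "\<exists>B\<ge>0. \<forall>k. cEN s b (ft (f k)) \<le> ennreal B"
proof -
 define M where "M = enn2real (X_norm s b U) + 1"
 have M: "M \<ge> 0" by (simp add: M_def)
 note bd = approximatesD(4)[OF assms(1)]
 have "X_norm s b U = ennreal (enn2real (X_norm s b U))" using approximatesD(2)[OF assms(1)] by simp
 also have "\<dots> < ennreal M" unfolding M_def by (intro ennreal_lessI) (auto intro: add_nonneg_pos)
 finally have less: "X_norm s b U < ennreal M" .
 have "cEN s b (ft (f k)) \<le> ennreal (2 * M\<^sup>2 + 2)" for k
 proof (rule order_trans[OF bd[OF M less]])
  show "ennreal (2 * M\<^sup>2 + 2 * (1/16) ^ k) \<le> ennreal (2 * M\<^sup>2 + 2)" by (intro ennreal_leI) (simp add: power_le_one)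
 qed
 thus ?thesis by (intro exI[of _ "2 * M\<^sup>2 + 2"]) auto
qed

text \<open>The products of the approximants are dominated by \<open>d\<^sub>1 d\<^sub>2 d\<^sub>3 \<le> d\<^sub>1\<^sup>3 + d\<^sub>2\<^sup>3 + d\<^sub>3\<^sup>3\<close>, so they converge in \<open>L\<^sup>1\<close> and
their Fourier transforms converge pointwise.\<close>

lemma product_limit:
 fixes T s b :: real
 assumes T: "T > 0"
  and a1: "approximates s b U1 f1 g1 d1" and a2: "approximates s b U2 f2 g2 d2" and a3: "approximates s b U3 f3 g3 d3"
 defines "R \<equiv> (\<lambda>p. g1 p * g2 p * g3 p)"
 shows "integrable stm R" and "integrable stm (\<lambda>p. R p * cutT T p)"
  and "(\<lambda>k. ft (PR T (f1 k) (f2 k) (f3 k)) q) \<longlonglongrightarrow> ft (\<lambda>p. R p * cutT T p) q"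
proof -
 note [measurable] = approximatesD(5)[OF a1] approximatesD(5)[OF a2] approximatesD(5)[OF a3]
  approximatesD(6)[OF a1] approximatesD(6)[OF a2] approximatesD(6)[OF a3]
 note f = approximatesD(1)[OF a1] approximatesD(1)[OF a2] approximatesD(1)[OF a3]
 note d0 = approximatesD(7)[OF a1] approximatesD(7)[OF a2] approximatesD(7)[OF a3]
 note ae = approximatesD(8)[OF a1] approximatesD(8)[OF a2] approximatesD(8)[OF a3]
 note di = approximates_cube_integrable[OF a1] approximates_cube_integrable[OF a2] approximates_cube_integrable[OF a3]
 define w where "w = (\<lambda>p. d1 p ^ 3 + d2 p ^ 3 + d3 p ^ 3)"
 have wi: "integrable stm w" unfolding w_def using di by auto
 have amgm: "x * y * z \<le> x ^ 3 + y ^ 3 + z ^ 3" if "0 \<le> x" "0 \<le> y" "0 \<le> z" for x y z :: real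
 proof -
  define m where "m = max x (max y z)"
  have "x * y * z \<le> m * m * m" using that by (intro mult_mono) (auto simp: m_def)
  also have "\<dots> = m ^ 3" by (simp add: power3_eq_cube)
  also have "\<dots> \<le> x ^ 3 + y ^ 3 + z ^ 3"
  proof -
   have n: "0 \<le> x ^ 3" "0 \<le> y ^ 3" "0 \<le> z ^ 3" using that by auto
   consider "m = x" | "m = y" | "m = z" unfolding m_def by linarith
   thus ?thesis by cases (use n in \<open>auto intro: add_increasing add_increasing2\<close>)
  qed
  finally show ?thesis .
 qed
 have bd: "AE p in stm. (\<forall>k. norm (f1 k p * f2 k p * f3 k p) \<le> w p) \<and> (\<lambda>k. f1 k p * f2 k p * f3 k p) \<longlonglongrightarrow> R p"
  using ae
 proof eventually_elim
  case (elim p)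
  have "norm (f1 k p * f2 k p * f3 k p) \<le> w p" for k
  proof -
   have "norm (f1 k p * f2 k p * f3 k p) \<le> d1 p * d2 p * d3 p"
    unfolding norm_mult using elim d0 by (intro mult_mono mult_nonneg_nonneg) auto
   thus ?thesis using amgm[OF d0(1)[of p] d0(2)[of p] d0(3)[of p]] unfolding w_def by linarith
  qed
  moreover have "(\<lambda>k. f1 k p * f2 k p * f3 k p) \<longlonglongrightarrow> R p" unfolding R_def using elim by (intro tendsto_mult) auto
  ultimately show ?case by blast
 qed
 have [measurable]: "smeas (f1 k)" "smeas (f2 k)" "smeas (f3 k)" for k
  using schwartz_integrable[OF f(1)] schwartz_integrable[OF f(2)] schwartz_integrable[OF f(3)] by auto
 have Rm[measurable]: "smeas R" unfolding R_def by measurable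
 show Ri: "integrable stm R"
 proof (rule Bochner_Integration.integrable_bound[OF wi])
  show "AE p in stm. norm (R p) \<le> norm (w p)"
   using bd
  proof eventually_elim
   case (elim p)
   have "norm (R p) \<le> w p" by (rule LIMSEQ_le_const2[OF tendsto_norm[OF elim[THEN conjunct2]]]) (use elim in auto)
   thus ?case by simp
  qed
 qed measurable
 have ks: "cutT T \<in> schwartz" by (rule cutT_schwartz[OF T])
 have km[measurable]: "smeas (cutT T)" using schwartz_integrable[OF ks] by auto
 obtain B where B: "\<And>p. norm (cutT T p) \<le> B" using schwartz_bounded[OF ks] by blast
 have B0: "0 \<le> B" by (rule order_trans[OF norm_ge_zero B])
 show "integrable stm (\<lambda>p. R p * cutT T p)" by (rule integrable_mult_bounded[OF Ri km B])
 show "(\<lambda>k. ft (PR T (f1 k) (f2 k) (f3 k)) q) \<longlonglongrightarrow> ft (\<lambda>p. R p * cutT T p) q"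
  unfolding ft_eq PR_def
 proof (rule integral_dominated_convergence[where w="\<lambda>p. w p * B"])
  show "integrable stm (\<lambda>p. w p * B)" using wi by auto
  show "AE p in stm. (\<lambda>k. f1 k p * f2 k p * f3 k p * cutT T p * chr (- q) p) \<longlonglongrightarrow> R p * cutT T p * chr (- q) p"
   using bd by eventually_elim (intro tendsto_mult tendsto_const, blast)
  show "AE p in stm. norm (f1 k p * f2 k p * f3 k p * cutT T p * chr (- q) p) \<le> w p * B" for k
   using bd
  proof eventually_elim
   case (elim p)
   have "norm (f1 k p * f2 k p * f3 k p) * norm (cutT T p) \<le> w p * B"
    by (rule mult_mono) (use elim B in \<open>auto intro: order_trans[OF norm_ge_zero]\<close>)
   thus ?case by (simp add: norm_mult)
  qed
 qed measurable
qed

lemma cEN_fatou: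
 assumes [measurable]: "\<And>k. fmeas (F k)" "fmeas G"
  and lim: "\<And>q. (\<lambda>k. F k q) \<longlonglongrightarrow> G q" and bd: "\<And>k. cEN s b (F k) \<le> B"
 shows "cEN s b G \<le> B"
 unfolding cEN_def EN_def
proof (rule fatou_le[of "\<lambda>k q. (ennreal (fq q powr s * md q powr b) * ennreal (norm (F k q)))\<^sup>2"])
 show "AE q in freq_measure. (\<lambda>k. (ennreal (fq q powr s * md q powr b) * ennreal (norm (F k q)))\<^sup>2) \<longlonglongrightarrow> (ennreal (fq q powr s * md q powr b) * ennreal (norm (G q)))\<^sup>2"
 proof (rule AE_I2)
  fix q
  have "(\<lambda>k. ennreal ((fq q powr s * md q powr b * norm (F k q))\<^sup>2)) \<longlonglongrightarrow> ennreal ((fq q powr s * md q powr b * norm (G q))\<^sup>2)"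
   by (intro tendsto_ennrealI tendsto_power tendsto_mult tendsto_const tendsto_norm lim)
  thus "(\<lambda>k. (ennreal (fq q powr s * md q powr b) * ennreal (norm (F k q)))\<^sup>2) \<longlonglongrightarrow> (ennreal (fq q powr s * md q powr b) * ennreal (norm (G q)))\<^sup>2"
   by (simp add: ennreal_power flip: ennreal_mult)
 qed
qed (use bd in \<open>auto simp: cEN_def EN_def\<close>)

text \<open>By telescoping, the products of the approximants form a Cauchy sequence for the weighted norm; by
\<open>cEN_fatou\<close> their distance from the limit is at most that from later members of the sequence. Hence
they approximate \<open>Z\<close>, and the estimate for Schwartz functions passes to the limit. The constant is
\<open>8 \<surd>C\<close> because the squared norm of an approximant is only known to be at most \<open>2 M\<^sup>2\<close> up to an error
that tends to \<open>0\<close>, hence at most \<open>(2 M)\<^sup>2\<close> in the end.\<close>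

lemma trilinear_in_X_space:
 fixes eps \<delta> C T :: real
 defines "s \<equiv> 1/4 + eps" and "b \<equiv> 1/2 + \<delta>" and "s' \<equiv> - 3/4 + eps" and "b' \<equiv> - 1/2 + \<delta>"
 assumes eps: "0 < eps" "eps < 1/12" and \<delta>: "0 < \<delta>" "\<delta> < 2/3 * eps" and C: "C > 0" and T: "0 < T" "T \<le> 1"
  and est: "\<And>f g h. f \<in> schwartz \<Longrightarrow> g \<in> schwartz \<Longrightarrow> h \<in> schwartz \<Longrightarrow>
    cEN s' b' (ft (PR T f g h)) \<le> ennreal (C * T powr (2/25)) * (cEN s b (ft f) * cEN s b (ft g) * cEN s b (ft h))"
  and a1: "approximates s b U1 f1 g1 d1" and a2: "approximates s b U2 f2 g2 d2" and a3: "approximates s b U3 f3 g3 d3"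
 defines "Z \<equiv> dist_of (\<lambda>p. g1 p * g2 p * g3 p * cutT T p)"
 shows "Z \<in> X_space s' b'"
  and "X_norm s' b' Z \<le> ennreal (8 * sqrt C * T powr (1/25)) * X_norm s b U1 * X_norm s b U2 * X_norm s b U3"
proof -
 define r where "r = (\<lambda>p. g1 p * g2 p * g3 p * cutT T p)"
 define P where "P = (\<lambda>k. PR T (f1 k) (f2 k) (f3 k))"
 have Z: "Z = dist_of r" by (simp add: Z_def r_def)
 have ri: "integrable stm r" unfolding r_def by (rule product_limit(2)[OF T(1) a1 a2 a3])
 have lim: "(\<lambda>k. ft (P k) q) \<longlonglongrightarrow> ft r q" for q unfolding P_def r_def by (rule product_limit(3)[OF T(1) a1 a2 a3])
 note f = approximatesD(1)[OF a1] approximatesD(1)[OF a2] approximatesD(1)[OF a3]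
 have P: "P k \<in> schwartz" for k unfolding P_def by (intro PR_schwartz T f)
 have Pi: "integrable stm (P k)" for k by (rule schwartz_integrable[OF P])
 have Pm[measurable]: "fmeas (ft (P k))" for k using ft_integrable[OF P] by auto
 have rm[measurable]: "fmeas (ft r)" using ri by (intro ft_measurable) auto
 have hZ: "has_fourier Z (ft r)" unfolding Z by (rule has_fourier_dist_of[OF ri])
 let ?c = "ennreal (C * T powr (2/25))"
 have sb: "s \<le> 1" "b \<le> 1" using eps \<delta> by (auto simp: s_def b_def)
 obtain B1 B2 B3 where B0: "B1 \<ge> 0" "B2 \<ge> 0" "B3 \<ge> 0" and B: "\<And>k. cEN s b (ft (f1 k)) \<le> ennreal B1"
   "\<And>k. cEN s b (ft (f2 k)) \<le> ennreal B2" "\<And>k. cEN s b (ft (f3 k)) \<le> ennreal B3"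
  using approximates_uniform_bound[OF a1 sb] approximates_uniform_bound[OF a2 sb] approximates_uniform_bound[OF a3 sb] by blast
 note diff = approximatesD(3)[OF a1] approximatesD(3)[OF a2] approximatesD(3)[OF a3]
 define K where "K = 4 * (C * T powr (2/25)) * (B2 * B3 + B1 * B3 + B1 * B2)"
 have K0: "K \<ge> 0" unfolding K_def using B0 C by (intro mult_nonneg_nonneg add_nonneg_nonneg) auto
 have step: "cEN s' b' (\<lambda>q. ft (P k) q - ft (P j) q) \<le> ennreal (K * (1/16) ^ j)" if jk: "j \<le> k" for j k
 proof -
  let ?X = "PR T (\<lambda>p. f1 k p - f1 j p) (f2 k) (f3 k)" and ?Y = "PR T (f1 j) (\<lambda>p. f2 k p - f2 j p) (f3 k)" and ?W = "PR T (f1 j) (f2 j) (\<lambda>p. f3 k p - f3 j p)"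
  have sc: "?X \<in> schwartz" "?Y \<in> schwartz" "?W \<in> schwartz" by (intro PR_schwartz T schwartz_diff f)+
  have [measurable]: "fmeas (ft ?X)" "fmeas (ft ?Y)" "fmeas (ft ?W)"
   using ft_integrable[OF sc(1)] ft_integrable[OF sc(2)] ft_integrable[OF sc(3)] by auto
  let ?t = "(1/16::real) ^ j"
  have e: "(\<lambda>q. ft (P k) q - ft (P j) q) = (\<lambda>q. (ft ?X q + ft ?Y q) + ft ?W q)"
   unfolding P_def by (rule ext) (rule ft_PR_diff[OF T(1) f(1) f(1) f(2) f(2) f(3) f(3)])
  have x: "cEN s' b' (ft ?X) \<le> ennreal (C * T powr (2/25) * (?t * B2 * B3))"
  proof -
   have "cEN s' b' (ft ?X) \<le> ?c * (cEN s b (ft (\<lambda>p. f1 k p - f1 j p)) * cEN s b (ft (f2 k)) * cEN s b (ft (f3 k)))" by (intro est schwartz_diff f)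
   also have "\<dots> \<le> ?c * (ennreal ?t * ennreal B2 * ennreal B3)" by (intro mult_left_mono mult_mono diff jk B) auto
   also have "\<dots> = ennreal (C * T powr (2/25) * (?t * B2 * B3))" using C B0 by (simp flip: ennreal_mult)
   finally show ?thesis .
  qed
  have y: "cEN s' b' (ft ?Y) \<le> ennreal (C * T powr (2/25) * (B1 * ?t * B3))"
  proof -
   have "cEN s' b' (ft ?Y) \<le> ?c * (cEN s b (ft (f1 j)) * cEN s b (ft (\<lambda>p. f2 k p - f2 j p)) * cEN s b (ft (f3 k)))" by (intro est schwartz_diff f)
   also have "\<dots> \<le> ?c * (ennreal B1 * ennreal ?t * ennreal B3)" by (intro mult_left_mono mult_mono diff jk B) auto
   also have "\<dots> = ennreal (C * T powr (2/25) * (B1 * ?t * B3))" using C B0 by (simp flip: ennreal_mult)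
   finally show ?thesis .
  qed
  have w: "cEN s' b' (ft ?W) \<le> ennreal (C * T powr (2/25) * (B1 * B2 * ?t))"
  proof -
   have "cEN s' b' (ft ?W) \<le> ?c * (cEN s b (ft (f1 j)) * cEN s b (ft (f2 j)) * cEN s b (ft (\<lambda>p. f3 k p - f3 j p)))" by (intro est schwartz_diff f)
   also have "\<dots> \<le> ?c * (ennreal B1 * ennreal B2 * ennreal ?t)" by (intro mult_left_mono mult_mono diff jk B) auto
   also have "\<dots> = ennreal (C * T powr (2/25) * (B1 * B2 * ?t))" using C B0 by (simp flip: ennreal_mult)
   finally show ?thesis .
  qed
  have "cEN s' b' (\<lambda>q. (ft ?X q + ft ?Y q) + ft ?W q) \<le> 2 * cEN s' b' (\<lambda>q. ft ?X q + ft ?Y q) + 2 * cEN s' b' (ft ?W)"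
   by (rule cEN_le_sum) (auto intro: norm_triangle_ineq)
  also have "\<dots> \<le> 2 * (2 * cEN s' b' (ft ?X) + 2 * cEN s' b' (ft ?Y)) + 2 * cEN s' b' (ft ?W)"
   by (intro add_mono mult_left_mono order_refl cEN_le_sum) (auto intro: norm_triangle_ineq)
  also have "\<dots> \<le> 2 * (2 * ennreal (C * T powr (2/25) * (?t * B2 * B3)) + 2 * ennreal (C * T powr (2/25) * (B1 * ?t * B3))) + 2 * ennreal (C * T powr (2/25) * (B1 * B2 * ?t))"
   by (intro add_mono mult_left_mono x y w) auto
  also have "\<dots> = ennreal (2 * (2 * (C * T powr (2/25) * (?t * B2 * B3)) + 2 * (C * T powr (2/25) * (B1 * ?t * B3))) + 2 * (C * T powr (2/25) * (B1 * B2 * ?t)))"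
   using C B0 by (simp flip: ennreal_plus ennreal_mult ennreal_numeral)
  also have "\<dots> \<le> ennreal (K * ?t)"
  proof (rule ennreal_leI)
   have "0 \<le> C * T powr (2/25) * (B1 * B2 * ?t)" using C B0 by simp
   thus "2 * (2 * (C * T powr (2/25) * (?t * B2 * B3)) + 2 * (C * T powr (2/25) * (B1 * ?t * B3))) + 2 * (C * T powr (2/25) * (B1 * B2 * ?t)) \<le> K * ?t"
    unfolding K_def by (simp add: algebra_simps)
  qed
  finally show ?thesis unfolding e .
 qed
 have tail: "X_norm s' b' (\<lambda>\<phi>. Z \<phi> - dist_of (P j) \<phi>) \<le> ennreal (sqrt K * (1/4) ^ j)" for j
 proof -
  have "cEN s' b' (\<lambda>q. ft r q - ft (P j) q) \<le> ennreal (K * (1/16) ^ j)"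
  proof (rule cEN_fatou[of "\<lambda>n q. ft (P (n + j)) q - ft (P j) q"])
   show "(\<lambda>n. ft (P (n + j)) q - ft (P j) q) \<longlonglongrightarrow> ft r q - ft (P j) q" for q
    by (intro tendsto_diff tendsto_const LIMSEQ_ignore_initial_segment lim)
  qed (auto intro: step)
  also have "K * (1/16) ^ j = (sqrt K * (1/4) ^ j)\<^sup>2"
  proof -
   have "((1/4::real) ^ j)\<^sup>2 = ((1/4)\<^sup>2) ^ j" by (simp only: power_mult[symmetric] mult.commute)
   hence "((1/4::real) ^ j)\<^sup>2 = (1/16) ^ j" by (simp add: power2_eq_square)
   thus ?thesis unfolding power_mult_distrib using K0 by simp
  qed
  finally have "weighted_L2 s' b' (\<lambda>q. ft r q - ft (P j) q) \<le> ennreal (sqrt K * (1/4) ^ j)"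
   by (subst weighted_L2_le_iff) (use K0 in auto)
  moreover have "has_fourier (\<lambda>\<phi>. Z \<phi> - dist_of (P j) \<phi>) (\<lambda>q. ft r q - ft (P j) q)"
   by (rule has_fourier_diff[OF hZ has_fourier_dist_of[OF Pi]])
  ultimately show ?thesis using X_norm_le order_trans by blast
 qed
 show "Z \<in> X_space s' b'"
  unfolding X_space_def
 proof (rule CollectI, intro conjI exI[of _ P] allI P)
  show "tempered Z" unfolding Z by (rule dist_of_tempered[OF ri])
  have "(\<lambda>j. sqrt K * (1/4) ^ j) \<longlonglongrightarrow> sqrt K * 0" by (intro tendsto_intros LIMSEQ_realpow_zero) auto
  hence "(\<lambda>j. ennreal (sqrt K * (1/4) ^ j)) \<longlonglongrightarrow> ennreal (sqrt K * 0)" by (rule tendsto_ennrealI)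
  hence z: "(\<lambda>j. ennreal (sqrt K * (1/4) ^ j)) \<longlonglongrightarrow> 0" by simp
  show "(\<lambda>k. X_norm s' b' (\<lambda>\<phi>. Z \<phi> - dist_of (P k) \<phi>)) \<longlonglongrightarrow> 0"
  proof (rule tendsto_sandwich[OF _ _ tendsto_const z])
   show "\<forall>\<^sub>F k in sequentially. X_norm s' b' (\<lambda>\<phi>. Z \<phi> - dist_of (P k) \<phi>) \<le> ennreal (sqrt K * (1/4) ^ k)"
    by (intro always_eventually allI tail)
  qed simp
 qed
 have XM: "X_norm s' b' Z \<le> ennreal (8 * sqrt C * T powr (1/25) * (M1 * M2 * M3))"
  if M0: "M1 > 0" "M2 > 0" "M3 > 0" and M: "X_norm s b U1 < ennreal M1" "X_norm s b U2 < ennreal M2" "X_norm s b U3 < ennreal M3" for M1 M2 M3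
 proof -
  have lim0: "(\<lambda>k. 2 * (1/16::real) ^ k) \<longlonglongrightarrow> 2 * 0" by (intro tendsto_intros LIMSEQ_realpow_zero) auto
  have "\<forall>\<^sub>F k in sequentially. 2 * (1/16::real) ^ k < 2 * M\<^sup>2" if "M > 0" for M :: real
   using order_tendstoD(2)[OF lim0, of "2 * M\<^sup>2"] that by simp
  hence "\<forall>\<^sub>F k in sequentially. 2 * (1/16::real) ^ k < 2 * M1\<^sup>2 \<and> 2 * (1/16::real) ^ k < 2 * M2\<^sup>2 \<and> 2 * (1/16::real) ^ k < 2 * M3\<^sup>2"
   using M0 by (intro eventually_conj) auto
  then obtain k0 where k0: "\<And>k. k \<ge> k0 \<Longrightarrow> 2 * (1/16::real) ^ k < 2 * M1\<^sup>2 \<and> 2 * (1/16::real) ^ k < 2 * M2\<^sup>2 \<and> 2 * (1/16::real) ^ k < 2 * M3\<^sup>2"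
   unfolding eventually_sequentially by blast
  note raw = approximatesD(4)[OF a1 less_imp_le[OF M0(1)] M(1)] approximatesD(4)[OF a2 less_imp_le[OF M0(2)] M(2)]
   approximatesD(4)[OF a3 less_imp_le[OF M0(3)] M(3)]
  have m: "cEN s b (ft (f1 k)) \<le> ennreal ((2 * M1)\<^sup>2)" "cEN s b (ft (f2 k)) \<le> ennreal ((2 * M2)\<^sup>2)" "cEN s b (ft (f3 k)) \<le> ennreal ((2 * M3)\<^sup>2)" if "k \<ge> k0" for k
   using k0[OF that] by (auto simp: power_mult_distrib intro!: order_trans[OF raw(1)] order_trans[OF raw(2)] order_trans[OF raw(3)] ennreal_leI)
  have "cEN s' b' (ft r) \<le> ennreal (C * T powr (2/25) * ((2 * M1)\<^sup>2 * (2 * M2)\<^sup>2 * (2 * M3)\<^sup>2))"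
  proof (rule cEN_fatou[of "\<lambda>n. ft (P (n + k0))"])
   show "(\<lambda>n. ft (P (n + k0)) q) \<longlonglongrightarrow> ft r q" for q by (intro LIMSEQ_ignore_initial_segment lim)
   fix n
   have "cEN s' b' (ft (P (n + k0))) \<le> ?c * (cEN s b (ft (f1 (n + k0))) * cEN s b (ft (f2 (n + k0))) * cEN s b (ft (f3 (n + k0))))"
    unfolding P_def by (intro est f)
   also have "\<dots> \<le> ?c * (ennreal ((2 * M1)\<^sup>2) * ennreal ((2 * M2)\<^sup>2) * ennreal ((2 * M3)\<^sup>2))" by (intro mult_left_mono mult_mono m) auto
   also have "\<dots> = ennreal (C * T powr (2/25) * ((2 * M1)\<^sup>2 * (2 * M2)\<^sup>2 * (2 * M3)\<^sup>2))" using C by (simp flip: ennreal_mult)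
   finally show "cEN s' b' (ft (P (n + k0))) \<le> ennreal (C * T powr (2/25) * ((2 * M1)\<^sup>2 * (2 * M2)\<^sup>2 * (2 * M3)\<^sup>2))" .
  qed measurable
  also have "C * T powr (2/25) * ((2 * M1)\<^sup>2 * (2 * M2)\<^sup>2 * (2 * M3)\<^sup>2) = (8 * sqrt C * T powr (1/25) * (M1 * M2 * M3))\<^sup>2"
  proof -
   have "T powr (2/25) = (T powr (1/25))\<^sup>2" by (simp add: powr_square)
   moreover have "C = (sqrt C)\<^sup>2" using C by simp
   ultimately show ?thesis by (simp add: power_mult_distrib)
  qed
  finally have "weighted_L2 s' b' (ft r) \<le> ennreal (8 * sqrt C * T powr (1/25) * (M1 * M2 * M3))"
   by (subst weighted_L2_le_iff) (use C M0 in auto)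
  thus ?thesis using X_norm_le[OF hZ] by (rule order_trans[rotated])
 qed
 define x y z where "x = enn2real (X_norm s b U1)" and "y = enn2real (X_norm s b U2)" and "z = enn2real (X_norm s b U3)"
 have xyz: "X_norm s b U1 = ennreal x" "X_norm s b U2 = ennreal y" "X_norm s b U3 = ennreal z" 
  using approximatesD(2)[OF a1] approximatesD(2)[OF a2] approximatesD(2)[OF a3] by (simp_all add: x_def y_def z_def)
 have nn: "0 \<le> x" "0 \<le> y" "0 \<le> z" by (simp_all add: x_def y_def z_def)
 let ?e = "\<lambda>n. 1 / real (Suc n)"
 have "X_norm s' b' Z \<le> ennreal (8 * sqrt C * T powr (1/25) * ((x + ?e n) * (y + ?e n) * (z + ?e n)))" for n
  using nn by (intro XM) (auto simp: xyz simp del: of_nat_Suc intro!: ennreal_lessI add_nonneg_pos)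
 moreover have "(\<lambda>n. ennreal (8 * sqrt C * T powr (1/25) * ((x + ?e n) * (y + ?e n) * (z + ?e n)))) \<longlonglongrightarrow> ennreal (8 * sqrt C * T powr (1/25) * ((x + 0) * (y + 0) * (z + 0)))"
  by (intro tendsto_ennrealI tendsto_mult tendsto_add tendsto_const LIMSEQ_Suc[OF lim_const_over_n])
 ultimately have "X_norm s' b' Z \<le> ennreal (8 * sqrt C * T powr (1/25) * ((x + 0) * (y + 0) * (z + 0)))"
  by (intro LIMSEQ_le_const[where a="X_norm s' b' Z"]) auto
 also have "\<dots> = ennreal (8 * sqrt C * T powr (1/25)) * X_norm s b U1 * X_norm s b U2 * X_norm s b U3"
  unfolding xyz using nn C by (simp add: mult.assoc flip: ennreal_mult)
 finally show "X_norm s' b' Z \<le> ennreal (8 * sqrt C * T powr (1/25)) * X_norm s b U1 * X_norm s b U2 * X_norm s b U3" .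
qed

section \<open>Restriction to a time interval\<close>

lemma zero_in_X_space: "(\<lambda>\<phi>. 0) \<in> X_space s b" and X_norm_zero: "X_norm s b (\<lambda>\<phi>. 0) = 0"
proof -
 have h: "has_fourier (\<lambda>\<phi>. 0) (\<lambda>q. 0)" by (simp add: has_fourier_iff)
 have "weighted_L2 s b (\<lambda>q. 0) = 0" by (simp add: weighted_L2_eq cEN_def EN_def ennsqrt_def)
 thus n: "X_norm s b (\<lambda>\<phi>. 0) = 0" using X_norm_le[OF h, of s b] by simp
 have z: "(\<lambda>p. 0) \<in> schwartz" using schwartz_cmult[OF cutoff_schwartz, of 0] by simp
 have t: "tempered (\<lambda>\<phi>. 0)" unfolding tempered_def by (auto intro!: exI[of _ 0])
 have "(\<lambda>k::nat. X_norm s b (\<lambda>\<phi>. 0 - dist_of (\<lambda>p. 0) \<phi>)) \<longlonglongrightarrow> 0"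
  using n by (simp add: dist_of_def lint_stm)
 thus "(\<lambda>\<phi>. 0) \<in> X_space s b" unfolding X_space_def using t z by (auto intro!: exI[of _ "\<lambda>k p. 0"])
qed

text \<open>The restriction norm is finite. If it is positive, twice its value is not a lower bound for the norms of the
extensions. If it is zero, the extensions of arbitrarily small norm show by \<open>fourier_pairing_bound\<close>
that \<open>u\<close> vanishes on all test functions, so \<open>0\<close> extends it.\<close>

lemma near_optimal_extension:
 fixes eps \<delta> T :: real
 defines "s \<equiv> 1/4 + eps" and "b \<equiv> 1/2 + \<delta>"
 assumes eps: "0 < eps" "eps < 1/12" and \<delta>: "0 < \<delta>" "\<delta> < 2/3 * eps" and u: "u \<in> XT_space s b T"
 shows "\<exists>U\<in>X_space s b. equal_on T U u \<and> X_norm s b U \<le> 2 * XT_norm s b T u"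
proof -
 obtain w where w: "w \<in> X_space s b" "equal_on T w u" using u by (auto simp: XT_space_def)
 obtain f g d where "approximates s b w f g d" using X_space_approximates[OF eps \<delta>] w(1) unfolding s_def b_def by blast
 hence "X_norm s b w < \<infinity>" unfolding approximates_def by blast
 moreover have "XT_norm s b T u \<le> X_norm s b w" unfolding XT_norm_def using w by (intro Inf_lower) blast
 ultimately have fin: "XT_norm s b T u < \<infinity>" by (rule le_less_trans[rotated])
 show ?thesis
 proof (cases "XT_norm s b T u = 0")
  case False
  obtain x where x: "XT_norm s b T u = ennreal x" "x \<ge> 0" using fin by (cases "XT_norm s b T u") auto
  have "XT_norm s b T u < 2 * XT_norm s b T u"
   using False x by (auto simp: ennreal_zero_less_mult_iff simp flip: ennreal_numeral ennreal_mult intro!: ennreal_lessI)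
  then obtain U where "U \<in> X_space s b" "equal_on T U u" "X_norm s b U < 2 * XT_norm s b T u"
   unfolding XT_norm_def[of s b T u] Inf_less_iff by blast
  thus ?thesis by (intro bexI[of _ U]) auto
 next
  case True
  have "u \<phi> = 0" if \<phi>: "\<phi> \<in> test_functions T" for \<phi>
  proof -
   have \<phi>s: "\<phi> \<in> schwartz" using \<phi> by (simp add: test_functions_def)
   have sb: "0 \<le> s" "0 \<le> b" using eps \<delta> by (auto simp: s_def b_def)
   obtain C where C: "C > 0" "\<And>u G e. has_fourier u G \<Longrightarrow> 0 \<le> e \<Longrightarrow> weighted_L2 s b G \<le> ennreal e \<Longrightarrow> norm (u \<phi>) \<le> C * e"
    using fourier_pairing_bound[OF \<phi>s sb] by blast
   have "norm (u \<phi>) \<le> 0 + e" if e: "e > 0" for e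
   proof -
    have "XT_norm s b T u < ennreal (e / C)" using True e C by simp
    then obtain W where W: "equal_on T W u" "X_norm s b W < ennreal (e / C)"
     unfolding XT_norm_def Inf_less_iff by blast
    obtain G where G: "has_fourier W G" "weighted_L2 s b G < ennreal (e / C)"
     using W(2) unfolding X_norm_def Inf_less_iff by blast
    have "norm (W \<phi>) \<le> C * (e / C)" using C(2)[OF G(1) _ less_imp_le[OF G(2)]] C(1) e by simp
    thus ?thesis using W(1) \<phi> C(1) by (simp add: equal_on_def)
   qed
   hence "norm (u \<phi>) \<le> 0" by (rule field_le_epsilon)
   thus ?thesis by simp
  qed
  hence "equal_on T (\<lambda>\<phi>. 0) u" by (simp add: equal_on_def)
  thus ?thesis using zero_in_X_space X_norm_zero by (intro bexI[of _ "\<lambda>\<phi>. 0"]) auto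
 qed
qed

theorem proposition5p6:
  fixes \<alpha> \<epsilon> :: real
  assumes "0 < \<alpha>" "\<alpha> < 1/4" and "0 < \<epsilon>" "\<epsilon> < 1/12"
  shows "\<exists>\<eta>::real. \<eta> > 0 \<and> (\<forall>\<delta>::real. 0 < \<delta> \<and> \<delta> < 2/3 * \<epsilon> \<longrightarrow>
           (\<exists>C::real. C > 0 \<and> (\<forall>T::real. 0 < T \<and> T \<le> 1 \<longrightarrow>
             (\<forall>u \<in> XT_space (1/4 + \<epsilon>) (1/2 + \<delta>) T.
              \<forall>v \<in> XT_space (1/4 + \<epsilon>) (1/2 + \<delta>) T.
              \<forall>w \<in> XT_space (1/4 + \<epsilon>) (1/2 + \<delta>) T.
                \<exists>z \<in> XT_space (- 3/4 + \<epsilon>) (- 1/2 + \<delta>) T. is_product T u v w z \<and>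
                  XT_norm (- 3/4 + \<epsilon>) (- 1/2 + \<delta>) T z
                    \<le> ennreal (C * T powr \<eta>) * XT_norm (1/4 + \<epsilon>) (1/2 + \<delta>) T u
                       * XT_norm (1/4 + \<epsilon>) (1/2 + \<delta>) T v
                       * XT_norm (1/4 + \<epsilon>) (1/2 + \<delta>) T w))))"
proof (rule exI[of _ "1/25"], intro conjI allI impI)
 fix \<delta> :: real assume \<delta>': "0 < \<delta> \<and> \<delta> < 2/3 * \<epsilon>"
 hence \<delta>: "0 < \<delta>" "\<delta> < 2/3 * \<epsilon>" by auto
 have \<epsilon>: "0 < \<epsilon>" "\<epsilon> < 1/12" by fact+
 let ?s = "1/4 + \<epsilon>" and ?b = "1/2 + \<delta>" and ?s' = "- 3/4 + \<epsilon>" and ?b' = "- 1/2 + \<delta>"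
 \<comment> \<open>this bounds squared norms by \<open>T^(2/25)\<close>, whence the exponent \<open>1/25\<close>\<close>
 obtain C where C: "C > 0" and est: "\<And>T f g h. 0 < T \<Longrightarrow> T \<le> 1 \<Longrightarrow> f \<in> schwartz \<Longrightarrow> g \<in> schwartz \<Longrightarrow> h \<in> schwartz \<Longrightarrow>
   cEN ?s' ?b' (ft (PR T f g h)) \<le> ennreal (C * T powr (2/25)) * (cEN ?s ?b (ft f) * cEN ?s ?b (ft g) * cEN ?s ?b (ft h))"
  using schwartz_product_estimate[OF \<epsilon> \<delta>] by blast
 show "\<exists>C::real. C > 0 \<and> (\<forall>T::real. 0 < T \<and> T \<le> 1 \<longrightarrow>
       (\<forall>u \<in> XT_space ?s ?b T. \<forall>v \<in> XT_space ?s ?b T. \<forall>w \<in> XT_space ?s ?b T.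
        \<exists>z \<in> XT_space ?s' ?b' T. is_product T u v w z \<and>
         XT_norm ?s' ?b' T z \<le> ennreal (C * T powr (1/25)) * XT_norm ?s ?b T u * XT_norm ?s ?b T v * XT_norm ?s ?b T w))"
 proof (intro exI[of _ "64 * sqrt C"] conjI allI impI ballI)
  show "64 * sqrt C > 0" using C by simp
  fix T u v w
  assume T': "0 < T \<and> T \<le> (1::real)" and u: "u \<in> XT_space ?s ?b T" and v: "v \<in> XT_space ?s ?b T" and w: "w \<in> XT_space ?s ?b T"
  have T: "0 < T" "T \<le> 1" using T' by auto
  obtain U where U: "U \<in> X_space ?s ?b" "equal_on T U u" "X_norm ?s ?b U \<le> 2 * XT_norm ?s ?b T u"
   using near_optimal_extension[OF \<epsilon> \<delta> u] by blast
  obtain V where V: "V \<in> X_space ?s ?b" "equal_on T V v" "X_norm ?s ?b V \<le> 2 * XT_norm ?s ?b T v"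
   using near_optimal_extension[OF \<epsilon> \<delta> v] by blast
  obtain W where W: "W \<in> X_space ?s ?b" "equal_on T W w" "X_norm ?s ?b W \<le> 2 * XT_norm ?s ?b T w"
   using near_optimal_extension[OF \<epsilon> \<delta> w] by blast
  obtain f1 g1 d1 where a1: "approximates ?s ?b U f1 g1 d1" using X_space_approximates[OF \<epsilon> \<delta> U(1)] by blast
  obtain f2 g2 d2 where a2: "approximates ?s ?b V f2 g2 d2" using X_space_approximates[OF \<epsilon> \<delta> V(1)] by blast
  obtain f3 g3 d3 where a3: "approximates ?s ?b W f3 g3 d3" using X_space_approximates[OF \<epsilon> \<delta> W(1)] by blast
  define Z where "Z = dist_of (\<lambda>p. g1 p * g2 p * g3 p * cutT T p)"
  have Z: "Z \<in> X_space ?s' ?b'" and XZ: "X_norm ?s' ?b' Z \<le> ennreal (8 * sqrt C * T powr (1/25)) * X_norm ?s ?b U * X_norm ?s ?b V * X_norm ?s ?b W"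
   unfolding Z_def by (rule trilinear_in_X_space[OF \<epsilon> \<delta> C T est[OF T] a1 a2 a3]; assumption)+
  have eqZ: "equal_on T Z Z" by (simp add: equal_on_def)
  show "\<exists>z \<in> XT_space ?s' ?b' T. is_product T u v w z \<and>
         XT_norm ?s' ?b' T z \<le> ennreal (64 * sqrt C * T powr (1/25)) * XT_norm ?s ?b T u * XT_norm ?s ?b T v * XT_norm ?s ?b T w"
  proof (intro bexI[of _ Z] conjI)
   show "Z \<in> XT_space ?s' ?b' T" unfolding XT_space_def using Z eqZ by blast
   have rep: "represents T g u'" if "approximates ?s ?b U' f g d" "equal_on T U' u'" for f g d U' u'
    unfolding represents_def using approximates_set_integrable[OF that(1) T(1)] approximates_dist_of[OF that(1)] that(2)
    by (auto simp: equal_on_def test_functions_def)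
   have prod: "represents T (\<lambda>p. g1 p * g2 p * g3 p) Z"
    unfolding represents_def
   proof
    have i: "integrable stm (\<lambda>p. g1 p * g2 p * g3 p)" by (rule product_limit(1)[OF T(1) a1 a2 a3])
    have [measurable]: "(\<lambda>p. indicator ({0..T} \<times> UNIV) p :: real) \<in> borel_measurable stm" by (intro measurable_stm) simp
    have [measurable]: "(\<lambda>p. g1 p * g2 p * g3 p) \<in> borel_measurable stm" using i by auto
    show "set_integrable lborel ({0..T} \<times> torus_cell) (\<lambda>p. g1 p * g2 p * g3 p)"
    proof (rule set_integrable_strip, rule Bochner_Integration.integrable_bound[OF i])
     show "(\<lambda>p. indicator ({0..T} \<times> UNIV) p *\<^sub>R (g1 p * g2 p * g3 p)) \<in> borel_measurable stm" by measurable
    qed (auto simp: indicator_def)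
    show "equal_on T (dist_of (\<lambda>p. g1 p * g2 p * g3 p)) Z"
     unfolding equal_on_def
    proof
     fix \<phi> assume "\<phi> \<in> test_functions T"
     then obtain a c where ac: "0 < a" "c < T" "\<And>p. fst p \<notin> {a..c} \<Longrightarrow> \<phi> p = 0" unfolding test_functions_def by blast
     have "g1 p * g2 p * g3 p * \<phi> p = g1 p * g2 p * g3 p * cutT T p * \<phi> p" for p
      using ac(3)[of p] cutT_1[of p T] ac(1,2) T(1) by (cases "fst p \<in> {a..c}") auto
     thus "dist_of (\<lambda>p. g1 p * g2 p * g3 p) \<phi> = Z \<phi>" unfolding Z_def dist_of_def by presburger
    qed
   qed
   show "is_product T u v w Z"
    unfolding is_product_def using rep[OF a1 U(2)] rep[OF a2 V(2)] rep[OF a3 W(2)] prod by blast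
   have "XT_norm ?s' ?b' T Z \<le> X_norm ?s' ?b' Z" unfolding XT_norm_def using Z eqZ by (intro Inf_lower) blast
   also note XZ
   also have "ennreal (8 * sqrt C * T powr (1/25)) * X_norm ?s ?b U * X_norm ?s ?b V * X_norm ?s ?b W
     \<le> ennreal (8 * sqrt C * T powr (1/25)) * (2 * XT_norm ?s ?b T u) * (2 * XT_norm ?s ?b T v) * (2 * XT_norm ?s ?b T w)"
    by (intro mult_mono U V W order_refl) auto
   also have "\<dots> = (ennreal (8 * sqrt C * T powr (1/25)) * 8) * XT_norm ?s ?b T u * XT_norm ?s ?b T v * XT_norm ?s ?b T w"
    by (simp add: mult_ac)
   also have "ennreal (8 * sqrt C * T powr (1/25)) * 8 = ennreal (64 * sqrt C * T powr (1/25))"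
    using C by (simp flip: ennreal_numeral ennreal_mult)
   finally show "XT_norm ?s' ?b' T Z \<le> ennreal (64 * sqrt C * T powr (1/25)) * XT_norm ?s ?b T u * XT_norm ?s ?b T v * XT_norm ?s ?b T w" .
  qed
 qed
qed simp

end
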